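(* Let $n\geq 2$ and let $f\colon M^{2n}\to\mathbb{H}^{3n-1}$ be an isometric immersion of a complete Kaehler manifold of real dimension $2n$ with sectional curvature bounded from below. Then $f(M)$ is unbounded in $\mathbb{H}^{3n-1}$.
   Context: A Kaehler manifold $(M^{2n},J)$ is a (connected) Riemannian manifold of real dimension $2n$ with an orthogonal almost complex structure $J$ that is parallel with respect to the Levi-Civita connection. $\mathbb{H}^{N}$ is the hyperbolic space of dimension $N$ and constant sectional curvature $-1$. *)

theory Defs
  imports "HOL-Analysis.Analysis"
begin

section \<open>Smooth maps between Euclidean spaces\<close>

primrec k_smooth_on ::
  "nat \<Rightarrow> 'e set \<Rightarrow> ('e::euclidean_space \<Rightarrow> 'b::real_normed_vector) \<Rightarrow> bool" where
  "k_smooth_on 0 S f \<longleftrightarrow> continuous_on S f"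
| "k_smooth_on (Suc k) S f \<longleftrightarrow>
     (\<forall>x\<in>S. f differentiable (at x)) \<and>
     (\<forall>v. k_smooth_on k S (\<lambda>x. frechet_derivative f (at x) v))"

text \<open>Only meant for open \<open>S\<close>.\<close>

definition smooth_on ::
  "'e set \<Rightarrow> ('e::euclidean_space \<Rightarrow> 'b::real_normed_vector) \<Rightarrow> bool" where
  "smooth_on S f \<longleftrightarrow> (\<forall>k. k_smooth_on k S f)"


section \<open>Smooth manifolds\<close>

text \<open>A chart is a pair of its domain and its coordinate map; the coordinate map is irrelevant
  outside the domain. The dimension of the manifold is the dimension of the model space \<open>'e\<close>.
  Atlases are not required to be maximal.\<close>

type_synonym ('a, 'e) chart = "'a set \<times> ('a \<Rightarrow> 'e)"

record ('a, 'e) manifold =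
  mtop :: "'a topology"
  atlas :: "('a, 'e) chart set"

abbreviation coords :: "('a, 'e) chart \<Rightarrow> 'e set" where
  "coords c \<equiv> snd c ` fst c"

definition local_rep ::
  "('a \<Rightarrow> 'b) \<Rightarrow> ('a, 'e) chart \<Rightarrow> ('b, 'd) chart \<Rightarrow> 'e \<Rightarrow> 'd" where
  "local_rep f c c' = snd c' \<circ> f \<circ> inv_into (fst c) (snd c)"

definition local_rep_dom ::
  "('a \<Rightarrow> 'b) \<Rightarrow> ('a, 'e) chart \<Rightarrow> ('b, 'd) chart \<Rightarrow> 'e set" where
  "local_rep_dom f c c' = snd c ` {p \<in> fst c. f p \<in> fst c'}"

abbreviation transition :: "('a, 'e) chart \<Rightarrow> ('a, 'd) chart \<Rightarrow> 'e \<Rightarrow> 'd" where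
  "transition \<equiv> local_rep id"

abbreviation transition_dom :: "('a, 'e) chart \<Rightarrow> ('a, 'd) chart \<Rightarrow> 'e set" where
  "transition_dom \<equiv> local_rep_dom id"

locale smooth_manifold =
  fixes M :: "('a, 'e::euclidean_space, 'z) manifold_scheme"
  assumes Hausdorff: "Hausdorff_space (mtop M)"
    and second_countable: "second_countable (mtop M)"
    and cover: "(\<Union>c\<in>atlas M. fst c) = topspace (mtop M)"
    and open_domain: "c \<in> atlas M \<Longrightarrow> openin (mtop M) (fst c)"
    and open_coords: "c \<in> atlas M \<Longrightarrow> open (coords c)"
    and chart_homeomorphic: "c \<in> atlas M \<Longrightarrow>
      homeomorphic_map (subtopology (mtop M) (fst c)) (top_of_set (coords c)) (snd c)"
    and smooth_transition: "\<lbrakk>c \<in> atlas M; c' \<in> atlas M\<rbrakk> \<Longrightarrow>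
      smooth_on (transition_dom c c') (transition c c')"

definition smooth_map ::
  "('a, 'e::euclidean_space, 'y) manifold_scheme \<Rightarrow>
   ('b, 'd::euclidean_space, 'z) manifold_scheme \<Rightarrow> ('a \<Rightarrow> 'b) \<Rightarrow> bool" where
  "smooth_map M N f \<longleftrightarrow> continuous_map (mtop M) (mtop N) f \<and>
     (\<forall>c\<in>atlas M. \<forall>c'\<in>atlas N. smooth_on (local_rep_dom f c c') (local_rep f c c'))"

definition immersion ::
  "('a, 'e::euclidean_space, 'y) manifold_scheme \<Rightarrow>
   ('b, 'd::euclidean_space, 'z) manifold_scheme \<Rightarrow> ('a \<Rightarrow> 'b) \<Rightarrow> bool" where
  "immersion M N f \<longleftrightarrow> smooth_map M N f \<and>
     (\<forall>c\<in>atlas M. \<forall>c'\<in>atlas N. \<forall>x\<in>local_rep_dom f c c'.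
        inj (frechet_derivative (local_rep f c c') (at x)))"


section \<open>Riemannian manifolds\<close>

text \<open>A tensor field is given by its components in each chart, subject to the transformation law
  under change of charts: \<open>riem_metric M c x u v\<close> is the inner product of the tangent vectors
  with components \<open>u\<close> and \<open>v\<close> at the point with coordinates \<open>x\<close> in the chart \<open>c\<close>.\<close>

record ('a, 'e) riemannian = "('a, 'e) manifold" +
  riem_metric :: "('a, 'e) chart \<Rightarrow> 'e \<Rightarrow> 'e \<Rightarrow> 'e \<Rightarrow> real"

locale riemannian_manifold = smooth_manifold M
  for M :: "('a, 'e::euclidean_space, 'z) riemannian_scheme" +
  assumes metric_bilinear: "\<lbrakk>c \<in> atlas M; x \<in> coords c\<rbrakk> \<Longrightarrow> bilinear (riem_metric M c x)"
    and metric_sym: "\<lbrakk>c \<in> atlas M; x \<in> coords c\<rbrakk> \<Longrightarrow>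
      riem_metric M c x u v = riem_metric M c x v u"
    and metric_pos: "\<lbrakk>c \<in> atlas M; x \<in> coords c; u \<noteq> 0\<rbrakk> \<Longrightarrow> riem_metric M c x u u > 0"
    and metric_smooth: "c \<in> atlas M \<Longrightarrow> smooth_on (coords c) (\<lambda>x. riem_metric M c x u v)"
    and metric_transform: "\<lbrakk>c \<in> atlas M; c' \<in> atlas M; x \<in> transition_dom c c'\<rbrakk> \<Longrightarrow>
      riem_metric M c x u v =
        riem_metric M c' (transition c c' x)
          (frechet_derivative (transition c c') (at x) u)
          (frechet_derivative (transition c c') (at x) v)"

definition isometric_immersion ::
  "('a, 'e::euclidean_space, 'y) riemannian_scheme \<Rightarrow>
   ('b, 'd::euclidean_space, 'z) riemannian_scheme \<Rightarrow> ('a \<Rightarrow> 'b) \<Rightarrow> bool" where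
  "isometric_immersion M N f \<longleftrightarrow> immersion M N f \<and>
     (\<forall>c\<in>atlas M. \<forall>c'\<in>atlas N. \<forall>x\<in>local_rep_dom f c c'. \<forall>u v.
        riem_metric M c x u v =
          riem_metric N c' (local_rep f c c' x)
            (frechet_derivative (local_rep f c c') (at x) u)
            (frechet_derivative (local_rep f c c') (at x) v))"


subsection \<open>Riemannian distance and completeness\<close>

definition piecewise_C1_curve ::
  "('a, 'e::euclidean_space, 'z) manifold_scheme \<Rightarrow> (real \<Rightarrow> 'a) \<Rightarrow> bool" where
  "piecewise_C1_curve M \<gamma> \<longleftrightarrow> continuous_map (top_of_set {0..1}) (mtop M) \<gamma> \<and>
     (\<forall>c\<in>atlas M. \<forall>a b. {a..b} \<subseteq> {0..1} \<longrightarrow> \<gamma> ` {a..b} \<subseteq> fst c \<longrightarrow>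
        (snd c \<circ> \<gamma>) piecewise_C1_differentiable_on {a..b})"

text \<open>By the transformation law, the speed does not depend on the chosen chart.\<close>

definition speed ::
  "('a, 'e::euclidean_space, 'z) riemannian_scheme \<Rightarrow> (real \<Rightarrow> 'a) \<Rightarrow> real \<Rightarrow> real" where
  "speed M \<gamma> t =
     (let c = SOME c. c \<in> atlas M \<and> \<gamma> t \<in> fst c;
          v = vector_derivative (snd c \<circ> \<gamma>) (at t)
      in sqrt (riem_metric M c (snd c (\<gamma> t)) v v))"

text \<open>The value outside the manifold is a dummy, as \<^locale>\<open>Metric_space\<close> wants a distance
  that is nonnegative and symmetric everywhere.\<close>

definition riem_dist ::
  "('a, 'e::euclidean_space, 'z) riemannian_scheme \<Rightarrow> 'a \<Rightarrow> 'a \<Rightarrow> real" where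
  "riem_dist M p q =
     (if p \<in> topspace (mtop M) \<and> q \<in> topspace (mtop M)
      then Inf {L. \<exists>\<gamma>. piecewise_C1_curve M \<gamma> \<and> \<gamma> 0 = p \<and> \<gamma> 1 = q \<and>
                       (speed M \<gamma> has_integral L) {0..1}}
      else 0)"

definition riem_complete :: "('a, 'e::euclidean_space, 'z) riemannian_scheme \<Rightarrow> bool" where
  "riem_complete M \<longleftrightarrow> Metric_space.mcomplete (topspace (mtop M)) (riem_dist M)"

definition riem_bounded :: "('a, 'e::euclidean_space, 'z) riemannian_scheme \<Rightarrow> 'a set \<Rightarrow> bool" where
  "riem_bounded M S \<longleftrightarrow> Metric_space.mbounded (topspace (mtop M)) (riem_dist M) S"


subsection \<open>Levi-Civita connection and sectional curvature\<close>

text \<open>In this subsection \<open>g\<close> is the metric in one chart. \<open>levi_civita g x u v\<close> is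
  \<open>\<nabla>\<^sub>u v\<close> at \<open>x\<close> for the constant coordinate vector field \<open>v\<close> (the Christoffel symbols).
  The conditions say that the connection is torsion-free and metric; they have exactly one
  solution at every point where \<open>g\<close> is a differentiable inner product.\<close>

definition levi_civita ::
  "('e::euclidean_space \<Rightarrow> 'e \<Rightarrow> 'e \<Rightarrow> real) \<Rightarrow> 'e \<Rightarrow> 'e \<Rightarrow> 'e \<Rightarrow> 'e" where
  "levi_civita g x = (THE \<Gamma>. bilinear \<Gamma> \<and> (\<forall>u v. \<Gamma> u v = \<Gamma> v u) \<and>
     (\<forall>u v w. frechet_derivative (\<lambda>y. g y v w) (at x) u = g x (\<Gamma> u v) w + g x v (\<Gamma> u w)))"

definition covariant_deriv ::
  "('e::euclidean_space \<Rightarrow> 'e \<Rightarrow> 'e \<Rightarrow> real) \<Rightarrow> 'e \<Rightarrow> 'e \<Rightarrow> ('e \<Rightarrow> 'e) \<Rightarrow> 'e" where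
  "covariant_deriv g x u Y = frechet_derivative Y (at x) u + levi_civita g x u (Y x)"

text \<open>\<open>R(u,v)w = \<nabla>\<^sub>u \<nabla>\<^sub>v w - \<nabla>\<^sub>v \<nabla>\<^sub>u w\<close>, for the commuting constant fields \<open>u\<close>, \<open>v\<close>, \<open>w\<close>.\<close>

definition curvature_tensor ::
  "('e::euclidean_space \<Rightarrow> 'e \<Rightarrow> 'e \<Rightarrow> real) \<Rightarrow> 'e \<Rightarrow> 'e \<Rightarrow> 'e \<Rightarrow> 'e \<Rightarrow> 'e" where
  "curvature_tensor g x u v w =
     covariant_deriv g x u (\<lambda>y. covariant_deriv g y v (\<lambda>_. w)) -
     covariant_deriv g x v (\<lambda>y. covariant_deriv g y u (\<lambda>_. w))"

definition sectional_curvature ::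
  "('e::euclidean_space \<Rightarrow> 'e \<Rightarrow> 'e \<Rightarrow> real) \<Rightarrow> 'e \<Rightarrow> 'e \<Rightarrow> 'e \<Rightarrow> real" where
  "sectional_curvature g x u v =
     g x (curvature_tensor g x u v v) u / (g x u u * g x v v - (g x u v)\<^sup>2)"

definition sectional_curvature_bounded_below ::
  "('a, 'e::euclidean_space, 'z) riemannian_scheme \<Rightarrow> bool" where
  "sectional_curvature_bounded_below M \<longleftrightarrow>
     (\<exists>\<kappa>. \<forall>c\<in>atlas M. \<forall>x\<in>coords c. \<forall>u v. u \<noteq> v \<longrightarrow> independent {u, v} \<longrightarrow>
        \<kappa> \<le> sectional_curvature (riem_metric M c) x u v)"


section \<open>Kaehler manifolds\<close>

locale kaehler_manifold = riemannian_manifold M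
  for M :: "('a, 'e::euclidean_space, 'z) riemannian_scheme"
    and J :: "('a, 'e) chart \<Rightarrow> 'e \<Rightarrow> 'e \<Rightarrow> 'e" +
  assumes nonempty: "topspace (mtop M) \<noteq> {}"
    and connected: "connected_space (mtop M)"
    and J_linear: "\<lbrakk>c \<in> atlas M; x \<in> coords c\<rbrakk> \<Longrightarrow> linear (J c x)"
    and J_smooth: "c \<in> atlas M \<Longrightarrow> smooth_on (coords c) (\<lambda>x. J c x u)"
    and J_transform: "\<lbrakk>c \<in> atlas M; c' \<in> atlas M; x \<in> transition_dom c c'\<rbrakk> \<Longrightarrow>
      frechet_derivative (transition c c') (at x) (J c x u) =
        J c' (transition c c' x) (frechet_derivative (transition c c') (at x) u)"
    and J_square: "\<lbrakk>c \<in> atlas M; x \<in> coords c\<rbrakk> \<Longrightarrow> J c x (J c x u) = - u"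
    and J_orthogonal: "\<lbrakk>c \<in> atlas M; x \<in> coords c\<rbrakk> \<Longrightarrow>
      riem_metric M c x (J c x u) (J c x v) = riem_metric M c x u v"
    and J_parallel: "\<lbrakk>c \<in> atlas M; smooth_on (coords c) Y; x \<in> coords c\<rbrakk> \<Longrightarrow>
      covariant_deriv (riem_metric M c) x u (\<lambda>y. J c y (Y y)) =
        J c x (covariant_deriv (riem_metric M c) x u Y)"


section \<open>Hyperbolic space\<close>

text \<open>The Poincare ball model of constant curvature \<open>-1\<close>, of dimension \<open>DIM('h)\<close>.\<close>

definition hyperbolic_space :: "('h::euclidean_space, 'h) riemannian" where
  "hyperbolic_space =
     \<lparr>mtop = top_of_set (ball 0 1),
      atlas = {(ball 0 1, \<lambda>x. x)},
      riem_metric = (\<lambda>_ x u v. 4 * (u \<bullet> v) / (1 - (norm x)\<^sup>2)\<^sup>2)\<rparr>"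

end

theory Submission
  imports Defs
begin

text \<open>Compose \<open>f\<close> with the hyperboloid model to get an immersion \<open>F\<close> into Lorentzian space of dimension \<open>3 n\<close>
  with second fundamental form \<open>\<alpha>\<close>, and put \<open>B(X, Y) = \<alpha>(X, Y) + \<alpha>(J X, J Y)\<close>. At every point there is \<open>X \<noteq> 0\<close>
  with \<open>B(X, X)\<close> causal: otherwise take \<open>X\<close> minimizing \<open>|W(X, X)|\<^sup>2 / |X|\<^sup>4\<close>, where \<open>W\<close> is the part of \<open>B\<close> orthogonal
  to \<open>F\<close>. By a dimension count there is \<open>Y \<noteq> 0\<close> with \<open>W(X, Y) = W(X, J Y) = 0\<close>, and for such \<open>Y\<close> the second order
  condition at the minimum contradicts the value of \<open>\<langle>W(X, X), W(Y, Y)\<rangle>\<close> given by the Gauss equation and the Kaehler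
  symmetries of the curvature. As the component of \<open>B(X, X)\<close> along \<open>F\<close> is \<open>2 |X|\<^sup>2\<close>, the time
  component of \<open>B(X, X)\<close> is at least \<open>|X|\<^sup>2\<close> divided by that of \<open>F\<close>.

  If \<open>f(M)\<close> were bounded, the time component \<open>\<phi>\<close> of \<open>F\<close> would be bounded above. By a Hessian comparison for the
  distance function (from the lower curvature bound) and the compactness of closed balls, an Omori type
  maximum principle applies to \<open>\<phi>\<close> and produces a point where its Hessian, the time component of \<open>\<alpha>\<close>, is as
  small as we like, a contradiction.

  The Hessian of the distance is only estimated from above, in the sense of symmetric second
  differences along curves with vanishing covariant acceleration. The estimate is propagated along a
  chain of points on which the distance to the base point is additive.\<close>

section \<open>Calculus\<close>

text \<open>The codimension enters through one count. The ambient dimension is 3 n, the tangent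
  space takes 2 n and \<open>F\<close> one more, so \<open>W\<close> has values in dimension n - 1
  and the two conditions on \<open>Y\<close> are 2 n - 2 linear equations in 2 n unknowns. The
  number 4 then decides: if no \<open>B(X, X)\<close> with X nonzero is causal, the minimal quotient
  exceeds 4, while the Gauss equation and the Kaehler symmetries make the product of
  \<open>W(X, X)\<close> and \<open>W(Y, Y)\<close> exactly 4 |X|^2 |Y|^2. The obstacle in the
  analytic half is that the distance function is not smooth. Second symmetric differences ask only
  for the triangle inequality and for nearly minimizing curves. For the chain of points to give a
  uniform bound, each link may only cost an error proportional to its length; a fixed factor per
  link would pile up. The comparison function 2 / D + k, D being the distance, has twice the leading
  coefficient of the model spaces, and this slack absorbs all numerical losses. The maximum
  principle is run on a single unit ball about a point where the bounded function is almost
  maximal.\<close>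

abbreviation fd :: "('e::real_normed_vector \<Rightarrow> 'b::real_normed_vector) \<Rightarrow> 'e \<Rightarrow> 'e \<Rightarrow> 'b" where
  "fd f x \<equiv> frechet_derivative f (at x)"

lemma fd_eqI: "(f has_derivative f') (at x) \<Longrightarrow> fd f x v = f' v"
  using frechet_derivative_at[of f f' x] by simp

lemma fd_works: "f differentiable (at x) \<Longrightarrow> (f has_derivative fd f x) (at x)"
  by (simp add: frechet_derivative_works)

section \<open>Closure properties of smooth functions\<close>

lemma fd_cong_open:
  assumes "open S" "x \<in> S" "\<And>y. y \<in> S \<Longrightarrow> f y = g y" "f differentiable (at x)"
  shows "g differentiable (at x)" "fd g x = fd f x"
proof -
  have "(g has_derivative fd f x) (at x)"
    using has_derivative_transform_within_open[OF fd_works[OF assms(4)] assms(1,2)] assms(3) by auto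
  then show "g differentiable (at x)" "fd g x = fd f x"
    by (auto simp: differentiable_def frechet_derivative_at[symmetric])
qed

lemma k_smooth_on_SucD:
  assumes "k_smooth_on (Suc k) S f"
  shows "x \<in> S \<Longrightarrow> f differentiable (at x)" "k_smooth_on k S (\<lambda>x. fd f x v)"
  by (rule bspec[OF conjunct1[OF assms[unfolded k_smooth_on.simps(2)]]], assumption)
     (rule spec[OF conjunct2[OF assms[unfolded k_smooth_on.simps(2)]]])

lemma k_smooth_on_cong:
  assumes "open S"
  shows "(\<And>x. x \<in> S \<Longrightarrow> f x = g x) \<Longrightarrow> k_smooth_on k S f \<Longrightarrow> k_smooth_on k S g"
proof (induction k arbitrary: f g)
  case 0
  then show ?case by (simp cong: continuous_on_cong)
next
  case (Suc k)
  have d: "g differentiable (at x)" "fd g x = fd f x" if "x \<in> S" for x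
    using fd_cong_open[OF assms that Suc.prems(1) k_smooth_on_SucD(1)[OF Suc.prems(2) that]] by blast+
  have "k_smooth_on k S (\<lambda>x. fd g x v)" for v
    by (rule Suc.IH[OF _ k_smooth_on_SucD(2)[OF Suc.prems(2), of v]]) (simp add: d(2))
  then show ?case unfolding k_smooth_on.simps(2) by (intro conjI ballI allI d(1))
qed

lemma k_smooth_on_SucI:
  assumes "open S" "\<And>x. x \<in> S \<Longrightarrow> (f has_derivative f' x) (at x)"
    "\<And>v. k_smooth_on k S (\<lambda>x. f' x v)"
  shows "k_smooth_on (Suc k) S f"
  unfolding k_smooth_on.simps(2)
  by (intro conjI ballI allI differentiableI[OF assms(2)]
      k_smooth_on_cong[OF assms(1) fd_eqI[OF assms(2), symmetric] assms(3)])

text \<open>The product and quotient rules leave undifferentiated factors in the derivative, so the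
  inductions on \<open>k\<close> below need order \<open>k\<close> of the factors themselves and not
  only of their derivatives.\<close>

lemma k_smooth_on_mono: "k_smooth_on (Suc k) S f \<Longrightarrow> k_smooth_on k S f"
proof (induction k arbitrary: f)
  case 0
  then show ?case
    using k_smooth_on_SucD(1)[OF 0] unfolding k_smooth_on.simps(1) continuous_on_eq_continuous_within
    by (blast intro: differentiable_imp_continuous_within differentiable_at_withinI)
next
  case (Suc k)
  show ?case unfolding k_smooth_on.simps(2)[of k]
    by (intro conjI ballI allI k_smooth_on_SucD(1)[OF Suc.prems] Suc.IH[OF k_smooth_on_SucD(2)[OF Suc.prems]])
qed

lemma k_smooth_on_const: "k_smooth_on k S (\<lambda>x. c)"
  by (induction k arbitrary: c) auto

lemma k_smooth_on_linear:
  assumes "bounded_linear T" shows "k_smooth_on k S T"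
proof (cases k)
  case 0
  then show ?thesis using assms by (simp add: linear_continuous_on)
next
  case (Suc j)
  have d: "(T has_derivative T) (at x)" for x by (rule bounded_linear_imp_has_derivative[OF assms])
  show ?thesis unfolding Suc k_smooth_on.simps(2) fd_eqI[OF d]
    by (intro conjI ballI allI differentiableI[OF d] k_smooth_on_const)
qed

lemma k_smooth_on_linear_comp:
  assumes "open S" "bounded_linear T"
  shows "k_smooth_on k S f \<Longrightarrow> k_smooth_on k S (\<lambda>x. T (f x))"
proof (induction k arbitrary: f)
  case 0
  then show ?case using assms by (auto intro: bounded_linear.continuous_on)
next
  case (Suc k)
  show ?case
    by (rule k_smooth_on_SucI[OF assms(1) bounded_linear.has_derivative[OF assms(2) fd_works[OF k_smooth_on_SucD(1)[OF Suc.prems]]]])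
       (assumption, rule Suc.IH[OF k_smooth_on_SucD(2)[OF Suc.prems]])
qed

lemma k_smooth_on_add:
  assumes "open S"
  shows "k_smooth_on k S f \<Longrightarrow> k_smooth_on k S g \<Longrightarrow> k_smooth_on k S (\<lambda>x. f x + g x)"
proof (induction k arbitrary: f g)
  case 0
  then show ?case by (auto intro: continuous_intros)
next
  case (Suc k)
  note d = fd_works[OF k_smooth_on_SucD(1)[OF Suc.prems(1)]] fd_works[OF k_smooth_on_SucD(1)[OF Suc.prems(2)]]
  show ?case
    by (rule k_smooth_on_SucI[OF assms(1) has_derivative_add[OF d]])
       (assumption, assumption, rule Suc.IH[OF Suc.prems[THEN k_smooth_on_SucD(2)]])
qed

lemma k_smooth_on_bilinear:
  assumes "open S" "bounded_bilinear B"
  shows "k_smooth_on k S f \<Longrightarrow> k_smooth_on k S g \<Longrightarrow> k_smooth_on k S (\<lambda>x. B (f x) (g x))"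
proof (induction k arbitrary: f g)
  case 0
  then show ?case using assms by (auto intro: bounded_bilinear.continuous_on)
next
  case (Suc k)
  note d = fd_works[OF k_smooth_on_SucD(1)[OF Suc.prems(1)]] fd_works[OF k_smooth_on_SucD(1)[OF Suc.prems(2)]]
  note m = k_smooth_on_mono[OF Suc.prems(1)] k_smooth_on_mono[OF Suc.prems(2)]
  show ?case
    by (rule k_smooth_on_SucI[OF assms(1) bounded_bilinear.FDERIV[OF assms(2) d]], assumption, assumption)
       (rule k_smooth_on_add[OF assms(1) Suc.IH[OF m(1) k_smooth_on_SucD(2)[OF Suc.prems(2)]]
           Suc.IH[OF k_smooth_on_SucD(2)[OF Suc.prems(1)] m(2)]])
qed

lemma k_smooth_on_inverse:
  fixes f :: "'e::euclidean_space \<Rightarrow> real"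
  assumes "open S" "\<And>x. x \<in> S \<Longrightarrow> f x \<noteq> 0"
  shows "k_smooth_on k S f \<Longrightarrow> k_smooth_on k S (\<lambda>x. inverse (f x))"
proof (induction k)
  case 0
  then show ?case using assms by (auto intro: continuous_intros)
next
  case (Suc k)
  have i: "k_smooth_on k S (\<lambda>x. inverse (f x))" by (rule Suc.IH[OF k_smooth_on_mono[OF Suc.prems]])
  note k_smooth_on_linear_comp[OF assms(1) bounded_linear_minus[OF bounded_linear_ident]
      k_smooth_on_bilinear[OF assms(1) bounded_bilinear_mult k_smooth_on_bilinear[OF assms(1) bounded_bilinear_mult i k_smooth_on_SucD(2)[OF Suc.prems]] i]]
  then show ?case
    by (rule k_smooth_on_SucI[OF assms(1) Deriv.has_derivative_inverse[OF assms(2) fd_works[OF k_smooth_on_SucD(1)[OF Suc.prems]]], rotated 2])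
qed

declare k_smooth_on.simps(2)[simp del]

lemma smooth_on_cong:
  assumes "open S" "\<And>x. x \<in> S \<Longrightarrow> f x = g x" "smooth_on S f"
  shows "smooth_on S g"
  unfolding smooth_on_def
  by (intro allI k_smooth_on_cong[OF assms(1,2) assms(3)[unfolded smooth_on_def, rule_format]])

lemma smooth_on_const: "smooth_on S (\<lambda>x. c)"
  unfolding smooth_on_def by (intro allI k_smooth_on_const)

lemma smooth_on_linear: "bounded_linear T \<Longrightarrow> smooth_on S T"
  unfolding smooth_on_def by (intro allI k_smooth_on_linear)

lemma smooth_on_linear_comp: "open S \<Longrightarrow> bounded_linear T \<Longrightarrow> smooth_on S f \<Longrightarrow> smooth_on S (\<lambda>x. T (f x))"
  unfolding smooth_on_def by (rule allI, rule k_smooth_on_linear_comp) (assumption | erule spec)+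

lemma smooth_on_add: "open S \<Longrightarrow> smooth_on S f \<Longrightarrow> smooth_on S g \<Longrightarrow> smooth_on S (\<lambda>x. f x + g x)"
  unfolding smooth_on_def by (rule allI, rule k_smooth_on_add) (assumption | erule spec)+

lemma smooth_on_bilinear:
  "open S \<Longrightarrow> bounded_bilinear B \<Longrightarrow> smooth_on S f \<Longrightarrow> smooth_on S h \<Longrightarrow> smooth_on S (\<lambda>x. B (f x) (h x))"
  unfolding smooth_on_def by (rule allI, rule k_smooth_on_bilinear) (assumption | erule spec)+

lemma smooth_on_inverse:
  fixes f :: "'e::euclidean_space \<Rightarrow> real"
  assumes "open S" "\<And>x. x \<in> S \<Longrightarrow> f x \<noteq> 0" "smooth_on S f"
  shows "smooth_on S (\<lambda>x. inverse (f x))"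
  unfolding smooth_on_def
  by (intro allI k_smooth_on_inverse[OF assms(1,2) assms(3)[unfolded smooth_on_def, rule_format]])

lemma smooth_on_diff:
  assumes "open S" "smooth_on S f" "smooth_on S g"
  shows "smooth_on S (\<lambda>x. f x - g x)"
  using smooth_on_add[OF assms(1,2) smooth_on_linear_comp[OF assms(1) bounded_linear_minus[OF bounded_linear_ident] assms(3)]]
  by simp

lemma smooth_on_continuous: "smooth_on S f \<Longrightarrow> continuous_on S f"
  unfolding smooth_on_def using k_smooth_on.simps(1)[of S f] by metis

lemma smooth_on_fd: "smooth_on S f \<Longrightarrow> smooth_on S (\<lambda>x. fd f x v)"
  unfolding smooth_on_def by (intro allI k_smooth_on_SucD(2)) (erule spec)

lemma smooth_on_differentiable: "smooth_on S f \<Longrightarrow> x \<in> S \<Longrightarrow> f differentiable (at x)"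
  unfolding smooth_on_def by (rule k_smooth_on_SucD(1)[where k=0]) (erule spec)

lemma smooth_on_has_derivative: "smooth_on S f \<Longrightarrow> x \<in> S \<Longrightarrow> (f has_derivative fd f x) (at x)"
  by (simp add: smooth_on_differentiable fd_works)

lemma smooth_on_fd_linear: "smooth_on S f \<Longrightarrow> x \<in> S \<Longrightarrow> linear (fd f x)"
  by (simp add: smooth_on_differentiable linear_frechet_derivative)

text \<open>Two mean value arguments: the increment in direction \<open>v\<close> is varied along
  \<open>u\<close>, and the resulting first derivative in direction \<open>u\<close> is then varied
  along \<open>v\<close>. Exchanging \<open>u\<close> and \<open>v\<close> gives a second expression
  for the same double difference.\<close>

lemma second_difference_mvt:
  fixes f :: "'e::euclidean_space \<Rightarrow> real"
  assumes sm: "smooth_on S f" and s: "s > 0"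
    and sub: "\<And>t r. 0 \<le> t \<Longrightarrow> t \<le> s \<Longrightarrow> 0 \<le> r \<Longrightarrow> r \<le> s \<Longrightarrow> x + t *\<^sub>R u + r *\<^sub>R v \<in> S"
  shows "\<exists>\<xi>\<in>{0..s}. \<exists>\<zeta>\<in>{0..s}. f (x + s *\<^sub>R u + s *\<^sub>R v) - f (x + s *\<^sub>R u) - f (x + s *\<^sub>R v) + f x
      = s\<^sup>2 * fd (\<lambda>y. fd f y u) (x + \<xi> *\<^sub>R u + \<zeta> *\<^sub>R v) v"
proof -
  define h where "h t = f (x + t *\<^sub>R u + s *\<^sub>R v) - f (x + t *\<^sub>R u)" for t
  have sub0: "x + t *\<^sub>R u \<in> S" if "0 \<le> t" "t \<le> s" for t using sub[OF that, of 0] s by simp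
  have hd: "(h has_derivative (\<lambda>k. fd f (x + t *\<^sub>R u + s *\<^sub>R v) (k *\<^sub>R u) - fd f (x + t *\<^sub>R u) (k *\<^sub>R u))) (at t within {0..s})"
    if t: "t \<in> {0..s}" for t
  proof -
    have 1: "((\<lambda>t. f (x + t *\<^sub>R u + s *\<^sub>R v)) has_derivative (\<lambda>k. fd f (x + t *\<^sub>R u + s *\<^sub>R v) (k *\<^sub>R u))) (at t within {0..s})"
      by (rule has_derivative_compose[where f="\<lambda>t. x + t *\<^sub>R u + s *\<^sub>R v", OF _ smooth_on_has_derivative[OF sm]])
         (use sub[of t s] s t in \<open>auto intro!: derivative_eq_intros\<close>)
    have 2: "((\<lambda>t. f (x + t *\<^sub>R u)) has_derivative (\<lambda>k. fd f (x + t *\<^sub>R u) (k *\<^sub>R u))) (at t within {0..s})"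
      by (rule has_derivative_compose[where f="\<lambda>t. x + t *\<^sub>R u", OF _ smooth_on_has_derivative[OF sm]])
         (use sub0[of t] t in \<open>auto intro!: derivative_eq_intros\<close>)
    show ?thesis unfolding h_def by (intro has_derivative_diff 1 2)
  qed
  have "\<exists>\<xi>\<in>{0<..<s}. h s - h 0 = fd f (x + \<xi> *\<^sub>R u + s *\<^sub>R v) ((s-0) *\<^sub>R u) - fd f (x + \<xi> *\<^sub>R u) ((s-0) *\<^sub>R u)"
    by (rule mvt_simple[OF s hd]) simp
  then obtain \<xi> where \<xi>: "\<xi> \<in> {0<..<s}" "h s - h 0 = fd f (x + \<xi> *\<^sub>R u + s *\<^sub>R v) ((s-0) *\<^sub>R u) - fd f (x + \<xi> *\<^sub>R u) ((s-0) *\<^sub>R u)" ..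
  have lin: "fd f y (s *\<^sub>R u) = s * fd f y u" if "y \<in> S" for y
    using linear_scale[OF smooth_on_fd_linear[OF sm that], of s u] by simp
  have e1: "h s - h 0 = s * (fd f (x + \<xi> *\<^sub>R u + s *\<^sub>R v) u - fd f (x + \<xi> *\<^sub>R u) u)"
    using \<xi> lin[OF sub[of \<xi> s]] lin[OF sub0[of \<xi>]] s by (simp add: right_diff_distrib)
  define k where "k r = fd f (x + \<xi> *\<^sub>R u + r *\<^sub>R v) u" for r
  have kd: "(k has_derivative (\<lambda>d. fd (\<lambda>y. fd f y u) (x + \<xi> *\<^sub>R u + r *\<^sub>R v) (d *\<^sub>R v))) (at r within {0..s})"
    if r: "r \<in> {0..s}" for r
    unfolding k_def
    by (rule has_derivative_compose[where f="\<lambda>r. x + \<xi> *\<^sub>R u + r *\<^sub>R v", OF _ smooth_on_has_derivative[OF smooth_on_fd[OF sm]]])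
       (use sub[of \<xi> r] \<xi> r in \<open>auto intro!: derivative_eq_intros\<close>)
  have "\<exists>\<zeta>\<in>{0<..<s}. k s - k 0 = fd (\<lambda>y. fd f y u) (x + \<xi> *\<^sub>R u + \<zeta> *\<^sub>R v) ((s-0) *\<^sub>R v)"
    by (rule mvt_simple[OF s kd]) simp
  then obtain \<zeta> where z: "\<zeta> \<in> {0<..<s}" "k s - k 0 = fd (\<lambda>y. fd f y u) (x + \<xi> *\<^sub>R u + \<zeta> *\<^sub>R v) ((s-0) *\<^sub>R v)" ..
  have mem: "x + \<xi> *\<^sub>R u + \<zeta> *\<^sub>R v \<in> S" using sub[of \<xi> \<zeta>] \<xi> z by auto
  have "k s - k 0 = s * fd (\<lambda>y. fd f y u) (x + \<xi> *\<^sub>R u + \<zeta> *\<^sub>R v) v"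
    using z(2) linear_scale[OF smooth_on_fd_linear[OF smooth_on_fd[OF sm, of u] mem], of s v] by simp
  then have "h s - h 0 = s * (s * fd (\<lambda>y. fd f y u) (x + \<xi> *\<^sub>R u + \<zeta> *\<^sub>R v) v)"
    using e1 by (simp only: k_def scaleR_zero_left add_0_right)
  moreover have "h s - h 0 = f (x + s *\<^sub>R u + s *\<^sub>R v) - f (x + s *\<^sub>R u) - f (x + s *\<^sub>R v) + f x"
    by (simp add: h_def)
  ultimately have "f (x + s *\<^sub>R u + s *\<^sub>R v) - f (x + s *\<^sub>R u) - f (x + s *\<^sub>R v) + f x
      = s\<^sup>2 * fd (\<lambda>y. fd f y u) (x + \<xi> *\<^sub>R u + \<zeta> *\<^sub>R v) v"
    by (simp only: power2_eq_square mult.assoc)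
  note eq = this
  have m: "\<xi> \<in> {0..s}" "\<zeta> \<in> {0..s}" using \<xi>(1) z(1) by simp_all
  show ?thesis by (rule bexI[OF _ m(1)], rule bexI[OF _ m(2)], rule eq)
qed

text \<open>Schwarz's theorem. If the mixed derivatives differed at \<open>x\<close>, continuity
  would keep them apart near \<open>x\<close>; but the double difference over a small parallelogram
  is \<open>s\<^sup>2\<close> times a nearby value of each of them.\<close>

lemma fd_commute_real:
  fixes f :: "'e::euclidean_space \<Rightarrow> real"
  assumes op: "open S" and sm: "smooth_on S f" and x: "x \<in> S"
  shows "fd (\<lambda>y. fd f y u) x v = fd (\<lambda>y. fd f y v) x u"
proof (rule ccontr)
  assume ne: "fd (\<lambda>y. fd f y u) x v \<noteq> fd (\<lambda>y. fd f y v) x u" (is "?A x \<noteq> ?B x")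
  define e where "e = dist (?A x) (?B x) / 2"
  have e: "e > 0" using ne by (simp add: e_def)
  have "continuous_on S ?A" "continuous_on S ?B"
    by (intro smooth_on_continuous smooth_on_fd sm)+
  then have "isCont ?A x" "isCont ?B x"
    using op x by (simp_all only: continuous_on_eq_continuous_at)
  then have "(?A \<longlongrightarrow> ?A x) (nhds x)" "(?B \<longlongrightarrow> ?B x) (nhds x)"
    unfolding isCont_def
    using tendsto_at_iff_tendsto_nhds[of ?A x] tendsto_at_iff_tendsto_nhds[of ?B x] by (simp_all only:)
  note this[THEN tendstoD, OF e]
  moreover have "\<forall>\<^sub>F y in nhds x. y \<in> S" using op x by (rule eventually_nhds_in_open)
  ultimately have "\<forall>\<^sub>F y in nhds x. dist (?A y) (?A x) < e \<and> dist (?B y) (?B x) < e \<and> y \<in> S"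
    by (simp add: eventually_conj_iff)
  then obtain d where d: "d > 0" "\<And>y. dist y x < d \<Longrightarrow> dist (?A y) (?A x) < e \<and> dist (?B y) (?B x) < e \<and> y \<in> S"
    unfolding eventually_nhds_metric by auto
  \<comment> \<open>Sides so short that the whole parallelogram lies in the ball of radius
    \<open>d\<close> about \<open>x\<close>.\<close>
  define s where "s = d / (2 * (norm u + norm v + 1))"
  have s: "s > 0" using d by (simp add: s_def add_nonneg_pos)
  have near: "dist (x + t *\<^sub>R u + r *\<^sub>R v) x < d" if "0 \<le> t" "t \<le> s" "0 \<le> r" "r \<le> s" for t r
  proof -
    have "dist (x + t *\<^sub>R u + r *\<^sub>R v) x \<le> t * norm u + r * norm v"
      using norm_triangle_ineq[of "t *\<^sub>R u" "r *\<^sub>R v"] that by (simp add: dist_norm add.assoc)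
    also have "\<dots> \<le> s * norm u + s * norm v" using that by (intro add_mono mult_right_mono) auto
    also have "\<dots> < s * (2 * (norm u + norm v + 1))" using s
      by (simp add: algebra_simps add_strict_increasing2 add_nonneg_pos)
    also have "\<dots> = d" using d by (simp add: s_def add_nonneg_eq_0_iff)
    finally show ?thesis .
  qed
  have near': "dist (x + t *\<^sub>R v + r *\<^sub>R u) x < d" if "0 \<le> t" "t \<le> s" "0 \<le> r" "r \<le> s" for t r
    using near[OF that(3,4,1,2)] by (simp add: add_ac)
  obtain a b where ab: "a \<in> {0..s}" "b \<in> {0..s}" "f (x + s *\<^sub>R u + s *\<^sub>R v) - f (x + s *\<^sub>R u) - f (x + s *\<^sub>R v) + f x
      = s\<^sup>2 * ?A (x + a *\<^sub>R u + b *\<^sub>R v)"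
    using second_difference_mvt[OF sm s d(2)[OF near, THEN conjunct2, THEN conjunct2]] by blast
  obtain a' b' where ab': "a' \<in> {0..s}" "b' \<in> {0..s}" "f (x + s *\<^sub>R v + s *\<^sub>R u) - f (x + s *\<^sub>R v) - f (x + s *\<^sub>R u) + f x
      = s\<^sup>2 * ?B (x + a' *\<^sub>R v + b' *\<^sub>R u)"
    using second_difference_mvt[OF sm s d(2)[OF near', THEN conjunct2, THEN conjunct2]] by blast
  have "s\<^sup>2 * ?A (x + a *\<^sub>R u + b *\<^sub>R v) = s\<^sup>2 * ?B (x + a' *\<^sub>R v + b' *\<^sub>R u)"
  proof -
    have "x + s *\<^sub>R u + s *\<^sub>R v = x + s *\<^sub>R v + s *\<^sub>R u" by simp
    then have "f (x + s *\<^sub>R u + s *\<^sub>R v) = f (x + s *\<^sub>R v + s *\<^sub>R u)" by (rule arg_cong)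
    with ab(3) ab'(3) show ?thesis by linarith
  qed
  then have "?A (x + a *\<^sub>R u + b *\<^sub>R v) = ?B (x + a' *\<^sub>R v + b' *\<^sub>R u)" using s by simp
  moreover have "dist (?A (x + a *\<^sub>R u + b *\<^sub>R v)) (?A x) < e"
    using d(2)[OF near[of a b]] ab(1,2) by simp
  moreover have "dist (?B (x + a' *\<^sub>R v + b' *\<^sub>R u)) (?B x) < e"
    using d(2)[OF near'[of a' b']] ab'(1,2) by simp
  ultimately show False unfolding e_def
    using dist_triangle_half_r[of "?A (x + a *\<^sub>R u + b *\<^sub>R v)" "?A x" "dist (?A x) (?B x)" "?B x"] by simp
qed

lemma fd_inner:
  assumes "f differentiable (at x)"
  shows "fd (\<lambda>y. f y \<bullet> b) x v = fd f x v \<bullet> b"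
  by (rule fd_eqI) (intro has_derivative_inner_left fd_works assms)

lemma fd_commute:
  fixes f :: "'e::euclidean_space \<Rightarrow> 'b::euclidean_space"
  assumes op: "open S" and sm: "smooth_on S f" and x: "x \<in> S"
  shows "fd (\<lambda>y. fd f y u) x v = fd (\<lambda>y. fd f y v) x u"
proof (rule euclidean_eqI)
  fix b :: 'b
  have smb: "smooth_on S (\<lambda>y. f y \<bullet> b)"
    by (rule smooth_on_linear_comp[OF op bounded_linear_inner_left sm])
  have *: "fd (\<lambda>y. fd f y u) x v \<bullet> b = fd (\<lambda>y. fd (\<lambda>y. f y \<bullet> b) y u) x v" for u v
  proof -
    have 1: "(\<lambda>y. fd f y u \<bullet> b) differentiable (at x)"
      by (rule smooth_on_differentiable[OF smooth_on_linear_comp[OF op bounded_linear_inner_left smooth_on_fd[OF sm]] x])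
    have "fd (\<lambda>y. fd (\<lambda>y. f y \<bullet> b) y u) x = fd (\<lambda>y. fd f y u \<bullet> b) x"
      by (rule fd_cong_open(2)[OF op x _ 1]) (simp add: fd_inner smooth_on_differentiable[OF sm])
    moreover have "fd (\<lambda>y. fd f y u \<bullet> b) x v = fd (\<lambda>y. fd f y u) x v \<bullet> b"
      by (rule fd_inner[OF smooth_on_differentiable[OF smooth_on_fd[OF sm] x]])
    ultimately show ?thesis by simp
  qed
  show "fd (\<lambda>y. fd f y u) x v \<bullet> b = fd (\<lambda>y. fd f y v) x u \<bullet> b"
    unfolding * by (rule fd_commute_real[OF op smb x])
qed

subsection \<open>Families of linear maps\<close>

lemma linear_expand:
  fixes h :: "'e::euclidean_space \<Rightarrow> 'b::real_vector"
  assumes "linear h"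
  shows "h w = (\<Sum>b\<in>Basis. (w \<bullet> b) *\<^sub>R h b)"
proof -
  have "h w = h (\<Sum>b\<in>Basis. (w \<bullet> b) *\<^sub>R b)" by (simp add: euclidean_representation)
  then show ?thesis by (simp add: linear_sum[OF assms] linear_scale[OF assms])
qed

lemma continuous_on_linear_family:
  fixes h :: "'a::topological_space \<Rightarrow> 'e::euclidean_space \<Rightarrow> 'b::real_normed_vector"
  assumes "\<And>x. x \<in> S \<Longrightarrow> linear (h x)" "\<And>b. b \<in> Basis \<Longrightarrow> continuous_on S (\<lambda>x. h x b)"
    "continuous_on S w"
  shows "continuous_on S (\<lambda>x. h x (w x))"
proof -
  have "continuous_on S (\<lambda>x. \<Sum>b\<in>Basis. (w x \<bullet> b) *\<^sub>R h x b)"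
    by (intro continuous_intros assms)
  then show ?thesis by (rule continuous_on_eq) (use assms(1) linear_expand in metis)
qed

text \<open>Differentiability is known only for fixed arguments of the linear maps. Finite dimension
  carries it from basis vectors to all vectors, and the derivative is again linear in the
  argument.\<close>

lemma fd_linear_family:
  fixes h :: "'d::real_normed_vector \<Rightarrow> 'e::euclidean_space \<Rightarrow> 'b::real_normed_vector"
  assumes op: "open S" and x: "x \<in> S" and lin: "\<And>y. y \<in> S \<Longrightarrow> linear (h y)"
    and diff: "\<And>b. b \<in> Basis \<Longrightarrow> (\<lambda>y. h y b) differentiable (at x)"
  shows "(\<lambda>y. h y w) differentiable (at x)"
    "fd (\<lambda>y. h y w) x k = (\<Sum>b\<in>Basis. (w \<bullet> b) *\<^sub>R fd (\<lambda>y. h y b) x k)"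
    "linear (\<lambda>w. fd (\<lambda>y. h y w) x k)"
proof -
  have *: "((\<lambda>y. h y w) has_derivative (\<lambda>k. \<Sum>b\<in>Basis. (w \<bullet> b) *\<^sub>R fd (\<lambda>y. h y b) x k)) (at x)" for w
  proof (rule has_derivative_transform_within_open[OF _ op x])
    show "((\<lambda>y. \<Sum>b\<in>Basis. (w \<bullet> b) *\<^sub>R h y b) has_derivative (\<lambda>k. \<Sum>b\<in>Basis. (w \<bullet> b) *\<^sub>R fd (\<lambda>y. h y b) x k)) (at x)"
      by (intro has_derivative_sum has_derivative_scaleR_right fd_works diff)
    show "(\<Sum>b\<in>Basis. (w \<bullet> b) *\<^sub>R h y b) = h y w" if "y \<in> S" for y
      using linear_expand[OF lin[OF that]] by metis
  qed
  show "(\<lambda>y. h y w) differentiable (at x)" using * differentiable_def by blast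
  show e: "fd (\<lambda>y. h y w) x k = (\<Sum>b\<in>Basis. (w \<bullet> b) *\<^sub>R fd (\<lambda>y. h y b) x k)" for w
    using fd_eqI[OF *] .
  show "linear (\<lambda>w. fd (\<lambda>y. h y w) x k)"
  proof (rule linearI)
    fix v w r
    show "fd (\<lambda>y. h y (v + w)) x k = fd (\<lambda>y. h y v) x k + fd (\<lambda>y. h y w) x k"
      unfolding e[of "v + w"] e[of v] e[of w] by (simp add: inner_add_left scaleR_add_left sum.distrib)
    show "fd (\<lambda>y. h y (r *\<^sub>R w)) x k = r *\<^sub>R fd (\<lambda>y. h y w) x k"
      unfolding e[of "r *\<^sub>R w"] e[of w] by (simp add: scaleR_sum_right)
  qed
qed

text \<open>Product rule for evaluating a point dependent linear map at a point dependent vector. It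
  serves \<open>D\<close>, \<open>Gam\<close> and \<open>J\<close>, which are given vector by vector
  and not as maps into a space of linear maps.\<close>

lemma has_derivative_linear_family:
  fixes h :: "'d::real_normed_vector \<Rightarrow> 'e::euclidean_space \<Rightarrow> 'b::real_normed_vector"
    and f :: "'t::real_normed_vector \<Rightarrow> 'd"
  assumes op: "open S" and x: "f t \<in> S" and lin: "\<And>y. y \<in> S \<Longrightarrow> linear (h y)"
    and diff: "\<And>b. b \<in> Basis \<Longrightarrow> (\<lambda>y. h y b) differentiable (at (f t))"
    and f: "(f has_derivative f') (at t)" and w: "(w has_derivative w') (at t)"
  shows "((\<lambda>s. h (f s) (w s)) has_derivative (\<lambda>k. fd (\<lambda>y. h y (w t)) (f t) (f' k) + h (f t) (w' k))) (at t)"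
proof -
  have ev: "\<forall>\<^sub>F s in nhds t. f s \<in> S"
    using has_derivative_continuous[OF f] op x
    unfolding isCont_def tendsto_at_iff_tendsto_nhds by (rule topological_tendstoD)
  then obtain A where A: "open A" "t \<in> A" "\<And>s. s \<in> A \<Longrightarrow> f s \<in> S" unfolding eventually_nhds by blast
  show ?thesis
  proof (rule has_derivative_transform_within_open[OF _ A(1,2)])
    have 1: "((\<lambda>s. h (f s) b) has_derivative (\<lambda>k. fd (\<lambda>y. h y b) (f t) (f' k))) (at t)" if "b \<in> Basis" for b
      by (rule has_derivative_compose[OF f fd_works[OF diff[OF that]]])
    have "((\<lambda>s. \<Sum>b\<in>Basis. (w s \<bullet> b) *\<^sub>R h (f s) b) has_derivative
        (\<lambda>k. \<Sum>b\<in>Basis. (w t \<bullet> b) *\<^sub>R fd (\<lambda>y. h y b) (f t) (f' k) + (w' k \<bullet> b) *\<^sub>R h (f t) b)) (at t)"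
      by (intro has_derivative_sum has_derivative_scaleR has_derivative_inner_left w 1)
    moreover have e: "fd (\<lambda>y. h y (w t)) (f t) k = (\<Sum>b\<in>Basis. (w t \<bullet> b) *\<^sub>R fd (\<lambda>y. h y b) (f t) k)" for k
      by (rule fd_linear_family(2)[where h=h and w="w t", OF op x lin diff])
    moreover have "h (f t) (w' k) = (\<Sum>b\<in>Basis. (w' k \<bullet> b) *\<^sub>R h (f t) b)" for k
      by (rule linear_expand[OF lin[OF x]])
    ultimately show "((\<lambda>s. \<Sum>b\<in>Basis. (w s \<bullet> b) *\<^sub>R h (f s) b) has_derivative
        (\<lambda>k. fd (\<lambda>y. h y (w t)) (f t) (f' k) + h (f t) (w' k))) (at t)"
      by (simp only: sum.distrib)
    show "(\<Sum>b\<in>Basis. (w s \<bullet> b) *\<^sub>R h (f s) b) = h (f s) (w s)" if "s \<in> A" for s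
      using linear_expand[OF lin[OF A(3)[OF that]]] by metis
  qed
qed

lemma vector_derivative_linear_family:
  fixes h :: "'d::real_normed_vector \<Rightarrow> 'e::euclidean_space \<Rightarrow> 'b::real_normed_vector"
  assumes op: "open S" and x: "f t \<in> S" and lin: "\<And>y. y \<in> S \<Longrightarrow> linear (h y)"
    and diff: "\<And>b. b \<in> Basis \<Longrightarrow> (\<lambda>y. h y b) differentiable (at (f t))"
    and f: "(f has_vector_derivative f') (at t)" and w: "(w has_vector_derivative w') (at t)"
  shows "((\<lambda>s. h (f s) (w s)) has_vector_derivative (fd (\<lambda>y. h y (w t)) (f t) f' + h (f t) w')) (at t)"
proof -
  have d: "(\<lambda>y. h y (w t)) differentiable (at (f t))" by (rule fd_linear_family[OF op x lin diff])
  have l: "linear (fd (\<lambda>y. h y (w t)) (f t))" by (rule linear_frechet_derivative[OF d])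
  show ?thesis
    using has_derivative_linear_family[OF op x lin diff f[unfolded has_vector_derivative_def] w[unfolded has_vector_derivative_def]]
    unfolding has_vector_derivative_def
    by (simp add: linear_scale[OF l] linear_scale[OF lin[OF x]] scaleR_add_right)
qed

lemma bilinear_linear:
  assumes "bilinear h" shows "linear (h x)" "linear (\<lambda>x. h x y)"
  using assms unfolding bilinear_def by auto

lemma continuous_on_bilinear_family:
  fixes h :: "'a::topological_space \<Rightarrow> 'd::euclidean_space \<Rightarrow> 'e::euclidean_space \<Rightarrow> 'b::real_normed_vector"
  assumes "\<And>x. x \<in> S \<Longrightarrow> bilinear (h x)" "\<And>a b. continuous_on S (\<lambda>x. h x a b)"
    "continuous_on S v" "continuous_on S w"
  shows "continuous_on S (\<lambda>x. h x (v x) (w x))"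
  by (rule continuous_on_linear_family[OF bilinear_linear(1)[OF assms(1)] _ assms(4)], assumption)
     (rule continuous_on_linear_family[OF bilinear_linear(2)[OF assms(1)] assms(2,3)])

subsection \<open>Second order jets of curves\<close>

text \<open>Peano form of the second order Taylor expansion at 0, with \<open>q\<close> as second
  derivative. Curves are compared later only up to \<open>o(s\<^sup>2)\<close>, and this form asks
  for no derivative away from 0.\<close>

definition jet2 :: "(real \<Rightarrow> 'b::real_normed_vector) \<Rightarrow> 'b \<Rightarrow> 'b \<Rightarrow> 'b \<Rightarrow> bool" where
  "jet2 y x v q \<longleftrightarrow> ((\<lambda>s. (1 / s\<^sup>2) *\<^sub>R (y s - x - s *\<^sub>R v - (s\<^sup>2 / 2) *\<^sub>R q)) \<longlongrightarrow> 0) (at 0)"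

lemma jet2_explicit: "jet2 (\<lambda>s. x + s *\<^sub>R v + (s\<^sup>2 / 2) *\<^sub>R q) x v q"
  unfolding jet2_def by simp

lemma jet2_iff_small: "jet2 y x v q \<longleftrightarrow>
   (\<forall>e>0. \<forall>\<^sub>F s in at 0. norm (y s - x - s *\<^sub>R v - (s\<^sup>2 / 2) *\<^sub>R q) \<le> e * s\<^sup>2)" (is "_ = (\<forall>e>0. ?P e)")
proof -
  have nz: "\<forall>\<^sub>F s in at (0::real). s \<noteq> 0" by (simp add: eventually_at_filter)
  have eq: "norm ((1 / s\<^sup>2) *\<^sub>R z) < e \<longleftrightarrow> norm z < e * s\<^sup>2" if "s \<noteq> 0" for s e :: real and z :: 'a
    using that by (simp add: divide_simps)
  show ?thesis
  proof
    assume j: "jet2 y x v q"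
    show "\<forall>e>0. ?P e"
    proof (intro allI impI)
      fix e :: real assume "e > 0"
      then have "\<forall>\<^sub>F s in at 0. norm ((1 / s\<^sup>2) *\<^sub>R (y s - x - s *\<^sub>R v - (s\<^sup>2 / 2) *\<^sub>R q)) < e"
        using j unfolding jet2_def tendsto_iff by (simp add: dist_norm)
      with nz show "?P e" by eventually_elim (simp add: pos_divide_less_eq less_imp_le)
    qed
  next
    assume r: "\<forall>e>0. ?P e"
    show "jet2 y x v q" unfolding jet2_def tendsto_iff
    proof (intro allI impI)
      fix e :: real assume "e > 0"
      then have "?P (e/2)" by (intro r[rule_format]) simp
      with nz show "\<forall>\<^sub>F s in at 0. dist ((1 / s\<^sup>2) *\<^sub>R (y s - x - s *\<^sub>R v - (s\<^sup>2 / 2) *\<^sub>R q)) 0 < e"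
      proof eventually_elim
        case (elim s)
        have "e / 2 * s\<^sup>2 < e * s\<^sup>2" using elim(1) \<open>e > 0\<close> by simp
        then show ?case using elim eq[OF elim(1), of _ e] by (simp add: dist_norm)
      qed
    qed
  qed
qed

lemma jet2_diff_small:
  assumes "jet2 y x v q" "jet2 z x v q" "e > 0"
  shows "\<forall>\<^sub>F s in at 0. norm (y s - z s) \<le> e * s\<^sup>2"
proof -
  have "e/2 > 0" using assms by simp
  from assms(1)[unfolded jet2_iff_small, rule_format, OF this] assms(2)[unfolded jet2_iff_small, rule_format, OF this]
  show ?thesis
  proof eventually_elim
    case (elim s)
    then show ?case
      using norm_triangle_ineq4[of "y s - x - s *\<^sub>R v - (s\<^sup>2 / 2) *\<^sub>R q" "z s - x - s *\<^sub>R v - (s\<^sup>2 / 2) *\<^sub>R q"]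
      by (simp add: algebra_simps)
  qed
qed

lemma jet2_close:
  assumes "jet2 y x v q" "\<And>e. e > 0 \<Longrightarrow> \<forall>\<^sub>F s in at 0. norm (y s - z s) \<le> e * s\<^sup>2"
  shows "jet2 z x v q"
  unfolding jet2_iff_small
proof (intro allI impI)
  fix e :: real assume "e > 0"
  then have h: "e/2 > 0" by simp
  from assms(1)[unfolded jet2_iff_small, rule_format, OF h] assms(2)[OF h]
  show "\<forall>\<^sub>F s in at 0. norm (z s - x - s *\<^sub>R v - (s\<^sup>2 / 2) *\<^sub>R q) \<le> e * s\<^sup>2"
  proof eventually_elim
    case (elim s)
    then show ?case
      using norm_triangle_ineq4[of "y s - x - s *\<^sub>R v - (s\<^sup>2 / 2) *\<^sub>R q" "y s - z s"]
      by (simp add: algebra_simps)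
  qed
qed

lemma jet2_tendsto:
  assumes "jet2 y x v q" shows "(y \<longlongrightarrow> x) (at 0)"
proof -
  have "((\<lambda>s. s\<^sup>2 *\<^sub>R ((1 / s\<^sup>2) *\<^sub>R (y s - x - s *\<^sub>R v - (s\<^sup>2 / 2) *\<^sub>R q)) + (x + s *\<^sub>R v + (s\<^sup>2 / 2) *\<^sub>R q))
     \<longlongrightarrow> (0::real)\<^sup>2 *\<^sub>R 0 + (x + 0 *\<^sub>R v + (0\<^sup>2 / 2) *\<^sub>R q)) (at 0)"
    by (intro tendsto_intros assms[unfolded jet2_def]) simp
  then have "((\<lambda>s. s\<^sup>2 *\<^sub>R ((1 / s\<^sup>2) *\<^sub>R (y s - x - s *\<^sub>R v - (s\<^sup>2 / 2) *\<^sub>R q)) + (x + s *\<^sub>R v + (s\<^sup>2 / 2) *\<^sub>R q))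
     \<longlongrightarrow> x) (at 0)" by simp
  then show ?thesis
    by (rule Lim_transform_eventually) (simp add: eventually_at_filter)
qed

lemma jet2_first:
  assumes "jet2 y x v q" shows "((\<lambda>s. (1 / s) *\<^sub>R (y s - x)) \<longlongrightarrow> v) (at 0)"
proof -
  have "((\<lambda>s. s *\<^sub>R ((1 / s\<^sup>2) *\<^sub>R (y s - x - s *\<^sub>R v - (s\<^sup>2 / 2) *\<^sub>R q)) + (v + (s / 2) *\<^sub>R q))
     \<longlongrightarrow> (0::real) *\<^sub>R 0 + (v + (0 / 2) *\<^sub>R q)) (at 0)"
    by (intro tendsto_intros assms[unfolded jet2_def]) simp
  then have "((\<lambda>s. s *\<^sub>R ((1 / s\<^sup>2) *\<^sub>R (y s - x - s *\<^sub>R v - (s\<^sup>2 / 2) *\<^sub>R q)) + (v + (s / 2) *\<^sub>R q))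
     \<longlongrightarrow> v) (at 0)" by simp
  then show ?thesis
    by (rule Lim_transform_eventually)
      (simp add: eventually_at_filter scaleR_diff_right scaleR_add_right power2_eq_square divide_simps)
qed

lemma jet2_unique:
  assumes "jet2 y x v q" "jet2 y x v' q'" shows "v = v'" "q = q'"
proof -
  show v: "v = v'"
    by (rule tendsto_unique[OF _ jet2_first[OF assms(1)] jet2_first[OF assms(2)]]) simp
  have "((\<lambda>s. 2 *\<^sub>R ((1 / s\<^sup>2) *\<^sub>R (y s - x - s *\<^sub>R v - (s\<^sup>2 / 2) *\<^sub>R q')
      - (1 / s\<^sup>2) *\<^sub>R (y s - x - s *\<^sub>R v - (s\<^sup>2 / 2) *\<^sub>R q))) \<longlongrightarrow> 2 *\<^sub>R (0 - 0)) (at 0)"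
    using assms unfolding v jet2_def by (intro tendsto_intros)
  then have 1: "((\<lambda>s. 2 *\<^sub>R ((1 / s\<^sup>2) *\<^sub>R (y s - x - s *\<^sub>R v - (s\<^sup>2 / 2) *\<^sub>R q')
      - (1 / s\<^sup>2) *\<^sub>R (y s - x - s *\<^sub>R v - (s\<^sup>2 / 2) *\<^sub>R q))) \<longlongrightarrow> 0) (at 0)" by simp
  have "((\<lambda>s::real. q - q') \<longlongrightarrow> 0) (at 0)"
    by (rule Lim_transform_eventually[OF 1])
      (simp add: eventually_at_filter scaleR_diff_right[symmetric])
  then have "q - q' = 0" by (simp add: tendsto_const_iff)
  then show "q = q'" by simp
qed

text \<open>Strict differentiability, by the mean value inequality for \<open>T - fd T x\<close> on
  a small ball. Both points \<open>a\<close> and \<open>b\<close> vary; \<open>jet2_map\<close>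
  compares a curve with a line, neither of which rests at \<open>x\<close>.\<close>

lemma C1_strict:
  fixes T :: "'e::euclidean_space \<Rightarrow> 'b::real_normed_vector"
  assumes op: "open S" and sm: "smooth_on S T" and x: "x \<in> S" and e: "e > 0"
  shows "\<exists>d>0. ball x d \<subseteq> S \<and> (\<forall>a\<in>ball x d. \<forall>b\<in>ball x d. norm (T a - T b - fd T x (a - b)) \<le> e * norm (a - b))"
proof -
  obtain d0 where d0: "d0 > 0" "ball x d0 \<subseteq> S" using op x open_contains_ball by blast
  \<comment> \<open>The deviations of the derivative at the basis vectors add up, so each may use
    less than a share of 1 / DIM('e).\<close>
  define e' where "e' = e / (DIM('e) + 1)"
  have e': "e' > 0" using e by (simp add: e'_def)
  have "\<forall>\<^sub>F y in nhds x. \<forall>b\<in>Basis. norm (fd T y b - fd T x b) < e'"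
  proof (intro eventually_ball_finite finite_Basis ballI)
    fix b :: 'e
    have "isCont (\<lambda>y. fd T y b) x"
      using smooth_on_continuous[OF smooth_on_fd[OF sm]] op x by (simp add: continuous_on_eq_continuous_at)
    then have "((\<lambda>y. fd T y b) \<longlongrightarrow> fd T x b) (nhds x)"
      unfolding isCont_def using tendsto_at_iff_tendsto_nhds[of "\<lambda>y. fd T y b" x] by simp
    from tendstoD[OF this e'] show "\<forall>\<^sub>F y in nhds x. norm (fd T y b - fd T x b) < e'" by (simp add: dist_norm)
  qed
  then obtain d1 where d1: "d1 > 0" "\<And>y b. dist y x < d1 \<Longrightarrow> b \<in> Basis \<Longrightarrow> norm (fd T y b - fd T x b) < e'"
    unfolding eventually_nhds_metric by blast
  define d where "d = min d0 d1"
  have sub: "ball x d \<subseteq> S" using d0 by (auto simp: d_def)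
  have lx: "linear (fd T x)" by (rule smooth_on_fd_linear[OF sm x])
  have on: "onorm (\<lambda>k. fd T y k - fd T x k) \<le> e" if y: "y \<in> ball x d" for y
  proof (rule onorm_le)
    fix k
    have ly: "linear (fd T y)" by (rule smooth_on_fd_linear[OF sm]) (use y sub in auto)
    have "fd T y k - fd T x k = (\<Sum>b\<in>Basis. (k \<bullet> b) *\<^sub>R (fd T y b - fd T x b))"
      using linear_expand[OF ly, of k] linear_expand[OF lx, of k]
      by (simp add: scaleR_diff_right sum_subtractf)
    also have "norm \<dots> \<le> (\<Sum>b\<in>(Basis::'e set). norm k * e')"
    proof (rule sum_norm_le)
      fix b :: 'e assume b: "b \<in> Basis"
      have "norm (fd T y b - fd T x b) \<le> e'" using d1(2)[of y b] b y by (simp add: d_def dist_commute less_imp_le)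
      then show "norm ((k \<bullet> b) *\<^sub>R (fd T y b - fd T x b)) \<le> norm k * e'"
        using Basis_le_norm[OF b, of k] by (simp add: mult_mono)
    qed
    also have "\<dots> = norm k * (DIM('e) * e')" by simp
    also have "\<dots> \<le> norm k * e" using e by (intro mult_left_mono) (auto simp: e'_def divide_simps)
    finally show "norm (fd T y k - fd T x k) \<le> e * norm k" by (simp add: mult.commute)
  qed
  have "norm (T a - T b - fd T x (a - b)) \<le> e * norm (a - b)" if "a \<in> ball x d" "b \<in> ball x d" for a b
  proof -
    have bl: "bounded_linear (fd T x)" using lx by (simp add: linear_conv_bounded_linear)
    have "norm ((T a - fd T x a) - (T b - fd T x b)) \<le> e * norm (a - b)"
    proof (rule differentiable_bound[OF convex_ball _ on that])
      fix y assume "y \<in> ball x d"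
      then have "y \<in> S" using sub by blast
      then show "((\<lambda>y. T y - fd T x y) has_derivative (\<lambda>k. fd T y k - fd T x k)) (at y within ball x d)"
        by (intro has_derivative_diff has_derivative_at_withinI[OF smooth_on_has_derivative[OF sm]]
            bounded_linear_imp_has_derivative[OF bl])
    qed
    then show ?thesis by (simp add: linear_diff[OF lx] algebra_simps)
  qed
  then show ?thesis using sub d0 d1 by (intro exI[of _ d]) (auto simp: d_def)
qed

text \<open>Taylor's formula with Peano remainder along a line; the remainder of \<open>T\<close> is only controlled
  through \<open>C1_strict\<close>, so no symmetry of the second derivative is needed.\<close>

lemma jet2_line:
  fixes T :: "'e::euclidean_space \<Rightarrow> 'b::real_normed_vector"
  assumes op: "open S" and sm: "smooth_on S T" and x: "x \<in> S"
  shows "jet2 (\<lambda>s. T (x + s *\<^sub>R v)) (T x) (fd T x v) (fd (\<lambda>y. fd T y v) x v)"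
  unfolding jet2_iff_small
proof (intro allI impI)
  fix e :: real assume e: "e > 0"
  define a where "a = fd (\<lambda>y. fd T y v) x v"
  have l: "((\<lambda>s. x + s *\<^sub>R v) has_vector_derivative v) (at s)" for s
    by (auto intro!: derivative_eq_intros)
  have ev: "\<forall>\<^sub>F s in nhds 0. x + s *\<^sub>R v \<in> S"
  proof -
    have "((\<lambda>s. x + s *\<^sub>R v) \<longlongrightarrow> x + 0 *\<^sub>R v) (nhds 0)" by (intro tendsto_intros filterlim_ident)
    then show ?thesis using topological_tendstoD[OF _ op] x by fastforce
  qed
  have "((\<lambda>s. fd T (x + s *\<^sub>R v) v) has_vector_derivative a) (at 0)"
  proof -
    have "((\<lambda>y. fd T y v) has_derivative fd (\<lambda>y. fd T y v) x) (at (x + 0 *\<^sub>R v))"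
      using smooth_on_has_derivative[OF smooth_on_fd[OF sm] x] by simp
    from vector_derivative_diff_chain_within[OF l[THEN has_vector_derivative_at_within] has_derivative_at_withinI[OF this]]
    show ?thesis by (simp add: o_def a_def)
  qed
  then have "\<forall>\<^sub>F s in nhds 0. norm (fd T (x + s *\<^sub>R v) v - fd T x v - s *\<^sub>R a) \<le> e * norm (s - 0)"
    using e unfolding has_vector_derivative_def has_derivative_within_alt2
    by (auto simp: eventually_at_filter elim!: eventually_mono allE[of _ e])
  with ev have "\<forall>\<^sub>F s in nhds 0. x + s *\<^sub>R v \<in> S \<and> norm (fd T (x + s *\<^sub>R v) v - fd T x v - s *\<^sub>R a) \<le> e * \<bar>s\<bar>"
    by eventually_elim simp
  then obtain d where d: "d > 0" "\<And>s. \<bar>s\<bar> < d \<Longrightarrow> x + s *\<^sub>R v \<in> S \<and> norm (fd T (x + s *\<^sub>R v) v - fd T x v - s *\<^sub>R a) \<le> e * \<bar>s\<bar>"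
    unfolding eventually_nhds_metric by (auto simp: dist_real_def)
  \<comment> \<open>Its derivative at \<open>t\<close> is at most \<open>e * \<bar>t\<bar>\<close>,
    so the mean value inequality on the segment from 0 to \<open>s\<close> gives a quadratic bound,
    for either sign of \<open>s\<close>.\<close>
  define r where "r s = T (x + s *\<^sub>R v) - s *\<^sub>R fd T x v - (s\<^sup>2 / 2) *\<^sub>R a" for s
  have rd: "(r has_derivative (\<lambda>h. h *\<^sub>R (fd T (x + s *\<^sub>R v) v - fd T x v - s *\<^sub>R a))) (at s within X)" if "\<bar>s\<bar> < d" for s X
  proof -
    have "((\<lambda>s. T (x + s *\<^sub>R v)) has_vector_derivative fd T (x + s *\<^sub>R v) v) (at s)"
      using vector_derivative_diff_chain_within[OF l[THEN has_vector_derivative_at_within]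
          has_derivative_at_withinI[OF smooth_on_has_derivative[OF sm d(2)[OF that, THEN conjunct1]]]]
      by (simp add: o_def)
    then have "(r has_vector_derivative (fd T (x + s *\<^sub>R v) v - fd T x v - s *\<^sub>R a)) (at s)"
      unfolding r_def by (auto intro!: derivative_eq_intros simp: algebra_simps)
    then show ?thesis unfolding has_vector_derivative_def by (rule has_derivative_at_withinI)
  qed
  have main: "norm (r s - r 0) \<le> e * s\<^sup>2" if s: "\<bar>s\<bar> < d" for s
  proof -
    let ?I = "closed_segment 0 s"
    have I: "\<bar>t\<bar> \<le> \<bar>s\<bar>" if "t \<in> ?I" for t using segment_bound1[OF that] by simp
    have "norm (r s - r 0) \<le> (e * \<bar>s\<bar>) * norm (s - 0)"
    proof (rule differentiable_bound[of ?I])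
      fix t assume t: "t \<in> ?I"
      have td: "\<bar>t\<bar> < d" using I[OF t] s by simp
      show "(r has_derivative (\<lambda>h. h *\<^sub>R (fd T (x + t *\<^sub>R v) v - fd T x v - t *\<^sub>R a))) (at t within ?I)"
        by (rule rd[OF td])
      show "onorm (\<lambda>h. h *\<^sub>R (fd T (x + t *\<^sub>R v) v - fd T x v - t *\<^sub>R a)) \<le> e * \<bar>s\<bar>"
      proof (rule onorm_le)
        fix h
        have "norm (fd T (x + t *\<^sub>R v) v - fd T x v - t *\<^sub>R a) \<le> e * \<bar>s\<bar>"
          using d(2)[OF td] I[OF t] e by (meson mult_left_mono order_trans less_imp_le)
        then show "norm (h *\<^sub>R (fd T (x + t *\<^sub>R v) v - fd T x v - t *\<^sub>R a)) \<le> e * \<bar>s\<bar> * norm h"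
          by (simp add: mult.commute mult_left_mono)
      qed
    qed auto
    then show ?thesis by (simp add: power2_eq_square mult.assoc)
  qed
  show "\<forall>\<^sub>F s in at 0. norm (T (x + s *\<^sub>R v) - T x - s *\<^sub>R fd T x v - (s\<^sup>2 / 2) *\<^sub>R fd (\<lambda>y. fd T y v) x v) \<le> e * s\<^sup>2"
    unfolding eventually_at using d(1) main
    by (intro exI[of _ d]) (auto simp: r_def a_def[symmetric] algebra_simps dist_real_def)
qed

text \<open>The curve differs from the line \<open>x + s *\<^sub>R v\<close> by a displacement of
  order \<open>s\<^sup>2\<close>. The line is covered by \<open>jet2_line\<close>, and on the
  displacement strict differentiability is precise enough.\<close>

lemma jet2_map:
  fixes T :: "'e::euclidean_space \<Rightarrow> 'b::real_normed_vector"
  assumes op: "open S" and sm: "smooth_on S T" and x: "x \<in> S" and y: "jet2 y x v q"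
  shows "jet2 (\<lambda>s. T (y s)) (T x) (fd T x v) (fd T x q + fd (\<lambda>y. fd T y v) x v)"
  unfolding jet2_iff_small
proof (intro allI impI)
  fix e :: real assume e: "e > 0"
  have lx: "linear (fd T x)" by (rule smooth_on_fd_linear[OF sm x])
  obtain K where K: "K > 0" "\<And>k. norm (fd T x k) \<le> K * norm k"
    using linear_bounded_pos[OF lx] by blast
  \<comment> \<open>\<open>e1\<close> and \<open>e2\<close> divide the error into thirds: strict
    differentiability on a displacement of size at most \<open>(norm q + 1) * s\<^sup>2\<close>, the
    image of the remainder of \<open>y\<close>, and the remainder along the line.\<close>
  define e1 where "e1 = e / (3 * (norm q + 1))"
  have e1: "e1 > 0" using e by (simp add: e1_def add_nonneg_pos)
  define e2 where "e2 = min 1 (e / (3 * K))"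
  have e2: "e2 > 0" using e K by (simp add: e2_def)
  obtain d where d: "d > 0" "\<forall>a\<in>ball x d. \<forall>b\<in>ball x d. norm (T a - T b - fd T x (a - b)) \<le> e1 * norm (a - b)"
    using C1_strict[OF op sm x e1] by blast
  have ytends: "\<forall>\<^sub>F s in at 0. dist (y s) x < d" using tendstoD[OF jet2_tendsto[OF y] d(1)] .
  have ltends: "\<forall>\<^sub>F s in at 0. dist (x + s *\<^sub>R v) x < d"
  proof -
    have "((\<lambda>s. x + s *\<^sub>R v) \<longlongrightarrow> x + 0 *\<^sub>R v) (at 0)" by (intro tendsto_intros)
    from tendstoD[OF this d(1)] show ?thesis by simp
  qed
  have e3: "e / 3 > 0" using e by simp
  from ytends ltends y[unfolded jet2_iff_small, rule_format, OF e2]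
    jet2_line[OF op sm x, of v, unfolded jet2_iff_small, rule_format, OF e3]
  show "\<forall>\<^sub>F s in at 0. norm (T (y s) - T x - s *\<^sub>R fd T x v - (s\<^sup>2 / 2) *\<^sub>R (fd T x q + fd (\<lambda>y. fd T y v) x v)) \<le> e * s\<^sup>2"
  proof eventually_elim
    case (elim s)
    define w where "w = y s - x - s *\<^sub>R v - (s\<^sup>2 / 2) *\<^sub>R q"
    have yw: "y s - (x + s *\<^sub>R v) = (s\<^sup>2 / 2) *\<^sub>R q + w" by (simp add: w_def)
    have w: "norm w \<le> e2 * s\<^sup>2" using elim(3) by (simp add: w_def)
    have "norm ((s\<^sup>2 / 2) *\<^sub>R q + w) \<le> (s\<^sup>2 / 2) * norm q + e2 * s\<^sup>2"
      using norm_triangle_ineq[of "(s\<^sup>2 / 2) *\<^sub>R q" w] w by simp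
    also have "\<dots> \<le> s\<^sup>2 * norm q + 1 * s\<^sup>2"
      by (intro add_mono mult_right_mono) (auto simp: e2_def)
    finally have n: "norm ((s\<^sup>2 / 2) *\<^sub>R q + w) \<le> (norm q + 1) * s\<^sup>2" by (simp add: algebra_simps)
    have "norm (T (y s) - T (x + s *\<^sub>R v) - fd T x (y s - (x + s *\<^sub>R v))) \<le> e1 * norm (y s - (x + s *\<^sub>R v))"
      using d(2) elim(1,2) by (simp add: dist_commute)
    also have "\<dots> \<le> e1 * ((norm q + 1) * s\<^sup>2)" unfolding yw using n e1 by (intro mult_left_mono) auto
    also have "\<dots> = e / 3 * s\<^sup>2"
    proof -
      have "norm q + 1 > 0" by (smt (verit) norm_ge_zero)
      then show ?thesis unfolding e1_def by (simp add: field_simps)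
    qed
    finally have A: "norm (T (y s) - T (x + s *\<^sub>R v) - fd T x (y s - (x + s *\<^sub>R v))) \<le> e / 3 * s\<^sup>2" .
    have "norm (fd T x w) \<le> K * (e2 * s\<^sup>2)" using K w by (meson mult_left_mono order_trans less_imp_le)
    also have "\<dots> \<le> K * (e / (3 * K) * s\<^sup>2)" using K by (intro mult_left_mono mult_right_mono) (auto simp: e2_def)
    also have "\<dots> = e / 3 * s\<^sup>2" using K by simp
    finally have B: "norm (fd T x w) \<le> e / 3 * s\<^sup>2" .
    have lin: "fd T x (y s - (x + s *\<^sub>R v)) = (s\<^sup>2 / 2) *\<^sub>R fd T x q + fd T x w"
      unfolding yw by (simp add: linear_add[OF lx] linear_scale[OF lx])
    have "T (y s) - T x - s *\<^sub>R fd T x v - (s\<^sup>2 / 2) *\<^sub>R (fd T x q + fd (\<lambda>y. fd T y v) x v) =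
      (T (y s) - T (x + s *\<^sub>R v) - fd T x (y s - (x + s *\<^sub>R v))) + fd T x w +
      (T (x + s *\<^sub>R v) - T x - s *\<^sub>R fd T x v - (s\<^sup>2 / 2) *\<^sub>R fd (\<lambda>y. fd T y v) x v)"
      unfolding lin by (simp add: scaleR_add_right)
    also have "norm \<dots> \<le> e / 3 * s\<^sup>2 + e / 3 * s\<^sup>2 + e / 3 * s\<^sup>2"
      by (intro norm_triangle_le add_mono A B elim(4))
    finally show ?case by (simp add: algebra_simps)
  qed
qed

section \<open>Immersions into a flat space\<close>

text \<open>Tube lemma. Counterexamples in balls of radius \<open>d0 / Suc n\<close> would, by
  compactness of \<open>K\<close>, accumulate at some \<open>(p, l)\<close> with
  \<open>h (p, l) \<le> 0\<close>. It is used to spread strict inequalities for unit vectors from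
  one point, or one time, to a neighbourhood.\<close>

lemma tube_positive:
  fixes h :: "'a::metric_space \<times> 'k::metric_space \<Rightarrow> real"
  assumes A: "open A" "p \<in> A" and K: "compact K" and h: "continuous_on (A \<times> K) h"
    and pos: "\<And>k. k \<in> K \<Longrightarrow> h (p, k) > 0"
  shows "\<exists>d>0. ball p d \<subseteq> A \<and> (\<forall>q\<in>ball p d. \<forall>k\<in>K. h (q, k) > 0)"
proof (rule ccontr)
  assume "\<not> ?thesis"
  then have *: "\<And>d. d > 0 \<Longrightarrow> ball p d \<subseteq> A \<Longrightarrow> \<exists>q\<in>ball p d. \<exists>k\<in>K. h (q, k) \<le> 0"
    by (meson not_le)
  obtain d0 where d0: "d0 > 0" "ball p d0 \<subseteq> A" using A open_contains_ball by blast
  have "\<exists>q k. q \<in> ball p (d0 / Suc n) \<and> k \<in> K \<and> h (q, k) \<le> 0" for n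
  proof -
    have "d0 / Suc n > 0" "d0 / Suc n \<le> d0" using d0 by (auto simp: divide_simps)
    then show ?thesis using *[of "d0 / Suc n"] d0 by (meson order_trans subset_ball)
  qed
  then obtain q k where qk: "\<And>n. q n \<in> ball p (d0 / Suc n)" "\<And>n. k n \<in> K" "\<And>n. h (q n, k n) \<le> 0"
    by metis
  obtain l r where l: "l \<in> K" "strict_mono r" "(k \<circ> r) \<longlonglongrightarrow> l"
    using K qk(2) unfolding compact_def by blast
  have q: "q \<longlonglongrightarrow> p"
  proof (rule metric_tendsto_imp_tendsto[where f="\<lambda>n. d0 / Suc n" and a=0])
    show "(\<lambda>n. d0 / real (Suc n)) \<longlonglongrightarrow> 0"
      using LIMSEQ_Suc[OF lim_const_over_n[of d0]] by simp
    show "\<forall>\<^sub>F n in sequentially. dist (q n) p \<le> dist (d0 / real (Suc n)) 0"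
      using qk(1) d0(1) by (intro always_eventually) (auto simp: dist_commute less_imp_le)
  qed
  have "(\<lambda>n. (q (r n), k (r n))) \<longlonglongrightarrow> (p, l)"
    using LIMSEQ_subseq_LIMSEQ[OF q l(2)] l(3) by (intro tendsto_Pair) (auto simp: o_def)
  moreover have "q n \<in> A" for n
  proof -
    have "d0 / Suc n \<le> d0" using d0 by (auto simp: divide_simps)
    then show ?thesis using qk(1)[of n] d0(2) subset_ball[of "d0 / Suc n" d0 p] by blast
  qed
  ultimately have "(\<lambda>n. h (q (r n), k (r n))) \<longlonglongrightarrow> h (p, l)"
    using continuous_on_tendsto_compose[OF h, of "\<lambda>n. (q (r n), k (r n))" "(p, l)" sequentially] A l qk(2) by simp
  then have "h (p, l) \<le> 0" by (rule LIMSEQ_le_const2) (use qk(3) in auto)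
  then show False using pos[OF l(1)] by simp
qed

text \<open>One chart of an immersion into a flat space: \<open>F\<close> is its coordinate
  representation on the coordinate domain \<open>U\<close>, \<open>Q\<close> the flat and possibly
  indefinite ambient product, \<open>g\<close> the induced metric. Positivity of \<open>g\<close> is
  what makes \<open>F\<close> an immersion.\<close>

locale lchart =
  fixes U :: "'e::euclidean_space set" and F :: "'e \<Rightarrow> 'l::euclidean_space"
    and Q :: "'l \<Rightarrow> 'l \<Rightarrow> real" and g :: "'e \<Rightarrow> 'e \<Rightarrow> 'e \<Rightarrow> real"
  assumes U: "open U" and F: "smooth_on U F"
    and Qb: "bounded_bilinear Q" and Qsym: "Q a b = Q b a"
    and g_eq: "x \<in> U \<Longrightarrow> g x u v = Q (fd F x u) (fd F x v)"
    and g_pos: "x \<in> U \<Longrightarrow> u \<noteq> 0 \<Longrightarrow> g x u u > 0"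
begin

abbreviation "D x v \<equiv> fd F x v"
abbreviation "D2 x u v \<equiv> fd (\<lambda>y. fd F y v) x u"
abbreviation "D3 x u v w \<equiv> fd (\<lambda>y. D2 y v w) x u"

lemma sm_D: "smooth_on U (\<lambda>x. D x v)"
  and sm_D2: "smooth_on U (\<lambda>x. D2 x u v)"
  by (intro smooth_on_fd F)+

lemma lin_D: "x \<in> U \<Longrightarrow> linear (D x)"
  by (rule smooth_on_fd_linear[OF F])

lemma lin_D2: "x \<in> U \<Longrightarrow> linear (\<lambda>u. D2 x u v)"
  by (rule smooth_on_fd_linear[OF sm_D])

lemma D2_sym: "x \<in> U \<Longrightarrow> D2 x u v = D2 x v u"
  by (rule fd_commute[OF U F])

lemma lin_D2': "x \<in> U \<Longrightarrow> linear (\<lambda>v. D2 x u v)"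
  using lin_D2[of x u] D2_sym[of x u] by simp

lemma D3_sym: "x \<in> U \<Longrightarrow> D3 x u v w = D3 x v u w"
  by (rule fd_commute[OF U sm_D])

lemmas Q_simps = bounded_bilinear.add_left[OF Qb] bounded_bilinear.add_right[OF Qb]
  bounded_bilinear.diff_left[OF Qb] bounded_bilinear.diff_right[OF Qb]
  bounded_bilinear.scaleR_left[OF Qb] bounded_bilinear.scaleR_right[OF Qb]
  bounded_bilinear.zero_left[OF Qb] bounded_bilinear.zero_right[OF Qb]
  bounded_bilinear.minus_left[OF Qb] bounded_bilinear.minus_right[OF Qb]

lemma g_sym: "x \<in> U \<Longrightarrow> g x u v = g x v u"
  by (simp add: g_eq Qsym)

lemma g_bilinear: "x \<in> U \<Longrightarrow> bilinear (g x)"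
  unfolding bilinear_def
  by (auto intro!: linearI simp: g_eq linear_add[OF lin_D] linear_scale[OF lin_D] Q_simps)

lemma g_simps:
  assumes "x \<in> U"
  shows "g x (a + b) c = g x a c + g x b c" "g x c (a + b) = g x c a + g x c b"
    "g x (a - b) c = g x a c - g x b c" "g x c (a - b) = g x c a - g x c b"
    "g x (r *\<^sub>R a) c = r * g x a c" "g x c (r *\<^sub>R a) = r * g x c a"
    "g x 0 c = 0" "g x c 0 = 0" "g x (- a) c = - g x a c" "g x c (- a) = - g x c a"
  using g_bilinear[OF assms]
  by (auto simp: bilinear_ladd bilinear_radd bilinear_lsub bilinear_rsub bilinear_lmul bilinear_rmul
      bilinear_lzero bilinear_rzero bilinear_lneg bilinear_rneg)

lemma g_nonneg: "x \<in> U \<Longrightarrow> g x u u \<ge> 0"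
  using g_pos[of x u] by (cases "u = 0") (auto simp: g_simps less_imp_le)

lemma g_eqI: "x \<in> U \<Longrightarrow> (\<And>z. g x a z = g x b z) \<Longrightarrow> a = b"
  using g_pos[of x "a - b"] g_simps(3)[of x a b "a - b"] by force

lemma g_smooth: "smooth_on U (\<lambda>x. g x u v)"
  by (rule smooth_on_cong[OF U _ smooth_on_bilinear[OF U Qb sm_D[of u] sm_D[of v]]]) (simp add: g_eq)

lemma g_cont: "continuous_on U (\<lambda>x. g x u v)"
  by (rule smooth_on_continuous[OF g_smooth])

lemma g_continuous_on:
  assumes "continuous_on S f" "continuous_on S v" "continuous_on S w" "f ` S \<subseteq> U"
  shows "continuous_on S (\<lambda>s. g (f s) (v s) (w s))"
  by (rule continuous_on_bilinear_family[where h="\<lambda>s. g (f s)", OF g_bilinear _ assms(2,3)])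
     (use assms(4) continuous_on_compose2[OF g_cont assms(1)] in auto)

text \<open>By definiteness the matrix of \<open>g\<close> is injective, hence surjective in finite
  dimension. \<open>Gam\<close> is introduced through this lemma, as the solution of a linear
  system, and not by a formula with the inverse matrix.\<close>

lemma riesz:
  assumes x: "x \<in> U" and l: "linear \<phi>"
  shows "\<exists>!h. \<forall>z. g x h z = \<phi> z"
proof -
  define A where "A h = (\<Sum>b\<in>Basis. g x h b *\<^sub>R b)" for h :: 'e
  have lA: "linear A" unfolding A_def
    by (rule linearI) (auto simp: g_simps[OF x] scaleR_add_left sum.distrib scaleR_sum_right)
  have Ab: "A h \<bullet> b = g x h b" if "b \<in> Basis" for h b
    using that by (simp add: A_def inner_sum_left inner_Basis if_distrib sum.delta cong: if_cong)
  have gA: "A h \<bullet> z = g x h z" for h z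
  proof -
    have "g x h z = (\<Sum>b\<in>Basis. (z \<bullet> b) *\<^sub>R g x h b)"
      by (rule linear_expand[OF bilinear_linear(1)[OF g_bilinear[OF x]]])
    also have "\<dots> = (\<Sum>b\<in>Basis. (A h \<bullet> b) * (z \<bullet> b))" by (rule sum.cong) (simp_all add: Ab)
    also have "\<dots> = A h \<bullet> z" by (rule euclidean_inner[symmetric])
    finally show ?thesis by simp
  qed
  have "inj A" unfolding linear_injective_0[OF lA]
  proof (intro allI impI)
    fix h assume "A h = 0"
    then have "g x h h = 0" using gA[of h h] by simp
    then show "h = 0" using g_pos[OF x, of h] by force
  qed
  then have "surj A" by (rule linear_inj_imp_surj[OF lA])
  then obtain h where h: "A h = (\<Sum>b\<in>Basis. \<phi> b *\<^sub>R b)" by (metis surj_def)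
  have "g x h z = \<phi> z" for z
  proof -
    have "g x h z = (\<Sum>b\<in>Basis. \<phi> b *\<^sub>R b) \<bullet> z" using gA h by metis
    also have "\<dots> = (\<Sum>b\<in>Basis. (z \<bullet> b) *\<^sub>R \<phi> b)" by (simp add: inner_sum_left) (simp add: inner_commute mult.commute)
    also have "\<dots> = \<phi> z" by (rule linear_expand[OF l, symmetric])
    finally show ?thesis .
  qed
  then show ?thesis using g_eqI[OF x] by (intro ex1I[of _ h]) auto
qed

lemma coercive:
  assumes x0: "x0 \<in> U"
  shows "\<exists>c>0. \<exists>d>0. ball x0 d \<subseteq> U \<and> (\<forall>y\<in>ball x0 d. \<forall>E. c * (norm E)\<^sup>2 \<le> g y E E)"
proof -
  let ?S = "sphere (0::'e) 1"
  have ne: "?S \<noteq> {}" by simp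
  have "continuous_on ?S (\<lambda>u. g x0 u u)" using x0 by (intro g_continuous_on) (auto intro: continuous_intros)
  then obtain u0 where u0: "u0 \<in> ?S" "\<And>u. u \<in> ?S \<Longrightarrow> g x0 u0 u0 \<le> g x0 u u"
    using continuous_attains_inf[OF compact_sphere ne] by blast
  define c where "c = g x0 u0 u0 / 2"
  have c: "c > 0" "\<And>u. u \<in> ?S \<Longrightarrow> g x0 u u - c > 0"
  proof -
    show c: "c > 0" using u0(1) g_pos[OF x0, of u0] by (force simp: c_def)
    show "\<And>u. u \<in> ?S \<Longrightarrow> g x0 u u - c > 0" using u0(2) c unfolding c_def by fastforce
  qed
  have "continuous_on (U \<times> ?S) (\<lambda>z. g (fst z) (snd z) (snd z) - c)"
    by (intro continuous_intros g_continuous_on) auto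
  from tube_positive[OF U x0 compact_sphere this] c(2)
  obtain d where d: "d > 0" "ball x0 d \<subseteq> U" "\<And>q u. q \<in> ball x0 d \<Longrightarrow> u \<in> ?S \<Longrightarrow> g q u u - c > 0"
    by auto
  have "c * (norm E)\<^sup>2 \<le> g y E E" if y: "y \<in> ball x0 d" for y E
  proof (cases "E = 0")
    case True
    then show ?thesis using y d by (simp add: g_simps subset_iff)
  next
    case False
    have yU: "y \<in> U" using y d by auto
    have "E /\<^sub>R norm E \<in> ?S" using False by simp
    from d(3)[OF y this] have "c < g y (E /\<^sub>R norm E) (E /\<^sub>R norm E)" by simp
    also have "\<dots> = g y E E / (norm E)\<^sup>2"
      by (simp add: g_simps[OF yU] power2_eq_square divide_simps)
    finally show ?thesis using False by (simp add: divide_simps)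
  qed
  then show ?thesis using c d by blast
qed

text \<open>A vector is controlled by its products with the basis vectors, with one constant near
  \<open>x0\<close>. This plays the part of a local bound on the inverse metric.\<close>

lemma coercive':
  assumes x0: "x0 \<in> U"
  shows "\<exists>c>0. \<forall>\<^sub>F y in nhds x0. y \<in> U \<and> (\<forall>E. c * norm E \<le> (\<Sum>b\<in>Basis. \<bar>g y E b\<bar>))"
proof -
  obtain c d where c: "c > 0" "d > 0" "ball x0 d \<subseteq> U" "\<And>y E. y \<in> ball x0 d \<Longrightarrow> c * (norm E)\<^sup>2 \<le> g y E E"
    using coercive[OF x0] by blast
  have "c * norm E \<le> (\<Sum>b\<in>Basis. \<bar>g y E b\<bar>)" if y: "y \<in> ball x0 d" for y E
  proof (cases "E = 0")
    case True then show ?thesis by (simp add: sum_nonneg)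
  next
    case False
    have yU: "y \<in> U" using y c by auto
    have "c * (norm E)\<^sup>2 \<le> (\<Sum>b\<in>Basis. (E \<bullet> b) *\<^sub>R g y E b)"
      using c(4)[OF y, of E] linear_expand[OF bilinear_linear(1)[OF g_bilinear[OF yU]], of E E] by simp
    also have "\<dots> \<le> (\<Sum>b\<in>Basis. norm E * \<bar>g y E b\<bar>)"
    proof (rule sum_mono)
      fix b :: 'e assume "b \<in> Basis"
      then show "(E \<bullet> b) *\<^sub>R g y E b \<le> norm E * \<bar>g y E b\<bar>"
        using Basis_le_norm[of b E] abs_ge_self[of "(E \<bullet> b) * g y E b"]
        by (simp add: abs_mult) (smt (verit) abs_ge_zero mult_right_mono)
    qed
    finally have "norm E * (c * norm E) \<le> norm E * (\<Sum>b\<in>Basis. \<bar>g y E b\<bar>)"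
      by (simp add: sum_distrib_left power2_eq_square mult_ac)
    then show ?thesis using False by simp
  qed
  moreover have "\<forall>\<^sub>F y in nhds x0. y \<in> ball x0 d" using c(2) by (intro eventually_nhds_in_open) auto
  ultimately show ?thesis using c(1,3) by (intro exI[of _ c]) (auto elim!: eventually_mono)
qed

section \<open>Regularity of fields defined by linear equations\<close>

lemma solution_continuous:
  assumes sol: "\<And>x b. x \<in> U \<Longrightarrow> b \<in> Basis \<Longrightarrow> g x (h x) b = \<beta> b x"
    and cont: "\<And>b. b \<in> Basis \<Longrightarrow> continuous_on U (\<beta> b)"
  shows "continuous_on U h"
proof -
  have "isCont h x0" if x0: "x0 \<in> U" for x0
  proof -
    obtain c where c: "c > 0" "\<forall>\<^sub>F y in nhds x0. y \<in> U \<and> (\<forall>E. c * norm E \<le> (\<Sum>b\<in>Basis. \<bar>g y E b\<bar>))"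
      using coercive'[OF x0] by blast
    have lim: "((\<lambda>y. (\<Sum>b\<in>Basis. \<bar>\<beta> b y - g y (h x0) b\<bar>) / c) \<longlongrightarrow> (\<Sum>b\<in>Basis. \<bar>\<beta> b x0 - g x0 (h x0) b\<bar>) / c) (at x0)"
    proof -
      have "isCont (\<beta> b) x0" if "b \<in> Basis" for b
        using cont[OF that] U x0 by (simp add: continuous_on_eq_continuous_at)
      moreover have "isCont (\<lambda>y. g y (h x0) b) x0" for b
        using g_cont U x0 by (simp add: continuous_on_eq_continuous_at)
      ultimately show ?thesis unfolding isCont_def using c(1) by (intro tendsto_intros) auto
    qed
    have "((\<lambda>y. h y - h x0) \<longlongrightarrow> 0) (at x0)"
    proof (rule Lim_null_comparison)
      show "\<forall>\<^sub>F y in at x0. norm (h y - h x0) \<le> (\<Sum>b\<in>Basis. \<bar>\<beta> b y - g y (h x0) b\<bar>) / c"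
        using c(2)[THEN eventually_nhds_conv_at[THEN iffD1, THEN conjunct1]]
      proof eventually_elim
        case (elim y)
        have "(\<Sum>b\<in>Basis. \<bar>\<beta> b y - g y (h x0) b\<bar>) = (\<Sum>b\<in>Basis. \<bar>g y (h y - h x0) b\<bar>)"
          using elim sol by (intro sum.cong) (auto simp: g_simps)
        then show ?case using elim[THEN conjunct2, THEN spec, of "h y - h x0"] c(1)
          by (simp add: pos_le_divide_eq mult.commute)
      qed
      show "((\<lambda>y. (\<Sum>b\<in>Basis. \<bar>\<beta> b y - g y (h x0) b\<bar>) / c) \<longlongrightarrow> 0) (at x0)"
        using lim sol[OF x0] by simp
    qed
    then show ?thesis unfolding isCont_def by (simp add: LIM_zero_iff)
  qed
  then show ?thesis by (simp add: continuous_at_imp_continuous_on)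
qed

text \<open>The derivative is guessed by differentiating the defining equations:
  \<open>l b k\<close> is the value that \<open>g x0 (L k) b\<close> must take. The error vector is
  tested against the basis, where it splits into the first order error of the right side and the
  variation of \<open>g\<close>, and \<open>coercive'\<close> brings the estimate back.\<close>

lemma solution_differentiable:
  assumes sol: "\<And>x b. x \<in> U \<Longrightarrow> b \<in> Basis \<Longrightarrow> g x (h x) b = \<beta> b x"
    and diff: "\<And>b. b \<in> Basis \<Longrightarrow> (\<beta> b) differentiable (at x0)"
    and x0: "x0 \<in> U"
  shows "h differentiable (at x0)"
    "\<And>k b. b \<in> Basis \<Longrightarrow> g x0 (fd h x0 k) b = fd (\<beta> b) x0 k - fd (\<lambda>y. g y (h x0) b) x0 k"
proof -
  define l where "l b k = fd (\<beta> b) x0 k - fd (\<lambda>y. g y (h x0) b) x0 k" for b k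
  have gd: "(\<lambda>y. g y (h x0) b) differentiable (at x0)" for b
    by (rule smooth_on_differentiable[OF g_smooth x0])
  have psi: "((\<lambda>y. \<beta> b y - g y (h x0) b) has_derivative l b) (at x0)" if "b \<in> Basis" for b
    unfolding l_def by (intro has_derivative_diff fd_works diff that gd)
  have ll: "linear (l b)" if "b \<in> Basis" for b using has_derivative_linear[OF psi[OF that]] .
  define L where "L k = (THE v. \<forall>z. g x0 v z = (\<Sum>b\<in>Basis. (z \<bullet> b) * l b k))" for k
  have Lp: "g x0 (L k) z = (\<Sum>b\<in>Basis. (z \<bullet> b) * l b k)" for k z
  proof -
    have "linear (\<lambda>z. \<Sum>b\<in>Basis. (z \<bullet> b) * l b k)"
      by (rule linearI) (auto simp: inner_add_left sum.distrib algebra_simps sum_distrib_left)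
    from theI'[OF riesz[OF x0 this]] show ?thesis unfolding L_def by blast
  qed
  have Lb: "g x0 (L k) b = l b k" if "b \<in> Basis" for k b
    unfolding Lp using that by (simp add: inner_Basis if_distrib[of "\<lambda>x. x * _"] sum.delta cong: if_cong)
  have lL: "linear L"
  proof (rule linearI; rule g_eqI[OF x0])
    show "g x0 (L (a + b)) z = g x0 (L a + L b) z" for a b z
      by (simp add: Lp g_simps[OF x0] linear_add[OF ll] algebra_simps sum.distrib)
    show "g x0 (L (r *\<^sub>R a)) z = g x0 (r *\<^sub>R L a) z" for r a z
      by (simp add: Lp g_simps[OF x0] linear_scale[OF ll] sum_distrib_left algebra_simps)
  qed
  obtain K where K: "K > 0" "\<And>k. norm (L k) \<le> K * norm k" using linear_bounded_pos[OF lL] by blast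
  obtain c where c: "c > 0" "\<forall>\<^sub>F y in nhds x0. y \<in> U \<and> (\<forall>E. c * norm E \<le> (\<Sum>b\<in>Basis. \<bar>g y E b\<bar>))"
    using coercive'[OF x0] by blast
  have "(h has_derivative L) (at x0)"
    unfolding has_derivative_within_alt2
  proof (intro conjI allI impI)
    show "bounded_linear L" using lL by (simp add: linear_conv_bounded_linear)
    fix e :: real assume e: "e > 0"
    define n where "n = real DIM('e)"
    have n: "n > 0" by (simp add: n_def)
    \<comment> \<open>Each of the \<open>n\<close> basis vectors contributes an error
      \<open>e1 * (1 + n * K) * norm (y - x0)\<close>, and \<open>coercive'\<close> costs a factor
      \<open>1 / c\<close>.\<close>
    define e1 where "e1 = c * e / (n * (1 + n * K))"
    have e1: "e1 > 0" using c e n K by (simp add: e1_def add_pos_pos)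
    have ev1: "\<forall>\<^sub>F y in at x0. \<forall>b\<in>Basis. norm ((\<beta> b y - g y (h x0) b) - (\<beta> b x0 - g x0 (h x0) b) - l b (y - x0)) \<le> e1 * norm (y - x0)"
      using psi e1 unfolding has_derivative_within_alt2 by (intro eventually_ball_finite finite_Basis) blast
    have ev2: "\<forall>\<^sub>F y in at x0. \<forall>a\<in>Basis. \<forall>b\<in>Basis. \<bar>g y a b - g x0 a b\<bar> < e1"
    proof (intro eventually_ball_finite finite_Basis ballI)
      fix a b :: 'e
      have "isCont (\<lambda>y. g y a b) x0" using g_cont U x0 by (simp add: continuous_on_eq_continuous_at)
      from tendstoD[OF this[unfolded isCont_def] e1]
      show "\<forall>\<^sub>F y in at x0. \<bar>g y a b - g x0 a b\<bar> < e1" by (simp add: dist_real_def)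
    qed
    show "\<forall>\<^sub>F y in at x0. norm (h y - h x0 - L (y - x0)) \<le> e * norm (y - x0)"
      using ev1 ev2 c(2)[THEN eventually_nhds_conv_at[THEN iffD1, THEN conjunct1]]
    proof eventually_elim
      case (elim y)
      have yU: "y \<in> U" using elim by blast
      let ?E = "h y - h x0 - L (y - x0)"
      have gE: "\<bar>g y ?E b\<bar> \<le> e1 * (1 + n * K) * norm (y - x0)" if b: "b \<in> Basis" for b
      proof -
        have 1: "g y ?E b = ((\<beta> b y - g y (h x0) b) - (\<beta> b x0 - g x0 (h x0) b) - l b (y - x0))
           - (g y (L (y - x0)) b - g x0 (L (y - x0)) b)"
          using sol[OF yU b] sol[OF x0 b] Lb[OF b] by (simp add: g_simps[OF yU])
        have "g y (L (y - x0)) b - g x0 (L (y - x0)) b = (\<Sum>a\<in>Basis. (L (y - x0) \<bullet> a) *\<^sub>R (g y a b - g x0 a b))"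
          using linear_expand[OF bilinear_linear(2)[OF g_bilinear[OF yU], where y=b], of "L (y - x0)"]
            linear_expand[OF bilinear_linear(2)[OF g_bilinear[OF x0], where y=b], of "L (y - x0)"]
          by (simp add: right_diff_distrib sum_subtractf)
        also have "norm \<dots> \<le> (\<Sum>a\<in>(Basis::'e set). (K * norm (y - x0)) * e1)"
        proof (rule sum_norm_le)
          fix a :: 'e assume a: "a \<in> Basis"
          have "\<bar>L (y - x0) \<bullet> a\<bar> \<le> K * norm (y - x0)" using Basis_le_norm[OF a, of "L (y - x0)"] K(2)[of "y - x0"] by linarith
          moreover have "\<bar>g y a b - g x0 a b\<bar> \<le> e1" using elim a b by (simp add: less_imp_le)
          ultimately show "norm ((L (y - x0) \<bullet> a) *\<^sub>R (g y a b - g x0 a b)) \<le> (K * norm (y - x0)) * e1"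
            by (simp add: abs_mult) (rule mult_mono, auto)
        qed
        finally have 2: "\<bar>g y (L (y - x0)) b - g x0 (L (y - x0)) b\<bar> \<le> n * K * e1 * norm (y - x0)"
          by (simp add: n_def mult_ac)
        have 3: "\<bar>(\<beta> b y - g y (h x0) b) - (\<beta> b x0 - g x0 (h x0) b) - l b (y - x0)\<bar> \<le> e1 * norm (y - x0)"
          using elim b by auto
        have "e1 * (1 + n * K) * norm (y - x0) = e1 * norm (y - x0) + n * K * e1 * norm (y - x0)"
          by (simp add: algebra_simps)
        then show ?thesis using 1 2 3 by linarith
      qed
      have "c * norm ?E \<le> (\<Sum>b\<in>Basis. \<bar>g y ?E b\<bar>)" using elim by blast
      also have "\<dots> \<le> (\<Sum>b\<in>(Basis::'e set). e1 * (1 + n * K) * norm (y - x0))" by (rule sum_mono) (rule gE)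
      also have "\<dots> = (n * (1 + n * K)) * e1 * norm (y - x0)" by (simp add: n_def mult_ac)
      also have "\<dots> = c * (e * norm (y - x0))"
      proof -
        have "1 + n * K > 0" using n K by (simp add: add_pos_pos)
        then show ?thesis unfolding e1_def using n by simp
      qed
      finally show ?case using c(1) by simp
    qed
  qed
  then show "h differentiable (at x0)"
    "\<And>k b. b \<in> Basis \<Longrightarrow> g x0 (fd h x0 k) b = fd (\<beta> b) x0 k - fd (\<lambda>y. g y (h x0) b) x0 k"
    using Lb by (auto simp: fd_eqI l_def intro: differentiableI)
qed

text \<open>The tangential and the normal part of \<open>D2\<close> are the Christoffel symbols and the second fundamental form.\<close>

definition "Gam x u v = (THE h. \<forall>z. g x h z = Q (D2 x u v) (D x z))"
definition "al x u v = D2 x u v - D x (Gam x u v)"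

lemma Gam: assumes x: "x \<in> U" shows "g x (Gam x u v) z = Q (D2 x u v) (D x z)"
proof -
  have "linear (\<lambda>z. Q (D2 x u v) (D x z))"
    by (rule linearI) (auto simp: linear_add[OF lin_D[OF x]] linear_scale[OF lin_D[OF x]] Q_simps)
  from theI'[OF riesz[OF x this]] show ?thesis unfolding Gam_def by blast
qed

lemma Gam_sym: "x \<in> U \<Longrightarrow> Gam x u v = Gam x v u"
  by (rule g_eqI) (auto simp: Gam D2_sym)

lemma Gam_bilinear: assumes x: "x \<in> U" shows "bilinear (Gam x)"
  unfolding bilinear_def
proof (intro conjI allI linearI; rule g_eqI[OF x])
  fix a b c z r
  show "g x (Gam x a (b + c)) z = g x (Gam x a b + Gam x a c) z"
    by (simp only: Gam[OF x] g_simps[OF x] linear_add[OF lin_D2'[OF x]] Q_simps)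
  show "g x (Gam x a (r *\<^sub>R b)) z = g x (r *\<^sub>R Gam x a b) z"
    by (simp only: Gam[OF x] g_simps[OF x] linear_scale[OF lin_D2'[OF x]] Q_simps real_scaleR_def)
  show "g x (Gam x (b + c) a) z = g x (Gam x b a + Gam x c a) z"
    by (simp only: Gam[OF x] g_simps[OF x] linear_add[OF lin_D2[OF x]] Q_simps)
  show "g x (Gam x (r *\<^sub>R b) a) z = g x (r *\<^sub>R Gam x b a) z"
    by (simp only: Gam[OF x] g_simps[OF x] linear_scale[OF lin_D2[OF x]] Q_simps real_scaleR_def)
qed

lemma fd_g: assumes x: "x \<in> U" shows "fd (\<lambda>y. g y v w) x u = g x (Gam x u v) w + g x v (Gam x u w)"
proof -
  have "((\<lambda>y. Q (D y v) (D y w)) has_derivative (\<lambda>u. Q (D x v) (D2 x u w) + Q (D2 x u v) (D x w))) (at x)"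
    by (rule bounded_bilinear.FDERIV[OF Qb smooth_on_has_derivative[OF sm_D x] smooth_on_has_derivative[OF sm_D x]])
  then have "((\<lambda>y. g y v w) has_derivative (\<lambda>u. Q (D x v) (D2 x u w) + Q (D2 x u v) (D x w))) (at x)"
    by (rule has_derivative_transform_within_open[OF _ U x]) (simp add: g_eq)
  from fd_eqI[OF this, of u] show ?thesis
    by (simp add: Gam[OF x] g_sym[OF x, of v] Qsym[of "D x v"])
qed

lemma levi_civita_eq: assumes x: "x \<in> U" shows "levi_civita g x = Gam x"
  unfolding levi_civita_def
proof (rule the_equality)
  show "bilinear (Gam x) \<and> (\<forall>u v. Gam x u v = Gam x v u) \<and>
     (\<forall>u v w. fd (\<lambda>y. g y v w) x u = g x (Gam x u v) w + g x v (Gam x u w))"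
    using Gam_bilinear[OF x] Gam_sym[OF x] fd_g[OF x] by auto
  fix G assume G: "bilinear G \<and> (\<forall>u v. G u v = G v u) \<and>
     (\<forall>u v w. fd (\<lambda>y. g y v w) x u = g x (G u v) w + g x v (G u w))"
  \<comment> \<open>The difference of two candidates is symmetric in \<open>u\<close>,
    \<open>v\<close>, while \<open>g x (d u v) w\<close> is skew in \<open>v\<close>,
    \<open>w\<close>; a trilinear form with both symmetries vanishes.\<close>
  define d where "d u v = G u v - Gam x u v" for u v
  have ds: "d u v = d v u" for u v using G Gam_sym[OF x] by (simp add: d_def)
  have da: "g x (d u v) w + g x v (d u w) = 0" for u v w
    using G fd_g[OF x, of v w u] by (simp add: d_def g_simps[OF x])
  have "g x (d u v) w = 0" for u v w
    using da[of u v w] da[of v w u] da[of w u v] ds[of u v] ds[of u w] ds[of v w]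
      g_sym[OF x, of v "d u w"] g_sym[OF x, of w "d v u"] g_sym[OF x, of u "d w v"] by simp
  then have "d u v = 0" for u v by (intro g_eqI[OF x]) (simp add: g_simps[OF x])
  then show "G = Gam x" by (simp add: d_def fun_eq_iff)
qed

lemma Gam_cont: "continuous_on U (\<lambda>x. Gam x u v)"
proof (rule solution_continuous[where \<beta>="\<lambda>b x. Q (D2 x u v) (D x b)"])
  show "continuous_on U (\<lambda>x. Q (D2 x u v) (D x b))" for b
    by (rule smooth_on_continuous[OF smooth_on_bilinear[OF U Qb sm_D2 sm_D]])
qed (simp add: Gam)

lemma Gam_diff:
  assumes x: "x \<in> U"
  shows "(\<lambda>x. Gam x u v) differentiable (at x)"
    "\<And>k b. b \<in> Basis \<Longrightarrow> g x (fd (\<lambda>x. Gam x u v) x k) b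
       = fd (\<lambda>x. Q (D2 x u v) (D x b)) x k - fd (\<lambda>y. g y (Gam x u v) b) x k"
proof -
  have 1: "g x (Gam x u v) b = Q (D2 x u v) (D x b)" if "x \<in> U" for x b by (rule Gam[OF that])
  have 2: "(\<lambda>x. Q (D2 x u v) (D x b)) differentiable (at x)" for b
    by (rule smooth_on_differentiable[OF smooth_on_bilinear[OF U Qb sm_D2 sm_D] x])
  show "(\<lambda>x. Gam x u v) differentiable (at x)"
    by (rule solution_differentiable(1)[where \<beta>="\<lambda>b x. Q (D2 x u v) (D x b)", OF 1 2 x])
  show "\<And>k b. b \<in> Basis \<Longrightarrow> g x (fd (\<lambda>x. Gam x u v) x k) b
       = fd (\<lambda>x. Q (D2 x u v) (D x b)) x k - fd (\<lambda>y. g y (Gam x u v) b) x k"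
    by (rule solution_differentiable(2)[where \<beta>="\<lambda>b x. Q (D2 x u v) (D x b)" and h="\<lambda>x. Gam x u v", OF 1 2 x])
qed

text \<open>The second variation contains first derivatives of \<open>Gam\<close> at moving points,
  and its uniformity on compact sets rests on their continuity.\<close>

lemma dGam_cont: "continuous_on U (\<lambda>x. fd (\<lambda>y. Gam y u v) x k)"
proof (rule solution_continuous[where \<beta>="\<lambda>b x. fd (\<lambda>x. Q (D2 x u v) (D x b)) x k
    - (g x (Gam x k (Gam x u v)) b + g x (Gam x u v) (Gam x k b))"])
  fix x b assume "x \<in> U" "b \<in> (Basis::'e set)"
  then show "g x (fd (\<lambda>y. Gam y u v) x k) b = fd (\<lambda>x. Q (D2 x u v) (D x b)) x k
    - (g x (Gam x k (Gam x u v)) b + g x (Gam x u v) (Gam x k b))"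
    using Gam_diff(2)[of x b] fd_g[of x] by simp
next
  fix b :: 'e
  have 1: "continuous_on U (\<lambda>x. fd (\<lambda>x. Q (D2 x u v) (D x b)) x k)"
    by (rule smooth_on_continuous[OF smooth_on_fd[OF smooth_on_bilinear[OF U Qb sm_D2 sm_D]]])
  have 2: "continuous_on U (\<lambda>x. Gam x k (Gam x u v))"
    by (rule continuous_on_bilinear_family[OF Gam_bilinear Gam_cont continuous_on_const Gam_cont])
  show "continuous_on U (\<lambda>x. fd (\<lambda>x. Q (D2 x u v) (D x b)) x k
    - (g x (Gam x k (Gam x u v)) b + g x (Gam x u v) (Gam x k b)))"
    by (intro continuous_on_diff continuous_on_add 1)
       (rule g_continuous_on[OF continuous_on_id 2 continuous_on_const] g_continuous_on[OF continuous_on_id Gam_cont Gam_cont], simp)+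
qed

end

section \<open>Gauss equation and curvature bounds\<close>

context lchart
begin

lemma Gam_simps:
  assumes "x \<in> U"
  shows "Gam x (a + b) c = Gam x a c + Gam x b c" "Gam x c (a + b) = Gam x c a + Gam x c b"
    "Gam x (a - b) c = Gam x a c - Gam x b c" "Gam x c (a - b) = Gam x c a - Gam x c b"
    "Gam x (r *\<^sub>R a) c = r *\<^sub>R Gam x a c" "Gam x c (r *\<^sub>R a) = r *\<^sub>R Gam x c a"
    "Gam x 0 c = 0" "Gam x c 0 = 0" "Gam x (- a) c = - Gam x a c" "Gam x c (- a) = - Gam x c a"
  using Gam_bilinear[OF assms]
  by (auto simp: bilinear_ladd bilinear_radd bilinear_lsub bilinear_rsub bilinear_lmul bilinear_rmul
      bilinear_lzero bilinear_rzero bilinear_lneg bilinear_rneg)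

lemma al_normal: "x \<in> U \<Longrightarrow> Q (al x u v) (D x z) = 0"
  by (simp add: al_def Q_simps Gam[symmetric] g_eq)

lemma al_sym: "x \<in> U \<Longrightarrow> al x u v = al x v u"
  by (simp add: al_def Gam_sym D2_sym)

lemma al_bilinear: "x \<in> U \<Longrightarrow> bilinear (al x)"
  unfolding bilinear_def al_def
  by (auto intro!: linearI simp: Gam_simps linear_add[OF lin_D2] linear_add[OF lin_D2'] linear_scale[OF lin_D2]
      linear_scale[OF lin_D2'] linear_add[OF lin_D] linear_scale[OF lin_D] scaleR_diff_right)

lemma Q_D2_al: "x \<in> U \<Longrightarrow> Q (al x v w) (D2 x u z) = Q (al x v w) (al x u z)"
  by (simp add: al_def[of x u z] Q_simps al_normal)

lemma fd_D_Gam: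
  assumes x: "x \<in> U"
  shows "((\<lambda>y. D y (Gam y v w)) has_derivative (\<lambda>u. D2 x u (Gam x v w) + D x (fd (\<lambda>y. Gam y v w) x u))) (at x)"
  using has_derivative_linear_family[where h="\<lambda>y. D y" and f="\<lambda>y. y" and w="\<lambda>y. Gam y v w", OF U x lin_D
      smooth_on_differentiable[OF sm_D x] has_derivative_ident fd_works[OF Gam_diff(1)[OF x]]]
  by simp

text \<open>Obtained by differentiating the orthogonality of \<open>al\<close> to the tangent
  vectors. The third derivative of \<open>F\<close> on the right is symmetric in \<open>u\<close>
  and \<open>v\<close> and therefore drops out of the curvature; what remains is the Gauss
  equation.\<close>

lemma dGam_normal_part:
  assumes x: "x \<in> U"
  shows "g x (fd (\<lambda>y. Gam y v w) x u + Gam x u (Gam x v w)) z = Q (D3 x u v w) (D x z) + Q (al x v w) (al x u z)"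
proof -
  define a' where "a' u = D3 x u v w - (D2 x u (Gam x v w) + D x (fd (\<lambda>y. Gam y v w) x u))" for u
  have "((\<lambda>y. al y v w) has_derivative a') (at x)"
    unfolding al_def a'_def by (intro has_derivative_diff fd_D_Gam[OF x] smooth_on_has_derivative[OF sm_D2 x])
  then have "((\<lambda>y. Q (al y v w) (D y z)) has_derivative (\<lambda>u. Q (al x v w) (D2 x u z) + Q (a' u) (D x z))) (at x)"
    by (intro bounded_bilinear.FDERIV[OF Qb] smooth_on_has_derivative[OF sm_D x])
  then have "((\<lambda>y. 0::real) has_derivative (\<lambda>u. Q (al x v w) (D2 x u z) + Q (a' u) (D x z))) (at x)"
    by (rule has_derivative_transform_within_open[OF _ U x]) (simp add: al_normal)
  from fd_eqI[OF this, of u] fd_eqI[OF has_derivative_const[of 0 "at x"], of u]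
  have "Q (al x v w) (D2 x u z) + Q (a' u) (D x z) = 0" by simp
  then have *: "Q (al x v w) (al x u z) + Q (a' u) (D x z) = 0" by (simp add: Q_D2_al[OF x])
  have "Q (a' u) (D x z) = Q (D3 x u v w) (D x z) - g x (Gam x u (Gam x v w)) z - g x (fd (\<lambda>y. Gam y v w) x u) z"
    by (simp add: a'_def Q_simps Gam[OF x, symmetric] g_eq[OF x, symmetric])
  then show ?thesis using * by (simp add: g_simps[OF x])
qed

definition "Rm x u v w = (fd (\<lambda>y. Gam y v w) x u + Gam x u (Gam x v w)) - (fd (\<lambda>y. Gam y u w) x v + Gam x v (Gam x u w))"

lemma gauss:
  assumes x: "x \<in> U"
  shows "g x (Rm x u v w) z = Q (al x v w) (al x u z) - Q (al x u w) (al x v z)"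
  unfolding Rm_def g_simps(3)[OF x] dGam_normal_part[OF x] using D3_sym[OF x, where u=u and v=v and w=w] by simp

lemma curvature_tensor_eq:
  assumes x: "x \<in> U"
  shows "curvature_tensor g x u v w = Rm x u v w"
proof -
  have c: "covariant_deriv g y v (\<lambda>_. w) = Gam y v w" if "y \<in> U" for y v
    unfolding covariant_deriv_def levi_civita_eq[OF that] using fd_eqI[OF has_derivative_const] by simp
  have "covariant_deriv g x u (\<lambda>y. covariant_deriv g y v (\<lambda>_. w)) = fd (\<lambda>y. Gam y v w) x u + Gam x u (Gam x v w)" for u v
  proof -
    have "fd (\<lambda>y. covariant_deriv g y v (\<lambda>_. w)) x = fd (\<lambda>y. Gam y v w) x"
      by (rule fd_cong_open(2)[OF U x _ Gam_diff(1)[OF x]]) (simp add: c)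
    then show ?thesis unfolding covariant_deriv_def[of g x u "\<lambda>y. covariant_deriv g y v (\<lambda>_. w)"] levi_civita_eq[OF x] c[OF x]
      by simp
  qed
  then show ?thesis by (simp add: curvature_tensor_def Rm_def)
qed

lemma Rm_antisym: "x \<in> U \<Longrightarrow> g x (Rm x u v w) z = - g x (Rm x u v z) w"
  by (simp add: gauss Qsym)

lemma g_cauchy_schwarz:
  assumes x: "x \<in> U" shows "(g x u v)\<^sup>2 \<le> g x u u * g x v v"
proof (cases "v = 0")
  case True then show ?thesis by (simp add: g_simps[OF x])
next
  case False
  then have p: "g x v v > 0" by (rule g_pos[OF x])
  have "0 \<le> g x (g x v v *\<^sub>R u - g x u v *\<^sub>R v) (g x v v *\<^sub>R u - g x u v *\<^sub>R v)" by (rule g_nonneg[OF x])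
  also have "\<dots> = g x v v * (g x u u * g x v v - (g x u v)\<^sup>2)"
    by (simp add: g_simps[OF x] g_sym[OF x, of v u] power2_eq_square algebra_simps)
  finally show ?thesis using p by (simp add: zero_le_mult_iff)
qed

lemma g_cauchy_schwarz':
  assumes x: "x \<in> U" shows "\<bar>g x u v\<bar> \<le> sqrt (g x u u) * sqrt (g x v v)"
  using real_sqrt_le_mono[OF g_cauchy_schwarz[OF x, of u v]] by (simp add: real_sqrt_mult)

lemma g_triangle:
  assumes x: "x \<in> U" shows "sqrt (g x (u + v) (u + v)) \<le> sqrt (g x u u) + sqrt (g x v v)"
proof (rule real_le_lsqrt)
  have "g x (u + v) (u + v) = g x u u + 2 * g x u v + g x v v"
    by (simp add: g_simps[OF x] g_sym[OF x, of v u])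
  also have "\<dots> \<le> g x u u + 2 * (sqrt (g x u u) * sqrt (g x v v)) + g x v v"
    using g_cauchy_schwarz'[OF x, of u v] by linarith
  also have "\<dots> = (sqrt (g x u u) + sqrt (g x v v))\<^sup>2"
    using g_nonneg[OF x] by (simp add: power2_sum)
  finally show "g x (u + v) (u + v) \<le> (sqrt (g x u u) + sqrt (g x v v))\<^sup>2" .
qed (use g_nonneg[OF x] in auto)

text \<open>Frees the bound from its denominator: the Gram determinant is at most
  \<open>g x u u * g x v v\<close>, and as \<open>k \<ge> 0\<close> the estimate goes in the right
  direction. For dependent vectors, which the sectional curvature bound does not cover, the
  curvature term is 0.\<close>

lemma curvature_lower_bound:
  assumes x: "x \<in> U" and k: "k \<ge> 0"
    and sec: "\<And>u v. u \<noteq> v \<Longrightarrow> independent {u, v} \<Longrightarrow> - k \<le> sectional_curvature g x u v"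
  shows "- g x (Rm x u v v) u \<le> k * (g x u u * g x v v)"
proof (cases "u \<noteq> v \<and> independent {u, v}")
  case True
  then have s: "- k \<le> g x (Rm x u v v) u / (g x u u * g x v v - (g x u v)\<^sup>2)"
    using sec[of u v] by (simp add: sectional_curvature_def curvature_tensor_eq[OF x])
  have cs: "g x u u * g x v v - (g x u v)\<^sup>2 \<ge> 0" using g_cauchy_schwarz[OF x, of u v] by simp
  show ?thesis
  proof (cases "g x u u * g x v v - (g x u v)\<^sup>2 = 0")
    case True
    have "v \<noteq> 0" using \<open>u \<noteq> v \<and> independent {u, v}\<close> dependent_zero[of "{u, v}"] by auto
    then have p: "g x v v > 0" by (rule g_pos[OF x])
    have "g x (g x v v *\<^sub>R u - g x u v *\<^sub>R v) (g x v v *\<^sub>R u - g x u v *\<^sub>R v) = g x v v * (g x u u * g x v v - (g x u v)\<^sup>2)"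
      by (simp add: g_simps[OF x] g_sym[OF x, of v u] power2_eq_square algebra_simps)
    then have "g x v v *\<^sub>R u - g x u v *\<^sub>R v = 0" using True g_pos[OF x] by fastforce
    then have "u = (g x u v / g x v v) *\<^sub>R v" using p
      by (metis (no_types) divide_inverse_commute eq_iff_diff_eq_0 eq_vector_fraction_iff less_irrefl scaleR_scaleR)
    then have "u \<in> span {v}" by (metis span_base span_scale singletonI)
    then have "dependent {u, v}" using \<open>u \<noteq> v \<and> independent {u, v}\<close> by (simp add: independent_insert)
    then show ?thesis using \<open>u \<noteq> v \<and> independent {u, v}\<close> by simp
  next
    case False
    then have p: "g x u u * g x v v - (g x u v)\<^sup>2 > 0" using cs by simp
    then have "- k * (g x u u * g x v v - (g x u v)\<^sup>2) \<le> g x (Rm x u v v) u" using s by (simp add: pos_le_divide_eq)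
    moreover have "k * (g x u u * g x v v - (g x u v)\<^sup>2) \<le> k * (g x u u * g x v v)" using k by (intro mult_left_mono) auto
    ultimately show ?thesis by simp
  qed
next
  case False
  then have dep: "u = v \<or> dependent {u, v}" by blast
  have lin: "\<exists>a w. (u = a *\<^sub>R w \<and> v = w) \<or> (u = w \<and> v = a *\<^sub>R w)"
  proof (cases "u = v")
    case True then show ?thesis by (intro exI[of _ 1] exI[of _ u]) simp
  next
    case False
    then have d: "dependent {u, v}" using dep by blast
    show ?thesis
    proof (cases "v = 0")
      case True then show ?thesis by (intro exI[of _ 0] exI[of _ u]) simp
    next
      case False
      then have "u \<in> span {v}" using d \<open>u \<noteq> v\<close> independent_insert[of u "{v}"] by auto
      then show ?thesis by (auto simp: span_singleton)
    qed
  qed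
  have "g x (Rm x u v v) u = 0"
    using lin by (auto simp: gauss[OF x] bilinear_lmul[OF al_bilinear[OF x]] bilinear_rmul[OF al_bilinear[OF x]]
        Q_simps)
  then show ?thesis using k g_nonneg[OF x] by simp
qed

subsection \<open>The second variation of length along a vector field\<close>

text \<open>A point \<open>x\<close> is displaced along \<open>x + s p + s\<^sup>2 q\<close>, and a tangent vector \<open>w\<close> becomes
  \<open>w + s a + s\<^sup>2 b\<close>; \<open>E0\<close> is its squared length, with derivatives \<open>E1\<close> and \<open>E2\<close> in \<open>s\<close>.\<close>

definition "Pt s x p q = x + s *\<^sub>R p + s\<^sup>2 *\<^sub>R q"

definition "E0 s x p q w a b = g (Pt s x p q) (Pt s w a b) (Pt s w a b)"

text \<open>The covariant derivative in \<open>s\<close> of the displaced vector, and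
  \<open>Zv'\<close> the ordinary derivative of that. The displacement has velocity
  \<open>p + (2 * s) *\<^sub>R q\<close>, because \<open>Pt\<close> carries \<open>s\<^sup>2\<close>
  without the factor 1/2.\<close>

definition "Zv s x p q w a b = (a + (2 * s) *\<^sub>R b) + Gam (Pt s x p q) (p + (2 * s) *\<^sub>R q) (Pt s w a b)"

definition "Zv' s x p q w a b = 2 *\<^sub>R b
  + (fd (\<lambda>y. Gam y (p + (2 * s) *\<^sub>R q) (Pt s w a b)) (Pt s x p q) (p + (2 * s) *\<^sub>R q)
     + (Gam (Pt s x p q) (2 *\<^sub>R q) (Pt s w a b) + Gam (Pt s x p q) (p + (2 * s) *\<^sub>R q) (a + (2 * s) *\<^sub>R b)))"

definition "E1 s x p q w a b = 2 * g (Pt s x p q) (Pt s w a b) (Zv s x p q w a b)"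

definition "E2 s x p q w a b = 2 * (g (Pt s x p q) (Zv s x p q w a b) (Zv s x p q w a b)
   + g (Pt s x p q) (Pt s w a b) (Zv' s x p q w a b + Gam (Pt s x p q) (p + (2 * s) *\<^sub>R q) (Zv s x p q w a b)))"

lemma Pt_deriv: "((\<lambda>s. Pt s x p q) has_vector_derivative p + (2 * s) *\<^sub>R q) (at s)"
  unfolding Pt_def by (auto intro!: derivative_eq_intros simp: scaleR_add_left)

lemma dPt_deriv: "((\<lambda>s. p + (2 * s) *\<^sub>R q) has_vector_derivative 2 *\<^sub>R q) (at s)"
  by (auto intro!: derivative_eq_intros)

lemma dGam_linear:
  assumes x: "x \<in> U"
  shows "linear (\<lambda>u. fd (\<lambda>y. Gam y u v) x k)" "linear (\<lambda>v. fd (\<lambda>y. Gam y u v) x k)"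
    "linear (\<lambda>k. fd (\<lambda>y. Gam y u v) x k)"
  by (rule fd_linear_family(3)[OF U x bilinear_linear(2)[OF Gam_bilinear] Gam_diff(1)[OF x]], assumption)
     (rule fd_linear_family(3)[OF U x bilinear_linear(1)[OF Gam_bilinear] Gam_diff(1)[OF x]], assumption,
      rule linear_frechet_derivative[OF Gam_diff(1)[OF x]])

lemma Gam_vector_derivative:
  assumes x: "f t \<in> U" and f: "(f has_vector_derivative f') (at t)"
    and u: "(u has_vector_derivative u') (at t)" and v: "(v has_vector_derivative v') (at t)"
  shows "((\<lambda>s. Gam (f s) (u s) (v s)) has_vector_derivative
    fd (\<lambda>y. Gam y (u t) (v t)) (f t) f' + (Gam (f t) u' (v t) + Gam (f t) (u t) v')) (at t)"
proof -
  have ev: "\<forall>\<^sub>F s in nhds t. f s \<in> U"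
    using has_vector_derivative_continuous[OF f] U x
    unfolding isCont_def tendsto_at_iff_tendsto_nhds by (rule topological_tendstoD)
  then obtain A where A: "open A" "t \<in> A" "\<And>s. s \<in> A \<Longrightarrow> f s \<in> U" unfolding eventually_nhds by blast
  have 1: "((\<lambda>s. Gam (f s) (u s) b) has_vector_derivative fd (\<lambda>y. Gam y (u t) b) (f t) f' + Gam (f t) u' b) (at t)" for b
    by (rule vector_derivative_linear_family[where h="\<lambda>x u. Gam x u b", OF U x bilinear_linear(2)[OF Gam_bilinear] Gam_diff(1)[OF x] f u])
  have "((\<lambda>s. \<Sum>b\<in>Basis. (v s \<bullet> b) *\<^sub>R Gam (f s) (u s) b) has_vector_derivative
      (\<Sum>b\<in>Basis. (v t \<bullet> b) *\<^sub>R (fd (\<lambda>y. Gam y (u t) b) (f t) f' + Gam (f t) u' b) + (v' \<bullet> b) *\<^sub>R Gam (f t) (u t) b)) (at t)"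
    by (intro has_vector_derivative_sum has_vector_derivative_scaleR 1)
       (use v in \<open>auto simp: has_real_derivative_iff_has_vector_derivative has_vector_derivative_def intro!: derivative_eq_intros\<close>)
  also have "(\<Sum>b\<in>Basis. (v t \<bullet> b) *\<^sub>R (fd (\<lambda>y. Gam y (u t) b) (f t) f' + Gam (f t) u' b) + (v' \<bullet> b) *\<^sub>R Gam (f t) (u t) b)
    = fd (\<lambda>y. Gam y (u t) (v t)) (f t) f' + (Gam (f t) u' (v t) + Gam (f t) (u t) v')"
    using linear_expand[OF dGam_linear(2)[OF x, of "u t" f'], of "v t"]
      linear_expand[OF bilinear_linear(1)[OF Gam_bilinear[OF x]], of u' "v t"]
      linear_expand[OF bilinear_linear(1)[OF Gam_bilinear[OF x]], of "u t" v']
    by (simp only: sum.distrib scaleR_add_right add.assoc)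
  finally have "((\<lambda>s. \<Sum>b\<in>Basis. (v s \<bullet> b) *\<^sub>R Gam (f s) (u s) b) has_vector_derivative
    fd (\<lambda>y. Gam y (u t) (v t)) (f t) f' + (Gam (f t) u' (v t) + Gam (f t) (u t) v')) (at t)" .
  then show ?thesis unfolding has_vector_derivative_def
    by (rule has_derivative_transform_within_open[OF _ A(1,2)])
       (use linear_expand[OF bilinear_linear(1)[OF Gam_bilinear[OF A(3)]]] in metis)
qed

text \<open>The product rule for \<open>Q\<close> in the ambient space; the defining property of
  \<open>Gam\<close> turns the second derivatives of \<open>F\<close> into covariant derivatives
  along the curve.\<close>

lemma g_vector_derivative:
  assumes x: "f t \<in> U" and f: "(f has_vector_derivative f') (at t)"
    and u: "(u has_vector_derivative u') (at t)" and v: "(v has_vector_derivative v') (at t)"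
  shows "((\<lambda>s. g (f s) (u s) (v s)) has_real_derivative
    g (f t) (u' + Gam (f t) f' (u t)) (v t) + g (f t) (u t) (v' + Gam (f t) f' (v t))) (at t)"
proof -
  have ev: "\<forall>\<^sub>F s in nhds t. f s \<in> U"
    using has_vector_derivative_continuous[OF f] U x
    unfolding isCont_def tendsto_at_iff_tendsto_nhds by (rule topological_tendstoD)
  then obtain A where A: "open A" "t \<in> A" "\<And>s. s \<in> A \<Longrightarrow> f s \<in> U" unfolding eventually_nhds by blast
  have 1: "((\<lambda>s. D (f s) (u s)) has_vector_derivative D2 (f t) f' (u t) + D (f t) u') (at t)"
    if "(u has_vector_derivative u') (at t)" for u u'
    by (rule vector_derivative_linear_family[where h="\<lambda>x u. D x u", OF U x lin_D smooth_on_differentiable[OF sm_D x] f that])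
  have "((\<lambda>s. Q (D (f s) (u s)) (D (f s) (v s))) has_vector_derivative
     Q (D (f t) (u t)) (D2 (f t) f' (v t) + D (f t) v') + Q (D2 (f t) f' (u t) + D (f t) u') (D (f t) (v t))) (at t)"
    by (rule bounded_bilinear.has_vector_derivative[OF Qb 1[OF u] 1[OF v]])
  then have "((\<lambda>s. g (f s) (u s) (v s)) has_vector_derivative
     Q (D (f t) (u t)) (D2 (f t) f' (v t) + D (f t) v') + Q (D2 (f t) f' (u t) + D (f t) u') (D (f t) (v t))) (at t)"
    unfolding has_vector_derivative_def
    by (rule has_derivative_transform_within_open[OF _ A(1,2)]) (simp add: g_eq A(3))
  moreover have "Q (D (f t) (u t)) (D2 (f t) f' (v t) + D (f t) v') + Q (D2 (f t) f' (u t) + D (f t) u') (D (f t) (v t))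
    = g (f t) (u' + Gam (f t) f' (u t)) (v t) + g (f t) (u t) (v' + Gam (f t) f' (v t))"
  proof -
    have 1: "g (f t) (a + Gam (f t) f' c) z = Q (D (f t) a) (D (f t) z) + Q (D2 (f t) f' c) (D (f t) z)" for a c z
      by (simp only: g_simps(1)[OF x] Gam[OF x], simp add: g_eq[OF x])
    show ?thesis unfolding 1 g_sym[OF x, of "u t" "v' + _"]
      by (simp add: Q_simps Qsym[of _ "D (f t) (u t)"])
  qed
  ultimately show ?thesis by (simp add: has_real_derivative_iff_has_vector_derivative)
qed

lemma E0_deriv:
  assumes "Pt s x p q \<in> U" shows "((\<lambda>s. E0 s x p q w a b) has_real_derivative E1 s x p q w a b) (at s)"
  using g_vector_derivative[OF assms Pt_deriv Pt_deriv Pt_deriv, of w a b w a b]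
  by (simp add: E0_def[abs_def] E1_def Zv_def g_sym[OF assms, of "_ + Gam _ _ _"])

lemma E1_deriv:
  assumes U': "Pt s x p q \<in> U" shows "((\<lambda>s. E1 s x p q w a b) has_real_derivative E2 s x p q w a b) (at s)"
proof -
  have z: "((\<lambda>s. Zv s x p q w a b) has_vector_derivative Zv' s x p q w a b) (at s)"
    unfolding Zv_def Zv'_def by (intro has_vector_derivative_add dPt_deriv Gam_vector_derivative U' Pt_deriv)
  have "((\<lambda>s. g (Pt s x p q) (Pt s w a b) (Zv s x p q w a b)) has_real_derivative
    g (Pt s x p q) (Zv s x p q w a b) (Zv s x p q w a b) +
    g (Pt s x p q) (Pt s w a b) (Zv' s x p q w a b + Gam (Pt s x p q) (p + (2 * s) *\<^sub>R q) (Zv s x p q w a b))) (at s)"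
    using g_vector_derivative[OF U' Pt_deriv Pt_deriv z] unfolding Zv_def[of s] by simp
  from DERIV_cmult[OF this, of 2] show ?thesis unfolding E1_def E2_def by simp
qed

text \<open>With vanishing covariant acceleration of all displacements, the second variation only contains the
  covariant derivative of the field and the curvature.\<close>

lemma E2_zero:
  assumes x: "x \<in> U"
  shows "E2 0 x V (- (1/2) *\<^sub>R Gam x V V) w dV (- (1/2) *\<^sub>R (fd (\<lambda>y. Gam y V V) x w + 2 *\<^sub>R Gam x V dV))
    = 2 * (g x (dV + Gam x V w) (dV + Gam x V w) - g x (Rm x V w w) V)"
proof -
  have "E2 0 x V (- (1/2) *\<^sub>R Gam x V V) w dV (- (1/2) *\<^sub>R (fd (\<lambda>y. Gam y V V) x w + 2 *\<^sub>R Gam x V dV))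
    = 2 * (g x (dV + Gam x V w) (dV + Gam x V w) + g x w (Rm x V w V))"
  proof -
    have "Gam x (Gam x V V) w = Gam x w (Gam x V V)" "fd (\<lambda>y. Gam y V w) x V = fd (\<lambda>y. Gam y w V) x V"
      "Gam x w V = Gam x V w"
      using Gam_sym[OF x] fd_cong_open(2)[OF U x _ Gam_diff(1)[OF x], of w V "\<lambda>y. Gam y V w"] Gam_sym by auto
    then show ?thesis
      by (simp add: E2_def Pt_def Zv_def Zv'_def Rm_def Gam_simps[OF x] scaleR_add_right scaleR_2 algebra_simps)
  qed
  moreover have "g x w (Rm x V w V) = - g x (Rm x V w w) V"
    using Rm_antisym[OF x, of V w V w] g_sym[OF x] by simp
  ultimately show ?thesis by simp
qed

end

section \<open>Kaehler submanifolds of low codimension\<close>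

text \<open>First and second order conditions at the minimum 0 of a quartic without constant term:
  divide by \<open>t\<close>, then by \<open>t\<^sup>2\<close>, and let \<open>t\<close> tend to 0,
  from both sides in the first case.\<close>

lemma quartic_nonneg_imp:
  fixes c1 c2 c3 c4 :: real
  assumes "\<And>t. c1 * t + c2 * t\<^sup>2 + c3 * t ^ 3 + c4 * t ^ 4 \<ge> 0"
  shows "c1 = 0" "c2 \<ge> 0"
proof -
  have lim: "((\<lambda>t. c1 + c2 * t + c3 * t\<^sup>2 + c4 * t ^ 3) \<longlongrightarrow> c1 + c2 * 0 + c3 * 0\<^sup>2 + c4 * 0 ^ 3) (at 0 within S)" for S
    by (intro tendsto_intros)
  have f: "t * (c1 + c2 * t + c3 * t\<^sup>2 + c4 * t ^ 3) \<ge> 0" for t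
    using assms[of t] by (simp add: algebra_simps power2_eq_square power3_eq_cube power4_eq_xxxx)
  have pm: "c1 + c2 * t + c3 * t\<^sup>2 + c4 * t ^ 3 \<ge> 0" if "t > 0" for t
    using f[of t] that by (simp add: zero_le_mult_iff)
  have nm: "c1 + c2 * t + c3 * t\<^sup>2 + c4 * t ^ 3 \<le> 0" if "t < 0" for t
    using f[of t] that by (simp add: zero_le_mult_iff)
  have "c1 + c2 * 0 + c3 * 0\<^sup>2 + c4 * 0 ^ 3 \<ge> 0"
    by (rule tendsto_lowerbound[OF lim[of "{0<..}"]])
       (unfold eventually_at_filter, intro always_eventually allI impI pm, simp_all)
  moreover have "c1 + c2 * 0 + c3 * 0\<^sup>2 + c4 * 0 ^ 3 \<le> 0"
    by (rule tendsto_upperbound[OF lim[of "{..<0}"]])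
       (unfold eventually_at_filter, intro always_eventually allI impI nm, simp_all)
  ultimately show c1: "c1 = 0" by simp
  have lim2: "((\<lambda>t. c2 + c3 * t + c4 * t\<^sup>2) \<longlongrightarrow> c2 + c3 * 0 + c4 * 0\<^sup>2) (at 0)"
    by (intro tendsto_intros)
  have "t\<^sup>2 * (c2 + c3 * t + c4 * t\<^sup>2) \<ge> 0" for t
    using assms[of t] c1 by (simp add: algebra_simps power2_eq_square power3_eq_cube power4_eq_xxxx)
  then have "c2 + c3 * t + c4 * t\<^sup>2 \<ge> 0" if "t \<noteq> 0" for t
    using that by (metis zero_le_mult_iff zero_less_power2 not_less)
  then have "c2 + c3 * 0 + c4 * 0\<^sup>2 \<ge> 0"
    by (intro tendsto_lowerbound[OF lim2]) (auto simp: eventually_at_filter)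
  then show "c2 \<ge> 0" by simp
qed

text \<open>The Kaehler structure in one chart, with \<open>F\<close> on the hyperboloid.
  \<open>dims\<close> is the count of \<open>kernel_exists\<close>: two equations with values in the
  ambient space against unknowns of total dimension 3 DIM('e) + 2. For DIM('e) = 2 n and DIM('l) = 3
  n it reads 6 n < 6 n + 2.\<close>

locale kchart = lchart U F Q g
  for U :: "'e::euclidean_space set" and F :: "'e \<Rightarrow> 'l::euclidean_space"
    and Q :: "'l \<Rightarrow> 'l \<Rightarrow> real" and g :: "'e \<Rightarrow> 'e \<Rightarrow> 'e \<Rightarrow> real" +
  fixes J :: "'e \<Rightarrow> 'e \<Rightarrow> 'e"
  assumes J_lin: "x \<in> U \<Longrightarrow> linear (J x)"
    and J_smooth: "smooth_on U (\<lambda>x. J x w)"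
    and J_sq: "x \<in> U \<Longrightarrow> J x (J x w) = - w"
    and J_orth: "x \<in> U \<Longrightarrow> g x (J x u) (J x v) = g x u v"
    and J_par: "x \<in> U \<Longrightarrow> fd (\<lambda>y. J y w) x u + Gam x u (J x w) = J x (Gam x u w)"
    and F_unit: "x \<in> U \<Longrightarrow> Q (F x) (F x) = - 1"
    and dims: "2 * DIM('l) < 3 * DIM('e) + 2"
begin

lemma fd_J: "x \<in> U \<Longrightarrow> fd (\<lambda>y. J y w) x u = J x (Gam x u w) - Gam x u (J x w)"
  using J_par[of x w u] by (simp add: algebra_simps)

text \<open>\<open>J_par\<close> is differentiated once more and antisymmetrized in \<open>u\<close>
  and \<open>v\<close>. The second derivatives of \<open>J\<close> cancel by symmetry, and the first
  derivatives are expressed through \<open>Gam\<close> by \<open>fd_J\<close>.\<close>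

lemma Rm_J:
  assumes x: "x \<in> U"
  shows "Rm x u v (J x w) = J x (Rm x u v w)"
proof -
  note Jl = linear_add[OF J_lin[OF x]] linear_diff[OF J_lin[OF x]]
  have *: "fd (\<lambda>z. fd (\<lambda>y. J y w) z v) x u + (fd (\<lambda>y. Gam y v (J x w)) x u + Gam x v (fd (\<lambda>y. J y w) x u))
     = fd (\<lambda>y. J y (Gam x v w)) x u + J x (fd (\<lambda>y. Gam y v w) x u)" for u v
  proof -
    have 1: "((\<lambda>y. Gam y v (J y w)) has_derivative (\<lambda>u. fd (\<lambda>y. Gam y v (J x w)) x u + Gam x v (fd (\<lambda>y. J y w) x u))) (at x)"
      using has_derivative_linear_family[where h="\<lambda>y. Gam y v" and f="\<lambda>y. y" and w="\<lambda>y. J y w", OF U x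
          bilinear_linear(1)[OF Gam_bilinear] Gam_diff(1)[OF x] has_derivative_ident smooth_on_has_derivative[OF J_smooth x]]
      by simp
    have 2: "((\<lambda>y. J y (Gam y v w)) has_derivative (\<lambda>u. fd (\<lambda>y. J y (Gam x v w)) x u + J x (fd (\<lambda>y. Gam y v w) x u))) (at x)"
      using has_derivative_linear_family[where h="\<lambda>y. J y" and f="\<lambda>y. y" and w="\<lambda>y. Gam y v w", OF U x
          J_lin smooth_on_differentiable[OF J_smooth x] has_derivative_ident fd_works[OF Gam_diff(1)[OF x]]]
      by simp
    have 3: "((\<lambda>z. fd (\<lambda>y. J y w) z v + Gam z v (J z w)) has_derivative
       (\<lambda>u. fd (\<lambda>z. fd (\<lambda>y. J y w) z v) x u + (fd (\<lambda>y. Gam y v (J x w)) x u + Gam x v (fd (\<lambda>y. J y w) x u)))) (at x)"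
      by (intro has_derivative_add 1 smooth_on_has_derivative[OF smooth_on_fd[OF J_smooth] x])
    have "((\<lambda>y. J y (Gam y v w)) has_derivative
       (\<lambda>u. fd (\<lambda>z. fd (\<lambda>y. J y w) z v) x u + (fd (\<lambda>y. Gam y v (J x w)) x u + Gam x v (fd (\<lambda>y. J y w) x u)))) (at x)"
      by (rule has_derivative_transform_within_open[OF 3 U x]) (rule J_par)
    from fun_cong[OF has_derivative_unique[OF this 2]] show ?thesis .
  qed
  have c: "fd (\<lambda>z. fd (\<lambda>y. J y w) z v) x u = fd (\<lambda>z. fd (\<lambda>y. J y w) z u) x v"
    by (rule fd_commute[OF U J_smooth x])
  note arg_cong2[where f="(-)", OF *[of u v] *[of v u]]
  then show ?thesis
    unfolding Rm_def fd_J[OF x] Gam_simps[OF x] Jl c by (simp add: algebra_simps)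
qed

lemma al_kaehler:
  assumes x: "x \<in> U"
  shows "Q (al x v (J x w)) (al x u (J x z)) - Q (al x u (J x w)) (al x v (J x z))
    = Q (al x v w) (al x u z) - Q (al x u w) (al x v z)"
  using J_orth[OF x, of "Rm x u v w" z] Rm_J[OF x, of u v w] gauss[OF x] by metis

text \<open>Twice the \<open>J\<close>-invariant part of the second fundamental form, its part of
  type (1,1).\<close>

definition "Bf x X Y = al x X Y + al x (J x X) (J x Y)"

lemma al_simps:
  assumes "x \<in> U"
  shows "al x (a + b) c = al x a c + al x b c" "al x c (a + b) = al x c a + al x c b"
    "al x (r *\<^sub>R a) c = r *\<^sub>R al x a c" "al x c (r *\<^sub>R a) = r *\<^sub>R al x c a"
    "al x (- a) c = - al x a c" "al x c (- a) = - al x c a"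
  using al_bilinear[OF assms]
  by (auto simp: bilinear_ladd bilinear_radd bilinear_lmul bilinear_rmul bilinear_lneg bilinear_rneg)

lemma Bf_bilinear: "x \<in> U \<Longrightarrow> bilinear (Bf x)"
  unfolding bilinear_def Bf_def
  by (auto intro!: linearI simp: al_simps linear_add[OF J_lin] linear_scale[OF J_lin] scaleR_add_right)

lemma Bf_sym: "x \<in> U \<Longrightarrow> Bf x X Y = Bf x Y X"
  by (simp add: Bf_def al_sym)

text \<open>The hypotheses say that \<open>al\<close> of \<open>J X\<close>, \<open>J Y\<close> is
  the negative of \<open>al\<close> of \<open>X\<close>, \<open>Y\<close>, and that \<open>J\<close>
  may be moved from \<open>X\<close> to \<open>Y\<close>. Summing \<open>al_kaehler\<close> over the
  four choices of \<open>X\<close> or \<open>J X\<close> and \<open>Y\<close> or \<open>J Y\<close>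
  produces the product in question on the left; by these relations all other terms of the sum
  cancel.\<close>

lemma Bf_orthogonal:
  assumes x: "x \<in> U" and 1: "Bf x X Y = 0" and 2: "Bf x X (J x Y) = 0"
  shows "Q (Bf x X X) (Bf x Y Y) = 0"
proof -
  let ?X = "J x X" and ?Y = "J x Y"
  let ?P = "\<lambda>a b c d. Q (al x a b) (al x c d)"
  have e1: "al x ?X ?Y = - al x X Y" using 1 by (simp add: Bf_def eq_neg_iff_add_eq_0 add.commute)
  have e2: "al x ?X Y = al x X ?Y" using 2 by (simp add: Bf_def J_sq[OF x] al_simps[OF x])
  have s: "al x Y X = al x X Y" "al x ?Y X = al x X ?Y" "al x Y ?X = al x X ?Y" "al x ?Y ?X = - al x X Y"
    "al x ?Y Y = al x Y ?Y" "al x ?X X = al x X ?X"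
    using al_sym[OF x] e1 e2 by auto
  have a: "?P Y Y X X - ?P X Y Y X = ?P Y ?Y X ?X - ?P X ?Y Y ?X"
    using al_kaehler[OF x, of Y Y X X] by simp
  have b: "?P ?Y ?Y X X - ?P X ?Y ?Y X = - (?P ?Y Y X ?X) + ?P X Y ?Y ?X"
    using al_kaehler[OF x, of ?Y ?Y X X] by (simp add: J_sq[OF x] al_simps[OF x] Q_simps)
  have c: "?P Y Y ?X ?X - ?P ?X Y Y ?X = - (?P Y ?Y ?X X) + ?P ?X ?Y Y X"
    using al_kaehler[OF x, of Y Y ?X ?X] by (simp add: J_sq[OF x] al_simps[OF x] Q_simps)
  have d: "?P ?Y ?Y ?X ?X - ?P ?X ?Y ?Y ?X = ?P ?Y Y ?X X - ?P ?X Y ?Y X"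
    using al_kaehler[OF x, of ?Y ?Y ?X ?X] by (simp add: J_sq[OF x] al_simps[OF x] Q_simps)
  show ?thesis unfolding Bf_def
    using a b c d by (simp add: Q_simps s e1 e2 Qsym[of "al x X X"] Qsym[of "al x ?X ?X"])
qed

lemma F_normal: assumes x: "x \<in> U" shows "Q (F x) (D x u) = 0"
proof -
  have "((\<lambda>y. Q (F y) (F y)) has_derivative (\<lambda>u. Q (F x) (D x u) + Q (D x u) (F x))) (at x)"
    by (intro bounded_bilinear.FDERIV[OF Qb] smooth_on_has_derivative[OF F x])
  then have "((\<lambda>y. - 1::real) has_derivative (\<lambda>u. Q (F x) (D x u) + Q (D x u) (F x))) (at x)"
    by (rule has_derivative_transform_within_open[OF _ U x]) (simp add: F_unit)
  from fd_eqI[OF this, of u] fd_eqI[OF has_derivative_const[of "-1" "at x"], of u]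
  have "Q (F x) (D x u) + Q (D x u) (F x) = (0::real)" by simp
  then show ?thesis using Qsym[of "F x" "D x u"] by simp
qed

text \<open>\<open>F_normal\<close> differentiated once more. Along the position vector
  \<open>al\<close> is the metric itself up to sign, as the hyperboloid is umbilic in the flat
  space.\<close>

lemma al_F: assumes x: "x \<in> U" shows "Q (al x u v) (F x) = - g x u v"
proof -
  have "((\<lambda>y. Q (F y) (D y v)) has_derivative (\<lambda>u. Q (F x) (D2 x u v) + Q (D x u) (D x v))) (at x)"
    by (intro bounded_bilinear.FDERIV[OF Qb] smooth_on_has_derivative[OF F x] smooth_on_has_derivative[OF sm_D x])
  then have "((\<lambda>y. 0::real) has_derivative (\<lambda>u. Q (F x) (D2 x u v) + Q (D x u) (D x v))) (at x)"
    by (rule has_derivative_transform_within_open[OF _ U x]) (simp add: F_normal)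
  from fd_eqI[OF this, of u] fd_eqI[OF has_derivative_const[of "0" "at x"], of u]
  have "Q (F x) (D2 x u v) + g x u v = 0" using g_eq[OF x] by simp
  then show ?thesis by (simp add: al_def Q_simps Qsym[of _ "F x"] F_normal[OF x])
qed

lemma Bf_F: "x \<in> U \<Longrightarrow> Q (Bf x X Y) (F x) = - 2 * g x X Y"
  by (simp add: Bf_def Q_simps al_F J_orth)

text \<open>The normal space is not named. Instead \<open>\<Lambda>\<close> takes a tangent vector
  and a multiple of \<open>F x\<close> as further unknowns in each of the two equations. Pairing a
  solution with tangent vectors and with \<open>F x\<close> forces the tangent vectors to be 0 and
  determines the multiples, so in a nonzero solution \<open>Y\<close> itself is nonzero.\<close>

lemma kernel_exists:
  assumes x: "x \<in> U"
  shows "\<exists>Y. Y \<noteq> 0 \<and> Bf x X Y = (2 * g x X Y) *\<^sub>R F x \<and> Bf x X (J x Y) = (2 * g x X (J x Y)) *\<^sub>R F x"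
proof -
  define \<Lambda> :: "'e \<times> ('e \<times> real) \<times> ('e \<times> real) \<Rightarrow> 'l \<times> 'l" where
    "\<Lambda> z = (Bf x X (fst z) - D x (fst (fst (snd z))) - snd (fst (snd z)) *\<^sub>R F x,
      Bf x X (J x (fst z)) - D x (fst (snd (snd z))) - snd (snd (snd z)) *\<^sub>R F x)" for z
  note l = linear_add[OF bilinear_linear(1)[OF Bf_bilinear[OF x]]] linear_scale[OF bilinear_linear(1)[OF Bf_bilinear[OF x]]]
    linear_add[OF lin_D[OF x]] linear_scale[OF lin_D[OF x]] linear_add[OF J_lin[OF x]] linear_scale[OF J_lin[OF x]]
  have lin: "linear \<Lambda>" unfolding \<Lambda>_def
    by (rule linearI) (auto simp: l algebra_simps)
  have "\<not> inj \<Lambda>"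
  proof
    assume "inj \<Lambda>"
    then have "DIM('e \<times> ('e \<times> real) \<times> ('e \<times> real)) \<le> DIM('l \<times> 'l)"
      using dim_image_eq[OF lin, of UNIV] dim_subset_UNIV[of "range \<Lambda>"] by simp
    then show False using dims by simp
  qed
  then obtain Y u1 t1 u2 t2 where nz: "(Y, (u1, t1), (u2, t2)) \<noteq> 0" and z: "\<Lambda> (Y, (u1, t1), (u2, t2)) = 0"
    unfolding linear_injective_0[OF lin] by (metis prod.collapse)
  have solve: "u = 0 \<and> t = 2 * g x X Z" if e: "Bf x X Z - D x u - t *\<^sub>R F x = 0" for Z u t
  proof -
    have "Q (Bf x X Z - D x u - t *\<^sub>R F x) (D x u) = - g x u u"
      by (simp add: Q_simps Bf_def al_normal[OF x] F_normal[OF x] g_eq[OF x])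
    then have u: "u = 0" using e g_pos[OF x, of u] by (force simp: Q_simps)
    have "Q (Bf x X Z - D x u - t *\<^sub>R F x) (F x) = - 2 * g x X Z + t"
      using Bf_F[OF x] F_unit[OF x] F_normal[OF x, of u] Qsym[of "D x u" "F x"] by (simp add: Q_simps)
    then have "0 = - 2 * g x X Z + t" by (simp only: e Q_simps)
    then show ?thesis using u by simp
  qed
  have 1: "u1 = 0 \<and> t1 = 2 * g x X Y" "Bf x X Y - D x u1 - t1 *\<^sub>R F x = 0"
    and 2: "u2 = 0 \<and> t2 = 2 * g x X (J x Y)" "Bf x X (J x Y) - D x u2 - t2 *\<^sub>R F x = 0"
    using z solve[of Y u1 t1] solve[of "J x Y" u2 t2] by (auto simp: \<Lambda>_def zero_prod_def)
  have D0: "D x 0 = 0" using linear_0[OF lin_D[OF x]] .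
  have "Y \<noteq> 0"
  proof
    assume "Y = 0"
    then have "t1 = 0" "t2 = 0" using 1 2 linear_0[OF J_lin[OF x]] by (auto simp: g_simps[OF x])
    then show False using nz \<open>Y = 0\<close> 1 2 by (simp add: zero_prod_def)
  qed
  then show ?thesis using 1 2 D0 by (intro exI[of _ Y]) auto
qed

theorem exists_causal:
  assumes x: "x \<in> U"
  shows "\<exists>X. X \<noteq> 0 \<and> Q (Bf x X X) (Bf x X X) \<le> 0"
proof (rule ccontr)
  assume "\<not> ?thesis"
  then have pos: "Q (Bf x X X) (Bf x X X) > 0" if "X \<noteq> 0" for X using that by (meson not_le)
  \<comment> \<open>Removes the component along the timelike vector \<open>F x\<close>, because
    \<open>Q (F x) (F x) = - 1\<close> and
    \<open>Q (Bf x X Y) (F x) = - 2 * g x X Y\<close>.\<close>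
  define W where "W X Y = Bf x X Y - (2 * g x X Y) *\<^sub>R F x" for X Y
  define q where "q X = Q (W X X) (W X X)" for X
  have QW: "Q (W X X) (W Y Y) = Q (Bf x X X) (Bf x Y Y) + 4 * g x X X * g x Y Y" for X Y
    by (simp add: W_def Q_simps Bf_F[OF x] Qsym[of "F x" "Bf _ _ _"] F_unit[OF x])
  have W_bil: "bilinear W" unfolding bilinear_def W_def
    using bilinear_ladd[OF Bf_bilinear[OF x]] bilinear_radd[OF Bf_bilinear[OF x]]
      bilinear_lmul[OF Bf_bilinear[OF x]] bilinear_rmul[OF Bf_bilinear[OF x]]
    by (auto intro!: linearI simp: g_simps[OF x] algebra_simps)
  have W_sym: "W X Y = W Y X" for X Y by (simp add: W_def Bf_sym[OF x] g_sym[OF x])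
  let ?S = "sphere (0::'e) 1"
  have gp: "g x X X > 0" if "X \<in> ?S" for X using that g_pos[OF x, of X] by force
  have cont: "continuous_on ?S (\<lambda>X. q X / (g x X X)\<^sup>2)"
  proof -
    have cW: "continuous_on ?S (\<lambda>X. W X X)"
      by (rule continuous_on_bilinear_family[where h="\<lambda>_. W", OF W_bil]) (auto intro: continuous_intros)
    have "continuous_on ?S (\<lambda>X. g x X X)"
      using x by (intro g_continuous_on) (auto intro: continuous_intros)
    then show ?thesis unfolding q_def using gp
      by (intro continuous_intros bounded_bilinear.continuous_on[OF Qb] cW) force+
  qed
  obtain X0 where X0: "X0 \<in> ?S" "\<And>X. X \<in> ?S \<Longrightarrow> q X0 / (g x X0 X0)\<^sup>2 \<le> q X / (g x X X)\<^sup>2"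
    using continuous_attains_inf[OF compact_sphere _ cont] by force
  define g0 where "g0 = g x X0 X0"
  define \<mu> where "\<mu> = q X0 / g0\<^sup>2"
  have X0nz: "X0 \<noteq> 0" and g0: "g0 > 0" using X0(1) gp unfolding g0_def by auto
  have q0: "q X0 = \<mu> * g0\<^sup>2" using g0 by (simp add: \<mu>_def)
  \<comment> \<open>By \<open>QW\<close> the square of \<open>W\<close> is that of \<open>Bf\<close>
    plus \<open>4 * g0\<^sup>2\<close>, and the square of \<open>Bf x X0 X0\<close> is positive by
    the assumption to be refuted.\<close>
  have \<mu>: "\<mu> > 4"
  proof -
    have "q X0 > 4 * g0\<^sup>2" using pos[OF X0nz] QW[of X0 X0] by (simp add: q_def g0_def power2_eq_square)
    then show ?thesis using g0 by (simp add: \<mu>_def pos_less_divide_eq)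
  qed
  have min: "\<mu> * (g x X X)\<^sup>2 \<le> q X" for X
  proof (cases "X = 0")
    case True then show ?thesis using bilinear_lzero[OF W_bil] by (simp add: q_def g_simps[OF x] Q_simps)
  next
    case False
    let ?X = "X /\<^sub>R norm X"
    have gX: "g x ?X ?X = g x X X / (norm X)\<^sup>2" by (simp add: g_simps[OF x] power2_eq_square divide_simps)
    have "W ?X ?X = (1 / (norm X)\<^sup>2) *\<^sub>R W X X"
      by (simp add: bilinear_lmul[OF W_bil] bilinear_rmul[OF W_bil] power2_eq_square divide_simps)
    then have "q ?X = q X / (norm X) ^ 4"
      by (simp add: q_def Q_simps power4_eq_xxxx power2_eq_square divide_simps)
    then have "q ?X / (g x ?X ?X)\<^sup>2 = q X / (g x X X)\<^sup>2"
      using False unfolding gX by (simp add: power4_eq_xxxx power2_eq_square divide_simps)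
    then have "\<mu> \<le> q X / (g x X X)\<^sup>2" using X0(2)[of ?X] False by (simp add: \<mu>_def g0_def)
    moreover have "g x X X > 0" using False by (rule g_pos[OF x])
    ultimately show ?thesis by (simp add: pos_le_divide_eq)
  qed
  \<comment> \<open>Moving \<open>X0\<close> along a kernel vector changes \<open>W\<close> only at
    order \<open>t\<^sup>2\<close>, so minimality becomes a quartic inequality in \<open>t\<close>.
    Its linear term gives \<open>g x X0 Y = 0\<close>, which turns the kernel condition for
    \<open>W\<close> into one for \<open>Bf\<close>; its quadratic term gives the lower
    bound.\<close>
  have second: "g x X0 Y = 0 \<and> Q (W X0 X0) (W Y Y) \<ge> \<mu> * g0 * g x Y Y" if Y: "W X0 Y = 0" for Y
  proof -
    define m where "m = g x X0 Y"
    define h where "h = g x Y Y"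
    define P where "P = Q (W X0 X0) (W Y Y)"
    have *: "(- 4 * \<mu> * g0 * m) * t + (2 * P - \<mu> * (4 * m\<^sup>2 + 2 * g0 * h)) * t\<^sup>2
       + (- 4 * \<mu> * m * h) * t ^ 3 + (q Y - \<mu> * h\<^sup>2) * t ^ 4 \<ge> 0" for t
    proof -
      have "W (X0 + t *\<^sub>R Y) (X0 + t *\<^sub>R Y) = W X0 X0 + t\<^sup>2 *\<^sub>R W Y Y"
        using Y W_sym[of Y X0]
        by (simp add: bilinear_ladd[OF W_bil] bilinear_radd[OF W_bil] bilinear_lmul[OF W_bil] bilinear_rmul[OF W_bil] power2_eq_square)
      then have "q (X0 + t *\<^sub>R Y) = \<mu> * g0\<^sup>2 + 2 * t\<^sup>2 * P + t ^ 4 * q Y"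
        using Qsym[of "W Y Y" "W X0 X0"] q0
        by (simp add: q_def Q_simps P_def power4_eq_xxxx power2_eq_square algebra_simps)
      moreover have "g x (X0 + t *\<^sub>R Y) (X0 + t *\<^sub>R Y) = g0 + 2 * t * m + t\<^sup>2 * h"
        by (simp add: g_simps[OF x] g_sym[OF x, of Y X0] g0_def m_def h_def power2_eq_square algebra_simps)
      ultimately have "\<mu> * (g0 + 2 * t * m + t\<^sup>2 * h)\<^sup>2 \<le> \<mu> * g0\<^sup>2 + 2 * t\<^sup>2 * P + t ^ 4 * q Y"
        using min[of "X0 + t *\<^sub>R Y"] by simp
      then show ?thesis by (simp add: algebra_simps power2_eq_square power3_eq_cube power4_eq_xxxx)
    qed
    from quartic_nonneg_imp[OF *] have "m = 0" "2 * P - \<mu> * (4 * m\<^sup>2 + 2 * g0 * h) \<ge> 0"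
      using \<mu> g0 by auto
    then show ?thesis unfolding m_def h_def P_def by (simp add: algebra_simps)
  qed
  obtain Y where Y: "Y \<noteq> 0" "W X0 Y = 0" "W X0 (J x Y) = 0"
    using kernel_exists[OF x, of X0] by (auto simp: W_def)
  have "Bf x X0 Y = 0" "Bf x X0 (J x Y) = 0"
    using Y second[OF Y(2)] second[OF Y(3)] by (auto simp: W_def)
  \<comment> \<open>By \<open>Bf_orthogonal\<close> only the product of the two components along
    \<open>F x\<close> survives in \<open>QW\<close>. With \<open>\<mu> > 4\<close> it falls short
    of the bound in \<open>second\<close>.\<close>
  then have "Q (W X0 X0) (W Y Y) = 4 * g0 * g x Y Y"
    using Bf_orthogonal[OF x] QW by (simp add: g0_def)
  moreover have "4 * g0 * g x Y Y < \<mu> * g0 * g x Y Y" using \<mu> g0 g_pos[OF x Y(1)] by simp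
  ultimately show False using second[OF Y(2)] by linarith
qed

end

section \<open>The Riemannian distance\<close>

lemma isCont_linear_family:
  fixes h :: "'d::topological_space \<Rightarrow> 'e::euclidean_space \<Rightarrow> 'b::real_normed_vector"
  assumes lin: "\<forall>\<^sub>F u in nhds t. linear (h (x u))"
    and x: "\<And>b. b \<in> Basis \<Longrightarrow> isCont (\<lambda>u. h (x u) b) t" and w: "isCont w t"
  shows "isCont (\<lambda>u. h (x u) (w u)) t"
proof -
  have "isCont (\<lambda>u. \<Sum>b\<in>Basis. (w u \<bullet> b) *\<^sub>R h (x u) b) t"
    by (intro continuous_intros x w)
  moreover have "\<forall>\<^sub>F u in nhds t. (\<Sum>b\<in>Basis. (w u \<bullet> b) *\<^sub>R h (x u) b) = h (x u) (w u)"
    using lin by eventually_elim (rule linear_expand[symmetric])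
  ultimately show ?thesis by (simp add: isCont_cong)
qed

lemma continuous_map_interval_openin:
  fixes \<gamma> :: "real \<Rightarrow> 'a"
  assumes c: "continuous_map (top_of_set {a..b}) X \<gamma>" and W: "openin X W" and t: "t \<in> {a..b}" "\<gamma> t \<in> W"
  shows "\<exists>d>0. \<forall>u\<in>{a..b}. \<bar>u - t\<bar> < d \<longrightarrow> \<gamma> u \<in> W"
proof -
  have "openin (top_of_set {a..b}) {u \<in> {a..b}. \<gamma> u \<in> W}"
    using openin_continuous_map_preimage[OF c W] by simp
  then show ?thesis using t unfolding openin_euclidean_subtopology_iff by (auto simp: dist_real_def)
qed

context riemannian_manifold
begin

abbreviation "ci c \<equiv> inv_into (fst c) (snd c)"
abbreviation "rm c \<equiv> riem_metric M c"

lemma domain_subset: "c \<in> atlas M \<Longrightarrow> fst c \<subseteq> topspace (mtop M)"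
  by (rule openin_subset[OF open_domain])

lemma topspace_domain: "c \<in> atlas M \<Longrightarrow> topspace (subtopology (mtop M) (fst c)) = fst c"
  by (rule topspace_subtopology_subset[OF domain_subset])

lemma chart_exists: "p \<in> topspace (mtop M) \<Longrightarrow> \<exists>c\<in>atlas M. p \<in> fst c"
  using cover by auto

lemma inj_chart: "c \<in> atlas M \<Longrightarrow> inj_on (snd c) (fst c)"
  using homeomorphic_imp_injective_map[OF chart_homeomorphic] topspace_domain by metis

lemma ci_snd: "c \<in> atlas M \<Longrightarrow> p \<in> fst c \<Longrightarrow> ci c (snd c p) = p"
  by (rule inv_into_f_f[OF inj_chart])

lemma snd_ci: "x \<in> coords c \<Longrightarrow> snd c (ci c x) = x"
  by (rule f_inv_into_f)

lemma ci_in: "x \<in> coords c \<Longrightarrow> ci c x \<in> fst c"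
  by (rule inv_into_into)

lemma continuous_chart: "c \<in> atlas M \<Longrightarrow> continuous_map (subtopology (mtop M) (fst c)) (top_of_set (coords c)) (snd c)"
  by (rule homeomorphic_imp_continuous_map[OF chart_homeomorphic])

lemma continuous_ci:
  assumes c: "c \<in> atlas M" shows "continuous_map (top_of_set (coords c)) (mtop M) (ci c)"
proof -
  obtain h where h: "homeomorphic_maps (subtopology (mtop M) (fst c)) (top_of_set (coords c)) (snd c) h"
    using chart_homeomorphic[OF c] homeomorphic_map_maps by blast
  then have ch: "continuous_map (top_of_set (coords c)) (mtop M) h"
    by (simp add: homeomorphic_maps_def continuous_map_in_subtopology)
  have "ci c x = h x" if "x \<in> coords c" for x
  proof -
    have "h x \<in> fst c" "snd c (h x) = x"
      using h that topspace_domain[OF c] continuous_map_image_subset_topspace[of "top_of_set (coords c)" "subtopology (mtop M) (fst c)" h]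
      unfolding homeomorphic_maps_def by auto
    then show ?thesis using ci_snd[OF c, of "h x"] by simp
  qed
  then show ?thesis by (intro continuous_map_eq[OF ch]) auto
qed

lemma ci_image:
  assumes c: "c \<in> atlas M" and W: "W \<subseteq> coords c"
  shows "ci c ` W = {p \<in> fst c. snd c p \<in> W}"
proof (intro equalityI subsetI)
  fix p assume "p \<in> ci c ` W"
  then obtain x where x: "p = ci c x" "x \<in> W" by blast
  then have "x \<in> coords c" using W by blast
  then show "p \<in> {p \<in> fst c. snd c p \<in> W}" using ci_in[of x c] snd_ci[of x c] x by simp
next
  fix p assume p: "p \<in> {p \<in> fst c. snd c p \<in> W}"
  then have "p = ci c (snd c p)" using ci_snd[OF c] by simp
  then show "p \<in> ci c ` W" using p by blast
qed

lemma openin_ci: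
  assumes c: "c \<in> atlas M" and W: "open W" "W \<subseteq> coords c"
  shows "openin (mtop M) (ci c ` W)"
proof -
  have "openin (top_of_set (coords c)) W" using W by (simp add: open_openin_trans openin_open_eq open_coords[OF c] Int_absorb1)
  from openin_continuous_map_preimage[OF continuous_chart[OF c] this]
  have "openin (subtopology (mtop M) (fst c)) {p \<in> fst c. snd c p \<in> W}" unfolding topspace_domain[OF c] .
  then show ?thesis using open_domain[OF c] ci_image[OF c W(2)] by (simp add: openin_open_subtopology)
qed

lemma closedin_ci:
  assumes c: "c \<in> atlas M" and C: "compact C" "C \<subseteq> coords c"
  shows "closedin (mtop M) (ci c ` C)"
proof (rule compactin_imp_closedin[OF Hausdorff])
  have "compactin (top_of_set (coords c)) C" using C by (simp add: compactin_subtopology)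
  then show "compactin (mtop M) (ci c ` C)" by (rule image_compactin) (rule continuous_ci[OF c])
qed

lemma transition_eq: "transition c c' = (\<lambda>x. snd c' (ci c x))"
  by (auto simp: local_rep_def)

lemma tdom: "c \<in> atlas M \<Longrightarrow> x \<in> transition_dom c c' \<longleftrightarrow> x \<in> coords c \<and> ci c x \<in> fst c'"
  unfolding local_rep_dom_def using ci_snd[of c] snd_ci[of x c] ci_in[of x c] by (auto simp: image_iff)

lemma open_tdom:
  assumes c: "c \<in> atlas M" "c' \<in> atlas M" shows "open (transition_dom c c')"
proof -
  have "openin (top_of_set (coords c)) {x \<in> coords c. ci c x \<in> fst c'}"
    using openin_continuous_map_preimage[OF continuous_ci[OF c(1)] open_domain[OF c(2)]] by simp
  moreover have "transition_dom c c' = {x \<in> coords c. ci c x \<in> fst c'}" using tdom[OF c(1), of _ c'] by auto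
  ultimately show ?thesis using open_coords[OF c(1)] by (simp add: openin_open_eq)
qed

text \<open>Regularity at one time in one chart. Unlike the interval condition of
  \<open>piecewise_C1_curve\<close>, it can be carried over time by time to another chart, to a
  reparametrization and to a concatenation.\<close>

definition "creg c \<gamma> t \<longleftrightarrow> (\<forall>\<^sub>F u in nhds t. \<gamma> u \<in> fst c \<and> (snd c \<circ> \<gamma>) differentiable (at u))
   \<and> isCont (\<lambda>u. vector_derivative (snd c \<circ> \<gamma>) (at u)) t"

lemma creg_D:
  assumes "creg c \<gamma> t"
  shows "\<gamma> t \<in> fst c" "(snd c \<circ> \<gamma> has_vector_derivative vector_derivative (snd c \<circ> \<gamma>) (at t)) (at t)"
  using eventually_nhds_x_imp_x[OF conjunct1[OF assms[unfolded creg_def]]]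
  by (simp_all add: vector_derivative_works[symmetric])

lemma creg_change:
  assumes c: "c \<in> atlas M" "c' \<in> atlas M" and r: "creg c \<gamma> t" and t: "\<gamma> t \<in> fst c'"
  shows "creg c' \<gamma> t"
    "vector_derivative (snd c' \<circ> \<gamma>) (at t) = fd (transition c c') (snd c (\<gamma> t)) (vector_derivative (snd c \<circ> \<gamma>) (at t))"
proof -
  let ?T = "transition c c'" and ?x = "snd c \<circ> \<gamma>"
  have sT: "smooth_on (transition_dom c c') ?T" by (rule smooth_transition[OF c])
  note oT = open_tdom[OF c]
  have contx: "isCont ?x t"
    by (rule has_vector_derivative_continuous[OF creg_D(2)[OF r]])
  have xt: "?x t \<in> transition_dom c c'" using creg_D(1)[OF r] t ci_snd[OF c(1), of "\<gamma> t"] tdom[OF c(1), of "?x t" c'] by simp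
  have "(?x \<longlongrightarrow> ?x t) (nhds t)" using contx unfolding isCont_def tendsto_at_iff_tendsto_nhds .
  from topological_tendstoD[OF this oT xt]
  have "\<forall>\<^sub>F u in nhds t. ?x u \<in> transition_dom c c'" .
  with r have "\<forall>\<^sub>F u in nhds t. ?x u \<in> transition_dom c c' \<and> \<gamma> u \<in> fst c \<and> ?x differentiable (at u)"
    unfolding creg_def by (auto elim: eventually_elim2)
  then obtain N where N: "open N" "t \<in> N" "\<And>u. u \<in> N \<Longrightarrow> ?x u \<in> transition_dom c c' \<and> \<gamma> u \<in> fst c \<and> ?x differentiable (at u)"
    unfolding eventually_nhds by blast
  have eq: "(snd c' \<circ> \<gamma>) u = ?T (?x u)" if "u \<in> N" for u
    using N(3)[OF that] ci_snd[OF c(1)] by (simp add: transition_eq)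
  have dv: "(snd c' \<circ> \<gamma> has_vector_derivative fd ?T (?x u) (vector_derivative ?x (at u))) (at u)" if u: "u \<in> N" for u
  proof -
    have "(?x has_vector_derivative vector_derivative ?x (at u)) (at u)"
      using N(3)[OF u] by (simp add: vector_derivative_works)
    moreover have "(?T has_derivative fd ?T (?x u)) (at (?x u))"
      using smooth_on_has_derivative[OF sT] N(3)[OF u] by blast
    ultimately have "(?T \<circ> ?x has_vector_derivative fd ?T (?x u) (vector_derivative ?x (at u))) (at u)"
      using vector_derivative_diff_chain_within[of ?x _ u UNIV ?T "fd ?T (?x u)"] has_derivative_at_withinI by blast
    then show ?thesis
      by (rule has_vector_derivative_transform_within_open[OF _ N(1) u]) (use eq in simp)
  qed
  have vd: "vector_derivative (snd c' \<circ> \<gamma>) (at u) = fd ?T (?x u) (vector_derivative ?x (at u))" if "u \<in> N" for u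
    by (rule vector_derivative_at[OF dv[OF that]])
  show "vector_derivative (snd c' \<circ> \<gamma>) (at t) = fd ?T (snd c (\<gamma> t)) (vector_derivative ?x (at t))"
    using vd[OF N(2)] by simp
  have evN: "\<forall>\<^sub>F u in nhds t. u \<in> N" using N by (rule_tac eventually_nhds_in_open)
  have "isCont (\<lambda>u. fd ?T (?x u) (vector_derivative ?x (at u))) t"
  proof (rule isCont_linear_family[where h="\<lambda>y. fd ?T y" and x="?x"])
    show "\<forall>\<^sub>F u in nhds t. linear (fd ?T (?x u))"
      using evN by eventually_elim (use N(3) smooth_on_fd_linear[OF sT] in blast)
    show "isCont (\<lambda>u. fd ?T (?x u) b) t" for b
    proof (rule isCont_o2[OF contx])
      show "isCont (\<lambda>y. fd ?T y b) (?x t)"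
        using smooth_on_continuous[OF smooth_on_fd[OF sT]] oT xt by (simp add: continuous_on_eq_continuous_at)
    qed
    show "isCont (\<lambda>u. vector_derivative ?x (at u)) t" using r unfolding creg_def by blast
  qed
  moreover have "\<forall>\<^sub>F u in nhds t. fd ?T (?x u) (vector_derivative ?x (at u)) = vector_derivative (snd c' \<circ> \<gamma>) (at u)"
    using evN by eventually_elim (simp add: vd)
  ultimately have "isCont (\<lambda>u. vector_derivative (snd c' \<circ> \<gamma>) (at u)) t" by (simp add: isCont_cong)
  moreover have "\<forall>\<^sub>F u in nhds t. \<gamma> u \<in> fst c' \<and> (snd c' \<circ> \<gamma>) differentiable (at u)"
    using evN
  proof eventually_elim
    case (elim u)
    have "ci c (?x u) \<in> fst c'" using N(3)[OF elim] tdom[OF c(1)] by blast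
    then show ?case using N(3)[OF elim] ci_snd[OF c(1)] dv[OF elim] by (auto simp: differentiableI_vector)
  qed
  ultimately show "creg c' \<gamma> t" unfolding creg_def by blast
qed

text \<open>\<open>speed\<close> works in a chart picked by choice. At a regular time the chain rule
  for the transition map and the transformation law of the metric allow any chart in its
  place.\<close>

lemma speed_eq:
  assumes c: "c \<in> atlas M" and r: "creg c \<gamma> t"
  shows "speed M \<gamma> t = sqrt (rm c (snd c (\<gamma> t)) (vector_derivative (snd c \<circ> \<gamma>) (at t)) (vector_derivative (snd c \<circ> \<gamma>) (at t)))"
proof -
  define c' where "c' = (SOME c. c \<in> atlas M \<and> \<gamma> t \<in> fst c)"
  have c': "c' \<in> atlas M" "\<gamma> t \<in> fst c'"
    using someI[of "\<lambda>c. c \<in> atlas M \<and> \<gamma> t \<in> fst c" c] c creg_D(1)[OF r] unfolding c'_def by auto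
  have dom: "snd c (\<gamma> t) \<in> transition_dom c c'"
    using creg_D(1)[OF r] c' ci_snd[OF c, of "\<gamma> t"] tdom[OF c, of _ c'] by simp
  have pt: "transition c c' (snd c (\<gamma> t)) = snd c' (\<gamma> t)" using ci_snd[OF c creg_D(1)[OF r]] by (simp add: transition_eq)
  show ?thesis
    unfolding speed_def c'_def[symmetric] Let_def creg_change(2)[OF c c'(1) r c'(2)]
      metric_transform[OF c c'(1) dom] pt by simp
qed

text \<open>The curves of \<open>piecewise_C1_curve\<close> on an arbitrary interval. The
  exceptional times are counted once for the whole curve and not chart by chart, and the endpoints
  are exempt, which suits restriction and concatenation.\<close>

definition "seg \<gamma> a b \<longleftrightarrow> continuous_map (top_of_set {a..b}) (mtop M) \<gamma> \<and>
   finite {t \<in> {a<..<b}. \<not> (\<exists>c\<in>atlas M. creg c \<gamma> t)}"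

lemma seg_imp_pc1:
  assumes s: "seg \<gamma> 0 1" shows "piecewise_C1_curve M \<gamma>"
  unfolding piecewise_C1_curve_def
proof (intro conjI ballI allI impI)
  show cont: "continuous_map (top_of_set {0..1}) (mtop M) \<gamma>" using s by (simp add: seg_def)
  fix c a b assume c: "c \<in> atlas M" and ab: "{a..b} \<subseteq> {0..1::real}" "\<gamma> ` {a..b} \<subseteq> fst c"
  define S where "S = {t \<in> {0<..<1}. \<not> (\<exists>c\<in>atlas M. creg c \<gamma> t)} \<union> {a, b}"
  have "finite S" using s by (simp add: seg_def S_def)
  have "continuous_map (top_of_set {a..b}) (mtop M) \<gamma>"
    by (rule continuous_map_from_subtopology_mono[OF cont ab(1)])
  then have "continuous_map (top_of_set {a..b}) (subtopology (mtop M) (fst c)) \<gamma>"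
    using ab(2) by (simp add: continuous_map_in_subtopology image_subset_iff_funcset)
  from continuous_map_compose[OF this continuous_chart[OF c]]
  have co: "continuous_on {a..b} (snd c \<circ> \<gamma>)" by (simp add: continuous_map_in_subtopology)
  have reg: "creg c \<gamma> t" if tS: "t \<in> {a..b} - S" for t
  proof -
    have "t \<in> {a<..<b}" using tS by (auto simp: S_def)
    then have "t \<in> {0<..<1}" using ab(1) by (auto simp: subset_iff dest: spec[of _ a] spec[of _ b])
    then obtain c' where "c' \<in> atlas M" "creg c' \<gamma> t" using tS unfolding S_def by blast
    then show ?thesis using creg_change(1)[OF _ c] ab(2) tS by blast
  qed
  have "(snd c \<circ> \<gamma>) C1_differentiable_on ({a..b} - S)"
    unfolding C1_differentiable_on_eq
  proof (intro conjI ballI continuous_at_imp_continuous_on)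
    fix t assume "t \<in> {a..b} - S"
    note r = reg[OF this]
    show "(snd c \<circ> \<gamma>) differentiable (at t)" using creg_D(2)[OF r] by (rule differentiableI_vector)
    show "isCont (\<lambda>x. vector_derivative (snd c \<circ> \<gamma>) (at x)) t" using r by (simp add: creg_def)
  qed
  then show "(snd c \<circ> \<gamma>) piecewise_C1_differentiable_on {a..b}"
    unfolding piecewise_C1_differentiable_on_def using co \<open>finite S\<close> by blast
qed

text \<open>A chart sees the curve only near a given time, so at first the exceptional times are
  locally finite; compactness of the interval makes them finite.\<close>

lemma pc1_imp_seg:
  assumes p: "piecewise_C1_curve M \<gamma>" shows "seg \<gamma> 0 1"
  unfolding seg_def
proof
  show cont: "continuous_map (top_of_set {0..1}) (mtop M) \<gamma>" using p by (simp add: piecewise_C1_curve_def)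
  let ?B = "{t \<in> {0<..<1}. \<not> (\<exists>c\<in>atlas M. creg c \<gamma> t)}"
  have "\<exists>d>0. finite (?B \<inter> ball t d)" if t: "t \<in> {0..1}" for t
  proof -
    have "\<gamma> t \<in> topspace (mtop M)" using continuous_map_image_subset_topspace[OF cont] t by auto
    then obtain c where c: "c \<in> atlas M" "\<gamma> t \<in> fst c" using chart_exists by blast
    obtain d where d: "d > 0" "\<And>u. u \<in> {0..1} \<Longrightarrow> \<bar>u - t\<bar> < d \<Longrightarrow> \<gamma> u \<in> fst c"
      using continuous_map_interval_openin[OF cont open_domain[OF c(1)] t c(2)] by blast
    \<comment> \<open>Half of \<open>d\<close>, so that the closed interval stays among the times at
      which the curve lies in \<open>fst c\<close>.\<close>
    define a b where "a = max 0 (t - d/2)" and "b = min 1 (t + d/2)"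
    have sub: "{a..b} \<subseteq> {0..1}" "\<gamma> ` {a..b} \<subseteq> fst c"
      using d by (auto simp: a_def b_def)
    then have "(snd c \<circ> \<gamma>) piecewise_C1_differentiable_on {a..b}"
      using p c(1) unfolding piecewise_C1_curve_def by blast
    then obtain S where S: "finite S" "(snd c \<circ> \<gamma>) C1_differentiable_on ({a..b} - S)"
      unfolding piecewise_C1_differentiable_on_def by blast
    have "creg c \<gamma> u" if u: "u \<in> {0<..<1}" "u \<in> ball t (d/2)" "u \<notin> S" for u
    proof -
      have "\<bar>t - u\<bar> < d / 2" using u(2) by (simp only: mem_ball dist_real_def)
      then have "t - d / 2 < u" "u < t + d / 2" by linarith+
      then have uN: "u \<in> {a<..<b} - S" using u(1,3) by (auto simp: a_def b_def)
      have oN: "open ({a<..<b} - S)" using S(1) by (simp add: finite_imp_closed open_Diff)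
      have N: "v \<in> {a..b} - S" if "v \<in> {a<..<b} - S" for v using that by auto
      have "\<forall>\<^sub>F v in nhds u. \<gamma> v \<in> fst c \<and> (snd c \<circ> \<gamma>) differentiable (at v)"
        using eventually_nhds_in_open[OF oN uN]
        by eventually_elim (use S(2) sub N in \<open>auto simp: C1_differentiable_on_eq\<close>)
      moreover have "continuous_on ({a<..<b} - S) (\<lambda>v. vector_derivative (snd c \<circ> \<gamma>) (at v))"
        using S(2) N unfolding C1_differentiable_on_eq by (auto intro: continuous_on_subset)
      ultimately show ?thesis unfolding creg_def
        using continuous_on_eq_continuous_at[OF oN] uN by blast
    qed
    then have "?B \<inter> ball t (d/2) \<subseteq> S" using c(1) by blast
    then show ?thesis using S(1) d(1) finite_subset by (intro exI[of _ "d/2"]) auto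
  qed
  then have "\<forall>t\<in>{0..1}. \<exists>d>0. finite (?B \<inter> ball t d)" by (intro ballI)
  from bchoice[OF this] obtain d where d: "\<forall>t\<in>{0..1}. d t > 0 \<and> finite (?B \<inter> ball t (d t))" ..
  have cov: "{0..1} \<subseteq> (\<Union>t\<in>{0..1}. ball t (d t))"
  proof
    fix t :: real assume t: "t \<in> {0..1}"
    then have "t \<in> ball t (d t)" using d by simp
    then show "t \<in> (\<Union>t\<in>{0..1}. ball t (d t))" using t by blast
  qed
  obtain T where T: "T \<subseteq> {0..1}" "finite T" "{0..1} \<subseteq> (\<Union>t\<in>T. ball t (d t))"
    by (rule compactE_image[OF compact_Icc open_ball cov])
  have "?B \<subseteq> {0..1}" by auto
  then have "?B \<subseteq> (\<Union>t\<in>T. ?B \<inter> ball t (d t))" using T(3) by blast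
  moreover have "finite (\<Union>t\<in>T. ?B \<inter> ball t (d t))"
    by (rule finite_UN_I[OF T(2)]) (use d T(1) in blast)
  ultimately show "finite ?B" by (rule finite_subset)
qed

text \<open>The parameter interval is left free, so that pieces of a curve qualify as they are;
  \<open>conn_normalize\<close> restores any wanted interval.\<close>

definition "conn p q L \<longleftrightarrow> (\<exists>\<gamma> a b. a < b \<and> seg \<gamma> a b \<and> (speed M \<gamma> has_integral L) {a..b} \<and> \<gamma> a = p \<and> \<gamma> b = q)"

lemma seg_good:
  assumes "seg \<gamma> a b"
  obtains S where "finite S" "\<And>t. t \<in> {a<..<b} - S \<Longrightarrow> \<exists>c\<in>atlas M. creg c \<gamma> t"
proof (rule that[of "{t \<in> {a<..<b}. \<not> (\<exists>c\<in>atlas M. creg c \<gamma> t)}"])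
  show "finite {t \<in> {a<..<b}. \<not> (\<exists>c\<in>atlas M. creg c \<gamma> t)}" using assms by (simp add: seg_def)
qed blast

lemma creg_affine:
  assumes r: "creg c \<gamma> (k * t + m)" and k: "k \<noteq> 0"
  shows "creg c (\<lambda>t. \<gamma> (k * t + m)) t"
    "vector_derivative (snd c \<circ> (\<lambda>t. \<gamma> (k * t + m))) (at t) = k *\<^sub>R vector_derivative (snd c \<circ> \<gamma>) (at (k * t + m))"
proof -
  obtain N where N: "open N" "k * t + m \<in> N" "\<And>u. u \<in> N \<Longrightarrow> \<gamma> u \<in> fst c \<and> (snd c \<circ> \<gamma>) differentiable (at u)"
    using r unfolding creg_def eventually_nhds by blast
  have lim: "((\<lambda>u. k * u + m) \<longlongrightarrow> k * t + m) (nhds t)" by (intro tendsto_intros filterlim_ident)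
  have ev: "\<forall>\<^sub>F u in nhds t. k * u + m \<in> N" by (rule topological_tendstoD[OF lim N(1,2)])
  have dv: "(snd c \<circ> (\<lambda>t. \<gamma> (k * t + m)) has_vector_derivative k *\<^sub>R vector_derivative (snd c \<circ> \<gamma>) (at (k * u + m))) (at u)"
    if "k * u + m \<in> N" for u
  proof -
    have 1: "((\<lambda>u. k * u + m) has_vector_derivative k) (at u)"
      by (auto intro!: derivative_eq_intros simp: has_real_derivative_iff_has_vector_derivative[symmetric])
    have "(snd c \<circ> \<gamma> has_vector_derivative vector_derivative (snd c \<circ> \<gamma>) (at (k * u + m))) (at (k * u + m))"
      using N(3)[OF that] by (simp add: vector_derivative_works)
    from vector_diff_chain_at[OF 1 this] show ?thesis by (simp add: o_def)
  qed
  have vd: "vector_derivative (snd c \<circ> (\<lambda>t. \<gamma> (k * t + m))) (at u) = k *\<^sub>R vector_derivative (snd c \<circ> \<gamma>) (at (k * u + m))"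
    if "k * u + m \<in> N" for u
    by (rule vector_derivative_at[OF dv[OF that]])
  show "vector_derivative (snd c \<circ> (\<lambda>t. \<gamma> (k * t + m))) (at t) = k *\<^sub>R vector_derivative (snd c \<circ> \<gamma>) (at (k * t + m))"
    by (rule vd[OF N(2)])
  have "isCont (\<lambda>u. k *\<^sub>R vector_derivative (snd c \<circ> \<gamma>) (at (k * u + m))) t"
  proof (intro continuous_intros)
    show "isCont (\<lambda>u. vector_derivative (snd c \<circ> \<gamma>) (at (k * u + m))) t"
      by (rule isCont_o2[where g="\<lambda>u. vector_derivative (snd c \<circ> \<gamma>) (at u)"])
         (use r in \<open>auto simp: creg_def intro!: continuous_intros\<close>)
  qed
  moreover have "\<forall>\<^sub>F u in nhds t. k *\<^sub>R vector_derivative (snd c \<circ> \<gamma>) (at (k * u + m)) = vector_derivative (snd c \<circ> (\<lambda>t. \<gamma> (k * t + m))) (at u)"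
    using ev by eventually_elim (simp add: vd)
  ultimately have "isCont (\<lambda>u. vector_derivative (snd c \<circ> (\<lambda>t. \<gamma> (k * t + m))) (at u)) t" by (simp add: isCont_cong)
  moreover have "\<forall>\<^sub>F u in nhds t. \<gamma> (k * u + m) \<in> fst c \<and> (snd c \<circ> (\<lambda>t. \<gamma> (k * t + m))) differentiable (at u)"
    using ev by eventually_elim (use N(3) dv differentiableI_vector in blast)
  ultimately show "creg c (\<lambda>t. \<gamma> (k * t + m)) t" unfolding creg_def by blast
qed

text \<open>The speed is multiplied by \<open>\<bar>k\<bar>\<close> and the interval is divided by
  it, so the length is preserved. Negative \<open>k\<close> reverses the curve and yields the
  symmetry of the distance.\<close>

lemma seg_affine:
  assumes s: "seg \<gamma> a b" and i: "(speed M \<gamma> has_integral L) {a..b}" and ab: "a < b" and k: "k \<noteq> 0"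
    and im: "\<And>t. k * t + m \<in> {a..b} \<longleftrightarrow> t \<in> {a2..b2}" "\<And>t. t \<in> {a2<..<b2} \<Longrightarrow> k * t + m \<in> {a<..<b}"
  shows "seg (\<lambda>t. \<gamma> (k * t + m)) a2 b2" "(speed M (\<lambda>t. \<gamma> (k * t + m)) has_integral L) {a2..b2}"
proof -
  obtain S where S: "finite S" "\<And>t. t \<in> {a<..<b} - S \<Longrightarrow> \<exists>c\<in>atlas M. creg c \<gamma> t" using seg_good[OF s] by blast
  define S2 where "S2 = (\<lambda>t. k * t + m) -` S"
  have fS2: "finite S2" unfolding S2_def by (rule finite_vimageI[OF S(1)]) (use k in \<open>auto intro: injI\<close>)
  have good: "\<exists>c\<in>atlas M. creg c \<gamma> (k * t + m)" if "t \<in> {a2<..<b2} - S2" for t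
    using S(2)[of "k * t + m"] im(2)[of t] that by (auto simp: S2_def)
  have cont: "continuous_map (top_of_set {a2..b2}) (mtop M) (\<lambda>t. \<gamma> (k * t + m))"
  proof -
    have "continuous_map (top_of_set {a2..b2}) (top_of_set {a..b}) (\<lambda>t. k * t + m)"
      using im(1) by (auto simp: continuous_map_in_subtopology intro!: continuous_intros)
    moreover have "continuous_map (top_of_set {a..b}) (mtop M) \<gamma>" using s by (simp add: seg_def)
    ultimately have "continuous_map (top_of_set {a2..b2}) (mtop M) (\<gamma> \<circ> (\<lambda>t. k * t + m))"
      by (rule continuous_map_compose)
    then show ?thesis by (simp only: o_def)
  qed
  have "{t \<in> {a2<..<b2}. \<not> (\<exists>c\<in>atlas M. creg c (\<lambda>t. \<gamma> (k * t + m)) t)} \<subseteq> S2"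
    using good creg_affine(1)[OF _ k] by blast
  then show "seg (\<lambda>t. \<gamma> (k * t + m)) a2 b2" unfolding seg_def using cont fS2 finite_subset by blast
  have sp: "speed M (\<lambda>t. \<gamma> (k * t + m)) t = \<bar>k\<bar> * speed M \<gamma> (k * t + m)" if t: "t \<in> {a2<..<b2} - S2" for t
  proof -
    obtain c where c: "c \<in> atlas M" "creg c \<gamma> (k * t + m)" using good[OF t] by blast
    have x: "snd c (\<gamma> (k * t + m)) \<in> coords c" using creg_D(1)[OF c(2)] by simp
    note bl = metric_bilinear[OF c(1) x]
    show ?thesis
      unfolding speed_eq[OF c(1) creg_affine(1)[OF c(2) k]] speed_eq[OF c] creg_affine(2)[OF c(2) k]
      by (simp add: bilinear_lmul[OF bl] bilinear_rmul[OF bl] real_sqrt_mult mult.assoc[symmetric])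
  qed
  have "((\<lambda>t. speed M \<gamma> (k *\<^sub>R t + m)) has_integral (1 / \<bar>k\<bar> ^ DIM(real)) *\<^sub>R L)
     ((\<lambda>t. (1 / k) *\<^sub>R t + - ((1 / k) *\<^sub>R m)) ` cbox a b)"
    by (rule has_integral_affinity) (use i k in auto)
  moreover have "(\<lambda>t. (1 / k) *\<^sub>R t + - ((1 / k) *\<^sub>R m)) ` cbox a b = {a2..b2}"
  proof -
    have "t \<in> (\<lambda>t. (1 / k) *\<^sub>R t + - ((1 / k) *\<^sub>R m)) ` cbox a b \<longleftrightarrow> k * t + m \<in> {a..b}" for t
    proof
      assume "k * t + m \<in> {a..b}"
      then show "t \<in> (\<lambda>t. (1 / k) *\<^sub>R t + - ((1 / k) *\<^sub>R m)) ` cbox a b"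
        using k by (intro image_eqI[of _ _ "k * t + m"]) (auto simp: field_simps)
    qed (use k in \<open>auto simp: field_simps\<close>)
    then show ?thesis using im(1) by blast
  qed
  ultimately have "((\<lambda>t. speed M \<gamma> (k * t + m)) has_integral (1 / \<bar>k\<bar>) * L) {a2..b2}" by simp
  from has_integral_mult_right[OF this, of "\<bar>k\<bar>"] k
  have 2: "((\<lambda>t. \<bar>k\<bar> * speed M \<gamma> (k * t + m)) has_integral L) {a2..b2}" by simp
  show "(speed M (\<lambda>t. \<gamma> (k * t + m)) has_integral L) {a2..b2}"
    by (rule has_integral_spike_finite[OF _ _ 2, of "S2 \<union> {a2, b2}"]) (use fS2 sp in auto)
qed

lemma conn_normalize:
  assumes "conn p q L" and b: "a2 < b2"
  shows "\<exists>\<gamma>. seg \<gamma> a2 b2 \<and> (speed M \<gamma> has_integral L) {a2..b2} \<and> \<gamma> a2 = p \<and> \<gamma> b2 = q"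
proof -
  obtain \<gamma> a b where g: "a < b" "seg \<gamma> a b" "(speed M \<gamma> has_integral L) {a..b}" "\<gamma> a = p" "\<gamma> b = q"
    using assms unfolding conn_def by blast
  define k where "k = (b - a) / (b2 - a2)"
  define m where "m = a - k * a2"
  have k: "k > 0" using g b by (simp add: k_def)
  have am: "k * a2 + m = a" by (simp add: m_def)
  have "k * (b2 - a2) = b - a" using b by (simp add: k_def)
  then have bm: "k * b2 + m = b" by (simp add: m_def algebra_simps)
  have le: "k * t + m \<ge> a \<longleftrightarrow> t \<ge> a2" "k * t + m \<le> b \<longleftrightarrow> t \<le> b2"
    and lt: "k * t + m > a \<longleftrightarrow> t > a2" "k * t + m < b \<longleftrightarrow> t < b2" for t
    using k unfolding am[symmetric] bm[symmetric] by auto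
  have k0: "k \<noteq> 0" using k by simp
  note sa = seg_affine[OF g(2,3,1) k0, of m a2 b2]
  have "seg (\<lambda>t. \<gamma> (k * t + m)) a2 b2" "(speed M (\<lambda>t. \<gamma> (k * t + m)) has_integral L) {a2..b2}"
    using sa le lt by auto
  then show ?thesis using g(4,5) am bm by (intro exI[of _ "\<lambda>t. \<gamma> (k * t + m)"]) auto
qed

lemma conn_sym: assumes "conn p q L" shows "conn q p L"
proof -
  obtain \<gamma> where g: "seg \<gamma> 0 1" "(speed M \<gamma> has_integral L) {0..1}" "\<gamma> 0 = p" "\<gamma> 1 = q"
    using conn_normalize[OF assms, of 0 1] by auto
  have "seg (\<lambda>t. \<gamma> (- 1 * t + 1)) 0 1" "(speed M (\<lambda>t. \<gamma> (- 1 * t + 1)) has_integral L) {0..1}"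
    using seg_affine[OF g(1,2), of "-1" 1 0 1] by auto
  then show ?thesis unfolding conn_def using g(3,4)
    by (intro exI[of _ "\<lambda>t. \<gamma> (- 1 * t + 1)"] exI[of _ 0] exI[of _ 1]) auto
qed

lemma creg_cong:
  assumes "\<forall>\<^sub>F u in nhds t. \<gamma> u = \<delta> u" "creg c \<gamma> t"
  shows "creg c \<delta> t" "vector_derivative (snd c \<circ> \<delta>) (at t) = vector_derivative (snd c \<circ> \<gamma>) (at t)"
proof -
  obtain N where N: "open N" "t \<in> N" "\<And>u. u \<in> N \<Longrightarrow> \<gamma> u = \<delta> u" using assms(1) unfolding eventually_nhds by blast
  have evN: "\<forall>\<^sub>F u in nhds t. u \<in> N" using N by (rule_tac eventually_nhds_in_open)
  have d: "(snd c \<circ> \<delta> has_vector_derivative v) (at u) \<longleftrightarrow> (snd c \<circ> \<gamma> has_vector_derivative v) (at u)" if "u \<in> N" for u v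
    using has_vector_derivative_transform_within_open[OF _ N(1) that, of "snd c \<circ> \<delta>" v "snd c \<circ> \<gamma>"]
      has_vector_derivative_transform_within_open[OF _ N(1) that, of "snd c \<circ> \<gamma>" v "snd c \<circ> \<delta>"] N(3) by auto
  have vd: "vector_derivative (snd c \<circ> \<delta>) (at u) = vector_derivative (snd c \<circ> \<gamma>) (at u)" if "u \<in> N" for u
    unfolding vector_derivative_def using d[OF that] by simp
  show "vector_derivative (snd c \<circ> \<delta>) (at t) = vector_derivative (snd c \<circ> \<gamma>) (at t)" by (rule vd[OF N(2)])
  have "\<forall>\<^sub>F u in nhds t. vector_derivative (snd c \<circ> \<gamma>) (at u) = vector_derivative (snd c \<circ> \<delta>) (at u)"
    using evN by eventually_elim (simp add: vd)
  then have "isCont (\<lambda>u. vector_derivative (snd c \<circ> \<delta>) (at u)) t"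
    using assms(2) by (simp add: creg_def isCont_cong)
  moreover have "\<forall>\<^sub>F u in nhds t. \<delta> u \<in> fst c \<and> (snd c \<circ> \<delta>) differentiable (at u)"
    using evN assms(2)[unfolded creg_def, THEN conjunct1]
  proof eventually_elim
    case (elim u)
    then show ?case using N(3) d vector_derivative_works[of "snd c \<circ> \<gamma>" "at u"] differentiableI_vector by metis
  qed
  ultimately show "creg c \<delta> t" unfolding creg_def by blast
qed

lemma conn_trans:
  assumes "conn p q L1" "conn q r L2" shows "conn p r (L1 + L2)"
proof -
  obtain \<gamma> where g: "seg \<gamma> 0 1" "(speed M \<gamma> has_integral L1) {0..1}" "\<gamma> 0 = p" "\<gamma> 1 = q"
    using conn_normalize[OF assms(1), of 0 1] by auto
  obtain \<delta> where d: "seg \<delta> 1 2" "(speed M \<delta> has_integral L2) {1..2}" "\<delta> 1 = q" "\<delta> 2 = r"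
    using conn_normalize[OF assms(2), of 1 2] by auto
  define \<eta> where "\<eta> t = (if t \<le> 1 then \<gamma> t else \<delta> t)" for t :: real
  obtain S where S: "finite S" "\<And>t. t \<in> {0<..<1} - S \<Longrightarrow> \<exists>c\<in>atlas M. creg c \<gamma> t" using seg_good[OF g(1)] by blast
  obtain S' where S': "finite S'" "\<And>t. t \<in> {1<..<2} - S' \<Longrightarrow> \<exists>c\<in>atlas M. creg c \<delta> t" using seg_good[OF d(1)] by blast
  have e1: "\<forall>\<^sub>F u in nhds t. \<gamma> u = \<eta> u" if "t < 1" for t
  proof -
    have "\<forall>\<^sub>F u in nhds t. u \<in> {..<1}" by (rule eventually_nhds_in_open) (use that in auto)
    then show ?thesis by eventually_elim (auto simp: \<eta>_def)
  qed
  have e2: "\<forall>\<^sub>F u in nhds t. \<delta> u = \<eta> u" if "t > 1" for t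
  proof -
    have "\<forall>\<^sub>F u in nhds t. u \<in> {1<..}" by (rule eventually_nhds_in_open) (use that in auto)
    then show ?thesis by eventually_elim (auto simp: \<eta>_def)
  qed
  have sp: "speed M \<eta> t = speed M \<gamma> t" "\<exists>c\<in>atlas M. creg c \<eta> t" if t: "t \<in> {0<..<1} - S" for t
  proof -
    obtain c where c: "c \<in> atlas M" "creg c \<gamma> t" using S(2)[OF t] by blast
    have t1: "t < 1" using t by simp
    note cc = creg_cong[OF e1[OF t1] c(2)]
    have et: "\<eta> t = \<gamma> t" using t by (simp add: \<eta>_def)
    show "speed M \<eta> t = speed M \<gamma> t" unfolding speed_eq[OF c(1) cc(1)] speed_eq[OF c] cc(2) et ..
    show "\<exists>c\<in>atlas M. creg c \<eta> t" using cc(1) c(1) by blast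
  qed
  have sp': "speed M \<eta> t = speed M \<delta> t" "\<exists>c\<in>atlas M. creg c \<eta> t" if t: "t \<in> {1<..<2} - S'" for t
  proof -
    obtain c where c: "c \<in> atlas M" "creg c \<delta> t" using S'(2)[OF t] by blast
    have t1: "t > 1" using t by simp
    note cc = creg_cong[OF e2[OF t1] c(2)]
    have et: "\<eta> t = \<delta> t" using t by (simp add: \<eta>_def)
    show "speed M \<eta> t = speed M \<delta> t" unfolding speed_eq[OF c(1) cc(1)] speed_eq[OF c] cc(2) et ..
    show "\<exists>c\<in>atlas M. creg c \<eta> t" using cc(1) c(1) by blast
  qed
  have i1: "(speed M \<eta> has_integral L1) {0..1}"
    by (rule has_integral_spike_finite[OF _ _ g(2), of "S \<union> {0,1}"]) (use S sp in auto)
  have i2: "(speed M \<eta> has_integral L2) {1..2}"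
    by (rule has_integral_spike_finite[OF _ _ d(2), of "S' \<union> {1,2}"]) (use S' sp' in auto)
  have i: "(speed M \<eta> has_integral (L1 + L2)) {0..2}"
    by (rule has_integral_combine[OF _ _ i1 i2]) auto
  have "continuous_map (top_of_set {0..2}) (mtop M) \<eta>"
    unfolding \<eta>_def
  proof (rule continuous_map_cases_le)
    show "continuous_map (subtopology (top_of_set {0..2}) {x \<in> topspace (top_of_set {0..2}). x \<le> 1}) (mtop M) \<gamma>"
      using g(1) unfolding seg_def subtopology_subtopology
      by (auto elim!: continuous_map_from_subtopology_mono)
    show "continuous_map (subtopology (top_of_set {0..2}) {x \<in> topspace (top_of_set {0..2}). 1 \<le> x}) (mtop M) \<delta>"
      using d(1) unfolding seg_def subtopology_subtopology
      by (auto elim!: continuous_map_from_subtopology_mono)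
  qed (use g d in \<open>auto intro!: continuous_map_from_subtopology\<close>)
  moreover have "{t \<in> {0<..<2}. \<not> (\<exists>c\<in>atlas M. creg c \<eta> t)} \<subseteq> S \<union> S' \<union> {1}"
    using sp(2) sp'(2) by (auto simp: not_less) (metis DiffI greaterThanLessThan_iff less_eq_real_def not_le)
  ultimately have "seg \<eta> 0 2" unfolding seg_def using S(1) S'(1) by (meson finite.emptyI finite.insertI finite_UnI finite_subset)
  then show ?thesis unfolding conn_def using i g(3) d(4)
    by (intro exI[of _ \<eta>] exI[of _ 0] exI[of _ 2]) (auto simp: \<eta>_def)
qed

lemma speed_nonneg_good:
  assumes "c \<in> atlas M" "creg c \<gamma> t" shows "speed M \<gamma> t \<ge> 0"
proof -
  have "snd c (\<gamma> t) \<in> coords c" using creg_D(1)[OF assms(2)] by simp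
  then have "riem_metric M c (snd c (\<gamma> t)) u u \<ge> 0" for u
    using metric_pos[OF assms(1)] bilinear_lzero[OF metric_bilinear[OF assms(1)]]
    by (cases "u = 0") (auto intro: less_imp_le)
  then show ?thesis unfolding speed_eq[OF assms] by simp
qed

text \<open>At an exceptional time the derivative inside \<open>speed\<close> need not exist, so no
  sign is claimed there. Putting 0 at finitely many times leaves integrals unchanged and makes their
  monotonicity applicable.\<close>

lemma good_speed_nonneg:
  assumes S: "\<And>t. t \<in> {a<..<b} - S \<Longrightarrow> \<exists>c\<in>atlas M. creg c \<gamma> t" and t: "t \<in> {a..b}"
  shows "0 \<le> (if t \<in> S \<union> {a, b} then 0 else speed M \<gamma> t)"
proof (cases "t \<in> S \<union> {a, b}")
  case False
  then have "t \<in> {a<..<b} - S" using t by auto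
  from S[OF this] obtain c where "c \<in> atlas M" "creg c \<gamma> t" by blast
  then show ?thesis using speed_nonneg_good False by simp
qed simp

lemma seg_length_nonneg:
  assumes s: "seg \<gamma> a b" and i: "(speed M \<gamma> has_integral L) {a..b}" shows "L \<ge> 0"
proof -
  obtain S where S: "finite S" "\<And>t. t \<in> {a<..<b} - S \<Longrightarrow> \<exists>c\<in>atlas M. creg c \<gamma> t" using seg_good[OF s] by blast
  have "((\<lambda>t. if t \<in> S \<union> {a, b} then 0 else speed M \<gamma> t) has_integral L) {a..b}"
    by (rule has_integral_spike_finite[OF _ _ i, of "S \<union> {a, b}"]) (use S in auto)
  then show ?thesis
    by (rule has_integral_nonneg) (rule good_speed_nonneg[OF S(2)])
qed

lemma conn_nonneg: "conn p q L \<Longrightarrow> L \<ge> 0"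
  unfolding conn_def by (elim exE conjE) (rule seg_length_nonneg)

lemma seg_restrict:
  assumes s: "seg \<gamma> a b" and i: "(speed M \<gamma> has_integral L) {a..b}" and ab: "a \<le> a'" "b' \<le> b"
  shows "seg \<gamma> a' b'" "(speed M \<gamma> has_integral integral {a'..b'} (speed M \<gamma>)) {a'..b'}"
    "integral {a'..b'} (speed M \<gamma>) \<le> L"
proof -
  have sub: "{a'..b'} \<subseteq> {a..b}" using ab by auto
  have "{t \<in> {a'<..<b'}. \<not> (\<exists>c\<in>atlas M. creg c \<gamma> t)} \<subseteq> {t \<in> {a<..<b}. \<not> (\<exists>c\<in>atlas M. creg c \<gamma> t)}" using ab by auto
  then show "seg \<gamma> a' b'" using s unfolding seg_def
    using continuous_map_from_subtopology_mono[OF _ sub] finite_subset by blast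
  have int: "speed M \<gamma> integrable_on {a..b}" using i by blast
  then have int': "speed M \<gamma> integrable_on {a'..b'}" using sub by (rule integrable_on_subinterval)
  then show "(speed M \<gamma> has_integral integral {a'..b'} (speed M \<gamma>)) {a'..b'}" by (rule integrable_integral)
  obtain S where S: "finite S" "\<And>t. t \<in> {a<..<b} - S \<Longrightarrow> \<exists>c\<in>atlas M. creg c \<gamma> t" using seg_good[OF s] by blast
  let ?f = "\<lambda>t. if t \<in> S \<union> {a, b} then 0 else speed M \<gamma> t"
  have f: "(?f has_integral L) {a..b}"
    by (rule has_integral_spike_finite[OF _ _ i, of "S \<union> {a, b}"]) (use S in auto)
  have fe: "integral {a'..b'} ?f = integral {a'..b'} (speed M \<gamma>)"
    by (rule integral_spike[of "S \<union> {a, b}"]) (use S in \<open>auto intro: negligible_finite\<close>)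
  have "integral {a'..b'} ?f \<le> integral {a..b} ?f"
  proof (rule integral_subset_le[OF sub])
    show "?f integrable_on {a..b}" using f by blast
    then show "?f integrable_on {a'..b'}" using sub by (rule integrable_on_subinterval)
    show "\<forall>t\<in>{a..b}. 0 \<le> ?f t" by (intro ballI good_speed_nonneg[OF S(2)])
  qed
  then show "integral {a'..b'} (speed M \<gamma>) \<le> L" using fe f by (simp add: integral_unique)
qed

text \<open>Arc length is a continuous function of the parameter, so the intermediate value theorem
  finds the point where the prescribed length is used up. This is the source of
  \<open>length_space\<close>.\<close>

lemma conn_split:
  assumes "conn p q L" "0 < t" "t < L"
  shows "\<exists>m. conn p m t \<and> conn m q (L - t)"
proof -
  obtain \<gamma> where g: "seg \<gamma> 0 1" "(speed M \<gamma> has_integral L) {0..1}" "\<gamma> 0 = p" "\<gamma> 1 = q"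
    using conn_normalize[OF assms(1), of 0 1] by auto
  let ?I = "\<lambda>x. integral {0..x} (speed M \<gamma>)"
  have int: "speed M \<gamma> integrable_on {0..1}" using g(2) by blast
  have "continuous_on {0..1} ?I" by (rule indefinite_integral_continuous_1[OF int])
  moreover have "?I 0 \<le> t" "t \<le> ?I 1" using assms(2,3) g(2) by (auto simp: integral_unique)
  ultimately obtain x where x: "0 \<le> x" "x \<le> 1" "?I x = t" using IVT'[of ?I 0 t 1] by auto
  have "x \<noteq> 0" using x assms(2) by auto
  have "x \<noteq> 1" using x assms(3) g(2) by (auto simp: integral_unique)
  have 1: "conn p (\<gamma> x) t"
    unfolding conn_def using seg_restrict(1,2)[OF g(1,2), of 0 x] x \<open>x \<noteq> 0\<close> g
    by (intro exI[of _ \<gamma>] exI[of _ 0] exI[of _ x]) auto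
  have "?I x + integral {x..1} (speed M \<gamma>) = integral {0..1} (speed M \<gamma>)"
    using x int by (intro Henstock_Kurzweil_Integration.integral_combine) auto
  then have "integral {x..1} (speed M \<gamma>) = L - t" using x g(2) by (simp add: integral_unique)
  then have 2: "conn (\<gamma> x) q (L - t)"
    unfolding conn_def using seg_restrict(1,2)[OF g(1,2), of x 1] x \<open>x \<noteq> 1\<close> g
    by (intro exI[of _ \<gamma>] exI[of _ x] exI[of _ 1]) auto
  show ?thesis using 1 2 by blast
qed

end

section \<open>Hopf-Rinow\<close>

context Metric_space
begin

lemma compactin_closed_subset:
  assumes "compactin mtopology K" "closedin mtopology C" "C \<subseteq> K" shows "compactin mtopology C"
  using closed_compactin[OF assms(1,3,2)] .

text \<open>Hopf-Rinow in metric form, for complete and locally compact length spaces. Let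
  \<open>s\<close> be the supremum of the radii with compact balls. Points of the ball of radius
  \<open>s\<close> are close to a slightly smaller ball, so it is totally bounded and hence compact;
  a finite cover by compact balls then reaches beyond \<open>s\<close>.\<close>

lemma hopf_rinow:
  assumes len: "\<And>p q e t. p \<in> M \<Longrightarrow> q \<in> M \<Longrightarrow> e > 0 \<Longrightarrow> 0 < t \<Longrightarrow> t < d p q \<Longrightarrow> \<exists>m\<in>M. d p m \<le> t \<and> d m q \<le> d p q - t + e"
    and loc: "\<And>p. p \<in> M \<Longrightarrow> \<exists>r>0. compactin mtopology (mcball p r)"
    and compl: "mcomplete" and z: "z \<in> M"
  shows "compactin mtopology (mcball z R)"
proof (rule ccontr)
  assume nR: "\<not> compactin mtopology (mcball z R)"
  define A where "A = {r. compactin mtopology (mcball z r)}"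
  have down: "r' \<in> A" if "r \<in> A" "r' \<le> r" for r r'
    using that compactin_closed_subset[OF _ closedin_mcball mcball_subset_concentric] unfolding A_def by blast
  have bd: "r < R" if "r \<in> A" for r using nR down[OF that, of R] by (force simp: A_def)
  then have bdd: "bdd_above A" by (meson bdd_aboveI less_imp_le)
  obtain r0 where r0: "r0 > 0" "r0 \<in> A" using loc[OF z] by (auto simp: A_def)
  define s where "s = Sup A"
  have s0: "s > 0" using cSup_upper[OF r0(2) bdd] r0(1) by (simp add: s_def)
  have lt: "r \<in> A" if "r < s" for r
    using less_cSupD[of A r] that r0 down unfolding s_def by (metis empty_iff less_imp_le)
  have sub: "mcball z s \<subseteq> M" by (rule mcball_subset_mspace)
  have tb: "mtotally_bounded (mcball z s)"
    unfolding mtotally_bounded_def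
  proof (intro allI impI)
    fix e :: real assume e: "e > 0"
    \<comment> \<open>The shell outside radius \<open>r\<close> has width at most
      \<open>e / 3\<close>. With the error \<open>e / 6\<close> of the length property and a net of
      mesh \<open>e / 3\<close> the total stays below \<open>e\<close>; \<open>s / 2\<close> keeps
      \<open>r\<close> positive.\<close>
    define r where "r = max (s / 2) (s - e / 3)"
    have "s - e / 3 \<le> r" by (simp add: r_def)
    then have "s - r \<le> e / 3" by linarith
    moreover have "r > 0" "r < s" using s0 e by (auto simp: r_def less_max_iff_disj)
    ultimately have r: "r > 0" "r < s" "s - r \<le> e / 3" by blast+
    have "mtotally_bounded (mcball z r)" using lt[OF r(2)] by (auto simp: A_def intro: compactin_imp_mtotally_bounded)
    then obtain K where K: "finite K" "K \<subseteq> mcball z r" "mcball z r \<subseteq> (\<Union>x\<in>K. mball x (e/3))"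
      unfolding mtotally_bounded_def using e by (meson divide_pos_pos zero_less_numeral)
    have "x \<in> (\<Union>x\<in>K. mball x e)" if x: "x \<in> mcball z s" for x
    proof -
      have xM: "x \<in> M" "d z x \<le> s" using x by auto
      obtain m where m: "m \<in> mcball z r" "d m x \<le> e / 2"
      proof (cases "d z x \<le> r")
        case True then show thesis using that[of x] xM z e by simp
      next
        case False
        have "e / 6 > 0" "r < d z x" using e False by auto
        from len[OF z xM(1) this(1) r(1) this(2)] obtain m where "m \<in> M" "d z m \<le> r" "d m x \<le> d z x - r + e / 6" by blast
        then show thesis using that[of m] z xM r(3) by simp
      qed
      obtain k where k: "k \<in> K" "m \<in> mball k (e/3)" using K(3) m(1) by blast
      have "d k x \<le> d k m + d m x" using k xM by (intro triangle) auto
      also have "\<dots> < e" using k m e by simp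
      finally have "x \<in> mball k e" using k xM by simp
      then show ?thesis using k by blast
    qed
    moreover have "K \<subseteq> mcball z s" using K(2) mcball_subset_concentric[of r s z] r(2) by simp
    ultimately show "\<exists>K. finite K \<and> K \<subseteq> mcball z s \<and> mcball z s \<subseteq> (\<Union>x\<in>K. mball x e)"
      using K(1) by blast
  qed
  have cs: "compactin mtopology (mcball z s)"
    using mtotally_bounded_eq_compact_closure_of[OF compl, of "mcball z s"] tb closure_of_closedin[OF closedin_mcball] by simp
  have "\<forall>p\<in>mcball z s. \<exists>r>0. compactin mtopology (mcball p r)" using loc sub by blast
  from bchoice[OF this] obtain \<rho> where \<rho>: "\<forall>p\<in>mcball z s. \<rho> p > 0 \<and> compactin mtopology (mcball p (\<rho> p))" ..
  have op: "openin mtopology (mball p (\<rho> p / 2))" for p by simp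
  have cov: "mcball z s \<subseteq> \<Union> ((\<lambda>p. mball p (\<rho> p / 2)) ` mcball z s)"
  proof
    fix p assume p: "p \<in> mcball z s"
    then have "p \<in> mball p (\<rho> p / 2)" using \<rho> by simp
    then show "p \<in> \<Union> ((\<lambda>p. mball p (\<rho> p / 2)) ` mcball z s)" using p by blast
  qed
  obtain \<F> where F: "finite \<F>" "\<F> \<subseteq> (\<lambda>p. mball p (\<rho> p / 2)) ` mcball z s" "mcball z s \<subseteq> \<Union> \<F>"
    using compactinD[OF cs _ cov] op by auto
  obtain P where P: "finite P" "P \<subseteq> mcball z s" "\<F> = (\<lambda>p. mball p (\<rho> p / 2)) ` P"
    using finite_subset_image[OF F(1,2)] by blast
  have "z \<in> mcball z s" using z s0 by simp
  then have Pne: "P \<noteq> {}" using F(3) P(3) by blast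
  define \<delta> where "\<delta> = Min ((\<lambda>p. \<rho> p / 2) ` P)"
  have \<delta>: "\<delta> > 0" "\<And>p. p \<in> P \<Longrightarrow> \<delta> \<le> \<rho> p / 2"
  proof -
    have fin: "finite ((\<lambda>p. \<rho> p / 2) ` P)" using P(1) by simp
    have "\<rho> p / 2 > 0" if "p \<in> P" for p using \<rho> P(2) that by auto
    then show "\<delta> > 0" unfolding \<delta>_def using fin Pne by (subst Min_gr_iff) auto
    show "\<delta> \<le> \<rho> p / 2" if "p \<in> P" for p unfolding \<delta>_def using fin that by (intro Min_le) auto
  qed
  have "mcball z (s + \<delta> / 2) \<subseteq> (\<Union>p\<in>P. mcball p (\<rho> p))"
  proof
    fix x assume "x \<in> mcball z (s + \<delta> / 2)"
    then have x: "x \<in> M" "d z x \<le> s + \<delta> / 2" by auto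
    obtain m where m: "m \<in> mcball z s" "d m x \<le> \<delta>"
    proof (cases "d z x \<le> s")
      case True then show thesis using that[of x] x z \<delta> by simp
    next
      case False
      have "\<delta> / 2 > 0" "s < d z x" using \<delta> False by auto
      from len[OF z x(1) this(1) s0 this(2)] obtain m where "m \<in> M" "d z m \<le> s" "d m x \<le> d z x - s + \<delta> / 2" by blast
      then show thesis using that[of m] z x by simp
    qed
    obtain p where p: "p \<in> P" "m \<in> mball p (\<rho> p / 2)" using F(3) P(3) m(1) by blast
    have "d p x \<le> d p m + d m x" using p x by (intro triangle) auto
    also have "\<dots> \<le> \<rho> p" using p m \<delta>(2)[OF p(1)] by simp
    finally have "x \<in> mcball p (\<rho> p)" using p x by simp
    then show "x \<in> (\<Union>p\<in>P. mcball p (\<rho> p))" using p by blast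
  qed
  moreover have "compactin mtopology (\<Union>p\<in>P. mcball p (\<rho> p))"
    using P \<rho> by (intro compactin_Union) auto
  ultimately have "s + \<delta> / 2 \<in> A" unfolding A_def by (auto intro: compactin_closed_subset)
  then show False using cSup_upper[OF _ bdd, of "s + \<delta> / 2"] \<delta>(1) by (simp add: s_def)
qed

lemma d_limit:
  assumes "limitin mtopology \<sigma> l sequentially" "\<And>n. \<sigma> n \<in> M" "q \<in> M"
  shows "(\<lambda>n. d (\<sigma> n) q) \<longlonglongrightarrow> d l q"
proof (rule LIM_zero_cancel, rule Lim_null_comparison)
  have l: "l \<in> M" "(\<lambda>n. d (\<sigma> n) l) \<longlonglongrightarrow> 0" using assms(1) by (auto simp: limitin_metric_dist_null)
  show "(\<lambda>n. d (\<sigma> n) l) \<longlonglongrightarrow> 0" by (rule l(2))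
  show "\<forall>\<^sub>F n in sequentially. norm (d (\<sigma> n) q - d l q) \<le> d (\<sigma> n) l"
    using mdist_reverse_triangle[OF assms(2,3) l(1)] commute[of q l] by (intro always_eventually allI) simp
qed

text \<open>Approximate intermediate points lie in a compact ball, and a limit of them satisfies
  both estimates without error. The triangle inequality turns the estimates into equalities.\<close>

lemma between_point:
  assumes len: "\<And>p q e t. p \<in> M \<Longrightarrow> q \<in> M \<Longrightarrow> e > 0 \<Longrightarrow> 0 < t \<Longrightarrow> t < d p q \<Longrightarrow> \<exists>m\<in>M. d p m \<le> t \<and> d m q \<le> d p q - t + e"
    and z: "z \<in> M" "q \<in> M" and t: "0 < t" "t < d z q" and c: "compactin mtopology (mcball z t)"
  shows "\<exists>m\<in>M. d z m = t \<and> d m q = d z q - t"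
proof -
  have "\<exists>m\<in>M. d z m \<le> t \<and> d m q \<le> d z q - t + 1 / Suc n" for n
    using len[OF z _ t, of "1 / Suc n"] by simp
  then obtain m where m: "\<And>n. m n \<in> M" "\<And>n. d z (m n) \<le> t" "\<And>n. d (m n) q \<le> d z q - t + 1 / Suc n" by metis
  have "range m \<subseteq> mcball z t" using m z by auto
  then obtain l r where l: "l \<in> mcball z t" "strict_mono r" "limitin mtopology (m \<circ> r) l sequentially"
    using c unfolding compactin_sequentially by blast
  have lim: "(\<lambda>n. d ((m \<circ> r) n) q) \<longlonglongrightarrow> d l q" by (rule d_limit[OF l(3)]) (use m z in auto)
  have lim2: "(\<lambda>n. d z q - t + 1 / Suc (r n)) \<longlonglongrightarrow> d z q - t + 0"
    by (intro tendsto_intros LIMSEQ_subseq_LIMSEQ[OF LIMSEQ_Suc[OF lim_const_over_n[of 1]] l(2), unfolded o_def, simplified])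
       (use LIMSEQ_subseq_LIMSEQ[OF LIMSEQ_Suc[OF lim_const_over_n[of "1::real"]] l(2)] in \<open>simp add: o_def\<close>)
  have "d l q \<le> d z q - t + 0"
    by (rule LIMSEQ_le[OF lim lim2]) (use m(3) in auto)
  moreover have "d z l \<le> t" "l \<in> M" using l(1) by auto
  moreover have "d z q \<le> d z l + d l q" using z l(1) by (intro triangle) auto
  ultimately show ?thesis by (intro bexI[of _ l]) auto
qed

end

section \<open>Distance and coordinates\<close>

lemma pos_def_bounds:
  fixes h :: "'e::euclidean_space \<Rightarrow> 'e \<Rightarrow> 'e \<Rightarrow> real"
  assumes C: "compact C" "C \<noteq> {}" and bil: "\<And>x. x \<in> C \<Longrightarrow> bilinear (h x)"
    and cont: "\<And>u v. continuous_on C (\<lambda>x. h x u v)" and pos: "\<And>x u. x \<in> C \<Longrightarrow> u \<noteq> 0 \<Longrightarrow> h x u u > 0"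
  shows "\<exists>K>0. \<forall>x\<in>C. \<forall>w. norm w \<le> K * sqrt (h x w w) \<and> sqrt (h x w w) \<le> K * norm w"
proof -
  let ?S = "sphere (0::'e) 1"
  have cS: "compact (C \<times> ?S)" "C \<times> ?S \<noteq> {}" using C by (auto simp: compact_Times)
  have co: "continuous_on (C \<times> ?S) (\<lambda>z. h (fst z) (snd z) (snd z))"
    by (rule continuous_on_bilinear_family[where h="\<lambda>z. h (fst z)"])
       (use bil in \<open>auto intro!: continuous_intros continuous_on_compose2[OF cont continuous_on_fst[OF continuous_on_id]]\<close>)
  obtain a where a: "a \<in> C \<times> ?S" "\<And>z. z \<in> C \<times> ?S \<Longrightarrow> h (fst a) (snd a) (snd a) \<le> h (fst z) (snd z) (snd z)"
    using continuous_attains_inf[OF cS co] by blast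
  obtain b where b: "b \<in> C \<times> ?S" "\<And>z. z \<in> C \<times> ?S \<Longrightarrow> h (fst z) (snd z) (snd z) \<le> h (fst b) (snd b) (snd b)"
    using continuous_attains_sup[OF cS co] by blast
  define m1 where "m1 = h (fst a) (snd a) (snd a)"
  define m2 where "m2 = h (fst b) (snd b) (snd b)"
  have "fst a \<in> C" "fst b \<in> C" "norm (snd a) = 1" "norm (snd b) = 1" using a(1) b(1) by auto
  moreover from this have "snd a \<noteq> 0" "snd b \<noteq> 0" by force+
  ultimately have m: "m1 > 0" "m2 > 0"
    using pos[of "fst a" "snd a"] pos[of "fst b" "snd b"] unfolding m1_def m2_def by blast+
  have hom: "m1 * (norm w)\<^sup>2 \<le> h x w w \<and> h x w w \<le> m2 * (norm w)\<^sup>2" if x: "x \<in> C" for x w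
  proof (cases "w = 0")
    case True then show ?thesis using bilinear_lzero[OF bil[OF x]] by simp
  next
    case False
    have mem: "(x, w /\<^sub>R norm w) \<in> C \<times> ?S" using x False by simp
    have "h x (w /\<^sub>R norm w) (w /\<^sub>R norm w) = h x w w / (norm w)\<^sup>2"
      by (simp add: bilinear_lmul[OF bil[OF x]] bilinear_rmul[OF bil[OF x]] power2_eq_square divide_simps)
    then have "m1 \<le> h x w w / (norm w)\<^sup>2" "h x w w / (norm w)\<^sup>2 \<le> m2"
      using a(2)[OF mem] b(2)[OF mem] unfolding m1_def[symmetric] m2_def[symmetric] by (simp_all only: fst_conv snd_conv)
    then show ?thesis using False by (simp add: pos_le_divide_eq pos_divide_le_eq)
  qed
  define K where "K = max (1 / sqrt m1) (sqrt m2)"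
  have K: "K > 0" "1 / sqrt m1 \<le> K" "sqrt m2 \<le> K" using m by (auto simp: K_def less_max_iff_disj)
  have "norm w \<le> K * sqrt (h x w w) \<and> sqrt (h x w w) \<le> K * norm w" if x: "x \<in> C" for x w
  proof
    have "sqrt m1 * norm w \<le> sqrt (h x w w)"
      using real_sqrt_le_mono[OF conjunct1[OF hom[OF x, of w]]] by (simp add: real_sqrt_mult)
    then have 1: "norm w \<le> (1 / sqrt m1) * sqrt (h x w w)" using m by (simp add: divide_simps mult.commute)
    have "h x w w \<ge> 0" using hom[OF x, of w] m by (meson mult_nonneg_nonneg order_trans less_imp_le zero_le_power2)
    then have "(1 / sqrt m1) * sqrt (h x w w) \<le> K * sqrt (h x w w)" using K by (intro mult_right_mono) auto
    then show "norm w \<le> K * sqrt (h x w w)" using 1 by linarith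
    have "sqrt (h x w w) \<le> sqrt m2 * norm w"
      using real_sqrt_le_mono[OF conjunct2[OF hom[OF x, of w]]] by (simp add: real_sqrt_mult)
    also have "\<dots> \<le> K * norm w" using K by (intro mult_right_mono) auto
    finally show "sqrt (h x w w) \<le> K * norm w" .
  qed
  then show ?thesis using K by blast
qed

lemma line_mem_segment:
  fixes x z :: "'e::real_vector"
  assumes "t \<in> {0..1::real}" shows "x + t *\<^sub>R (z - x) \<in> closed_segment x z"
proof -
  have "x + t *\<^sub>R (z - x) = (1 - t) *\<^sub>R x + t *\<^sub>R z" by (simp add: algebra_simps)
  then show ?thesis unfolding closed_segment_def mem_Collect_eq
    by (intro exI[of _ t]) (use assms in simp)
qed

context riemannian_manifold
begin

lemma rm_continuous_on:
  assumes c: "c \<in> atlas M" and "continuous_on S f" "continuous_on S v" "continuous_on S w" "f ` S \<subseteq> coords c"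
  shows "continuous_on S (\<lambda>s. rm c (f s) (v s) (w s))"
proof (rule continuous_on_bilinear_family[where h="\<lambda>s. rm c (f s)", OF _ _ assms(3,4)])
  show "bilinear (rm c (f s))" if "s \<in> S" for s using metric_bilinear[OF c] assms(5) that by blast
  show "continuous_on S (\<lambda>s. rm c (f s) u v)" for u v
    using continuous_on_compose2[OF smooth_on_continuous[OF metric_smooth[OF c]] assms(2,5)] .
qed

lemma rm_nonneg: "c \<in> atlas M \<Longrightarrow> x \<in> coords c \<Longrightarrow> rm c x u u \<ge> 0"
  using metric_pos[of c x u] bilinear_lzero[OF metric_bilinear[of c x], of u] by (cases "u = 0") (simp_all add: less_imp_le)

lemma creg_chart:
  assumes c: "c \<in> atlas M" and y: "\<forall>\<^sub>F u in nhds t. y u \<in> coords c \<and> y differentiable (at u)"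
    and co: "isCont (\<lambda>u. vector_derivative y (at u)) t"
  shows "creg c (\<lambda>u. ci c (y u)) t"
    "vector_derivative (snd c \<circ> (\<lambda>u. ci c (y u))) (at t) = vector_derivative y (at t)"
proof -
  obtain N where N: "open N" "t \<in> N" "\<And>u. u \<in> N \<Longrightarrow> y u \<in> coords c \<and> y differentiable (at u)"
    using y unfolding eventually_nhds by blast
  have evN: "\<forall>\<^sub>F u in nhds t. u \<in> N" using N by (rule_tac eventually_nhds_in_open)
  let ?z = "snd c \<circ> (\<lambda>u. ci c (y u))"
  have eq: "y u = ?z u" if "u \<in> N" for u using snd_ci[of "y u" c] N(3)[OF that] by simp
  have d: "(?z has_vector_derivative vector_derivative y (at u)) (at u)" if u: "u \<in> N" for u
    by (rule has_vector_derivative_transform_within_open[OF _ N(1) u eq])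
       (use N(3)[OF u] vector_derivative_works in blast)
  have vd: "vector_derivative ?z (at u) = vector_derivative y (at u)" if "u \<in> N" for u
    by (rule vector_derivative_at[OF d[OF that]])
  show "vector_derivative ?z (at t) = vector_derivative y (at t)" by (rule vd[OF N(2)])
  have "\<forall>\<^sub>F u in nhds t. vector_derivative y (at u) = vector_derivative ?z (at u)"
    using evN by eventually_elim (simp add: vd)
  then have "isCont (\<lambda>u. vector_derivative ?z (at u)) t" using co by (simp add: isCont_cong)
  moreover have "\<forall>\<^sub>F u in nhds t. ci c (y u) \<in> fst c \<and> ?z differentiable (at u)"
    using evN
  proof eventually_elim
    case (elim u)
    then show ?case using ci_in[of "y u" c] N(3)[OF elim] differentiableI_vector[OF d[OF elim]] by blast
  qed
  ultimately show "creg c (\<lambda>u. ci c (y u)) t" unfolding creg_def by blast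
qed

lemma chart_curve:
  assumes c: "c \<in> atlas M" and co: "continuous_on {a..b} y" and im: "y ` {a..b} \<subseteq> coords c" and S: "finite S"
    and good: "\<And>t. t \<in> {a<..<b} - S \<Longrightarrow> (\<forall>\<^sub>F u in nhds t. y differentiable (at u)) \<and> isCont (\<lambda>u. vector_derivative y (at u)) t"
  shows "seg (\<lambda>u. ci c (y u)) a b"
    "\<And>t. t \<in> {a<..<b} - S \<Longrightarrow> speed M (\<lambda>u. ci c (y u)) t
        = sqrt (rm c (y t) (vector_derivative y (at t)) (vector_derivative y (at t)))"
proof -
  have r: "creg c (\<lambda>u. ci c (y u)) t"
    "vector_derivative (snd c \<circ> (\<lambda>u. ci c (y u))) (at t) = vector_derivative y (at t)" if t: "t \<in> {a<..<b} - S" for t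
  proof -
    have "\<forall>\<^sub>F u in nhds t. u \<in> {a<..<b}" using t by (intro eventually_nhds_in_open) auto
    then have "\<forall>\<^sub>F u in nhds t. y u \<in> coords c \<and> y differentiable (at u)"
      using good[OF t, THEN conjunct1] by eventually_elim (use im in auto)
    from creg_chart[OF c this good[OF t, THEN conjunct2]]
    show "creg c (\<lambda>u. ci c (y u)) t"
      "vector_derivative (snd c \<circ> (\<lambda>u. ci c (y u))) (at t) = vector_derivative y (at t)" by auto
  qed
  have "continuous_map (top_of_set {a..b}) (top_of_set (coords c)) y"
    using co im by (auto simp: continuous_map_in_subtopology)
  from continuous_map_compose[OF this continuous_ci[OF c]]
  have 1: "continuous_map (top_of_set {a..b}) (mtop M) (\<lambda>u. ci c (y u))" by (simp only: o_def)
  have "{t \<in> {a<..<b}. \<not> (\<exists>c'\<in>atlas M. creg c' (\<lambda>u. ci c (y u)) t)} \<subseteq> S"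
  proof
    fix t assume t: "t \<in> {t \<in> {a<..<b}. \<not> (\<exists>c'\<in>atlas M. creg c' (\<lambda>u. ci c (y u)) t)}"
    show "t \<in> S"
    proof (rule ccontr)
      assume "t \<notin> S"
      then have "creg c (\<lambda>u. ci c (y u)) t" using t by (intro r(1)) simp
      then show False using t c by blast
    qed
  qed
  from finite_subset[OF this S] show "seg (\<lambda>u. ci c (y u)) a b" unfolding seg_def using 1 by (intro conjI)
  fix t assume t: "t \<in> {a<..<b} - S"
  have "y t \<in> coords c" using im t by auto
  then have "snd c (ci c (y t)) = y t" by (rule snd_ci)
  then show "speed M (\<lambda>u. ci c (y u)) t = sqrt (rm c (y t) (vector_derivative y (at t)) (vector_derivative y (at t)))"
    unfolding speed_eq[OF c r(1)[OF t]] r(2)[OF t] by simp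
qed

lemma conn_line:
  assumes c: "c \<in> atlas M" and sub: "closed_segment x z \<subseteq> coords c"
  shows "conn (ci c x) (ci c z) (integral {0..1} (\<lambda>t. sqrt (rm c (x + t *\<^sub>R (z - x)) (z - x) (z - x))))"
proof -
  let ?y = "\<lambda>t::real. x + t *\<^sub>R (z - x)"
  have d: "(?y has_vector_derivative z - x) (at u)" for u by (auto intro!: derivative_eq_intros)
  have vd: "vector_derivative ?y (at u) = z - x" for u by (rule vector_derivative_at[OF d])
  have mem: "?y t \<in> coords c" if "t \<in> {0..1}" for t
    using sub line_mem_segment[OF that] by blast
  have co: "continuous_on {0..1} ?y" by (intro continuous_intros)
  have good: "(\<forall>\<^sub>F u in nhds t. ?y differentiable (at u)) \<and> isCont (\<lambda>u. vector_derivative ?y (at u)) t" for t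
    unfolding vd using differentiableI_vector[OF d] by simp
  have im: "?y ` {0..1} \<subseteq> coords c" using mem by blast
  note cc = chart_curve[OF c co im finite.emptyI good]
  have "continuous_on {0..1} (\<lambda>t. sqrt (rm c (?y t) (z - x) (z - x)))"
    by (intro continuous_intros rm_continuous_on[OF c co] im)
  then have "((\<lambda>t. sqrt (rm c (?y t) (z - x) (z - x))) has_integral
      integral {0..1} (\<lambda>t. sqrt (rm c (?y t) (z - x) (z - x)))) {0..1}"
    by (intro integrable_integral integrable_continuous_real)
  then have "(speed M (\<lambda>u. ci c (?y u)) has_integral integral {0..1} (\<lambda>t. sqrt (rm c (?y t) (z - x) (z - x)))) {0..1}"
    by (rule has_integral_spike_finite[where S="{0,1}", rotated 2]) (use cc(2) vd in auto)
  then show ?thesis unfolding conn_def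
    by (intro exI[of _ "\<lambda>u. ci c (?y u)"] exI[of _ 0] exI[of _ 1] conjI cc(1)) auto
qed

text \<open>Integrates the derivative of \<open>h\<close> along the curve and compares it with the
  speed. With linear \<open>h\<close> this bounds coordinates by distances; with the logarithm of
  \<open>conf\<close> it controls the position in hyperbolic space.\<close>

lemma seg_potential:
  fixes h :: "'e \<Rightarrow> real"
  assumes c: "c \<in> atlas M" and s: "seg \<gamma> a b" and i: "(speed M \<gamma> has_integral L) {a..b}" and ab: "a \<le> b"
    and im: "\<gamma> ` {a..b} \<subseteq> fst c" and h: "\<And>x. x \<in> coords c \<Longrightarrow> (h has_derivative dh x) (at x)"
    and bd: "\<And>t w. t \<in> {a..b} \<Longrightarrow> dh (snd c (\<gamma> t)) w \<le> K * sqrt (rm c (snd c (\<gamma> t)) w w)"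
  shows "h (snd c (\<gamma> b)) - h (snd c (\<gamma> a)) \<le> K * L"
proof -
  let ?x = "snd c \<circ> \<gamma>"
  obtain S where S: "finite S" "\<And>t. t \<in> {a<..<b} - S \<Longrightarrow> \<exists>c\<in>atlas M. creg c \<gamma> t" using seg_good[OF s] by blast
  have r: "creg c \<gamma> t" if t: "t \<in> {a<..<b} - S" for t
  proof -
    obtain c' where c': "c' \<in> atlas M" "creg c' \<gamma> t" using S(2)[OF t] by blast
    have "\<gamma> t \<in> fst c" using im t by auto
    then show ?thesis by (rule creg_change(1)[OF c'(1) c c'(2)])
  qed
  have cx: "continuous_on {a..b} ?x"
  proof -
    have "continuous_map (top_of_set {a..b}) (subtopology (mtop M) (fst c)) \<gamma>"
      using s im by (simp add: seg_def continuous_map_in_subtopology image_subset_iff_funcset)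
    from continuous_map_compose[OF this continuous_chart[OF c]]
    show ?thesis by (simp add: continuous_map_in_subtopology)
  qed
  have xU: "?x t \<in> coords c" if "t \<in> {a..b}" for t
  proof -
    have "\<gamma> t \<in> fst c" using im that by blast
    then show ?thesis by simp
  qed
  have ch: "continuous_on (coords c) h"
    by (intro continuous_at_imp_continuous_on ballI has_derivative_continuous[OF h])
  have "((\<lambda>t. dh (?x t) (vector_derivative ?x (at t))) has_integral h (?x b) - h (?x a)) {a..b}"
  proof (rule fundamental_theorem_of_calculus_interior_strong[OF S(1) ab])
    show "continuous_on {a..b} (\<lambda>t. h (?x t))" by (rule continuous_on_compose2[OF ch cx]) (use xU in blast)
    show "((\<lambda>t. h (?x t)) has_vector_derivative dh (?x t) (vector_derivative ?x (at t))) (at t)" if t: "t \<in> {a<..<b} - S" for t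
    proof -
      have "t \<in> {a..b}" using t by auto
      from vector_derivative_diff_chain_within[OF creg_D(2)[OF r[OF t]] has_derivative_at_withinI[OF h[OF xU[OF this]]]]
      show ?thesis unfolding o_def .
    qed
  qed
  then have 1: "((\<lambda>t. if t \<in> S \<union> {a, b} then 0 else dh (?x t) (vector_derivative ?x (at t))) has_integral h (?x b) - h (?x a)) {a..b}"
    by (rule has_integral_spike_finite[where S="S \<union> {a, b}", rotated 2]) (use S in auto)
  have 2: "((\<lambda>t. if t \<in> S \<union> {a, b} then 0 else K * speed M \<gamma> t) has_integral K * L) {a..b}"
    by (rule has_integral_spike_finite[OF _ _ has_integral_mult_right[OF i], of "S \<union> {a, b}"]) (use S in auto)
  have "h (?x b) - h (?x a) \<le> K * L"
  proof (rule has_integral_le[OF 1 2])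
    fix t assume t: "t \<in> {a..b}"
    show "(if t \<in> S \<union> {a, b} then 0 else dh (?x t) (vector_derivative ?x (at t))) \<le> (if t \<in> S \<union> {a, b} then 0 else K * speed M \<gamma> t)"
    proof (cases "t \<in> S \<union> {a, b}")
      case False
      then have "t \<in> {a<..<b} - S" using t by auto
      then show ?thesis using bd[OF t] speed_eq[OF c r] False by simp
    qed simp
  qed
  then show ?thesis by simp
qed

lemma seg_lower:
  assumes c: "c \<in> atlas M" and s: "seg \<gamma> a b" and i: "(speed M \<gamma> has_integral L) {a..b}" and ab: "a \<le> b"
    and im: "\<gamma> ` {a..b} \<subseteq> fst c" and l: "linear l"
    and bd: "\<And>t w. t \<in> {a..b} \<Longrightarrow> l w \<le> K * sqrt (rm c (snd c (\<gamma> t)) w w)"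
  shows "l (snd c (\<gamma> b) - snd c (\<gamma> a)) \<le> K * L"
proof -
  have bl: "bounded_linear l" using l by (simp add: linear_conv_bounded_linear)
  have "l (snd c (\<gamma> b)) - l (snd c (\<gamma> a)) \<le> K * L"
    by (rule seg_potential[OF c s i ab im bounded_linear_imp_has_derivative[OF bl] bd])
  then show ?thesis by (simp add: linear_diff[OF l])
qed

text \<open>The displacement is tested against the unit vector in its own direction, which reduces
  the norm to a linear function.\<close>

lemma seg_lower_norm:
  assumes c: "c \<in> atlas M" and s: "seg \<gamma> a b" and i: "(speed M \<gamma> has_integral L) {a..b}" and ab: "a \<le> b"
    and im: "\<gamma> ` {a..b} \<subseteq> fst c" and K: "K \<ge> 0"
    and bd: "\<And>t w. t \<in> {a..b} \<Longrightarrow> norm w \<le> K * sqrt (rm c (snd c (\<gamma> t)) w w)"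
  shows "norm (snd c (\<gamma> b) - snd c (\<gamma> a)) \<le> K * L"
proof (cases "snd c (\<gamma> b) = snd c (\<gamma> a)")
  case True
  then show ?thesis using seg_length_nonneg[OF s i] K by simp
next
  case False
  let ?v = "snd c (\<gamma> b) - snd c (\<gamma> a)"
  have nv: "norm ?v > 0" using False by simp
  have "(\<lambda>w. ?v \<bullet> w / norm ?v) ?v \<le> K * L"
  proof (rule seg_lower[where l="\<lambda>w. ?v \<bullet> w / norm ?v", OF c s i ab im])
    show "linear (\<lambda>w. ?v \<bullet> w / norm ?v)"
      by (rule linearI) (auto simp: inner_add_right add_divide_distrib)
    show "?v \<bullet> w / norm ?v \<le> K * sqrt (rm c (snd c (\<gamma> t)) w w)" if "t \<in> {a..b}" for t w
    proof -
      have "?v \<bullet> w / norm ?v \<le> norm w" using norm_cauchy_schwarz[of ?v w] nv by (simp add: pos_divide_le_eq mult.commute)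
      then show ?thesis using bd[OF that, of w] by linarith
    qed
  qed
  then show ?thesis using nv by (simp add: dot_square_norm power2_eq_square)
qed

text \<open>The times outside the open set form a compact set with a first element \<open>T\<close>.
  Before \<open>T\<close> the curve is in \<open>N\<close>, so at \<open>T\<close> it is still in
  the closed image of \<open>C\<close>.\<close>

lemma seg_exit:
  assumes c: "c \<in> atlas M" and N: "open N" "N \<subseteq> C" "compact C" "C \<subseteq> coords c"
    and s: "seg \<gamma> a b" and a: "\<gamma> a \<in> ci c ` N" and ab: "a \<le> b" and nin: "\<not> \<gamma> ` {a..b} \<subseteq> ci c ` N"
  shows "\<exists>T\<in>{a..b}. \<gamma> ` {a..T} \<subseteq> ci c ` C \<and> \<gamma> T \<in> ci c ` (C - N)"
proof -
  have ct: "continuous_map (top_of_set {a..b}) (mtop M) \<gamma>" using s by (simp add: seg_def)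
  have oN: "openin (mtop M) (ci c ` N)" by (rule openin_ci[OF c N(1)]) (use N in auto)
  have clC: "closedin (mtop M) (ci c ` C)" by (rule closedin_ci[OF c N(3,4)])
  define B where "B = {t \<in> {a..b}. \<gamma> t \<notin> ci c ` N}"
  have "closedin (top_of_set {a..b}) {t \<in> {a..b}. \<gamma> t \<in> topspace (mtop M) - ci c ` N}"
    using closedin_continuous_map_preimage[OF ct closedin_diff[OF closedin_topspace oN]] by simp
  moreover have "{t \<in> {a..b}. \<gamma> t \<in> topspace (mtop M) - ci c ` N} = B"
    using continuous_map_image_subset_topspace[OF ct] unfolding B_def by auto
  ultimately have "closedin (top_of_set {a..b}) B" by simp
  then have cB: "compact B" by (rule closedin_compact[OF compact_Icc])
  have neB: "B \<noteq> {}" using nin by (auto simp: B_def)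
  then obtain T where T: "T \<in> B" "\<And>t. t \<in> B \<Longrightarrow> T \<le> t" using compact_attains_inf[OF cB] by blast
  have Tab: "T \<in> {a..b}" using T(1) by (simp add: B_def)
  have "T \<noteq> a" using T(1) a by (auto simp: B_def)
  then have aT: "a < T" using Tab by simp
  have before: "\<gamma> t \<in> ci c ` N" if "t \<in> {a..<T}" for t using that T(2)[of t] Tab by (force simp: B_def)
  have "closedin (top_of_set {a..b}) {t \<in> {a..b}. \<gamma> t \<in> ci c ` C}"
    using closedin_continuous_map_preimage[OF ct clC] by simp
  then have clP: "closed {t \<in> {a..b}. \<gamma> t \<in> ci c ` C}" by (rule closedin_closed_trans) simp
  have "{a..<T} \<subseteq> {t \<in> {a..b}. \<gamma> t \<in> ci c ` C}"
  proof
    fix t assume t: "t \<in> {a..<T}"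
    then have "\<gamma> t \<in> ci c ` C" using before[OF t] N(2) by blast
    then show "t \<in> {t \<in> {a..b}. \<gamma> t \<in> ci c ` C}" using t Tab by simp
  qed
  then have "closure {a..<T} \<subseteq> {t \<in> {a..b}. \<gamma> t \<in> ci c ` C}" using clP by (rule closure_minimal)
  then have all: "{a..T} \<subseteq> {t \<in> {a..b}. \<gamma> t \<in> ci c ` C}" using aT by simp
  then have "\<gamma> T \<in> ci c ` C" using subsetD[OF all, of T] aT by simp
  then obtain x where x: "x \<in> C" "\<gamma> T = ci c x" by blast
  then have "x \<notin> N" using T(1) by (auto simp: B_def)
  then have "\<gamma> T \<in> ci c ` (C - N)" using x by blast
  then show ?thesis using all Tab by (intro bexI[of _ T]) auto
qed

text \<open>Up to its first exit the curve lies in the closed ball, where coordinates grow by at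
  most \<open>K\<close> times the length. Reaching the sphere would take more length than there
  is.\<close>

lemma seg_stay:
  assumes c: "c \<in> atlas M" and sub: "cball x0 r \<subseteq> coords c" and K: "K > 0"
    and bd: "\<And>\<xi> w. \<xi> \<in> cball x0 r \<Longrightarrow> norm w \<le> K * sqrt (rm c \<xi> w w)"
    and s: "seg \<gamma> a b" and i: "(speed M \<gamma> has_integral L) {a..b}" and ab: "a \<le> b"
    and x: "\<gamma> a = ci c x" and small: "norm (x - x0) + K * L < r"
  shows "\<gamma> ` {a..b} \<subseteq> ci c ` ball x0 r"
proof (rule ccontr)
  assume nin: "\<not> \<gamma> ` {a..b} \<subseteq> ci c ` ball x0 r"
  have L: "L \<ge> 0" by (rule seg_length_nonneg[OF s i])
  then have "norm (x - x0) < r" using small K by (smt (verit) mult_nonneg_nonneg)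
  then have xb: "x \<in> ball x0 r" by (simp add: dist_norm norm_minus_commute)
  have xc: "x \<in> coords c" using xb sub ball_subset_cball by blast
  obtain T where T: "T \<in> {a..b}" "\<gamma> ` {a..T} \<subseteq> ci c ` cball x0 r" "\<gamma> T \<in> ci c ` (cball x0 r - ball x0 r)"
    using seg_exit[OF c open_ball ball_subset_cball compact_cball sub s _ ab nin] x xb by blast
  have Tb: "a \<le> T" "T \<le> b" using T by auto
  note sr = seg_restrict[OF s i order_refl Tb(2)]
  have mem: "\<gamma> t \<in> fst c \<and> snd c (\<gamma> t) \<in> cball x0 r" if t: "t \<in> {a..T}" for t
  proof -
    have "\<gamma> t \<in> ci c ` cball x0 r" using T(2) t by blast
    then obtain \<xi> where \<xi>: "\<xi> \<in> cball x0 r" "\<gamma> t = ci c \<xi>" by blast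
    then have "\<xi> \<in> coords c" using sub by blast
    then show ?thesis using ci_in[of \<xi> c] snd_ci[of \<xi> c] \<xi> by simp
  qed
  have "norm (snd c (\<gamma> T) - snd c (\<gamma> a)) \<le> K * integral {a..T} (speed M \<gamma>)"
    by (rule seg_lower_norm[OF c sr(1,2) Tb(1)]) (use mem bd K in auto)
  also have "\<dots> \<le> K * L" using sr(3) K by simp
  finally have n: "norm (snd c (\<gamma> T) - x) \<le> K * L" using snd_ci[OF xc] x by simp
  obtain \<xi> where \<xi>: "\<xi> \<in> cball x0 r - ball x0 r" "\<gamma> T = ci c \<xi>" using T(3) by blast
  then have "\<xi> \<in> coords c" using sub by blast
  then have "snd c (\<gamma> T) = \<xi>" using snd_ci[of \<xi> c] \<xi> by simp
  moreover have "norm (\<xi> - x0) = r" using \<xi>(1) by (simp add: dist_norm norm_minus_commute)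
  ultimately have "r \<le> norm (snd c (\<gamma> T) - x) + norm (x - x0)"
    using norm_triangle_ineq[of "\<xi> - x" "x - x0"] by simp
  then show False using n small by simp
qed

lemma conn_topspace:
  assumes "conn p q L" shows "p \<in> topspace (mtop M)" "q \<in> topspace (mtop M)"
proof -
  obtain \<gamma> a b where g: "a < b" "seg \<gamma> a b" "\<gamma> a = p" "\<gamma> b = q" using assms unfolding conn_def by blast
  have "continuous_map (top_of_set {a..b}) (mtop M) \<gamma>" using g(2) by (simp add: seg_def)
  from continuous_map_image_subset_topspace[OF this] have "\<gamma> ` {a..b} \<subseteq> topspace (mtop M)" by simp
  then show "p \<in> topspace (mtop M)" "q \<in> topspace (mtop M)" using g by auto
qed

lemma riem_dist_conn:
  assumes "p \<in> topspace (mtop M)" "q \<in> topspace (mtop M)"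
  shows "riem_dist M p q = Inf {L. conn p q L}"
proof -
  have "(\<exists>\<gamma>. piecewise_C1_curve M \<gamma> \<and> \<gamma> 0 = p \<and> \<gamma> 1 = q \<and> (speed M \<gamma> has_integral L) {0..1}) \<longleftrightarrow> conn p q L" for L
  proof
    assume "\<exists>\<gamma>. piecewise_C1_curve M \<gamma> \<and> \<gamma> 0 = p \<and> \<gamma> 1 = q \<and> (speed M \<gamma> has_integral L) {0..1}"
    then obtain \<gamma> where "piecewise_C1_curve M \<gamma>" "\<gamma> 0 = p" "\<gamma> 1 = q" "(speed M \<gamma> has_integral L) {0..1}" by blast
    then show "conn p q L" unfolding conn_def using pc1_imp_seg
      by (intro exI[of _ \<gamma>] exI[of _ 0] exI[of _ 1]) auto
  next
    assume "conn p q L"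
    from conn_normalize[OF this, of 0 1] obtain \<gamma> where "seg \<gamma> 0 1" "(speed M \<gamma> has_integral L) {0..1}" "\<gamma> 0 = p" "\<gamma> 1 = q" by auto
    then show "\<exists>\<gamma>. piecewise_C1_curve M \<gamma> \<and> \<gamma> 0 = p \<and> \<gamma> 1 = q \<and> (speed M \<gamma> has_integral L) {0..1}"
      using seg_imp_pc1 by blast
  qed
  then show ?thesis using assms by (simp add: riem_dist_def)
qed

lemma riem_dist_le:
  assumes "conn p q L" shows "riem_dist M p q \<le> L"
proof -
  have "bdd_below {L. conn p q L}" by (rule bdd_belowI[of _ 0]) (simp add: conn_nonneg)
  then have "Inf {L. conn p q L} \<le> L" using assms by (intro cInf_lower) auto
  then show ?thesis using riem_dist_conn[OF conn_topspace[OF assms]] by simp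
qed

lemma riem_dist_le_line:
  assumes c: "c \<in> atlas M" and sub: "closed_segment x z \<subseteq> coords c"
    and bd: "\<And>\<xi>. \<xi> \<in> closed_segment x z \<Longrightarrow> sqrt (rm c \<xi> (z - x) (z - x)) \<le> k"
  shows "riem_dist M (ci c x) (ci c z) \<le> k"
proof (rule order_trans[OF riem_dist_le[OF conn_line[OF c sub]]])
  let ?f = "\<lambda>t. sqrt (rm c (x + t *\<^sub>R (z - x)) (z - x) (z - x))"
  have mem: "x + t *\<^sub>R (z - x) \<in> closed_segment x z" if "t \<in> {0..1}" for t
    by (rule line_mem_segment[OF that])
  have im: "(\<lambda>t. x + t *\<^sub>R (z - x)) ` {0..1} \<subseteq> coords c" using mem sub by blast
  have "continuous_on {0..1} ?f"
    by (intro continuous_intros rm_continuous_on[OF c] im)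
  then have "integral {0..1} ?f \<le> integral {0..1} (\<lambda>t::real. k)"
    by (intro integral_le integrable_continuous_real) (use bd mem in auto)
  then show "integral {0..1} ?f \<le> k" by simp
qed

lemma chart_nbhd:
  assumes c: "c \<in> atlas M" and x0: "x0 \<in> coords c"
  shows "\<exists>r>0. \<exists>K>0. cball x0 r \<subseteq> coords c \<and>
    (\<forall>\<xi>\<in>cball x0 r. \<forall>w. norm w \<le> K * sqrt (rm c \<xi> w w) \<and> sqrt (rm c \<xi> w w) \<le> K * norm w)"
proof -
  obtain r where r: "r > 0" "cball x0 r \<subseteq> coords c" using open_coords[OF c] x0 open_contains_cball by blast
  have "\<exists>K>0. \<forall>x\<in>cball x0 r. \<forall>w. norm w \<le> K * sqrt (rm c x w w) \<and> sqrt (rm c x w w) \<le> K * norm w"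
  proof (rule pos_def_bounds[where h="rm c", OF compact_cball])
    show "cball x0 r \<noteq> {}" using r by simp
    show "continuous_on (cball x0 r) (\<lambda>x. rm c x u v)" for u v
      by (rule continuous_on_subset[OF smooth_on_continuous[OF metric_smooth[OF c]] r(2)])
  qed (use r(2) metric_bilinear[OF c] metric_pos[OF c] in auto)
  then show ?thesis using r by blast
qed

end

text \<open>Connectedness makes the set of lengths in \<open>riem_dist\<close> nonempty; only then
  does its infimum carry information.\<close>

locale riem_conn = riemannian_manifold M for M :: "('a, 'e::euclidean_space, 'z) riemannian_scheme" +
  assumes connM: "connected_space (mtop M)"
begin

abbreviation "dM \<equiv> riem_dist M"
abbreviation "SM \<equiv> topspace (mtop M)"

lemma conn_local:
  assumes p: "p \<in> SM"
  shows "\<exists>W. openin (mtop M) W \<and> p \<in> W \<and> (\<forall>q\<in>W. \<exists>L. conn p q L)"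
proof -
  obtain c where c: "c \<in> atlas M" "p \<in> fst c" using chart_exists[OF p] by blast
  have x0: "snd c p \<in> coords c" using c by blast
  obtain r where r: "r > 0" "ball (snd c p) r \<subseteq> coords c" using open_coords[OF c(1)] x0 open_contains_ball by blast
  show ?thesis
  proof (rule exI[of _ "ci c ` ball (snd c p) r"], intro conjI ballI)
    show "openin (mtop M) (ci c ` ball (snd c p) r)" by (rule openin_ci[OF c(1) open_ball r(2)])
    have "ci c (snd c p) = p" by (rule ci_snd[OF c])
    then show "p \<in> ci c ` ball (snd c p) r" using r(1) by (metis centre_in_ball imageI)
    fix q assume "q \<in> ci c ` ball (snd c p) r"
    then obtain z where z: "z \<in> ball (snd c p) r" "q = ci c z" by blast
    have "closed_segment (snd c p) z \<subseteq> ball (snd c p) r" using z(1) r(1) by (intro closed_segment_subset convex_ball) auto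
    then have "closed_segment (snd c p) z \<subseteq> coords c" using r(2) by blast
    from conn_line[OF c(1) this] show "\<exists>L. conn p q L" using z(2) ci_snd[OF c] by auto
  qed
qed

text \<open>Straight lines in charts make the set of points reachable from \<open>p\<close> open,
  and its complement as well.\<close>

lemma conn_exists:
  assumes p: "p \<in> SM" and q: "q \<in> SM" shows "\<exists>L. conn p q L"
proof -
  define A where "A = {q. \<exists>L. conn p q L}"
  have sub: "A \<subseteq> SM" using conn_topspace(2) by (auto simp: A_def)
  have "openin (mtop M) A" unfolding openin_subopen[of _ A]
  proof
    fix x assume x: "x \<in> A"
    obtain W where W: "openin (mtop M) W" "x \<in> W" "\<And>q. q \<in> W \<Longrightarrow> \<exists>L. conn x q L"
      using conn_local[of x] x sub by blast
    have "W \<subseteq> A" using W(3) x conn_trans unfolding A_def by blast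
    then show "\<exists>T. openin (mtop M) T \<and> x \<in> T \<and> T \<subseteq> A" using W by blast
  qed
  moreover have "openin (mtop M) (SM - A)" unfolding openin_subopen[of _ "SM - A"]
  proof
    fix x assume x: "x \<in> SM - A"
    obtain W where W: "openin (mtop M) W" "x \<in> W" "\<And>q. q \<in> W \<Longrightarrow> \<exists>L. conn x q L"
      using conn_local[of x] x by blast
    have "W \<subseteq> SM - A"
    proof
      fix w assume w: "w \<in> W"
      obtain L where "conn x w L" using W(3)[OF w] by blast
      then have "w \<notin> A" using x conn_trans[OF _ conn_sym] unfolding A_def by blast
      then show "w \<in> SM - A" using openin_subset[OF W(1)] w by blast
    qed
    then show "\<exists>T. openin (mtop M) T \<and> x \<in> T \<and> T \<subseteq> SM - A" using W by blast
  qed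
  then have "closedin (mtop M) A" using sub by (simp add: closedin_def)
  ultimately have "A = {} \<or> A = SM" using connM by (simp add: connected_space_clopen_in)
  moreover have "p \<in> A" using conn_local[OF p] by (auto simp: A_def)
  ultimately show ?thesis using q by (auto simp: A_def)
qed

lemma dist_approx:
  assumes "p \<in> SM" "q \<in> SM" "e > 0" shows "\<exists>L. conn p q L \<and> dM p q \<le> L \<and> L < dM p q + e"
proof -
  have "{L. conn p q L} \<noteq> {}" using conn_exists[OF assms(1,2)] by blast
  moreover have "Inf {L. conn p q L} < dM p q + e" using assms by (simp add: riem_dist_conn)
  ultimately have "\<exists>L\<in>{L. conn p q L}. L < dM p q + e" by (rule cInf_lessD)
  then obtain L where L: "conn p q L" "L < dM p q + e" by auto
  show ?thesis using L riem_dist_le[OF L(1)] by blast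
qed

lemma dist_nonneg: "dM p q \<ge> 0"
proof (cases "p \<in> SM \<and> q \<in> SM")
  case True
  then have "{L. conn p q L} \<noteq> {}" using conn_exists[of p q] by blast
  then have "0 \<le> Inf {L. conn p q L}" by (rule cInf_greatest) (simp add: conn_nonneg)
  then show ?thesis using riem_dist_conn[of p q] True by simp
next
  case False
  then show ?thesis unfolding riem_dist_def by (simp only: if_False)
qed

lemma conn_refl: assumes p: "p \<in> SM" shows "conn p p 0"
proof -
  obtain c where c: "c \<in> atlas M" "p \<in> fst c" using chart_exists[OF p] by blast
  have x0: "snd c p \<in> coords c" using c by blast
  then have "closed_segment (snd c p) (snd c p) \<subseteq> coords c" by simp
  note l = conn_line[OF c(1) this]
  have z: "rm c (snd c p) 0 0 = 0" by (rule bilinear_lzero[OF metric_bilinear[OF c(1) x0]])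
  have e: "integral {0..1} (\<lambda>t. sqrt (rm c (snd c p + t *\<^sub>R (snd c p - snd c p)) (snd c p - snd c p) (snd c p - snd c p))) = 0"
    by (simp add: z)
  from l show ?thesis unfolding e ci_snd[OF c] .
qed

lemma dist_triangle:
  assumes "p \<in> SM" "q \<in> SM" "r \<in> SM" shows "dM p r \<le> dM p q + dM q r"
proof (rule field_le_epsilon)
  fix e :: real assume "e > 0"
  then have e: "e / 2 > 0" by simp
  obtain L1 where 1: "conn p q L1" "L1 < dM p q + e / 2" using dist_approx[OF assms(1,2) e] by blast
  obtain L2 where 2: "conn q r L2" "L2 < dM q r + e / 2" using dist_approx[OF assms(2,3) e] by blast
  show "dM p r \<le> dM p q + dM q r + e" using riem_dist_le[OF conn_trans[OF 1(1) 2(1)]] 1 2 by simp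
qed

lemma dist_commute': "dM p q = dM q p"
proof (cases "p \<in> SM \<and> q \<in> SM")
  case True
  have "{L. conn p q L} = {L. conn q p L}" using conn_sym by blast
  then show ?thesis using True by (simp add: riem_dist_conn)
next
  case False
  then have "\<not> (q \<in> SM \<and> p \<in> SM)" by blast
  with False show ?thesis unfolding riem_dist_def by (simp only: if_False)
qed

text \<open>Nearly minimizing curves stay in the coordinate ball by \<open>seg_stay\<close>, and
  there \<open>seg_lower_norm\<close> applies. The excess \<open>e\<close> of their length is
  finally sent to 0.\<close>

lemma local_lower:
  assumes c: "c \<in> atlas M" and sub: "cball x0 r \<subseteq> coords c" and K: "K > 0"
    and bd: "\<And>\<xi> w. \<xi> \<in> cball x0 r \<Longrightarrow> norm w \<le> K * sqrt (rm c \<xi> w w)"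
    and q: "q \<in> SM" and x: "norm (x - x0) + K * dM (ci c x) q < r"
  shows "q \<in> fst c" "snd c q \<in> ball x0 r" "norm (snd c q - x) \<le> K * dM (ci c x) q"
proof -
  have r0: "norm (x - x0) < r" using x K dist_nonneg[of "ci c x" q] by (smt (verit) mult_nonneg_nonneg)
  have xb: "x \<in> cball x0 r" using r0 by (simp add: dist_norm norm_minus_commute)
  have xc: "x \<in> coords c" using xb sub by blast
  have pS: "ci c x \<in> SM" using ci_in[OF xc] domain_subset[OF c] by blast
  have *: "q \<in> fst c \<and> snd c q \<in> ball x0 r \<and> norm (snd c q - x) \<le> K * (dM (ci c x) q + e)"
    if e: "e > 0" "norm (x - x0) + K * (dM (ci c x) q + e) < r" for e
  proof -
    obtain L where L: "conn (ci c x) q L" "L < dM (ci c x) q + e" using dist_approx[OF pS q e(1)] by blast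
    obtain \<gamma> a b where g: "a < b" "seg \<gamma> a b" "(speed M \<gamma> has_integral L) {a..b}" "\<gamma> a = ci c x" "\<gamma> b = q"
      using L(1) unfolding conn_def by blast
    have KL: "K * L < K * (dM (ci c x) q + e)" using L(2) K by simp
    have st: "\<gamma> ` {a..b} \<subseteq> ci c ` ball x0 r"
      by (rule seg_stay[OF c sub K bd g(2,3) _ g(4)]) (use g(1) KL e(2) in auto)
    have mem: "\<gamma> t \<in> fst c \<and> snd c (\<gamma> t) \<in> ball x0 r" if t: "t \<in> {a..b}" for t
    proof -
      obtain \<xi> where \<xi>: "\<xi> \<in> ball x0 r" "\<gamma> t = ci c \<xi>" using st t by blast
      then have "\<xi> \<in> coords c" using sub ball_subset_cball by blast
      then show ?thesis using ci_in[of \<xi> c] snd_ci[of \<xi> c] \<xi> by simp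
    qed
    have "norm (snd c (\<gamma> b) - snd c (\<gamma> a)) \<le> K * L"
    proof (rule seg_lower_norm[OF c g(2,3)])
      show "norm w \<le> K * sqrt (rm c (snd c (\<gamma> t)) w w)" if "t \<in> {a..b}" for t w
        using bd mem[OF that] ball_subset_cball by blast
    qed (use g(1) mem K in auto)
    then show ?thesis using mem[of b] g KL snd_ci[OF xc] by auto
  qed
  \<comment> \<open>This excess uses up half of the margin left by the hypothesis.\<close>
  define e0 where "e0 = (r - norm (x - x0) - K * dM (ci c x) q) / (2 * K)"
  have e0: "e0 > 0" using x K by (simp add: e0_def)
  have "K * e0 = (r - norm (x - x0) - K * dM (ci c x) q) / 2" using K by (simp add: e0_def)
  then have small: "norm (x - x0) + K * (dM (ci c x) q + e0) < r" using x by (simp add: distrib_left)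
  from *[OF e0 this] show "q \<in> fst c" "snd c q \<in> ball x0 r" by auto
  show "norm (snd c q - x) \<le> K * dM (ci c x) q"
  proof (rule field_le_epsilon)
    fix e :: real assume e: "e > 0"
    define e' where "e' = min e0 (e / K)"
    have "K * e' \<le> K * (e / K)" using K by (intro mult_left_mono) (auto simp: e'_def)
    then have "K * e' \<le> e" using K by simp
    moreover have "e' > 0" "K * e' \<le> K * e0"
      using e e0 K by (auto simp: e'_def intro!: mult_left_mono)
    moreover note small
    ultimately show "norm (snd c q - x) \<le> K * dM (ci c x) q + e"
      using *[of e'] by (simp add: distrib_left)
  qed
qed

lemma dist_zero:
  assumes p: "p \<in> SM" and q: "q \<in> SM" and z: "dM p q = 0" shows "p = q"
proof -
  obtain c where c: "c \<in> atlas M" "p \<in> fst c" using chart_exists[OF p] by blast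
  have x0: "snd c p \<in> coords c" using c by blast
  obtain r K where rK: "r > 0" "K > 0" "cball (snd c p) r \<subseteq> coords c"
    "\<And>\<xi> w. \<xi> \<in> cball (snd c p) r \<Longrightarrow> norm w \<le> K * sqrt (rm c \<xi> w w)"
    using chart_nbhd[OF c(1) x0] by blast
  have "norm (snd c p - snd c p) + K * dM (ci c (snd c p)) q < r" using z rK(1) ci_snd[OF c] by simp
  from local_lower[OF c(1) rK(3,2,4) q this]
  have "q \<in> fst c" "snd c q = snd c p" using z ci_snd[OF c] by auto
  then show ?thesis using ci_snd[OF c] ci_snd[OF c(1), of q] by simp
qed

lemma metric: "Metric_space SM dM"
proof
  show "(dM x y = 0) = (x = y)" if "x \<in> SM" "y \<in> SM" for x y
    using dist_zero[OF that] riem_dist_le[OF conn_refl[OF that(1)]] dist_nonneg[of x x] by auto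
qed (use dist_nonneg dist_commute' dist_triangle in auto)

lemma length_space:
  assumes "p \<in> SM" "q \<in> SM" "e > 0" "0 < t" "t < dM p q"
  shows "\<exists>m\<in>SM. dM p m \<le> t \<and> dM m q \<le> dM p q - t + e"
proof -
  obtain L where L: "conn p q L" "dM p q \<le> L" "L < dM p q + e" using dist_approx[OF assms(1-3)] by blast
  obtain m where m: "conn p m t" "conn m q (L - t)" using conn_split[OF L(1) assms(4)] assms(5) L(2) by auto
  then show ?thesis using riem_dist_le[OF m(1)] riem_dist_le[OF m(2)] L conn_topspace[OF m(1)] by (intro bexI[of _ m]) auto
qed

end

section \<open>Displacement along a vector field\<close>

text \<open>Taylor's formula at \<open>s\<close> and at \<open>- s\<close>: the linear terms cancel,
  and the second derivative enters only through its upper bound.\<close>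

lemma symmetric_second_order_bound:
  fixes f :: "real \<Rightarrow> real"
  assumes "\<And>t. \<bar>t\<bar> \<le> \<bar>s\<bar> \<Longrightarrow> (f has_real_derivative f1 t) (at t)"
    "\<And>t. \<bar>t\<bar> \<le> \<bar>s\<bar> \<Longrightarrow> (f1 has_real_derivative f2 t) (at t)"
    "\<And>t. \<bar>t\<bar> \<le> \<bar>s\<bar> \<Longrightarrow> f2 t \<le> B"
  shows "f s + f (- s) \<le> 2 * f 0 + B * s\<^sup>2"
proof -
  define df where "df m = (if m = 0 then f else if m = 1 then f1 else f2)" for m :: nat
  have *: "f x \<le> f 0 + f1 0 * x + B / 2 * x\<^sup>2" if x: "\<bar>x\<bar> = \<bar>s\<bar>" for x
  proof -
    have 1: "\<forall>m t. m < 2 \<and> \<bar>t\<bar> \<le> \<bar>x\<bar> \<longrightarrow> (df m has_real_derivative df (Suc m) t) (at t)"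
      using assms(1,2) x by (auto simp: df_def less_2_cases_iff)
    have "df 0 = f" by (simp add: df_def)
    from Maclaurin_bi_le[OF this 1] obtain t where t: "\<bar>t\<bar> \<le> \<bar>x\<bar>"
      "f x = (\<Sum>m<2. df m 0 / fact m * x ^ m) + df 2 t / fact 2 * x ^ 2" by blast
    have "f x = f 0 + f1 0 * x + f2 t / 2 * x\<^sup>2" using t(2) by (simp add: df_def numeral_2_eq_2)
    moreover have "f2 t / 2 * x\<^sup>2 \<le> B / 2 * x\<^sup>2" using assms(3)[of t] t(1) x by (intro mult_right_mono) auto
    ultimately show ?thesis by linarith
  qed
  show ?thesis using *[of s] *[of "- s"] by simp
qed

context lchart
begin

lemma Gam_continuous_on:
  assumes "continuous_on S f" "continuous_on S v" "continuous_on S w" "f ` S \<subseteq> U"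
  shows "continuous_on S (\<lambda>s. Gam (f s) (v s) (w s))"
proof (rule continuous_on_bilinear_family[where h="\<lambda>s. Gam (f s)", OF _ _ assms(2,3)])
  show "bilinear (Gam (f s))" if "s \<in> S" for s using Gam_bilinear assms(4) that by blast
  show "continuous_on S (\<lambda>s. Gam (f s) u v)" for u v
    by (rule continuous_on_compose2[OF Gam_cont assms(1,4)])
qed

lemma dGam_continuous_on:
  assumes f: "continuous_on S f" "f ` S \<subseteq> U" and "continuous_on S u" "continuous_on S v" "continuous_on S k"
  shows "continuous_on S (\<lambda>s. fd (\<lambda>y. Gam y (u s) (v s)) (f s) (k s))"
proof -
  have U': "f s \<in> U" if "s \<in> S" for s using f(2) that by blast
  have 0: "continuous_on S (\<lambda>s. fd (\<lambda>y. Gam y a b) (f s) c)" for a b c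
    by (rule continuous_on_compose2[OF dGam_cont f])
  have 1: "continuous_on S (\<lambda>s. fd (\<lambda>y. Gam y a b) (f s) (k s))" for a b
    by (rule continuous_on_linear_family[where h="\<lambda>s. fd (\<lambda>y. Gam y a b) (f s)", OF dGam_linear(3)[OF U'] 0 assms(5)])
  have 2: "continuous_on S (\<lambda>s. fd (\<lambda>y. Gam y (u s) b) (f s) (k s))" for b
    by (rule continuous_on_linear_family[where h="\<lambda>s a. fd (\<lambda>y. Gam y a b) (f s) (k s)", OF dGam_linear(1)[OF U'] 1 assms(3)])
  show ?thesis
    by (rule continuous_on_linear_family[where h="\<lambda>s b. fd (\<lambda>y. Gam y (u s) b) (f s) (k s)", OF dGam_linear(2)[OF U'] 2 assms(4)])
qed

lemma E2_continuous_on: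
  assumes c: "continuous_on S s" "continuous_on S x" "continuous_on S p" "continuous_on S q"
    "continuous_on S w" "continuous_on S a" "continuous_on S b"
    and U': "\<And>z. z \<in> S \<Longrightarrow> Pt (s z) (x z) (p z) (q z) \<in> U"
  shows "continuous_on S (\<lambda>z. E2 (s z) (x z) (p z) (q z) (w z) (a z) (b z))"
proof -
  have P: "continuous_on S (\<lambda>z. Pt (s z) (x z) (p z) (q z))" "continuous_on S (\<lambda>z. Pt (s z) (w z) (a z) (b z))"
    unfolding Pt_def by (intro continuous_intros c)+
  have d: "continuous_on S (\<lambda>z. p z + (2 * s z) *\<^sub>R q z)" "continuous_on S (\<lambda>z. a z + (2 * s z) *\<^sub>R b z)"
    "continuous_on S (\<lambda>z. 2 *\<^sub>R q z)" "continuous_on S (\<lambda>z. 2 *\<^sub>R b z)"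
    by (intro continuous_intros c)+
  have im: "(\<lambda>z. Pt (s z) (x z) (p z) (q z)) ` S \<subseteq> U" using U' by blast
  have Z: "continuous_on S (\<lambda>z. Zv (s z) (x z) (p z) (q z) (w z) (a z) (b z))"
    unfolding Zv_def by (intro continuous_on_add Gam_continuous_on P d im)
  have Z': "continuous_on S (\<lambda>z. Zv' (s z) (x z) (p z) (q z) (w z) (a z) (b z))"
    unfolding Zv'_def by (intro continuous_on_add Gam_continuous_on dGam_continuous_on P d im)
  show ?thesis unfolding E2_def
    by (intro continuous_on_mult continuous_on_const continuous_on_add g_continuous_on Gam_continuous_on P d im Z Z')
qed

section \<open>The second variation, uniformly on compact sets\<close>

context
  fixes V :: "'e \<Rightarrow> 'e" and dV :: "'e \<Rightarrow> 'e \<Rightarrow> 'e"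
  assumes V: "\<And>x. x \<in> U \<Longrightarrow> (V has_derivative dV x) (at x)"
    and dV: "\<And>w. continuous_on U (\<lambda>x. dV x w)"
begin

text \<open>As \<open>Pt\<close> has \<open>s\<^sup>2\<close> in place of
  \<open>s\<^sup>2 / 2\<close>, the factor 1/2 makes the acceleration of the displaced point at
  \<open>s = 0\<close> equal to \<open>- Gam x (V x) (V x)\<close>. Thus \<open>Psi s\<close> agrees
  to second order with the exponential map applied to \<open>s *\<^sub>R V\<close>.
  \<open>bV\<close> is the derivative of \<open>qV\<close>, and \<open>DPsi\<close> that of
  \<open>Psi\<close>.\<close>

definition "qV x = - (1/2) *\<^sub>R Gam x (V x) (V x)"
definition "bV x w = - (1/2) *\<^sub>R (fd (\<lambda>y. Gam y (V x) (V x)) x w + 2 *\<^sub>R Gam x (V x) (dV x w))"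
definition "Psi s x = Pt s x (V x) (qV x)"
definition "DPsi s x w = Pt s w (dV x w) (bV x w)"

lemma V_cont: "continuous_on U V"
  using V by (intro continuous_at_imp_continuous_on ballI has_derivative_continuous) blast

lemma dV_linear: "x \<in> U \<Longrightarrow> linear (dV x)"
  using has_derivative_linear[OF V] .

lemma qV_deriv:
  assumes x: "x \<in> U" shows "(qV has_derivative bV x) (at x)"
proof -
  have 1: "((\<lambda>y. Gam y (V y) c) has_derivative (\<lambda>w. fd (\<lambda>y. Gam y (V x) c) x w + Gam x (dV x w) c)) (at x)" for c
    using has_derivative_linear_family[where h="\<lambda>y u. Gam y u c" and f="\<lambda>y. y" and w=V, OF U x
        bilinear_linear(2)[OF Gam_bilinear] Gam_diff(1)[OF x] has_derivative_ident V[OF x]] by simp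
  have d: "(\<lambda>y. Gam y (V y) c) differentiable (at x)" for c using 1 differentiableI by blast
  have "((\<lambda>y. Gam y (V y) (V y)) has_derivative (\<lambda>w. fd (\<lambda>y. Gam y (V y) (V x)) x w + Gam x (V x) (dV x w))) (at x)"
    using has_derivative_linear_family[where h="\<lambda>y. Gam y (V y)" and f="\<lambda>y. y" and w=V, OF U x
        bilinear_linear(1)[OF Gam_bilinear] d has_derivative_ident V[OF x]] by simp
  then have "((\<lambda>y. - (1/2) *\<^sub>R Gam y (V y) (V y)) has_derivative
     (\<lambda>w. - (1/2) *\<^sub>R (fd (\<lambda>y. Gam y (V y) (V x)) x w + Gam x (V x) (dV x w)))) (at x)"
    by (rule has_derivative_scaleR_right)
  moreover have "fd (\<lambda>y. Gam y (V y) (V x)) x w + Gam x (V x) (dV x w)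
      = fd (\<lambda>y. Gam y (V x) (V x)) x w + 2 *\<^sub>R Gam x (V x) (dV x w)" for w
    using fd_eqI[OF 1, of "V x" w] Gam_sym[OF x, of "dV x w" "V x"] by (simp add: scaleR_2)
  ultimately show ?thesis unfolding qV_def[abs_def] bV_def[abs_def] by simp
qed

lemma qV_cont: "continuous_on U qV"
  using qV_deriv by (intro continuous_at_imp_continuous_on ballI has_derivative_continuous) blast

lemma Psi_deriv: "x \<in> U \<Longrightarrow> (Psi s has_derivative DPsi s x) (at x)"
  unfolding Psi_def[abs_def] DPsi_def[abs_def] Pt_def
  by (intro has_derivative_add has_derivative_scaleR_right has_derivative_ident V qV_deriv)

lemma DPsi_linear: "x \<in> U \<Longrightarrow> linear (DPsi s x)"
  using has_derivative_linear[OF Psi_deriv] .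

lemma bV_continuous_on:
  assumes "continuous_on S f" "continuous_on S w" "f ` S \<subseteq> U"
  shows "continuous_on S (\<lambda>z. bV (f z) (w z))" "continuous_on S (\<lambda>z. dV (f z) (w z))" "continuous_on S (\<lambda>z. DPsi s (f z) (w z))"
proof -
  have cV: "continuous_on S (\<lambda>z. V (f z))" by (rule continuous_on_compose2[OF V_cont assms(1,3)])
  show cdV: "continuous_on S (\<lambda>z. dV (f z) (w z))"
    by (rule continuous_on_linear_family[where h="\<lambda>z. dV (f z)", OF dV_linear continuous_on_compose2[OF dV assms(1,3)] assms(2)])
       (use assms(3) in blast)
  show b: "continuous_on S (\<lambda>z. bV (f z) (w z))" unfolding bV_def
    by (intro continuous_on_scaleR continuous_on_const continuous_on_add dGam_continuous_on Gam_continuous_on assms cV cdV)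
  show "continuous_on S (\<lambda>z. DPsi s (f z) (w z))" unfolding DPsi_def Pt_def
    by (intro continuous_on_add continuous_on_scaleR continuous_on_const assms(2) cdV b)
qed

text \<open>By \<open>E2_zero\<close> the second derivative of the squared length at
  \<open>s = 0\<close> is twice the left side of assumption \<open>A\<close>. Its continuity in
  \<open>s\<close>, made uniform over \<open>C\<close> and the unit vectors by
  \<open>tube_positive\<close>, costs the \<open>e\<close>; taking \<open>s\<close> together with
  \<open>- s\<close> removes the first order term, and homogeneity extends the bound to all
  \<open>w\<close>.\<close>

lemma variation_uniform:
  assumes C: "compact C" "C \<subseteq> U" and e: "e > 0"
    and A: "\<And>x w. x \<in> C \<Longrightarrow> g x (dV x w + Gam x (V x) w) (dV x w + Gam x (V x) w) - g x (Rm x (V x) w w) (V x) \<le> A * g x w w"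
  shows "\<exists>s0>0. \<forall>s. \<bar>s\<bar> < s0 \<longrightarrow> (\<forall>x\<in>C. Psi s x \<in> U \<and> (\<forall>w.
     g (Psi s x) (DPsi s x w) (DPsi s x w) + g (Psi (- s) x) (DPsi (- s) x w) (DPsi (- s) x w) \<le> (2 + s\<^sup>2 * (2 * A + e)) * g x w w))"
proof (cases "C = {}")
  case True then show ?thesis by (intro exI[of _ 1]) simp
next
  case Cne: False
  have cV: "continuous_on C V" "continuous_on C qV" by (rule continuous_on_subset[OF V_cont C(2)], rule continuous_on_subset[OF qV_cont C(2)])
  obtain \<delta> where \<delta>: "\<delta> > 0" "(\<Union>x\<in>C. cball x \<delta>) \<subseteq> U"
    using compact_subset_open_imp_cball_epsilon_subset[OF C(1) U C(2)] by blast
  have "compact ((\<lambda>x. norm (V x) + norm (qV x)) ` C)" by (intro compact_continuous_image continuous_intros cV C(1))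
  from bounded_imp_bdd_above[OF compact_imp_bounded[OF this]]
  obtain N where "\<And>y. y \<in> (\<lambda>x. norm (V x) + norm (qV x)) ` C \<Longrightarrow> y \<le> N" unfolding bdd_above_def by blast
  then have N: "norm (V x) + norm (qV x) \<le> N" if "x \<in> C" for x using that by blast
  \<comment> \<open>For \<open>\<bar>s\<bar> < 1\<close> also
    \<open>s\<^sup>2 \<le> \<bar>s\<bar>\<close>, so the displacement is at most
    \<open>\<bar>s\<bar> * (\<bar>N\<bar> + 1)\<close> and stays within the collar of width
    \<open>\<delta>\<close> about \<open>C\<close>.\<close>
  define s1 where "s1 = min 1 (\<delta> / (\<bar>N\<bar> + 1))"
  have s1: "s1 > 0" using \<delta>(1) by (simp add: s1_def)
  have inU: "Psi s x \<in> U" if s: "\<bar>s\<bar> < s1" and x: "x \<in> C" for s x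
  proof -
    have "\<bar>s\<bar> * \<bar>s\<bar> \<le> \<bar>s\<bar> * 1" using s by (intro mult_left_mono) (auto simp: s1_def)
    then have "s\<^sup>2 \<le> \<bar>s\<bar>" by (simp add: power2_eq_square)
    then have "norm (s *\<^sub>R V x + s\<^sup>2 *\<^sub>R qV x) \<le> \<bar>s\<bar> * norm (V x) + \<bar>s\<bar> * norm (qV x)"
      by (intro norm_triangle_le) (auto intro!: add_mono mult_right_mono)
    also have "\<dots> = \<bar>s\<bar> * (norm (V x) + norm (qV x))" by (simp add: distrib_left)
    also have "\<dots> \<le> \<bar>s\<bar> * (\<bar>N\<bar> + 1)" using N[OF x] by (intro mult_left_mono) auto
    also have "\<dots> \<le> (\<delta> / (\<bar>N\<bar> + 1)) * (\<bar>N\<bar> + 1)" using s by (intro mult_right_mono) (auto simp: s1_def)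
    also have "\<dots> = \<delta>" by simp
    finally have "norm (s *\<^sub>R V x + s\<^sup>2 *\<^sub>R qV x) \<le> \<delta>" .
    moreover have "Psi s x - x = s *\<^sub>R V x + s\<^sup>2 *\<^sub>R qV x" by (simp add: Psi_def Pt_def)
    ultimately have "dist x (Psi s x) \<le> \<delta>" by (metis dist_norm dist_commute)
    then have "Psi s x \<in> cball x \<delta>" by simp
    then show ?thesis using \<delta>(2) x by blast
  qed
  let ?S = "sphere (0::'e) 1"
  let ?K = "C \<times> ?S"
  define Eh where "Eh s z = E2 s (fst z) (V (fst z)) (qV (fst z)) (snd z) (dV (fst z) (snd z)) (bV (fst z) (snd z))" for s and z :: "'e \<times> 'e"
  have cpK: "compact ?K" by (intro compact_Times C compact_sphere)
  have cg: "continuous_on ?K (\<lambda>z. g (fst z) (snd z) (snd z))"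
    by (intro g_continuous_on continuous_intros) (use C(2) in auto)
  have "?K \<noteq> {}" using Cne by simp
  then obtain z0 where z0: "z0 \<in> ?K" "\<And>z. z \<in> ?K \<Longrightarrow> g (fst z0) (snd z0) (snd z0) \<le> g (fst z) (snd z) (snd z)"
    using continuous_attains_inf[OF cpK _ cg] by blast
  \<comment> \<open>The least value of the metric on unit vectors over \<open>C\<close>; it converts
    an additive error \<open>e * m\<close> into the relative error
    \<open>e * g x w w\<close>.\<close>
  define m where "m = g (fst z0) (snd z0) (snd z0)"
  have m: "m > 0"
  proof -
    have "fst z0 \<in> U" "norm (snd z0) = 1" using z0(1) C(2) by auto
    then show ?thesis using g_pos[of "fst z0" "snd z0"] unfolding m_def by force
  qed
  have e': "e * m > 0" using e m by simp
  have "\<exists>d>0. ball 0 d \<subseteq> {-s1<..<s1} \<and> (\<forall>s\<in>ball 0 d. \<forall>z\<in>?K. 0 < Eh 0 (snd (s, z)) + e * m - Eh (fst (s, z)) (snd (s, z)))"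
  proof (rule tube_positive[OF _ _ cpK])
    show "continuous_on ({-s1<..<s1} \<times> ?K) (\<lambda>q. Eh 0 (snd q) + e * m - Eh (fst q) (snd q))"
    proof -
      have co: "continuous_on ({-s1<..<s1} \<times> ?K) (\<lambda>q. fst (snd q))" "continuous_on ({-s1<..<s1} \<times> ?K) (\<lambda>q. snd (snd q))"
        "continuous_on ({-s1<..<s1} \<times> ?K) fst"
        by (intro continuous_intros)+
      have im: "(\<lambda>q. fst (snd q)) ` ({-s1<..<s1} \<times> ?K) \<subseteq> U" using C(2) by auto
      have E: "continuous_on ({-s1<..<s1} \<times> ?K) (\<lambda>q. Eh (f q) (snd q))"
        if f: "continuous_on ({-s1<..<s1} \<times> ?K) f" "\<And>q. q \<in> {-s1<..<s1} \<times> ?K \<Longrightarrow> \<bar>f q\<bar> < s1" for f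
        unfolding Eh_def
      proof (intro E2_continuous_on f(1) co bV_continuous_on im continuous_on_compose2[OF V_cont co(1) im] continuous_on_compose2[OF qV_cont co(1) im])
        fix q assume q: "q \<in> {-s1<..<s1} \<times> ?K"
        then have "fst (snd q) \<in> C" by auto
        from inU[OF f(2)[OF q] this] show "Pt (f q) (fst (snd q)) (V (fst (snd q))) (qV (fst (snd q))) \<in> U"
          by (simp add: Psi_def)
      qed
      show ?thesis by (intro continuous_on_diff continuous_on_add continuous_on_const E co(3)) (use s1 in auto)
    qed
  qed (use s1 e' in auto)
  then obtain d where d: "d > 0" "ball 0 d \<subseteq> {-s1<..<s1}"
    and d3': "\<forall>s\<in>ball 0 d. \<forall>z\<in>?K. 0 < Eh 0 (snd (s, z)) + e * m - Eh (fst (s, z)) (snd (s, z))" by blast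
  have d3: "Eh s z < Eh 0 z + e * m" if "s \<in> ball 0 d" "z \<in> ?K" for s z
    using bspec[OF bspec[OF d3' that(1)] that(2)] unfolding fst_conv snd_conv by linarith
  have ds1: "\<bar>s\<bar> < s1" if "\<bar>s\<bar> < d" for s
  proof -
    have "s \<in> ball 0 d" using that by simp
    then show ?thesis using d(2) by (auto simp: subset_iff abs_less_iff)
  qed
  have unit: "g (Psi s x) (DPsi s x w) (DPsi s x w) + g (Psi (- s) x) (DPsi (- s) x w) (DPsi (- s) x w) \<le> (2 + s\<^sup>2 * (2 * A + e)) * g x w w"
    if s: "\<bar>s\<bar> < d" and x: "x \<in> C" and w: "norm w = 1" for s x w
  proof -
    have xU: "x \<in> U" using x C(2) by blast
    have z: "(x, w) \<in> ?K" using x w by simp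
    let ?f = "\<lambda>s. E0 s x (V x) (qV x) w (dV x w) (bV x w)"
    let ?f1 = "\<lambda>s. E1 s x (V x) (qV x) w (dV x w) (bV x w)"
    have "?f s + ?f (- s) \<le> 2 * ?f 0 + (Eh 0 (x, w) + e * m) * s\<^sup>2"
    proof (rule symmetric_second_order_bound)
      fix t assume t: "\<bar>t\<bar> \<le> \<bar>s\<bar>"
      then have td: "\<bar>t\<bar> < d" using s by simp
      have PU: "Pt t x (V x) (qV x) \<in> U" using inU[OF ds1[OF td] x] by (simp add: Psi_def)
      show "(?f has_real_derivative ?f1 t) (at t)" by (rule E0_deriv[OF PU])
      show "(?f1 has_real_derivative Eh t (x, w)) (at t)" unfolding Eh_def fst_conv snd_conv by (rule E1_deriv[OF PU])
      show "Eh t (x, w) \<le> Eh 0 (x, w) + e * m" using d3[OF _ z, of t] td by (simp add: less_imp_le)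
    qed
    moreover have "?f 0 = g x w w" by (simp add: E0_def Pt_def)
    moreover have "Eh 0 (x, w) \<le> 2 * (A * g x w w)"
    proof -
      have "Eh 0 (x, w) = 2 * (g x (dV x w + Gam x (V x) w) (dV x w + Gam x (V x) w) - g x (Rm x (V x) w w) (V x))"
        unfolding Eh_def fst_conv snd_conv qV_def bV_def by (rule E2_zero[OF xU])
      then show ?thesis using A[OF x, of w] by simp
    qed
    moreover have "e * m \<le> e * g x w w" using z0(2)[OF z] e by (simp add: m_def)
    ultimately have "?f s + ?f (- s) \<le> 2 * g x w w + (2 * (A * g x w w) + e * g x w w) * s\<^sup>2"
      by (smt (verit) mult_right_mono zero_le_power2)
    then show ?thesis by (simp add: E0_def Psi_def DPsi_def algebra_simps)
  qed
  have all: "g (Psi s x) (DPsi s x w) (DPsi s x w) + g (Psi (- s) x) (DPsi (- s) x w) (DPsi (- s) x w) \<le> (2 + s\<^sup>2 * (2 * A + e)) * g x w w"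
    if s: "\<bar>s\<bar> < d" and x: "x \<in> C" for s x w
  proof -
    have xU: "x \<in> U" using x C(2) by blast
    have P: "Psi s x \<in> U" "Psi (- s) x \<in> U" using inU[OF ds1 x] s by auto
    define w1 where "w1 = (if w = 0 then (SOME b. b \<in> Basis) else w /\<^sub>R norm w)"
    have "norm w1 = 1" by (simp add: w1_def some_in_eq nonempty_Basis)
    moreover have w: "w = norm w *\<^sub>R w1" by (simp add: w1_def)
    ultimately have "(norm w)\<^sup>2 * (g (Psi s x) (DPsi s x w1) (DPsi s x w1) + g (Psi (- s) x) (DPsi (- s) x w1) (DPsi (- s) x w1))
        \<le> (norm w)\<^sup>2 * ((2 + s\<^sup>2 * (2 * A + e)) * g x w1 w1)"
      using unit[OF s x, of w1] by (intro mult_left_mono) auto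
    moreover have "g (Psi t x) (DPsi t x (r *\<^sub>R w1)) (DPsi t x (r *\<^sub>R w1)) = r\<^sup>2 * g (Psi t x) (DPsi t x w1) (DPsi t x w1)"
      if "Psi t x \<in> U" for t r
      by (simp add: linear_scale[OF DPsi_linear[OF xU]] g_simps[OF that] power2_eq_square)
    note this[OF P(1), of "norm w"] this[OF P(2), of "norm w"]
    moreover have "g x (r *\<^sub>R w1) (r *\<^sub>R w1) = r\<^sup>2 * g x w1 w1" for r
      by (simp add: g_simps[OF xU] power2_eq_square)
    note this[of "norm w"]
    ultimately show ?thesis unfolding w[symmetric] by (simp add: algebra_simps)
  qed
  show ?thesis using d(1) all inU[OF ds1] by (intro exI[of _ d]) auto
qed

end

text \<open>Constants in \<open>V\<close> are kept in a fixed tangent space by \<open>v - Gam y (x - y) v\<close>, which is parallel to first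
  order at \<open>y\<close>; on a small ball all deviations are at most \<open>\<eta>\<close>.\<close>

definition "ev y v x = v - Gam y (x - y) v"
definition "nv y x w v = Gam x w (ev y v x) - Gam y w v"

text \<open>\<open>nv y x w v\<close> is the covariant derivative at \<open>x\<close> of the field
  \<open>ev y v\<close> in direction \<open>w\<close>, and it vanishes for \<open>x = y\<close>.
  Hence at \<open>x = y = p\<close> all three inequalities are strict on unit vectors;
  \<open>tube_positive\<close> spreads them to nearby pairs and homogeneity to all vectors.\<close>

lemma good_nbhd:
  assumes p: "p \<in> U" and \<eta>: "\<eta> > 0"
  shows "\<exists>r>0. ball p r \<subseteq> U \<and> (\<forall>x\<in>ball p r. \<forall>y\<in>ball p r.
     (\<forall>w. g x w w \<le> (1 + \<eta>)\<^sup>2 * g y w w) \<and>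
     (\<forall>w v. g x (nv y x w v) (nv y x w v) \<le> \<eta>\<^sup>2 * (g x w w * g y v v)) \<and>
     (\<forall>v. g x (ev y v x) (ev y v x) \<le> (1 + \<eta>)\<^sup>2 * g y v v))"
proof -
  let ?S = "sphere (0::'e) 1"
  let ?K = "?S \<times> ?S"
  let ?A = "(U \<times> U) \<times> ?K"
  have K: "compact ?K" by (intro compact_Times compact_sphere)
  have UU: "open (U \<times> U)" "(p, p) \<in> U \<times> U" using U p by (auto intro: open_Times)
  let ?x = "\<lambda>q::('e \<times> 'e) \<times> ('e \<times> 'e). fst (fst q)" and ?y = "\<lambda>q::('e \<times> 'e) \<times> ('e \<times> 'e). snd (fst q)"
  let ?w = "\<lambda>q::('e \<times> 'e) \<times> ('e \<times> 'e). fst (snd q)" and ?v = "\<lambda>q::('e \<times> 'e) \<times> ('e \<times> 'e). snd (snd q)"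
  have im: "?x ` ?A \<subseteq> U" "?y ` ?A \<subseteq> U" by auto
  have co: "continuous_on ?A ?x" "continuous_on ?A ?y" "continuous_on ?A ?w" "continuous_on ?A ?v"
    "continuous_on ?A (\<lambda>q. ?x q - ?y q)"
    by (intro continuous_intros)+
  have ce: "continuous_on ?A (\<lambda>q. ev (?y q) (?v q) (?x q))"
    unfolding ev_def by (intro continuous_on_diff Gam_continuous_on co im)
  have cn: "continuous_on ?A (\<lambda>q. nv (?y q) (?x q) (?w q) (?v q))"
    unfolding nv_def by (intro continuous_on_diff Gam_continuous_on co im ce)
  have e0: "ev p v p = v" "nv p p w v = 0" for v w using p by (simp_all add: ev_def nv_def Gam_simps)
  have nz: "g p w w > 0" if "w \<in> ?S" for w using that g_pos[OF p, of w] by force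
  have c1: "continuous_on ?A (\<lambda>q. (1 + \<eta>)\<^sup>2 * g (?y q) (?w q) (?w q) - g (?x q) (?w q) (?w q))"
    by (intro continuous_on_diff continuous_on_mult continuous_on_const g_continuous_on co im)
  have c2: "continuous_on ?A (\<lambda>q. \<eta>\<^sup>2 * (g (?x q) (?w q) (?w q) * g (?y q) (?v q) (?v q))
      - g (?x q) (nv (?y q) (?x q) (?w q) (?v q)) (nv (?y q) (?x q) (?w q) (?v q)))"
    by (intro continuous_on_diff continuous_on_mult continuous_on_const g_continuous_on co im cn)
  have c3: "continuous_on ?A (\<lambda>q. (1 + \<eta>)\<^sup>2 * g (?y q) (?v q) (?v q) - g (?x q) (ev (?y q) (?v q) (?x q)) (ev (?y q) (?v q) (?x q)))"
    by (intro continuous_on_diff continuous_on_mult continuous_on_const g_continuous_on co im ce)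
  have big: "a < (1 + \<eta>)\<^sup>2 * a" if "a > 0" for a :: real
    using that \<eta> by (simp add: one_less_power)
  have s: "0 < (1 + \<eta>)\<^sup>2 * g p w w - g p w w" if "w \<in> ?S" for w using big[OF nz[OF that]] by linarith
  have p1: "0 < (1 + \<eta>)\<^sup>2 * g (?y ((p, p), k)) (?w ((p, p), k)) (?w ((p, p), k)) - g (?x ((p, p), k)) (?w ((p, p), k)) (?w ((p, p), k))"
    if "k \<in> ?K" for k
    unfolding fst_conv snd_conv by (rule s) (use that in auto)
  have p2: "0 < \<eta>\<^sup>2 * (g (?x ((p, p), k)) (?w ((p, p), k)) (?w ((p, p), k)) * g (?y ((p, p), k)) (?v ((p, p), k)) (?v ((p, p), k)))
      - g (?x ((p, p), k)) (nv (?y ((p, p), k)) (?x ((p, p), k)) (?w ((p, p), k)) (?v ((p, p), k)))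
         (nv (?y ((p, p), k)) (?x ((p, p), k)) (?w ((p, p), k)) (?v ((p, p), k)))"
    if "k \<in> ?K" for k
  proof -
    have "g p (fst k) (fst k) > 0" "g p (snd k) (snd k) > 0" by (rule nz, use that in auto)+
    then show ?thesis unfolding fst_conv snd_conv e0 g_simps(7)[OF p] using \<eta> by simp
  qed
  have p3: "0 < (1 + \<eta>)\<^sup>2 * g (?y ((p, p), k)) (?v ((p, p), k)) (?v ((p, p), k))
      - g (?x ((p, p), k)) (ev (?y ((p, p), k)) (?v ((p, p), k)) (?x ((p, p), k))) (ev (?y ((p, p), k)) (?v ((p, p), k)) (?x ((p, p), k)))"
    if "k \<in> ?K" for k
    unfolding fst_conv snd_conv e0 by (rule s) (use that in auto)
  obtain d1 where d1: "d1 > 0" "ball (p, p) d1 \<subseteq> U \<times> U"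
    and d1': "\<forall>q\<in>ball (p, p) d1. \<forall>k\<in>?K. 0 < (1 + \<eta>)\<^sup>2 * g (?y (q, k)) (?w (q, k)) (?w (q, k)) - g (?x (q, k)) (?w (q, k)) (?w (q, k))"
    using tube_positive[OF UU K c1 p1] by blast
  obtain d2 where d2: "d2 > 0"
    and d2': "\<forall>q\<in>ball (p, p) d2. \<forall>k\<in>?K. 0 < \<eta>\<^sup>2 * (g (?x (q, k)) (?w (q, k)) (?w (q, k)) * g (?y (q, k)) (?v (q, k)) (?v (q, k)))
      - g (?x (q, k)) (nv (?y (q, k)) (?x (q, k)) (?w (q, k)) (?v (q, k))) (nv (?y (q, k)) (?x (q, k)) (?w (q, k)) (?v (q, k)))"
    using tube_positive[OF UU K c2 p2] by blast
  obtain d3 where d3: "d3 > 0"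
    and d3': "\<forall>q\<in>ball (p, p) d3. \<forall>k\<in>?K. 0 < (1 + \<eta>)\<^sup>2 * g (?y (q, k)) (?v (q, k)) (?v (q, k))
      - g (?x (q, k)) (ev (?y (q, k)) (?v (q, k)) (?x (q, k))) (ev (?y (q, k)) (?v (q, k)) (?x (q, k)))"
    using tube_positive[OF UU K c3 p3] by blast
  \<comment> \<open>Half, since the distance of \<open>(x, y)\<close> from \<open>(p, p)\<close> is
    at most the sum of the distances of \<open>x\<close> and \<open>y\<close> from
    \<open>p\<close>.\<close>
  define r where "r = min d1 (min d2 d3) / 2"
  have r: "r > 0" using d1 d2 d3 by (simp add: r_def)
  have mem: "(x, y) \<in> ball (p, p) d1 \<and> (x, y) \<in> ball (p, p) d2 \<and> (x, y) \<in> ball (p, p) d3"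
    if "x \<in> ball p r" "y \<in> ball p r" for x y
  proof -
    have "dist (p, p) (x, y) \<le> dist p x + dist p y"
      unfolding dist_Pair_Pair by (rule sqrt_sum_squares_le_sum) auto
    also have "\<dots> < 2 * r" using that by simp
    finally show ?thesis by (simp add: r_def)
  qed
  define \<nu> where "\<nu> w = (if w = 0 then (SOME b. b \<in> Basis) else w /\<^sub>R norm w)" for w :: 'e
  have \<nu>: "\<nu> w \<in> ?S" "w = norm w *\<^sub>R \<nu> w" for w by (simp_all add: \<nu>_def some_in_eq nonempty_Basis)
  have main: "(\<forall>w. g x w w \<le> (1 + \<eta>)\<^sup>2 * g y w w) \<and>
     (\<forall>w v. g x (nv y x w v) (nv y x w v) \<le> \<eta>\<^sup>2 * (g x w w * g y v v)) \<and>
     (\<forall>v. g x (ev y v x) (ev y v x) \<le> (1 + \<eta>)\<^sup>2 * g y v v)" if xy: "x \<in> ball p r" "y \<in> ball p r" for x y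
  proof (intro conjI allI)
    have mem1: "(x, y) \<in> ball (p, p) d1" and mem2: "(x, y) \<in> ball (p, p) d2" and mem3: "(x, y) \<in> ball (p, p) d3"
      using mem[OF xy] by blast+
    then have "(x, y) \<in> U \<times> U" using d1(2) by blast
    then have xU: "x \<in> U" and yU: "y \<in> U" by auto
    fix w v
    have k: "(\<nu> w, \<nu> v) \<in> ?K" using \<nu>(1) by simp
    have sq: "g z (a *\<^sub>R b) (a *\<^sub>R b) = a\<^sup>2 * g z b b" if "z \<in> U" for z a b
      using that by (simp add: g_simps power2_eq_square)
    have "(norm w)\<^sup>2 * g x (\<nu> w) (\<nu> w) \<le> (norm w)\<^sup>2 * ((1 + \<eta>)\<^sup>2 * g y (\<nu> w) (\<nu> w))"
      using bspec[OF bspec[OF d1' mem1] k] unfolding fst_conv snd_conv by (intro mult_left_mono) auto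
    then have "g x (norm w *\<^sub>R \<nu> w) (norm w *\<^sub>R \<nu> w) \<le> (1 + \<eta>)\<^sup>2 * g y (norm w *\<^sub>R \<nu> w) (norm w *\<^sub>R \<nu> w)"
      unfolding sq[OF xU] sq[OF yU] by (simp add: mult_ac)
    then show "g x w w \<le> (1 + \<eta>)\<^sup>2 * g y w w" unfolding \<nu>(2)[of w, symmetric] .
    have evs: "ev y (a *\<^sub>R b) x = a *\<^sub>R ev y b x" for a b
      by (simp add: ev_def Gam_simps[OF yU] scaleR_diff_right)
    have nvs: "nv y x (a *\<^sub>R b) (a' *\<^sub>R b') = (a * a') *\<^sub>R nv y x b b'" for a b a' b'
      by (simp add: nv_def evs Gam_simps[OF yU] Gam_simps[OF xU] scaleR_diff_right mult.commute)
    have "(norm w * norm v)\<^sup>2 * g x (nv y x (\<nu> w) (\<nu> v)) (nv y x (\<nu> w) (\<nu> v))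
      \<le> (norm w * norm v)\<^sup>2 * (\<eta>\<^sup>2 * (g x (\<nu> w) (\<nu> w) * g y (\<nu> v) (\<nu> v)))"
      using bspec[OF bspec[OF d2' mem2] k] unfolding fst_conv snd_conv by (intro mult_left_mono) auto
    then have "g x (nv y x (norm w *\<^sub>R \<nu> w) (norm v *\<^sub>R \<nu> v)) (nv y x (norm w *\<^sub>R \<nu> w) (norm v *\<^sub>R \<nu> v))
      \<le> \<eta>\<^sup>2 * (g x (norm w *\<^sub>R \<nu> w) (norm w *\<^sub>R \<nu> w) * g y (norm v *\<^sub>R \<nu> v) (norm v *\<^sub>R \<nu> v))"
      unfolding nvs sq[OF xU] sq[OF yU] by (simp add: mult_ac power_mult_distrib)
    then show "g x (nv y x w v) (nv y x w v) \<le> \<eta>\<^sup>2 * (g x w w * g y v v)" unfolding \<nu>(2)[symmetric] .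
    have "(norm v)\<^sup>2 * g x (ev y (\<nu> v) x) (ev y (\<nu> v) x) \<le> (norm v)\<^sup>2 * ((1 + \<eta>)\<^sup>2 * g y (\<nu> v) (\<nu> v))"
      using bspec[OF bspec[OF d3' mem3] k] unfolding fst_conv snd_conv by (intro mult_left_mono) auto
    then have "g x (ev y (norm v *\<^sub>R \<nu> v) x) (ev y (norm v *\<^sub>R \<nu> v) x) \<le> (1 + \<eta>)\<^sup>2 * g y (norm v *\<^sub>R \<nu> v) (norm v *\<^sub>R \<nu> v)"
      unfolding evs sq[OF xU] sq[OF yU] by (simp add: mult_ac)
    then show "g x (ev y v x) (ev y v x) \<le> (1 + \<eta>)\<^sup>2 * g y v v" unfolding \<nu>(2)[symmetric] .
  qed
  have "ball p r \<subseteq> U"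
  proof
    fix x assume "x \<in> ball p r"
    then have "(x, p) \<in> U \<times> U" using mem[of x p] r d1(2) by auto
    then show "x \<in> U" by simp
  qed
  then show ?thesis using r main by blast
qed

end

section \<open>Second order growth of the distance function\<close>

context Metric_space
begin

text \<open>Lebesgue number argument: the cover uses half of the local radii, so a point within
  \<open>l\<close> of a covered point still lies in the full ball.\<close>

lemma compact_uniform_radius:
  assumes K: "compactin mtopology K"
    and R: "\<And>p. p \<in> K \<Longrightarrow> \<exists>\<rho>>0. \<forall>z\<in>M. \<forall>z'\<in>M. d p z < \<rho> \<longrightarrow> d p z' < \<rho> \<longrightarrow> R z z'"
  shows "\<exists>l>0. \<forall>z'\<in>K. \<forall>z\<in>M. d z z' < l \<longrightarrow> R z z'"
proof -
  have sub: "K \<subseteq> M" using compactin_subset_topspace[OF K] by simp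
  have "\<forall>p\<in>K. \<exists>\<rho>>0. \<forall>z\<in>M. \<forall>z'\<in>M. d p z < \<rho> \<longrightarrow> d p z' < \<rho> \<longrightarrow> R z z'" using R by blast
  from bchoice[OF this] obtain \<rho> where \<rho>: "\<forall>p\<in>K. \<rho> p > 0 \<and> (\<forall>z\<in>M. \<forall>z'\<in>M. d p z < \<rho> p \<longrightarrow> d p z' < \<rho> p \<longrightarrow> R z z')" ..
  have op: "openin mtopology (mball p (\<rho> p / 2))" for p by simp
  have cov: "K \<subseteq> \<Union> ((\<lambda>p. mball p (\<rho> p / 2)) ` K)"
  proof
    fix p assume p: "p \<in> K"
    then have "p \<in> mball p (\<rho> p / 2)" using \<rho> sub by auto
    then show "p \<in> \<Union> ((\<lambda>p. mball p (\<rho> p / 2)) ` K)" using p by blast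
  qed
  obtain \<F> where F: "finite \<F>" "\<F> \<subseteq> (\<lambda>p. mball p (\<rho> p / 2)) ` K" "K \<subseteq> \<Union> \<F>"
    using compactinD[OF K _ cov] op by auto
  obtain P where P: "finite P" "P \<subseteq> K" "\<F> = (\<lambda>p. mball p (\<rho> p / 2)) ` P"
    using finite_subset_image[OF F(1,2)] by blast
  define l where "l = Min (insert 1 ((\<lambda>p. \<rho> p / 2) ` P))"
  have fin: "finite (insert 1 ((\<lambda>p. \<rho> p / 2) ` P))" using P(1) by simp
  have "\<rho> p / 2 > 0" if "p \<in> P" for p using \<rho> P(2) that by auto
  then have l: "l > 0" unfolding l_def using fin by (subst Min_gr_iff) auto
  have lle: "l \<le> \<rho> p / 2" if "p \<in> P" for p unfolding l_def using fin that by (intro Min_le) auto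
  have "R z z'" if z: "z' \<in> K" "z \<in> M" "d z z' < l" for z z'
  proof -
    obtain p where p: "p \<in> P" "z' \<in> mball p (\<rho> p / 2)" using F(3) P(3) z(1) by blast
    have pK: "p \<in> K" using p P by blast
    then have pos: "\<rho> p > 0" using \<rho> by blast
    have z': "z' \<in> M" "d p z' < \<rho> p / 2" "p \<in> M" using p(2) by auto
    have "d p z \<le> d p z' + d z' z" using z' z by (intro triangle) auto
    then have "d p z < \<rho> p" using z' z lle[OF p(1)] by (simp add: commute)
    moreover have "d p z' < \<rho> p" using z'(2) pos by linarith
    ultimately show ?thesis using \<rho> pK z'(1) z(2) by blast
  qed
  then show ?thesis using l by blast
qed

end

lemma jet2_cong:
  assumes "jet2 y x v q" "\<forall>\<^sub>F s in at 0. y s = z s" shows "jet2 z x v q"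
proof (rule jet2_close[OF assms(1)])
  fix e :: real assume "e > 0"
  show "\<forall>\<^sub>F s in at 0. norm (y s - z s) \<le> e * s\<^sup>2"
    using assms(2) by eventually_elim (use \<open>e > 0\<close> in simp)
qed

lemma eventually_at_0_minus: "(\<forall>\<^sub>F s in at (0::real). P s) \<Longrightarrow> \<forall>\<^sub>F s in at 0. P (- s)"
  unfolding eventually_at by (auto simp: dist_real_def)

text \<open>Meant for \<open>Psi\<close>, which is only known to be C1 because \<open>Gam\<close>
  enters it. The regularity that \<open>creg\<close> asks of a displaced curve is drawn from
  continuity of the derivative in each fixed direction.\<close>

lemma C1_comp_regular:
  fixes T :: "'e::euclidean_space \<Rightarrow> 'd::real_normed_vector" and y :: "real \<Rightarrow> 'e"
  assumes T: "\<And>x. x \<in> U \<Longrightarrow> (T has_derivative DT x) (at x)" and DT: "\<And>w. continuous_on U (\<lambda>x. DT x w)" and U: "open U"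
    and y: "\<forall>\<^sub>F u in nhds t. y u \<in> U \<and> y differentiable (at u)" and co: "isCont (\<lambda>u. vector_derivative y (at u)) t"
  shows "(\<forall>\<^sub>F u in nhds t. (\<lambda>u. T (y u)) differentiable (at u)) \<and> isCont (\<lambda>u. vector_derivative (\<lambda>u. T (y u)) (at u)) t"
    "vector_derivative (\<lambda>u. T (y u)) (at t) = DT (y t) (vector_derivative y (at t))"
proof -
  obtain N where N: "open N" "t \<in> N" "\<And>u. u \<in> N \<Longrightarrow> y u \<in> U \<and> y differentiable (at u)"
    using y unfolding eventually_nhds by blast
  have evN: "\<forall>\<^sub>F u in nhds t. u \<in> N" using N by (rule_tac eventually_nhds_in_open)
  have yd: "(y has_vector_derivative vector_derivative y (at u)) (at u)" if "u \<in> N" for u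
    using N(3)[OF that] by (simp add: vector_derivative_works)
  have dv: "((\<lambda>u. T (y u)) has_vector_derivative DT (y u) (vector_derivative y (at u))) (at u)" if u: "u \<in> N" for u
    using vector_derivative_diff_chain_within[of y _ u UNIV T "DT (y u)", OF yd[OF u] has_derivative_at_withinI[OF T]] N(3)[OF u]
    by (simp add: o_def)
  have vd: "vector_derivative (\<lambda>u. T (y u)) (at u) = DT (y u) (vector_derivative y (at u))" if "u \<in> N" for u
    by (rule vector_derivative_at[OF dv[OF that]])
  show "vector_derivative (\<lambda>u. T (y u)) (at t) = DT (y t) (vector_derivative y (at t))" by (rule vd[OF N(2)])
  have cy: "isCont y t" by (rule has_vector_derivative_continuous[OF yd[OF N(2)]])
  have "isCont (\<lambda>u. DT (y u) (vector_derivative y (at u))) t"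
  proof (rule isCont_linear_family[where h=DT and x=y])
    show "\<forall>\<^sub>F u in nhds t. linear (DT (y u))"
      using evN by eventually_elim (use N(3) has_derivative_linear[OF T] in blast)
    show "isCont (\<lambda>u. DT (y u) b) t" for b
      by (rule isCont_o2[OF cy]) (use DT U N(3)[OF N(2)] in \<open>simp add: continuous_on_eq_continuous_at\<close>)
  qed (rule co)
  moreover have "\<forall>\<^sub>F u in nhds t. DT (y u) (vector_derivative y (at u)) = vector_derivative (\<lambda>u. T (y u)) (at u)"
    using evN by eventually_elim (simp add: vd)
  ultimately have "isCont (\<lambda>u. vector_derivative (\<lambda>u. T (y u)) (at u)) t" by (simp add: isCont_cong)
  moreover have "\<forall>\<^sub>F u in nhds t. (\<lambda>u. T (y u)) differentiable (at u)"
    using evN by eventually_elim (rule differentiableI_vector[OF dv])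
  ultimately show "(\<forall>\<^sub>F u in nhds t. (\<lambda>u. T (y u)) differentiable (at u)) \<and> isCont (\<lambda>u. vector_derivative (\<lambda>u. T (y u)) (at u)) t"
    by blast
qed

text \<open>The speed of a displaced curve is continuous off a finite set, but no bound near that
  set is at hand. A multiple of the speed of the original curve dominates it, and that one is
  integrable.\<close>

lemma integrable_dominated:
  fixes f h :: "real \<Rightarrow> real"
  assumes S: "finite S" and f: "continuous_on ({a<..<b} - S) f" and h: "h integrable_on {a..b}"
    and le: "\<And>t. t \<in> {a<..<b} - S \<Longrightarrow> \<bar>f t\<bar> \<le> h t"
  shows "(\<lambda>t. if t \<in> S \<union> {a, b} then 0 else f t) integrable_on {a..b}"
proof -
  let ?T = "{a<..<b} - S"
  have T: "?T \<in> sets lebesgue" using S by (intro lmeasurable_open[THEN fmeasurableD] open_Diff finite_imp_closed) (auto intro: bounded_subset[of "{a..b}"])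
  have neg: "negligible (S \<union> {a, b})" using S by (simp add: negligible_finite)
  have "h integrable_on ?T"
    by (rule integrable_spike_set[OF h]) (rule negligible_subset[OF neg], force)+
  then have "f integrable_on ?T"
    by (rule measurable_bounded_by_integrable_imp_integrable[OF continuous_imp_measurable_on_sets_lebesgue[OF f T]])
       (use le T in auto)
  then have "f integrable_on {a..b}"
    by (rule integrable_spike_set) (rule negligible_subset[OF neg], force)+
  then show ?thesis by (rule integrable_spike[OF _ neg]) auto
qed

text \<open>Passes from squared speeds to speeds by concavity of the root and
  \<open>sqrt (1 + h) \<le> 1 + h / 2\<close>, which halves the second order coefficient.\<close>

lemma sqrt_sum_le:
  fixes p q m h :: real
  assumes "p + q \<le> (2 + 2 * h) * m" "0 \<le> p" "0 \<le> q" "0 \<le> h" "0 \<le> m"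
  shows "sqrt p + sqrt q \<le> (2 + h) * sqrt m"
proof (rule power2_le_imp_le)
  have "(sqrt p + sqrt q)\<^sup>2 \<le> 2 * (p + q)"
    using assms sum_squares_bound[of "sqrt p" "sqrt q"] by (simp add: power2_sum)
  also have "\<dots> \<le> 2 * ((2 + 2 * h) * m)" using assms by simp
  also have "\<dots> \<le> (2 + h)\<^sup>2 * m"
  proof -
    have "(2 + h)\<^sup>2 * m - 2 * ((2 + 2 * h) * m) = h\<^sup>2 * m" by (simp add: power2_eq_square algebra_simps)
    moreover have "h\<^sup>2 * m \<ge> 0" using assms by simp
    ultimately show ?thesis by linarith
  qed
  also have "\<dots> = ((2 + h) * sqrt m)\<^sup>2" using assms by (simp add: power_mult_distrib)
  finally show "(sqrt p + sqrt q)\<^sup>2 \<le> ((2 + h) * sqrt m)\<^sup>2" .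
qed (use assms in auto)

text \<open>The global form of \<open>lchart\<close>: a single map \<open>FF\<close> into the flat
  space whose chart representations all induce the metric, together with the lower curvature bound
  \<open>- \<kappa>\<close> in the shape of \<open>curvature_lower_bound\<close>.\<close>

locale rlor = riem_conn M for M :: "('a, 'e::euclidean_space, 'z) riemannian_scheme" +
  fixes FF :: "'a \<Rightarrow> 'l::euclidean_space" and Q :: "'l \<Rightarrow> 'l \<Rightarrow> real" and \<kappa> :: real
  assumes lc: "c \<in> atlas M \<Longrightarrow> lchart (coords c) (\<lambda>x. FF (ci c x)) Q (rm c)"
    and \<kappa>: "\<kappa> \<ge> 0"
    and curv: "c \<in> atlas M \<Longrightarrow> x \<in> coords c \<Longrightarrow>
      - rm c x (lchart.Rm (\<lambda>x. FF (ci c x)) Q (rm c) x u v v) u \<le> \<kappa> * (rm c x u u * rm c x v v)"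
begin

abbreviation "Fc c \<equiv> \<lambda>x. FF (ci c x)"
abbreviation "Gc c \<equiv> lchart.Gam (Fc c) Q (rm c)"
abbreviation "alc c \<equiv> lchart.al (Fc c) Q (rm c)"

text \<open>A substitute for the geodesic through \<open>z\<close> with velocity \<open>v\<close>:
  the covariant acceleration vanishes at \<open>z\<close>, and the curve is determined up to
  \<open>o(s\<^sup>2)\<close>, which is all that second differences see.\<close>

definition "gjet z c v \<sigma> \<longleftrightarrow> c \<in> atlas M \<and> z \<in> fst c \<and> (\<forall>\<^sub>F s in at 0. \<sigma> s \<in> fst c)
   \<and> jet2 (\<lambda>s. snd c (\<sigma> s)) (snd c z) v (- Gc c (snd c z) v v)"

text \<open>The acceleration \<open>- Gam\<close> cancels the tangential part of the second
  derivative of the immersion. So second differences of a component of \<open>FF\<close> along such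
  curves read off that component of \<open>al\<close>.\<close>

lemma gjet_F:
  assumes j: "gjet z c v \<sigma>"
  shows "jet2 (\<lambda>s. FF (\<sigma> s)) (FF z) (fd (Fc c) (snd c z) v) (alc c (snd c z) v v)"
proof -
  have c: "c \<in> atlas M" "z \<in> fst c" using j by (auto simp: gjet_def)
  interpret C: lchart "coords c" "Fc c" Q "rm c" by (rule lc[OF c(1)])
  have x: "snd c z \<in> coords c" using c by blast
  have 1: "jet2 (\<lambda>s. Fc c (snd c (\<sigma> s))) (Fc c (snd c z)) (fd (Fc c) (snd c z) v)
     (fd (Fc c) (snd c z) (- Gc c (snd c z) v v) + fd (\<lambda>y. fd (Fc c) y v) (snd c z) v)"
    using j unfolding gjet_def by (intro jet2_map[OF C.U C.F x]) blast
  have 2: "fd (Fc c) (snd c z) (- Gc c (snd c z) v v) + fd (\<lambda>y. fd (Fc c) y v) (snd c z) v = alc c (snd c z) v v"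
    by (simp add: C.al_def linear_neg[OF C.lin_D[OF x]])
  have 3: "\<forall>\<^sub>F s in at 0. Fc c (snd c (\<sigma> s)) = FF (\<sigma> s)"
  proof -
    have "\<forall>\<^sub>F s in at 0. \<sigma> s \<in> fst c" using j by (simp add: gjet_def)
    then show ?thesis by eventually_elim (simp add: ci_snd[OF c(1)])
  qed
  from jet2_cong[OF 1 3] show ?thesis unfolding 2 ci_snd[OF c] .
qed

lemma fd_Fc_transition:
  assumes c: "c \<in> atlas M" "c' \<in> atlas M" and x: "x \<in> transition_dom c c'"
  shows "fd (Fc c) x u = fd (Fc c') (transition c c' x) (fd (transition c c') x u)"
proof -
  interpret C': lchart "coords c'" "Fc c'" Q "rm c'" by (rule lc[OF c(2)])
  have x': "transition c c' x \<in> coords c'" using x tdom[OF c(1), of x c'] by (simp add: transition_eq)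
  have "((\<lambda>y. Fc c' (transition c c' y)) has_derivative (\<lambda>u. fd (Fc c') (transition c c' x) (fd (transition c c') x u))) (at x)"
    by (rule has_derivative_compose[OF smooth_on_has_derivative[OF smooth_transition[OF c] x] smooth_on_has_derivative[OF C'.F x']])
  then have "(Fc c has_derivative (\<lambda>u. fd (Fc c') (transition c c' x) (fd (transition c c') x u))) (at x)"
  proof (rule has_derivative_transform_within_open[OF _ open_tdom[OF c] x])
    fix y assume "y \<in> transition_dom c c'"
    then have "ci c y \<in> fst c'" using tdom[OF c(1), of y c'] by simp
    then show "Fc c' (transition c c' y) = Fc c y" using ci_snd[OF c(2)] by (simp add: transition_eq)
  qed
  then show ?thesis by (rule fd_eqI)
qed

text \<open>The curve in the flat space does not depend on the chart. Its second order term is the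
  normal vector \<open>al\<close> when computed in \<open>c\<close>, and \<open>al\<close> plus the
  image of \<open>w\<close> when computed in \<open>c'\<close>; so the image of \<open>w\<close> is
  tangent and normal at once, and \<open>w = 0\<close>. This takes the place of the transformation
  law of Christoffel symbols.\<close>

lemma gjet_change:
  assumes j: "gjet z c v \<sigma>" and c': "c' \<in> atlas M" "z \<in> fst c'"
  shows "\<exists>v'. gjet z c' v' \<sigma> \<and> rm c' (snd c' z) v' v' = rm c (snd c z) v v"
proof -
  have c: "c \<in> atlas M" "z \<in> fst c" using j by (auto simp: gjet_def)
  interpret C: lchart "coords c" "Fc c" Q "rm c" by (rule lc[OF c(1)])
  interpret C': lchart "coords c'" "Fc c'" Q "rm c'" by (rule lc[OF c'(1)])
  let ?T = "transition c c'" and ?x = "snd c z" and ?x' = "snd c' z"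
  have x: "?x \<in> coords c" and x': "?x' \<in> coords c'" using c c' by blast+
  have xt: "?x \<in> transition_dom c c'" using tdom[OF c(1), of ?x c'] x ci_snd[OF c] c' by simp
  have Tx: "?T ?x = ?x'" using ci_snd[OF c] by (simp add: transition_eq)
  have sT: "smooth_on (transition_dom c c') ?T" by (rule smooth_transition[OF c(1) c'(1)])
  note oT = open_tdom[OF c(1) c'(1)]
  have jy: "jet2 (\<lambda>s. snd c (\<sigma> s)) ?x v (- Gc c ?x v v)" and es: "\<forall>\<^sub>F s in at 0. \<sigma> s \<in> fst c"
    using j by (auto simp: gjet_def)
  have evt: "\<forall>\<^sub>F s in at 0. snd c (\<sigma> s) \<in> transition_dom c c'"
    by (rule topological_tendstoD[OF jet2_tendsto[OF jy] oT xt])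
  have es': "\<forall>\<^sub>F s in at 0. \<sigma> s \<in> fst c'"
    using evt es by eventually_elim (use tdom[OF c(1), of _ c'] ci_snd[OF c(1)] in fastforce)
  define v' where "v' = fd ?T ?x v"
  define q' where "q' = fd ?T ?x (- Gc c ?x v v) + fd (\<lambda>y. fd ?T y v) ?x v"
  have "jet2 (\<lambda>s. ?T (snd c (\<sigma> s))) (?T ?x) v' q'"
    unfolding v'_def q'_def by (rule jet2_map[OF oT sT xt jy])
  moreover have "\<forall>\<^sub>F s in at 0. ?T (snd c (\<sigma> s)) = snd c' (\<sigma> s)"
    using es by eventually_elim (simp add: transition_eq ci_snd[OF c(1)])
  ultimately have jy': "jet2 (\<lambda>s. snd c' (\<sigma> s)) ?x' v' q'" unfolding Tx by (rule jet2_cong)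
  have "jet2 (\<lambda>s. Fc c' (snd c' (\<sigma> s))) (Fc c' ?x') (fd (Fc c') ?x' v') (fd (Fc c') ?x' q' + fd (\<lambda>y. fd (Fc c') y v') ?x' v')"
    by (rule jet2_map[OF C'.U C'.F x' jy'])
  moreover have "\<forall>\<^sub>F s in at 0. Fc c' (snd c' (\<sigma> s)) = FF (\<sigma> s)"
    using es' by eventually_elim (simp add: ci_snd[OF c'(1)])
  ultimately have "jet2 (\<lambda>s. FF (\<sigma> s)) (FF z) (fd (Fc c') ?x' v') (fd (Fc c') ?x' q' + fd (\<lambda>y. fd (Fc c') y v') ?x' v')"
    unfolding ci_snd[OF c'] by (rule jet2_cong)
  from jet2_unique(2)[OF gjet_F[OF j] this]
  have al: "alc c ?x v v = fd (Fc c') ?x' q' + fd (\<lambda>y. fd (Fc c') y v') ?x' v'" .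
  define w where "w = q' + Gc c' ?x' v' v'"
  have Dw: "alc c ?x v v - alc c' ?x' v' v' = fd (Fc c') ?x' w"
    unfolding al C'.al_def w_def by (simp add: linear_add[OF C'.lin_D[OF x']])
  have chain: "fd (Fc c) ?x u = fd (Fc c') ?x' (fd ?T ?x u)" for u
    using fd_Fc_transition[OF c(1) c'(1) xt] Tx by simp
  have lT: "linear (fd ?T ?x)" by (rule smooth_on_fd_linear[OF sT xt])
  have "inj (fd ?T ?x)" unfolding linear_injective_0[OF lT]
  proof (intro allI impI)
    fix u assume "fd ?T ?x u = 0"
    then have "fd (Fc c) ?x u = 0" using chain[of u] linear_0[OF C'.lin_D[OF x']] by simp
    then have "rm c ?x u u = 0" by (simp add: C.g_eq[OF x] C.Q_simps)
    then show "u = 0" using C.g_pos[OF x, of u] by force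
  qed
  then have "surj (fd ?T ?x)" by (rule linear_inj_imp_surj[OF lT])
  then obtain u where u: "fd ?T ?x u = w" by (metis surj_def)
  have "Q (alc c ?x v v - alc c' ?x' v' v') (fd (Fc c') ?x' w) = 0"
    using C.al_normal[OF x, of v v u] C'.al_normal[OF x', of v' v' w] chain[of u] u by (simp add: C.Q_simps)
  then have "rm c' ?x' w w = 0" unfolding Dw by (simp add: C'.g_eq[OF x'])
  then have "w = 0" using C'.g_pos[OF x', of w] by force
  then have "q' = - Gc c' ?x' v' v'" by (simp add: w_def eq_neg_iff_add_eq_0)
  then have "gjet z c' v' \<sigma>" unfolding gjet_def using c' es' jy' by simp
  moreover have "rm c' ?x' v' v' = rm c ?x v v"
    using metric_transform[OF c(1) c'(1) xt, of v v] by (simp add: Tx v'_def)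
  ultimately show ?thesis by blast
qed

lemma local_upper:
  assumes c: "c \<in> atlas M" and x0: "x0 \<in> coords c"
  shows "\<exists>r>0. \<exists>K>0. ball x0 r \<subseteq> coords c \<and> (\<forall>x\<in>ball x0 r. \<forall>z\<in>ball x0 r. dM (ci c x) (ci c z) \<le> K * norm (z - x))"
proof -
  obtain r K where rK: "r > 0" "K > 0" "cball x0 r \<subseteq> coords c"
    "\<And>\<xi> w. \<xi> \<in> cball x0 r \<Longrightarrow> sqrt (rm c \<xi> w w) \<le> K * norm w"
    using chart_nbhd[OF c x0] by blast
  have "dM (ci c x) (ci c z) \<le> K * norm (z - x)" if "x \<in> ball x0 r" "z \<in> ball x0 r" for x z
  proof -
    have "closed_segment x z \<subseteq> ball x0 r" using that by (intro closed_segment_subset convex_ball)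
    then have s: "closed_segment x z \<subseteq> cball x0 r" using ball_subset_cball by blast
    then have "closed_segment x z \<subseteq> coords c" using rK(3) by blast
    from riem_dist_le_line[OF c this] show ?thesis using rK(4) s by blast
  qed
  moreover have "ball x0 r \<subseteq> coords c" using rK(3) ball_subset_cball by blast
  ultimately show ?thesis using rK(1,2) by blast
qed

lemma jet_dist_small:
  assumes c: "c \<in> atlas M" and x0: "x0 \<in> coords c" and j: "jet2 y x0 v q" "jet2 y' x0 v q" and e: "e > 0"
  shows "\<forall>\<^sub>F s in at 0. dM (ci c (y s)) (ci c (y' s)) \<le> e * s\<^sup>2"
proof -
  obtain r K where rK: "r > 0" "K > 0"
    "\<And>x z. x \<in> ball x0 r \<Longrightarrow> z \<in> ball x0 r \<Longrightarrow> dM (ci c x) (ci c z) \<le> K * norm (z - x)"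
    using local_upper[OF c x0] by blast
  have "e / K > 0" using e rK by simp
  from jet2_diff_small[OF j(2,1) this] tendstoD[OF jet2_tendsto[OF j(1)] rK(1)] tendstoD[OF jet2_tendsto[OF j(2)] rK(1)]
  show ?thesis
  proof eventually_elim
    case (elim s)
    have "dM (ci c (y s)) (ci c (y' s)) \<le> K * norm (y' s - y s)" using elim by (intro rK(3)) (auto simp: dist_commute)
    also have "\<dots> \<le> K * (e / K * s\<^sup>2)" using elim(1) rK(2) by (intro mult_left_mono) auto
    finally show ?case using rK(2) by simp
  qed
qed

text \<open>The curve is displaced by \<open>Psi\<close> for \<open>s\<close> and for
  \<open>- s\<close>. At each regular time the hypothesis bounds the sum of the two squared speeds,
  \<open>sqrt_sum_le\<close> then the sum of the speeds, and integration the sum of the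
  lengths.\<close>

lemma displaced_dist:
  fixes c :: "('a, 'e) chart" and V :: "'e \<Rightarrow> 'e" and dV :: "'e \<Rightarrow> 'e \<Rightarrow> 'e" and s :: real
  defines "P \<equiv> lchart.Psi (Fc c) Q (rm c) V" and "DP \<equiv> lchart.DPsi (Fc c) Q (rm c) V dV"
  assumes c: "c \<in> atlas M"
    and V: "\<And>x. x \<in> coords c \<Longrightarrow> (V has_derivative dV x) (at x)" and dV: "\<And>w. continuous_on (coords c) (\<lambda>x. dV x w)"
    and C: "C \<subseteq> coords c" and h: "h \<ge> 0"
    and bd: "\<And>x. x \<in> C \<Longrightarrow> P s x \<in> coords c \<and> P (- s) x \<in> coords c \<and> (\<forall>w. rm c (P s x) (DP s x w) (DP s x w)
        + rm c (P (- s) x) (DP (- s) x w) (DP (- s) x w) \<le> (2 + 2 * h) * rm c x w w)"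
    and g: "seg \<gamma> a b" "(speed M \<gamma> has_integral L) {a..b}" "a < b" "\<gamma> ` {a..b} \<subseteq> ci c ` C"
  shows "dM (ci c (P s (snd c (\<gamma> a)))) (ci c (P s (snd c (\<gamma> b))))
     + dM (ci c (P (- s) (snd c (\<gamma> a)))) (ci c (P (- s) (snd c (\<gamma> b)))) \<le> (2 + h) * L"
proof -
  interpret C: lchart "coords c" "Fc c" Q "rm c" by (rule lc[OF c])
  have Pd: "(P r has_derivative DP r x) (at x)" if "x \<in> coords c" for r x
    unfolding P_def DP_def by (rule C.Psi_deriv[OF V dV that])
  have Pc: "continuous_on (coords c) (P r)" for r
    by (intro continuous_at_imp_continuous_on ballI has_derivative_continuous[OF Pd])
  have DPc: "continuous_on S (\<lambda>z. DP r (f z) (w z))"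
    if "continuous_on S f" "continuous_on S w" "f ` S \<subseteq> coords c" for S :: "real set" and r f w
    unfolding DP_def by (rule C.bV_continuous_on(3)[OF V dV that])
  have DPc1: "continuous_on (coords c) (\<lambda>x. DP r x w)" for r w
  proof -
    have "(\<lambda>x::'e. x) ` coords c \<subseteq> coords c" by auto
    from C.bV_continuous_on(3)[OF V dV continuous_on_id continuous_on_const this]
    show ?thesis unfolding DP_def .
  qed
  obtain S where S: "finite S" "\<And>t. t \<in> {a<..<b} - S \<Longrightarrow> \<exists>c\<in>atlas M. creg c \<gamma> t" using seg_good[OF g(1)] by blast
  define y where "y = snd c \<circ> \<gamma>"
  have yC: "\<gamma> t \<in> fst c \<and> y t \<in> C" if t: "t \<in> {a..b}" for t
  proof -
    have "\<gamma> t \<in> ci c ` C" using g(4) t by blast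
    then obtain \<xi> where "\<xi> \<in> C" "\<gamma> t = ci c \<xi>" by blast
    moreover from this C have "\<xi> \<in> coords c" by blast
    ultimately show ?thesis using ci_in[of \<xi> c] snd_ci[of \<xi> c] by (simp add: y_def)
  qed
  have reg: "creg c \<gamma> t" if t: "t \<in> {a<..<b} - S" for t
  proof -
    obtain c' where c': "c' \<in> atlas M" "creg c' \<gamma> t" using S(2)[OF t] by blast
    have "\<gamma> t \<in> fst c" using yC t by auto
    then show ?thesis by (rule creg_change(1)[OF c'(1) c c'(2)])
  qed
  have yr: "\<forall>\<^sub>F u in nhds t. y u \<in> coords c \<and> y differentiable (at u)" "isCont (\<lambda>u. vector_derivative y (at u)) t"
    if t: "t \<in> {a<..<b} - S" for t
  proof -
    show "isCont (\<lambda>u. vector_derivative y (at u)) t" using reg[OF t] unfolding creg_def y_def by blast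
    have "\<forall>\<^sub>F u in nhds t. \<gamma> u \<in> fst c \<and> y differentiable (at u)" using reg[OF t] unfolding creg_def y_def by blast
    then show "\<forall>\<^sub>F u in nhds t. y u \<in> coords c \<and> y differentiable (at u)"
      by eventually_elim (auto simp: y_def)
  qed
  let ?y' = "\<lambda>t. vector_derivative y (at t)"
  have cy: "continuous_on {a..b} y"
  proof -
    have "\<gamma> ` {a..b} \<subseteq> fst c" using yC by blast
    then have "continuous_map (top_of_set {a..b}) (subtopology (mtop M) (fst c)) \<gamma>"
      using g(1) by (simp add: seg_def continuous_map_in_subtopology image_subset_iff_funcset)
    from continuous_map_compose[OF this continuous_chart[OF c]]
    show ?thesis by (simp add: continuous_map_in_subtopology y_def)
  qed
  have yU: "y ` {a..b} \<subseteq> coords c" using yC C by blast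
  let ?T = "{a<..<b} - S"
  have Tsub: "?T \<subseteq> {a..b}" by auto
  have cyT: "continuous_on ?T y" by (rule continuous_on_subset[OF cy Tsub])
  have yUT: "y ` ?T \<subseteq> coords c" using yU Tsub by blast
  have cy'T: "continuous_on ?T ?y'" by (intro continuous_at_imp_continuous_on ballI yr(2))
  have sp: "speed M \<gamma> t = sqrt (rm c (y t) (?y' t) (?y' t))" if "t \<in> ?T" for t
    using speed_eq[OF c reg[OF that]] by (simp add: y_def)
  define f where "f r t = sqrt (rm c (P r (y t)) (DP r (y t) (?y' t)) (DP r (y t) (?y' t)))" for r t
  have PU: "P r (y t) \<in> coords c" if "r = s \<or> r = - s" "t \<in> {a..b}" for r t
    using bd[of "y t"] yC[OF that(2)] that(1) by auto
  have le: "f s t + f (- s) t \<le> (2 + h) * speed M \<gamma> t" if t: "t \<in> ?T" for t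
  proof -
    have tab: "t \<in> {a..b}" using t by auto
    have yt: "y t \<in> coords c" using yU tab by blast
    show ?thesis unfolding f_def sp[OF t]
    proof (rule sqrt_sum_le[OF _ _ _ h])
      show "rm c (P s (y t)) (DP s (y t) (?y' t)) (DP s (y t) (?y' t)) +
        rm c (P (- s) (y t)) (DP (- s) (y t) (?y' t)) (DP (- s) (y t) (?y' t)) \<le> (2 + 2 * h) * rm c (y t) (?y' t) (?y' t)"
        using bd[of "y t"] yC[OF tab] by blast
    qed (use C.g_nonneg PU tab yt in auto)
  qed
  have f0: "f r t \<ge> 0" if "r = s \<or> r = - s" "t \<in> ?T" for r t
    unfolding f_def using C.g_nonneg[OF PU[OF that(1)]] that(2) by auto
  have int: "(\<lambda>t. if t \<in> S \<union> {a, b} then 0 else f r t) integrable_on {a..b}" if r: "r = s \<or> r = - s" for r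
  proof (rule integrable_dominated[OF S(1), of _ _ _ "\<lambda>t. (2 + h) * speed M \<gamma> t"])
    have cP: "continuous_on ?T (\<lambda>t. P r (y t))" by (rule continuous_on_compose2[OF Pc cyT yUT])
    show "continuous_on ?T (f r)" unfolding f_def
      by (intro continuous_on_real_sqrt C.g_continuous_on cP DPc cyT cy'T yUT) (use PU[OF r] in auto)
    show "(\<lambda>t. (2 + h) * speed M \<gamma> t) integrable_on {a..b}" using g(2) by (intro integrable_on_mult_right) blast
    show "\<bar>f r t\<bar> \<le> (2 + h) * speed M \<gamma> t" if "t \<in> ?T" for t
      using le[OF that] f0[of s t] f0[of "- s" t] that r by auto
  qed
  define I where "I r = integral {a..b} (\<lambda>t. if t \<in> S \<union> {a, b} then 0 else f r t)" for r
  have cn: "conn (ci c (P r (snd c (\<gamma> a)))) (ci c (P r (snd c (\<gamma> b)))) (I r)" if r: "r = s \<or> r = - s" for r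
  proof -
    have co: "continuous_on {a..b} (\<lambda>t. P r (y t))" by (rule continuous_on_compose2[OF Pc cy yU])
    have im: "(\<lambda>t. P r (y t)) ` {a..b} \<subseteq> coords c" using PU[OF r] by blast
    have good: "(\<forall>\<^sub>F u in nhds t. (\<lambda>t. P r (y t)) differentiable (at u)) \<and> isCont (\<lambda>u. vector_derivative (\<lambda>t. P r (y t)) (at u)) t"
      and vd: "vector_derivative (\<lambda>t. P r (y t)) (at t) = DP r (y t) (?y' t)" if "t \<in> ?T" for t
      using C1_comp_regular[where T="P r" and DT="DP r", OF Pd DPc1 C.U yr(1)[OF that] yr(2)[OF that]] by auto
    note cc = chart_curve[OF c co im S(1) good]
    have "((\<lambda>t. if t \<in> S \<union> {a, b} then 0 else f r t) has_integral I r) {a..b}"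
      unfolding I_def by (rule integrable_integral[OF int[OF r]])
    then have "(speed M (\<lambda>t. ci c (P r (y t))) has_integral I r) {a..b}"
      by (rule has_integral_spike_finite[where S="S \<union> {a, b}", rotated 2])
         (use S(1) cc(2) vd in \<open>auto simp: f_def\<close>)
    then show ?thesis unfolding conn_def using cc(1) g(3)
      by (intro exI[of _ "\<lambda>t. ci c (P r (y t))"] exI[of _ a] exI[of _ b]) (auto simp: y_def)
  qed
  have "I s + I (- s) = integral {a..b} (\<lambda>t. (if t \<in> S \<union> {a, b} then 0 else f s t) + (if t \<in> S \<union> {a, b} then 0 else f (- s) t))"
    unfolding I_def by (rule integral_add[symmetric]) (rule int, simp)+
  also have "\<dots> \<le> integral {a..b} (\<lambda>t. if t \<in> S \<union> {a, b} then 0 else (2 + h) * speed M \<gamma> t)"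
  proof (rule integral_le)
    show "(\<lambda>t. (if t \<in> S \<union> {a, b} then 0 else f s t) + (if t \<in> S \<union> {a, b} then 0 else f (- s) t)) integrable_on {a..b}"
      by (rule integrable_add) (rule int, simp)+
    show "(\<lambda>t. if t \<in> S \<union> {a, b} then 0 else (2 + h) * speed M \<gamma> t) integrable_on {a..b}"
    proof (rule integrable_spike[where S="S \<union> {a, b}"])
      show "(\<lambda>t. (2 + h) * speed M \<gamma> t) integrable_on {a..b}" using g(2) by (intro integrable_on_mult_right) blast
    qed (use S(1) in \<open>auto intro: negligible_finite\<close>)
    fix t assume t: "t \<in> {a..b}"
    show "(if t \<in> S \<union> {a, b} then 0 else f s t) + (if t \<in> S \<union> {a, b} then 0 else f (- s) t)
       \<le> (if t \<in> S \<union> {a, b} then 0 else (2 + h) * speed M \<gamma> t)"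
      using le[of t] t by auto
  qed
  also have "\<dots> = (2 + h) * L"
  proof (rule integral_unique)
    show "((\<lambda>t. if t \<in> S \<union> {a, b} then 0 else (2 + h) * speed M \<gamma> t) has_integral (2 + h) * L) {a..b}"
      by (rule has_integral_spike_finite[OF _ _ has_integral_mult_right[OF g(2)], of "S \<union> {a, b}"]) (use S in auto)
  qed
  finally show ?thesis using riem_dist_le[OF cn[of s]] riem_dist_le[OF cn[of "- s"]] by simp
qed

end

section \<open>Arithmetic for a single link of the chain\<close>

lemma frac_rearrange: "t * (c * n / l) = t / l * c * n" for t c n l :: real
  by simp

text \<open>The error budget of \<open>link_chart\<close>: \<open>e / 4\<close> for the bound at
  \<open>x\<close>, \<open>e / 4\<close> for the variation of length between \<open>x\<close> and
  \<open>y\<close>, and twice \<open>e / 8\<close> for exchanging the displaced \<open>y\<close> for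
  the given curve.\<close>

lemma second_difference_sum:
  fixes S :: real
  assumes "d1 \<le> a1 + b1 + c1" "d2 \<le> a2 + b2 + c2" "a1 + a2 \<le> 2 * D + S * (X + e / 4)" "b1 + b2 \<le> 2 * l + S * Y"
    "c1 \<le> e / 8 * S" "c2 \<le> e / 8 * S" "X + Y \<le> Z + e / 4" "0 \<le> S" "D + l \<le> D'" "0 \<le> e"
  shows "d1 + d2 \<le> 2 * D' + S * (Z + e)"
proof -
  have "S * (X + Y) \<le> S * (Z + e / 4)" using assms by (intro mult_left_mono)
  moreover have "0 \<le> S * e" using assms by simp
  ultimately show ?thesis using assms(1-6,9) by (simp add: algebra_simps)
qed

text \<open>The two terms stem from the derivative of the factor \<open>lam\<close> and from the
  covariant derivative of \<open>ev\<close>. With \<open>10201/10000 = (101/100)\<^sup>2\<close> the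
  numbers are \<open>(101/100) ^ 3 \<le> 104/100\<close> and
  \<open>(104/100) / 100 \<le> 2 / 100\<close>.\<close>

lemma gradient_estimate:
  fixes q s n :: real
  assumes "0 \<le> q" "0 \<le> s" "0 \<le> n"
  shows "(q * (10201/10000) * n) * ((101/100) * s) + (104/100) * (1/100 * (n * s)) \<le> ((104/100) * q + 2 / 100) * s * n"
proof -
  have "q * (s * n) \<ge> 0" "s * n \<ge> 0" using assms by simp_all
  then show ?thesis by (simp add: algebra_simps)
qed

text \<open>Since \<open>2 / 100 * (101/100) ^ 3 \<le> 3 / 100\<close>; this is the origin of
  \<open>3 / 100\<close> in \<open>lstep\<close>.\<close>

lemma norm_growth_estimate:
  fixes l s :: real
  assumes "0 \<le> l"
  shows "2 * ((1/100 * (((101/100) * ((101/100) * l)) * s)) * ((101/100) * s)) \<le> 3 / 100 * l * (s * s)"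
proof -
  have "l * (s * s) \<ge> 0" using assms by simp
  then show ?thesis by (simp add: algebra_simps)
qed

lemma mvt_bound: "e1 - e0 = (1 - 0) * d \<Longrightarrow> d \<le> b * v \<Longrightarrow> e0 = v \<Longrightarrow> e1 \<le> (1 + b) * v" for v :: real
  by (simp add: distrib_right)

lemma lstep_expand: "t * B * (u * v) + ((a + k) * v) * l = (t * u * B + a * l + k * l) * v" for v :: real
  by (simp add: algebra_simps)
lemma abs_convex_le:
  fixes t X b :: real
  assumes t: "0 \<le> t" "t \<le> 1" and X: "\<bar>X\<bar> \<le> b" "1 \<le> b"
  shows "\<bar>t + (1 - t) * X\<bar> \<le> b"
proof -
  have "\<bar>(1 - t) * X\<bar> \<le> (1 - t) * b" unfolding abs_mult using t X by (intro mult_mono) auto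
  moreover have "t * 1 \<le> t * b" using t X by (intro mult_left_mono)
  ultimately have "\<bar>t\<bar> + \<bar>(1 - t) * X\<bar> \<le> b" using t by (simp add: left_diff_distrib)
  then show ?thesis using abs_triangle_ineq[of t "(1 - t) * X"] by linarith
qed

context rlor
begin

text \<open>\<open>hbound bp z \<theta> B\<close>: the second symmetric difference of the distance from \<open>bp\<close> along curves of
  vanishing covariant acceleration, with initial velocity \<open>\<theta> v\<close>, is at most \<open>\<theta>\<^sup>2 B |v|\<^sup>2\<close>.\<close>

definition "hbound bp z \<theta> B \<longleftrightarrow> (\<forall>c v \<sigma> e. gjet z c (\<theta> *\<^sub>R v) \<sigma> \<longrightarrow> e > 0 \<longrightarrow>
   (\<forall>\<^sub>F s in at 0. dM bp (\<sigma> s) + dM bp (\<sigma> (- s)) \<le> 2 * dM bp z + s\<^sup>2 * (\<theta>\<^sup>2 * B * rm c (snd c z) v v + e)))"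

lemma hbound_scale:
  assumes "hbound bp z 1 B" shows "hbound bp z \<theta> B"
  unfolding hbound_def
proof (intro allI impI)
  fix c v \<sigma> and e :: real assume j: "gjet z c (\<theta> *\<^sub>R v) \<sigma>" and e: "e > 0"
  then have c: "c \<in> atlas M" "snd c z \<in> coords c" by (auto simp: gjet_def)
  have "rm c (snd c z) (\<theta> *\<^sub>R v) (\<theta> *\<^sub>R v) = \<theta>\<^sup>2 * rm c (snd c z) v v"
    using metric_bilinear[OF c] by (simp add: bilinear_lmul bilinear_rmul power2_eq_square)
  then have eq: "1\<^sup>2 * B * rm c (snd c z) (\<theta> *\<^sub>R v) (\<theta> *\<^sub>R v) = \<theta>\<^sup>2 * B * rm c (snd c z) v v" by simp
  have "gjet z c (1 *\<^sub>R (\<theta> *\<^sub>R v)) \<sigma>" using j by simp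
  from assms[unfolded hbound_def, rule_format, OF this e]
  show "\<forall>\<^sub>F s in at 0. dM bp (\<sigma> s) + dM bp (\<sigma> (- s)) \<le> 2 * dM bp z + s\<^sup>2 * (\<theta>\<^sup>2 * B * rm c (snd c z) v v + e)"
    unfolding eq .
qed

lemma hbound_mono:
  assumes h: "hbound bp z 1 B" and le: "B \<le> B'" shows "hbound bp z 1 B'"
  unfolding hbound_def
proof (intro allI impI)
  fix c v \<sigma> and e :: real assume j: "gjet z c (1 *\<^sub>R v) \<sigma>" and e: "e > 0"
  then have c: "c \<in> atlas M" "snd c z \<in> coords c" by (auto simp: gjet_def)
  have "B * rm c (snd c z) v v \<le> B' * rm c (snd c z) v v" using le rm_nonneg[OF c] by (rule mult_right_mono)
  then have *: "s\<^sup>2 * (1\<^sup>2 * B * rm c (snd c z) v v + e) \<le> s\<^sup>2 * (1\<^sup>2 * B' * rm c (snd c z) v v + e)" for s :: real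
    by (intro mult_left_mono) auto
  have "\<forall>\<^sub>F s in at 0. dM bp (\<sigma> s) + dM bp (\<sigma> (- s)) \<le> 2 * dM bp z + s\<^sup>2 * (1\<^sup>2 * B * rm c (snd c z) v v + e)"
    using h j e unfolding hbound_def by blast
  then show "\<forall>\<^sub>F s in at 0. dM bp (\<sigma> s) + dM bp (\<sigma> (- s)) \<le> 2 * dM bp z + s\<^sup>2 * (1\<^sup>2 * B' * rm c (snd c z) v v + e)"
    by eventually_elim (use * in \<open>meson add_left_mono order_trans\<close>)
qed

lemma gjet_dist_small:
  assumes j: "gjet z c v \<sigma>" "gjet z c v \<sigma>'" and e: "e > 0"
  shows "\<forall>\<^sub>F s in at 0. dM (\<sigma> s) (\<sigma>' s) \<le> e * s\<^sup>2"
proof -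
  have c: "c \<in> atlas M" "snd c z \<in> coords c" using j by (auto simp: gjet_def)
  have ev: "\<forall>\<^sub>F s in at 0. \<sigma> s \<in> fst c" "\<forall>\<^sub>F s in at 0. \<sigma>' s \<in> fst c" using j by (auto simp: gjet_def)
  have jj: "jet2 (\<lambda>s. snd c (\<sigma> s)) (snd c z) v (- Gc c (snd c z) v v)"
    "jet2 (\<lambda>s. snd c (\<sigma>' s)) (snd c z) v (- Gc c (snd c z) v v)" using j by (auto simp: gjet_def)
  from jet_dist_small[OF c jj e] ev show ?thesis
    by eventually_elim (simp add: ci_snd[OF c(1)])
qed

text \<open>At \<open>bp\<close> the distance has a conical singularity, and only curves of zero
  velocity admit a second order bound: they stay within \<open>o(s\<^sup>2)\<close> of
  \<open>bp\<close>. This is why \<open>hbound\<close> carries a factor \<open>\<theta>\<close>, and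
  it is the start of the chain of links.\<close>

lemma hbound_base:
  assumes bp: "bp \<in> SM" shows "hbound bp bp 0 B"
  unfolding hbound_def
proof (intro allI impI)
  fix c v \<sigma> and e :: real assume j: "gjet bp c (0 *\<^sub>R v) \<sigma>" and e: "e > 0"
  then have c: "c \<in> atlas M" "bp \<in> fst c" by (auto simp: gjet_def)
  interpret C: lchart "coords c" "Fc c" Q "rm c" by (rule lc[OF c(1)])
  have x: "snd c bp \<in> coords c" using c by blast
  have "jet2 (\<lambda>s. snd c bp) (snd c bp) 0 0" unfolding jet2_def by simp
  then have j0: "gjet bp c (0 *\<^sub>R v) (\<lambda>_. bp)" unfolding gjet_def using c by (simp add: C.Gam_simps[OF x])
  have e2: "e / 2 > 0" using e by simp
  note ev = gjet_dist_small[OF j0 j e2]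
  have d0: "dM bp bp = 0" using Metric_space.zero[OF metric bp bp] by simp
  from ev eventually_at_0_minus[OF ev]
  show "\<forall>\<^sub>F s in at 0. dM bp (\<sigma> s) + dM bp (\<sigma> (- s)) \<le> 2 * dM bp bp + s\<^sup>2 * (0\<^sup>2 * B * rm c (snd c bp) v v + e)"
    by eventually_elim (simp add: d0 algebra_simps)
qed

text \<open>The numbers \<open>101/100\<close>, \<open>104/100\<close>, \<open>12/10\<close> come from \<open>\<eta> = 1/100\<close> in \<open>good_nbhd\<close>: they bound small powers of \<open>1 + \<eta>\<close>.\<close>

definition "lstep B l \<theta> = \<theta>\<^sup>2 * (1 + 3 / 100 * l) * B + ((104/100) * ((1 - \<theta>) / l) + 2 / 100)\<^sup>2 * l + (12/10) * \<kappa> * l"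

text \<open>Nearly minimizing curves from \<open>x\<close> to \<open>y\<close> are displaced along \<open>V = lam *\<^sub>R ev y v\<close>, where the factor
  \<open>lam\<close> grows linearly from \<open>\<theta>\<close> at \<open>x\<close> to \<open>1\<close> at \<open>y\<close>. This replaces the second variation formula along
  a minimizing geodesic, so that neither geodesics nor the exponential map are needed.\<close>

lemma link_chart:
  assumes c: "c \<in> atlas M" and x0: "x0 \<in> coords c"
  shows "\<exists>\<rho>>0. \<exists>r>0. cball x0 r \<subseteq> coords c \<and> (\<forall>x\<in>ball x0 \<rho>. \<forall>y\<in>ball x0 \<rho>. \<forall>bp \<theta> B l.
    bp \<in> SM \<longrightarrow> l = dM (ci c x) (ci c y) \<longrightarrow> 0 < l \<longrightarrow> l < \<rho> \<longrightarrow> dM bp (ci c x) + l \<le> dM bp (ci c y) \<longrightarrow> 0 \<le> \<theta> \<longrightarrow> \<theta> \<le> 1 \<longrightarrow> 0 \<le> B \<longrightarrow>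
    hbound bp (ci c x) \<theta> B \<longrightarrow> hbound bp (ci c y) 1 (lstep B l \<theta>))"
proof -
  interpret C: lchart "coords c" "Fc c" Q "rm c" by (rule lc[OF c])
  obtain r1 K where rK: "r1 > 0" "K > 0" "cball x0 r1 \<subseteq> coords c"
    "\<And>\<xi> w. \<xi> \<in> cball x0 r1 \<Longrightarrow> norm w \<le> K * sqrt (rm c \<xi> w w)"
    "\<And>\<xi> w. \<xi> \<in> cball x0 r1 \<Longrightarrow> sqrt (rm c \<xi> w w) \<le> K * norm w"
    using chart_nbhd[OF c x0] by blast
  have "(1/100::real) > 0" by simp
  from C.good_nbhd[OF x0 this] obtain r2 where r2: "r2 > 0" "ball x0 r2 \<subseteq> coords c"
    and good: "\<forall>x\<in>ball x0 r2. \<forall>y\<in>ball x0 r2.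
     (\<forall>w. rm c x w w \<le> (1 + 1/100)\<^sup>2 * rm c y w w) \<and>
     (\<forall>w v. rm c x (C.nv y x w v) (C.nv y x w v) \<le> (1/100)\<^sup>2 * (rm c x w w * rm c y v v)) \<and>
     (\<forall>v. rm c x (C.ev y v x) (C.ev y v x) \<le> (1 + 1/100)\<^sup>2 * rm c y v v)" by blast
  define r where "r = min r1 (r2 / 2)"
  have r: "r > 0" "r \<le> r1" "r < r2" using rK r2 by (auto simp: r_def)
  have cb: "cball x0 r \<subseteq> coords c" "cball x0 r \<subseteq> ball x0 r2" "cball x0 r \<subseteq> cball x0 r1"
    using rK(3) r by auto
  \<comment> \<open>A curve of length at most \<open>2 * l\<close> that starts in the small ball is
    then within \<open>r / 8 + r / 4\<close> of \<open>x0\<close>, so \<open>seg_stay\<close> keeps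
    it in the ball of radius \<open>r\<close>.\<close>
  define \<rho> where "\<rho> = min (r / 8) (r / (8 * K))"
  have \<rho>: "\<rho> > 0" "\<rho> \<le> r / 8" "K * \<rho> \<le> r / 8"
  proof -
    show "\<rho> > 0" "\<rho> \<le> r / 8" using r rK by (auto simp: \<rho>_def)
    have "K * \<rho> \<le> K * (r / (8 * K))" using rK by (intro mult_left_mono) (auto simp: \<rho>_def)
    then show "K * \<rho> \<le> r / 8" using rK by simp
  qed
  have main: "hbound bp (ci c y) 1 (lstep B l \<theta>)"
    if x: "x \<in> ball x0 \<rho>" and y: "y \<in> ball x0 \<rho>" and bp: "bp \<in> SM" and l: "l = dM (ci c x) (ci c y)" "0 < l" "l < \<rho>"
      and tri: "dM bp (ci c x) + l \<le> dM bp (ci c y)" and \<theta>: "0 \<le> \<theta>" "\<theta> \<le> 1" and B: "0 \<le> B" and hb: "hbound bp (ci c x) \<theta> B"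
    for x y bp \<theta> B l
  proof -
    have xb: "x \<in> ball x0 r" "y \<in> ball x0 r" using x y \<rho> r by auto
    have xc: "x \<in> cball x0 r" "y \<in> cball x0 r" using xb by auto
    have xU: "x \<in> coords c" and yU: "y \<in> coords c" using xc cb by auto
    define N where "N u = sqrt (rm c y u u)" for u
    have N0: "N u \<ge> 0" for u using C.g_nonneg[OF yU] by (simp add: N_def)
    have N2: "(N u)\<^sup>2 = rm c y u u" for u using C.g_nonneg[OF yU] by (simp add: N_def)
    have F1: "sqrt (rm c \<xi> w w) \<le> (101/100) * N w" "N w \<le> (101/100) * sqrt (rm c \<xi> w w)" if "\<xi> \<in> cball x0 r" for \<xi> w
    proof -
      have m: "\<xi> \<in> ball x0 r2" "y \<in> ball x0 r2" using that xc cb by auto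
      have "rm c \<xi> w w \<le> (1 + 1/100)\<^sup>2 * rm c y w w" "rm c y w w \<le> (1 + 1/100)\<^sup>2 * rm c \<xi> w w" using good m by blast+
      from this[THEN real_sqrt_le_mono] show "sqrt (rm c \<xi> w w) \<le> (101/100) * N w" "N w \<le> (101/100) * sqrt (rm c \<xi> w w)"
        by (simp_all add: N_def real_sqrt_mult)
    qed
    define m where "m = N (y - x)"
    have xy: "x \<noteq> y"
    proof
      assume "x = y"
      then have "l = 0" using l(1) Metric_space.zero[OF metric] ci_in[OF xU] domain_subset[OF c] by auto
      then show False using l by simp
    qed
    have m: "m > 0" using C.g_pos[OF yU, of "y - x"] xy by (simp add: m_def N_def)
    \<comment> \<open>\<open>F2\<close> and \<open>F4\<close> say that the distance \<open>l\<close>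
      and the chord length \<open>m\<close> in the inner product at \<open>y\<close> agree up to a
      factor \<open>101/100\<close>. One direction uses the straight segment, the other nearly
      minimizing curves.\<close>
    have F2: "l \<le> (101/100) * m"
    proof -
      have seg: "closed_segment x y \<subseteq> cball x0 r" using xc by (intro closed_segment_subset convex_cball)
      have "dM (ci c x) (ci c y) \<le> (101/100) * m"
        by (rule riem_dist_le_line[OF c]) (use seg cb F1 in \<open>auto simp: m_def\<close>)
      then show ?thesis using l by simp
    qed
    have F3: "\<gamma> ` {a..b} \<subseteq> ci c ` ball x0 r \<and> (\<forall>t\<in>{a..b}. N (snd c (\<gamma> t) - x) \<le> (101/100) * L)"
      if g: "seg \<gamma> a b" "(speed M \<gamma> has_integral L) {a..b}" "a < b" "\<gamma> a = ci c x" and L: "L \<le> 2 * l" for \<gamma> a b L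
    proof
      have "K * L \<le> K * (2 * \<rho>)" using L l rK by (intro mult_left_mono) auto
      then have KL: "K * L \<le> r / 4" using \<rho> by simp
      have "norm (x - x0) < \<rho>" using x by (simp add: dist_norm norm_minus_commute)
      then have small: "norm (x - x0) + K * L < r" using KL \<rho> r by linarith
      show st: "\<gamma> ` {a..b} \<subseteq> ci c ` ball x0 r"
        by (rule seg_stay[OF c cb(1) rK(2) _ g(1,2) _ g(4) small]) (use rK(4) cb(3) g(3) in auto)
      have mem: "\<gamma> t \<in> fst c \<and> snd c (\<gamma> t) \<in> cball x0 r" if t: "t \<in> {a..b}" for t
      proof -
        obtain \<xi> where \<xi>: "\<xi> \<in> ball x0 r" "\<gamma> t = ci c \<xi>" using st t by blast
        then have "\<xi> \<in> coords c" using cb ball_subset_cball by blast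
        then show ?thesis using ci_in[of \<xi> c] snd_ci[of \<xi> c] \<xi> by auto
      qed
      show "\<forall>t\<in>{a..b}. N (snd c (\<gamma> t) - x) \<le> (101/100) * L"
      proof
        fix t assume t: "t \<in> {a..b}"
        let ?u = "snd c (\<gamma> t) - x"
        have L0: "L \<ge> 0" by (rule seg_length_nonneg[OF g(1,2)])
        show "N ?u \<le> (101/100) * L"
        proof (cases "N ?u = 0")
          case True then show ?thesis using L0 by simp
        next
          case False
          then have Nu: "N ?u > 0" using N0[of ?u] by simp
          have at: "a \<le> t" "t \<le> b" using t by auto
          note sr = seg_restrict[OF g(1,2) order_refl at(2)]
          have "(\<lambda>w. rm c y w ?u / N ?u) (snd c (\<gamma> t) - snd c (\<gamma> a)) \<le> (101/100) * integral {a..t} (speed M \<gamma>)"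
          proof (rule seg_lower[where l="\<lambda>w. rm c y w ?u / N ?u", OF c sr(1,2) at(1)])
            show "linear (\<lambda>w. rm c y w ?u / N ?u)"
              by (rule linearI) (simp_all only: bilinear_ladd[OF C.g_bilinear[OF yU]] bilinear_lmul[OF C.g_bilinear[OF yU]]
                  add_divide_distrib real_scaleR_def times_divide_eq_right)
            show "\<gamma> ` {a..t} \<subseteq> fst c" using mem t by auto
            fix \<tau> w assume \<tau>: "\<tau> \<in> {a..t}"
            have "rm c y w ?u \<le> N w * N ?u" using C.g_cauchy_schwarz'[OF yU, of w ?u] by (simp add: N_def)
            then have "rm c y w ?u / N ?u \<le> N w" using Nu by (simp add: pos_divide_le_eq)
            also have "\<dots> \<le> (101/100) * sqrt (rm c (snd c (\<gamma> \<tau>)) w w)" by (rule F1(2)) (use mem \<tau> t in auto)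
            finally show "rm c y w ?u / N ?u \<le> (101/100) * sqrt (rm c (snd c (\<gamma> \<tau>)) w w)" .
          qed
          moreover have "snd c (\<gamma> t) - snd c (\<gamma> a) = ?u" using g(4) snd_ci[OF xU] by simp
          moreover have "rm c y ?u ?u / N ?u = N ?u" using Nu N2[of ?u] by (simp add: power2_eq_square[symmetric] divide_simps)
          ultimately have "N ?u \<le> (101/100) * integral {a..t} (speed M \<gamma>)" by simp
          then show ?thesis using sr(3) by simp
        qed
      qed
    qed
    have pS: "ci c x \<in> SM" "ci c y \<in> SM" using ci_in[OF xU] ci_in[OF yU] domain_subset[OF c] by auto
    have curve: "\<exists>\<gamma> a b L. seg \<gamma> a b \<and> (speed M \<gamma> has_integral L) {a..b} \<and> a < b \<and> \<gamma> a = ci c x \<and> \<gamma> b = ci c y \<and> L < l + e \<and> l \<le> L"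
      if e: "e > 0" for e
      using dist_approx[OF pS e] unfolding l(1) conn_def by blast
    have F4: "m \<le> (101/100) * l"
    proof (rule field_le_epsilon)
      fix e :: real assume e: "e > 0"
      define e' where "e' = min l (e / 2)"
      have e': "e' > 0" "e' \<le> l" "(101/100) * e' \<le> e" using e l by (auto simp: e'_def min_def)
      obtain \<gamma> a b L where g: "seg \<gamma> a b" "(speed M \<gamma> has_integral L) {a..b}" "a < b" "\<gamma> a = ci c x" "\<gamma> b = ci c y" "L < l + e'"
        using curve[OF e'(1)] by blast
      have "L \<le> 2 * l" using g(6) e' by linarith
      from F3[OF g(1-4) this] have "N (snd c (\<gamma> b) - x) \<le> (101/100) * L" using g(3) by auto
      then have "m \<le> (101/100) * L" using g(5) snd_ci[OF yU] by (simp add: m_def)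
      then show "m \<le> (101/100) * l + e" using g(6) e' by linarith
    qed
    \<comment> \<open>A compact region containing every curve from \<open>x\<close> of length at
      most \<open>(1005/1000) * l\<close>, because
      \<open>(101/100) * (1005/1000) * (101/100) \<le> 104/100\<close>. The variation estimate is
      applied on it, so its constants do not depend on the curve.\<close>
    define Cc where "Cc = {\<xi> \<in> cball x0 r. N (\<xi> - x) \<le> (104/100) * m}"
    have CcU: "Cc \<subseteq> coords c" using cb by (auto simp: Cc_def)
    have Ccr: "\<xi> \<in> cball x0 r" if "\<xi> \<in> Cc" for \<xi> using that by (simp add: Cc_def)
    have cpC: "compact Cc"
    proof -
      have "continuous_on (cball x0 r) (\<lambda>\<xi>. N (\<xi> - x))" unfolding N_def
        by (intro continuous_on_real_sqrt C.g_continuous_on continuous_intros) (use yU in auto)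
      from continuous_on_closed_Collect_le[OF this continuous_on_const closed_cball]
      have "closed Cc" unfolding Cc_def .
      moreover have "Cc \<subseteq> cball x0 r" by (auto simp: Cc_def)
      ultimately show ?thesis using compact_cball compact_Int_closed[of "cball x0 r" Cc] by (simp add: Int_absorb1)
    qed
    have curveC: "\<gamma> ` {a..b} \<subseteq> ci c ` Cc"
      if g: "seg \<gamma> a b" "(speed M \<gamma> has_integral L) {a..b}" "a < b" "\<gamma> a = ci c x" and L: "L \<le> (1005/1000) * l" for \<gamma> a b L
    proof
      fix p assume "p \<in> \<gamma> ` {a..b}"
      then obtain t where t: "t \<in> {a..b}" "p = \<gamma> t" by blast
      have L2: "L \<le> 2 * l" using L l by linarith
      note f3 = F3[OF g L2]
      obtain \<xi> where \<xi>: "\<xi> \<in> ball x0 r" "\<gamma> t = ci c \<xi>" using f3 t by blast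
      have \<xi>U: "\<xi> \<in> coords c" using \<xi> cb ball_subset_cball by blast
      have "N (\<xi> - x) \<le> (101/100) * L" using f3 t snd_ci[OF \<xi>U] \<xi> by (metis (no_types, lifting))
      also have "\<dots> \<le> (104/100) * m" using L F2 m by linarith
      finally have "\<xi> \<in> Cc" using \<xi>(1) by (simp add: Cc_def)
      then show "p \<in> ci c ` Cc" using \<xi>(2) t(2) by blast
    qed
    show ?thesis
      unfolding hbound_def
    proof (intro allI impI)
      fix c2 v2 \<sigma> and e :: real assume j2: "gjet (ci c y) c2 (1 *\<^sub>R v2) \<sigma>" and e: "e > 0"
      have "ci c y \<in> fst c" by (rule ci_in[OF yU])
      from gjet_change[OF j2 c this] obtain v where j: "gjet (ci c y) c v \<sigma>"
        and veq: "rm c y v v = rm c2 (snd c2 (ci c y)) v2 v2" using snd_ci[OF yU] by auto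
      define vv where "vv = rm c y v v"
      have vv: "vv \<ge> 0" "N v = sqrt vv" using C.g_nonneg[OF yU] by (simp_all add: vv_def N_def)
      \<comment> \<open>The projection of \<open>\<xi> - x\<close> to the chord
        \<open>y - x\<close>, taken in the inner product at \<open>y\<close> and divided by its
        value at \<open>y\<close>, serves as the parameter between \<open>x\<close> and
        \<open>y\<close>. It is affine in the coordinates, and \<open>lam'\<close> is the derivative
        of \<open>lam\<close>.\<close>
      define lam where "lam \<xi> = \<theta> + (1 - \<theta>) * rm c y (\<xi> - x) (y - x) / m\<^sup>2" for \<xi>
      define lam' where "lam' w = (1 - \<theta>) * rm c y w (y - x) / m\<^sup>2" for w
      define V where "V \<xi> = lam \<xi> *\<^sub>R C.ev y v \<xi>" for \<xi>
      define dV where "dV \<xi> w = lam \<xi> *\<^sub>R (- C.Gam y w v) + lam' w *\<^sub>R C.ev y v \<xi>" for \<xi> w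
      have d1: "((\<lambda>\<xi>. \<xi> - a) has_derivative (\<lambda>w. w)) (at \<xi>)" for a \<xi> :: 'e
        by (auto intro!: derivative_eq_intros)
      have ev_d: "(C.ev y v has_derivative (\<lambda>w. - C.Gam y w v)) (at \<xi>)" for \<xi>
      proof -
        have "bounded_linear (\<lambda>w. C.Gam y w v)"
          using bilinear_linear(2)[OF C.Gam_bilinear[OF yU]] by (simp add: linear_conv_bounded_linear)
        from bounded_linear.has_derivative[OF this, of "\<lambda>\<xi>. \<xi> - y" "\<lambda>w. w" "at \<xi>"] d1
        have "((\<lambda>\<xi>. C.Gam y (\<xi> - y) v) has_derivative (\<lambda>w. C.Gam y w v)) (at \<xi>)"
          by blast
        from has_derivative_diff[OF has_derivative_const[of v] this] show ?thesis by (simp add: C.ev_def[abs_def])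
      qed
      have lam_d: "(lam has_derivative lam') (at \<xi>)" for \<xi>
      proof -
        have "linear (\<lambda>w. (1 - \<theta>) * rm c y w (y - x) / m\<^sup>2)"
          by (rule linearI) (simp_all only: bilinear_ladd[OF C.g_bilinear[OF yU]] bilinear_lmul[OF C.g_bilinear[OF yU]] add_divide_distrib distrib_left real_scaleR_def times_divide_eq_right mult.left_commute)
        then have bl: "bounded_linear lam'" unfolding lam'_def by (simp add: linear_conv_bounded_linear)
        from bounded_linear.has_derivative[OF bl, of "\<lambda>\<xi>. \<xi> - x" "\<lambda>w. w" "at \<xi>"] d1
        have "((\<lambda>\<xi>. lam' (\<xi> - x)) has_derivative lam') (at \<xi>)" by simp
        from has_derivative_add[OF has_derivative_const[of \<theta>] this] show ?thesis by (simp add: lam_def[abs_def] lam'_def[abs_def])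
      qed
      have V_d: "(V has_derivative dV \<xi>) (at \<xi>)" for \<xi>
        unfolding V_def[abs_def] dV_def[abs_def] by (rule has_derivative_scaleR[OF lam_d ev_d])
      have V_dU: "(V has_derivative dV \<xi>) (at \<xi>)" if "\<xi> \<in> coords c" for \<xi> by (rule V_d)
      have ev_c: "continuous_on S (C.ev y v)" for S
        by (intro continuous_at_imp_continuous_on ballI has_derivative_continuous[OF ev_d])
      have lam_c: "continuous_on S lam" for S
        by (intro continuous_at_imp_continuous_on ballI has_derivative_continuous[OF lam_d])
      have dV_c: "continuous_on S (\<lambda>\<xi>. dV \<xi> w)" for S w
        unfolding dV_def by (intro continuous_intros lam_c ev_c)
      have lam_y: "lam y = 1"
      proof -
        have "rm c y (y - x) (y - x) = m\<^sup>2" using N2[of "y - x"] by (simp add: m_def)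
        then show ?thesis unfolding lam_def using m by simp
      qed
      have lam_x: "lam x = \<theta>" by (simp add: lam_def C.g_simps[OF yU])
      have Vy: "V y = v" by (simp add: V_def lam_y C.ev_def C.Gam_simps[OF yU])
      have cs: "\<bar>rm c y w (y - x)\<bar> \<le> N w * m" for w using C.g_cauchy_schwarz'[OF yU, of w "y - x"] by (simp add: N_def m_def)
      have lam_b: "\<bar>lam \<xi>\<bar> \<le> (104/100)" if \<xi>: "\<xi> \<in> Cc" for \<xi>
      proof -
        have b: "N (\<xi> - x) * m \<le> ((104/100) * m) * m" using \<xi> m unfolding Cc_def by (intro mult_right_mono) auto
        have "\<bar>rm c y (\<xi> - x) (y - x)\<bar> \<le> ((104/100) * m) * m"
          by (rule order_trans[OF cs b])
        then have "\<bar>rm c y (\<xi> - x) (y - x) / m\<^sup>2\<bar> \<le> (104/100)" using m by (simp add: power2_eq_square divide_simps)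
        from abs_convex_le[OF \<theta> this] show ?thesis unfolding lam_def by simp
      qed
      have lam'_b: "\<bar>lam' w\<bar> \<le> (1 - \<theta>) / l * (10201/10000) * sqrt (rm c \<xi> w w)" if \<xi>: "\<xi> \<in> Cc" for \<xi> w
      proof -
        let ?n = "sqrt (rm c \<xi> w w)"
        have n0: "?n \<ge> 0" using C.g_nonneg CcU \<xi> by auto
        have "\<bar>rm c y w (y - x) / m\<^sup>2\<bar> \<le> N w / m" using cs[of w] m by (simp add: power2_eq_square divide_simps)
        also have "\<dots> \<le> (101/100) * ?n / m" using F1(2)[OF Ccr[OF \<xi>], of w] m by (intro divide_right_mono) auto
        also have "\<dots> \<le> (101/100) * ?n * ((101/100) / l)"
        proof -
          have "1 / m \<le> (101/100) / l" using F2 m l by (simp add: divide_simps)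
          then have "((101/100) * ?n) * (1 / m) \<le> ((101/100) * ?n) * ((101/100) / l)" using n0 by (intro mult_left_mono) auto
          then show ?thesis by simp
        qed
        finally have "\<bar>rm c y w (y - x) / m\<^sup>2\<bar> \<le> (10201/10000) * ?n / l" by simp
        then have "(1 - \<theta>) * \<bar>rm c y w (y - x) / m\<^sup>2\<bar> \<le> (1 - \<theta>) * ((10201/10000) * ?n / l)" using \<theta> by (intro mult_left_mono) auto
        moreover have "lam' w = (1 - \<theta>) * (rm c y w (y - x) / m\<^sup>2)" by (simp add: lam'_def)
        moreover have "\<bar>1 - \<theta>\<bar> = 1 - \<theta>" using \<theta> by simp
        ultimately have "\<bar>lam' w\<bar> \<le> (1 - \<theta>) * ((10201/10000) * ?n / l)" by (simp only: abs_mult)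
        then show ?thesis unfolding frac_rearrange .
      qed
      define a0 where "a0 = (104/100) * ((1 - \<theta>) / l) + 2 / 100"
      have a0: "a0 \<ge> 0" using \<theta> l by (simp add: a0_def)
      \<comment> \<open>\<open>a0\<close> bounds the covariant derivative of \<open>V\<close>. In
        the curvature term the square of \<open>V\<close> is at most
        \<open>110334016/100000000 * vv\<close>, the square of \<open>(104/100) * (101/100)\<close>,
        which \<open>12/10\<close> rounds up.\<close>
      define A where "A = (a0\<^sup>2 + (12/10) * \<kappa>) * vv"
      have g_n: "sqrt (rm c \<xi> (C.nv y \<xi> w v) (C.nv y \<xi> w v)) \<le> 1/100 * (sqrt (rm c \<xi> w w) * sqrt vv)"
        and g_e: "sqrt (rm c \<xi> (C.ev y v \<xi>) (C.ev y v \<xi>)) \<le> (101/100) * sqrt vv" if \<xi>: "\<xi> \<in> cball x0 r" for \<xi> w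
      proof -
        have mm: "\<xi> \<in> ball x0 r2" "y \<in> ball x0 r2" using \<xi> xc cb by auto
        have "rm c \<xi> (C.nv y \<xi> w v) (C.nv y \<xi> w v) \<le> (1/100)\<^sup>2 * (rm c \<xi> w w * rm c y v v)" using good mm by blast
        from real_sqrt_le_mono[OF this] show "sqrt (rm c \<xi> (C.nv y \<xi> w v) (C.nv y \<xi> w v)) \<le> 1/100 * (sqrt (rm c \<xi> w w) * sqrt vv)"
          by (simp add: real_sqrt_mult vv_def)
        have "rm c \<xi> (C.ev y v \<xi>) (C.ev y v \<xi>) \<le> (1 + 1/100)\<^sup>2 * rm c y v v" using good mm by blast
        from real_sqrt_le_mono[OF this] show "sqrt (rm c \<xi> (C.ev y v \<xi>) (C.ev y v \<xi>)) \<le> (101/100) * sqrt vv"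
          by (simp add: real_sqrt_mult vv_def)
      qed
      have sc: "sqrt (rm c \<xi> (a *\<^sub>R b) (a *\<^sub>R b)) = \<bar>a\<bar> * sqrt (rm c \<xi> b b)" if "\<xi> \<in> coords c" for \<xi> a b
        by (simp add: C.g_simps[OF that] real_sqrt_mult mult.assoc[symmetric])
      have Abound: "rm c \<xi> (dV \<xi> w + C.Gam \<xi> (V \<xi>) w) (dV \<xi> w + C.Gam \<xi> (V \<xi>) w) - rm c \<xi> (C.Rm \<xi> (V \<xi>) w w) (V \<xi>) \<le> A * rm c \<xi> w w"
        if \<xi>: "\<xi> \<in> Cc" for \<xi> w
      proof -
        have \<xi>U: "\<xi> \<in> coords c" using \<xi> CcU by blast
        let ?n = "sqrt (rm c \<xi> w w)"
        have n0: "?n \<ge> 0" using C.g_nonneg[OF \<xi>U] by simp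
        have eq: "dV \<xi> w + C.Gam \<xi> (V \<xi>) w = lam' w *\<^sub>R C.ev y v \<xi> + lam \<xi> *\<^sub>R C.nv y \<xi> w v"
          by (simp add: dV_def V_def C.nv_def C.Gam_simps[OF \<xi>U] C.Gam_sym[OF \<xi>U, of _ w] scaleR_diff_right)
        have "sqrt (rm c \<xi> (dV \<xi> w + C.Gam \<xi> (V \<xi>) w) (dV \<xi> w + C.Gam \<xi> (V \<xi>) w))
          \<le> \<bar>lam' w\<bar> * sqrt (rm c \<xi> (C.ev y v \<xi>) (C.ev y v \<xi>)) + \<bar>lam \<xi>\<bar> * sqrt (rm c \<xi> (C.nv y \<xi> w v) (C.nv y \<xi> w v))"
          unfolding eq using C.g_triangle[OF \<xi>U, of "lam' w *\<^sub>R C.ev y v \<xi>" "lam \<xi> *\<^sub>R C.nv y \<xi> w v"] unfolding sc[OF \<xi>U] .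
        also have "\<dots> \<le> ((1 - \<theta>) / l * (10201/10000) * ?n) * ((101/100) * sqrt vv) + (104/100) * (1/100 * (?n * sqrt vv))"
          using lam'_b[OF \<xi>] lam_b[OF \<xi>] g_n[OF Ccr[OF \<xi>]] g_e[OF Ccr[OF \<xi>]] vv n0 C.g_nonneg[OF \<xi>U] \<theta> l
          by (intro add_mono mult_mono) auto
        also have "\<dots> \<le> a0 * sqrt vv * ?n"
          unfolding a0_def by (rule gradient_estimate) (use \<theta> l vv n0 in auto)
        finally have "sqrt (rm c \<xi> (dV \<xi> w + C.Gam \<xi> (V \<xi>) w) (dV \<xi> w + C.Gam \<xi> (V \<xi>) w)) \<le> a0 * sqrt vv * ?n" .
        from power_mono[OF this, of 2]
        have 1: "rm c \<xi> (dV \<xi> w + C.Gam \<xi> (V \<xi>) w) (dV \<xi> w + C.Gam \<xi> (V \<xi>) w) \<le> a0\<^sup>2 * vv * rm c \<xi> w w"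
          using C.g_nonneg[OF \<xi>U] vv by (simp add: power_mult_distrib)
        have "sqrt (rm c \<xi> (V \<xi>) (V \<xi>)) \<le> (104/100) * ((101/100) * sqrt vv)"
          unfolding V_def sc[OF \<xi>U] using lam_b[OF \<xi>] g_e[OF Ccr[OF \<xi>]] C.g_nonneg[OF \<xi>U] by (intro mult_mono) auto
        from power_mono[OF this, of 2] have "rm c \<xi> (V \<xi>) (V \<xi>) \<le> ((10504/10000) * sqrt vv)\<^sup>2"
          using C.g_nonneg[OF \<xi>U] by simp
        also have "\<dots> = (110334016/100000000) * vv" using vv by (simp add: power_mult_distrib power2_eq_square)
        finally have 2: "rm c \<xi> (V \<xi>) (V \<xi>) \<le> (110334016/100000000) * vv" .
        have w0: "rm c \<xi> w w \<ge> 0" by (rule C.g_nonneg[OF \<xi>U])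
        have "- rm c \<xi> (C.Rm \<xi> (V \<xi>) w w) (V \<xi>) \<le> \<kappa> * (rm c \<xi> (V \<xi>) (V \<xi>) * rm c \<xi> w w)" by (rule curv[OF c \<xi>U])
        also have "\<dots> \<le> \<kappa> * ((110334016/100000000) * vv * rm c \<xi> w w)" using \<kappa> 2 w0 by (intro mult_left_mono mult_right_mono)
        also have "\<dots> \<le> \<kappa> * ((12/10) * vv * rm c \<xi> w w)" using \<kappa> vv(1) w0 by (intro mult_left_mono mult_right_mono) auto
        finally show ?thesis using 1 by (simp add: A_def algebra_simps)
      qed
      show "\<forall>\<^sub>F s in at 0. dM bp (\<sigma> s) + dM bp (\<sigma> (- s)) \<le> 2 * dM bp (ci c y) + s\<^sup>2 * (1\<^sup>2 * lstep B l \<theta> * rm c2 (snd c2 (ci c y)) v2 v2 + e)"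
      proof -
        have seg: "closed_segment y x \<subseteq> cball x0 r" using xc by (intro closed_segment_subset convex_cball)
        \<comment> \<open>The field at \<open>x\<close> is compared with \<open>v\<close> up to an
          error proportional to \<open>l\<close>. The fixed factor
          \<open>(1 + 1/100)\<^sup>2\<close> of \<open>good_nbhd\<close> would be lost anew at every
          link; so its derivative along the segment is integrated.\<close>
        define E where "E = rm c x (C.ev y v x) (C.ev y v x)"
        have E: "E \<le> (1 + 3 / 100 * l) * vv"
        proof -
          define p where "p t = y + t *\<^sub>R (x - y)" for t :: real
          define ee where "ee t = rm c (p t) (C.ev y v (p t)) (C.ev y v (p t))" for t
          have pin: "p t \<in> cball x0 r" if "0 \<le> t" "t \<le> 1" for t
            unfolding p_def using line_mem_segment[of t y x] that by (intro subsetD[OF seg]) auto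
          have pd: "(p has_vector_derivative (x - y)) (at t)" for t
            unfolding p_def[abs_def] has_vector_derivative_def by (auto intro!: derivative_eq_intros)
          have evd: "((\<lambda>t. C.ev y v (p t)) has_vector_derivative - C.Gam y (x - y) v) (at t)" for t
            using vector_derivative_diff_chain_within[OF pd has_derivative_at_withinI[OF ev_d]] unfolding o_def .
          define ed where "ed t = 2 * rm c (p t) (C.nv y (p t) (x - y) v) (C.ev y v (p t))" for t
          have der: "(ee has_real_derivative ed t) (at t)" if "0 \<le> t" "t \<le> 1" for t
          proof -
            have pU: "p t \<in> coords c" using pin[OF that] cb(1) by (rule rev_subsetD)
            have e1: "- C.Gam y (x - y) v + C.Gam (p t) (x - y) (C.ev y v (p t)) = C.nv y (p t) (x - y) v" by (simp add: C.nv_def)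
            from C.g_vector_derivative[OF pU pd evd evd] show ?thesis
              unfolding e1 ee_def[abs_def] ed_def C.g_sym[OF pU, of "C.ev y v (p t)" "C.nv y (p t) (x - y) v"] mult_2 .
          qed
          have edb: "ed t \<le> 3 / 100 * l * vv" if "0 \<le> t" "t \<le> 1" for t
          proof -
            have pU: "p t \<in> coords c" using pin[OF that] cb(1) by (rule rev_subsetD)
            note t = that
            have Nxy: "N (x - y) = m" unfolding m_def N_def using C.g_simps[OF yU] by simp
            have s1: "sqrt (rm c (p t) (x - y) (x - y)) \<le> (101/100) * ((101/100) * l)" using F1(1)[OF pin[OF t], of "x - y"] F4 unfolding Nxy by linarith
            have "rm c (p t) (C.nv y (p t) (x - y) v) (C.ev y v (p t)) \<le>
              sqrt (rm c (p t) (C.nv y (p t) (x - y) v) (C.nv y (p t) (x - y) v)) * sqrt (rm c (p t) (C.ev y v (p t)) (C.ev y v (p t)))"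
              using C.g_cauchy_schwarz'[OF pU] abs_le_D1 by blast
            also have "\<dots> \<le> (1/100 * (sqrt (rm c (p t) (x - y) (x - y)) * sqrt vv)) * ((101/100) * sqrt vv)"
              using g_n[OF pin[OF t]] g_e[OF pin[OF t]] C.g_nonneg[OF pU] vv(1) by (intro mult_mono) auto
            also have "\<dots> \<le> (1/100 * (((101/100) * ((101/100) * l)) * sqrt vv)) * ((101/100) * sqrt vv)"
              using s1 vv(1) by (intro mult_right_mono mult_left_mono) auto
            finally have "ed t \<le> 2 * ((1/100 * (((101/100) * ((101/100) * l)) * sqrt vv)) * ((101/100) * sqrt vv))"
              unfolding ed_def by (rule mult_left_mono) simp
            also have "\<dots> \<le> 3 / 100 * l * (sqrt vv * sqrt vv)" using l by (intro norm_growth_estimate) simp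
            also have "\<dots> = 3 / 100 * l * vv" using vv(1) by simp
            finally show ?thesis .
          qed
          obtain \<tau> where \<tau>: "0 < \<tau>" "\<tau> < 1" "ee 1 - ee 0 = (1 - 0) * ed \<tau>"
            using MVT2[of 0 1 ee ed] der by auto
          have "ee 1 = E" by (simp add: ee_def p_def E_def)
          moreover have "ee 0 = vv" by (simp add: ee_def p_def vv_def C.ev_def C.Gam_simps[OF yU])
          moreover have "ed \<tau> \<le> 3 / 100 * l * vv" using edb \<tau> by simp
          ultimately show ?thesis using mvt_bound[OF \<tau>(3)] by simp
        qed
        \<comment> \<open>Contributes \<open>ep / 2 * l = e / 4\<close> to the sum of the displaced
          distances, per \<open>s\<^sup>2\<close>.\<close>
        define ep where "ep = e / (2 * l)"
        have ep: "ep > 0" "ep * l = e / 2" using e l(2) by (simp_all add: ep_def)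
        define P where "P = C.Psi V"
        define DP where "DP = C.DPsi V dV"
        have "\<exists>s0>0. \<forall>s. \<bar>s\<bar> < s0 \<longrightarrow> (\<forall>x\<in>Cc. P s x \<in> coords c \<and> (\<forall>w.
          rm c (P s x) (DP s x w) (DP s x w) + rm c (P (- s) x) (DP (- s) x w) (DP (- s) x w) \<le> (2 + s\<^sup>2 * (2 * A + ep)) * rm c x w w))"
          unfolding P_def DP_def by (rule C.variation_uniform[where V=V and dV=dV, OF V_dU dV_c cpC CcU ep(1) Abound])
        then obtain s0 where s0: "s0 > 0" and s0b: "\<And>s x w. \<bar>s\<bar> < s0 \<Longrightarrow> x \<in> Cc \<Longrightarrow> P s x \<in> coords c \<and>
          rm c (P s x) (DP s x w) (DP s x w) + rm c (P (- s) x) (DP (- s) x w) (DP (- s) x w) \<le> (2 + s\<^sup>2 * (2 * A + ep)) * rm c x w w" by blast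
        have A0: "A \<ge> 0" unfolding A_def using vv(1) \<kappa> by simp
        have ev0: "\<forall>\<^sub>F s in at (0::real). \<bar>s\<bar> < s0" using s0 unfolding eventually_at by (auto simp: dist_real_def)
        have xCc: "x \<in> Cc" using xc m by (simp add: Cc_def N_def C.g_simps[OF yU])
        have yCc: "y \<in> Cc" using xc m by (simp add: Cc_def m_def[symmetric])
        have dist: "dM (ci c (P s x)) (ci c (P s y)) + dM (ci c (P (- s) x)) (ci c (P (- s) y)) \<le> (2 + s\<^sup>2 * (A + ep / 2)) * l"
          if s: "\<bar>s\<bar> < s0" for s
        proof -
          define h where "h = s\<^sup>2 * (A + ep / 2)"
          have h: "h \<ge> 0" using A0 ep by (simp add: h_def)
          have bd: "P s z \<in> coords c \<and> P (- s) z \<in> coords c \<and> (\<forall>w. rm c (P s z) (DP s z w) (DP s z w)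
            + rm c (P (- s) z) (DP (- s) z w) (DP (- s) z w) \<le> (2 + 2 * h) * rm c z w w)" if z: "z \<in> Cc" for z
          proof -
            have "2 + 2 * h = 2 + s\<^sup>2 * (2 * A + ep)" by (simp add: h_def algebra_simps)
            then show ?thesis using s0b[of s z] s0b[of "- s" z] s z by simp
          qed
          show ?thesis unfolding h_def[symmetric]
          proof (rule field_le_epsilon)
            fix e1 :: real assume e1: "e1 > 0"
            \<comment> \<open>Short enough an excess for \<open>curveC\<close> to apply, and after
              multiplication by \<open>2 + h\<close> it costs at most \<open>e1\<close>.\<close>
            define e2 where "e2 = min (l / 200) (e1 / (2 + h))"
            have h2: "2 + h > 0" using h by linarith
            have e2: "e2 > 0" unfolding e2_def min_less_iff_conj using e1 l(2) h2 by (intro conjI divide_pos_pos) auto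
            have e2l: "e2 \<le> l / 200" unfolding e2_def by (rule min.cobounded1)
            have "e2 \<le> e1 / (2 + h)" unfolding e2_def by (rule min.cobounded2)
            then have e3: "(2 + h) * e2 \<le> e1" unfolding pos_le_divide_eq[OF h2] by (simp only: mult.commute)
            obtain \<gamma> a b L where g: "seg \<gamma> a b" "(speed M \<gamma> has_integral L) {a..b}" "a < b" "\<gamma> a = ci c x" "\<gamma> b = ci c y" "L < l + e2"
              using curve[OF e2] by blast
            have "L \<le> (1005/1000) * l" using g(6) e2l by linarith
            note gC = curveC[OF g(1-4) this]
            have "dM (ci c (P s (snd c (\<gamma> a)))) (ci c (P s (snd c (\<gamma> b)))) + dM (ci c (P (- s) (snd c (\<gamma> a)))) (ci c (P (- s) (snd c (\<gamma> b)))) \<le> (2 + h) * L"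
              unfolding P_def by (rule displaced_dist[where c=c and V=V and dV=dV and s=s and h=h and C=Cc, OF c V_dU dV_c CcU h bd[unfolded P_def DP_def] g(1-3) gC])
            then have "dM (ci c (P s x)) (ci c (P s y)) + dM (ci c (P (- s) x)) (ci c (P (- s) y)) \<le> (2 + h) * L"
              unfolding g(4,5) snd_ci[OF xU] snd_ci[OF yU] .
            also have "\<dots> \<le> (2 + h) * (l + e2)" using g(6) h by (intro mult_left_mono) auto
            also have "\<dots> \<le> (2 + h) * l + e1" unfolding distrib_left[of "2 + h" l] using e3 by simp
            finally show "dM (ci c (P s x)) (ci c (P s y)) + dM (ci c (P (- s) x)) (ci c (P (- s) y)) \<le> (2 + h) * l + e1" .
          qed
        qed
        have gj: "gjet (ci c z) c (V z) (\<lambda>s. ci c (P s z))" if z: "z \<in> Cc" for z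
        proof -
          have zU: "z \<in> coords c" using z CcU by blast
          have e1: "\<forall>\<^sub>F s in at 0. P s z \<in> coords c" using ev0 by eventually_elim (use s0b z in blast)
          then have e2: "\<forall>\<^sub>F s in at 0. ci c (P s z) \<in> fst c" by eventually_elim (rule ci_in)
          have e3: "\<forall>\<^sub>F s in at 0. z + s *\<^sub>R V z + (s\<^sup>2 / 2) *\<^sub>R (- C.Gam z (V z) (V z)) = snd c (ci c (P s z))" using e1
            by eventually_elim (simp add: snd_ci P_def C.Psi_def[OF V_dU dV_c] C.qV_def[OF V_dU dV_c] C.Pt_def)
          show ?thesis unfolding gjet_def snd_ci[OF zU] using c ci_in[OF zU] e2 jet2_cong[OF jet2_explicit e3] by blast
        qed
        have e4: "e / 4 > 0" "e / 8 > 0" using e by auto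
        have "gjet (ci c x) c (\<theta> *\<^sub>R C.ev y v x) (\<lambda>s. ci c (P s x))" using gj[OF xCc] by (simp add: V_def lam_x)
        from hb[unfolded hbound_def, rule_format, OF this e4(1)]
        have h1: "\<forall>\<^sub>F s in at 0. dM bp (ci c (P s x)) + dM bp (ci c (P (- s) x)) \<le> 2 * dM bp (ci c x) + s\<^sup>2 * (\<theta>\<^sup>2 * B * E + e / 4)"
          by (simp only: snd_ci[OF xU] E_def)
        have "gjet (ci c y) c v (\<lambda>s. ci c (P s y))" using gj[OF yCc] by (simp only: Vy)
        note h2 = gjet_dist_small[OF this j e4(2)]
        have inS: "\<forall>\<^sub>F s in at 0. \<sigma> s \<in> SM"
        proof -
          have "\<forall>\<^sub>F s in at 0. \<sigma> s \<in> fst c" using j by (simp add: gjet_def)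
          then show ?thesis by eventually_elim (use domain_subset[OF c] in blast)
        qed
        have PS: "ci c (P s z) \<in> SM" if "\<bar>s\<bar> < s0" "z \<in> Cc" for s z
        proof -
          have "P s z \<in> coords c" using s0b[OF that] by blast
          from ci_in[OF this] show ?thesis using domain_subset[OF c] by blast
        qed
        have tr: "dM bp (\<sigma> s) \<le> dM bp (ci c (P s x)) + dM (ci c (P s x)) (ci c (P s y)) + dM (ci c (P s y)) (\<sigma> s)"
          if "\<bar>s\<bar> < s0" "\<sigma> s \<in> SM" for s
          using dist_triangle[OF bp PS[OF that(1) xCc] that(2)] dist_triangle[OF PS[OF that(1) xCc] PS[OF that(1) yCc] that(2)] by linarith
        have fin: "\<theta>\<^sup>2 * B * E + (A + ep / 2) * l \<le> lstep B l \<theta> * vv + e / 4"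
        proof -
          have "\<theta>\<^sup>2 * B * E \<le> \<theta>\<^sup>2 * B * ((1 + 3 / 100 * l) * vv)" using E B by (intro mult_left_mono) auto
          moreover have "(A + ep / 2) * l = A * l + e / 4" using ep(2) by (simp add: algebra_simps)
          moreover have "\<theta>\<^sup>2 * B * ((1 + 3 / 100 * l) * vv) + A * l = lstep B l \<theta> * vv"
            unfolding lstep_def A_def a0_def[symmetric] by (rule lstep_expand)
          ultimately show ?thesis by linarith
        qed
        from h1 h2 eventually_at_0_minus[OF h2] inS eventually_at_0_minus[OF inS] ev0
        show ?thesis
        proof eventually_elim
          case (elim s)
          have d: "dM (ci c (P s x)) (ci c (P s y)) + dM (ci c (P (- s) x)) (ci c (P (- s) y)) \<le> 2 * l + s\<^sup>2 * ((A + ep / 2) * l)"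
            using dist[OF elim(6)] by (simp only: distrib_right mult.assoc)
          have ms: "\<bar>- s\<bar> < s0" using elim(6) by simp
          have t2: "dM (ci c (P (- s) y)) (\<sigma> (- s)) \<le> e / 8 * s\<^sup>2" using elim(3) by simp
          have e0: "0 \<le> e" using e by simp
          have "dM bp (\<sigma> s) + dM bp (\<sigma> (- s)) \<le> 2 * dM bp (ci c y) + s\<^sup>2 * (lstep B l \<theta> * vv + e)"
            by (rule second_difference_sum[OF tr[OF elim(6,4)] tr[OF ms elim(5)] elim(1) d elim(2) t2 fin zero_le_power2 tri e0])
          then show ?case unfolding veq[symmetric] vv_def by simp
        qed
      qed
    qed
  qed
  show ?thesis
    by (rule exI[of _ \<rho>], rule conjI[OF \<rho>(1)], rule exI[of _ r], rule conjI[OF r(1)], rule conjI[OF cb(1)],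
        intro ballI allI impI, rule main)
qed

end

text \<open>Here \<open>a = 1 / D\<close> and \<open>1 - l * a = (D - l) / D = \<theta>\<close>, so
  the left side is \<open>lstep\<close> at the comparison value \<open>2 / (D - l) + k\<close>.
  Doubling the leading coefficient 1 / D gains \<open>2 * u * a\<close>, which outweighs the
  gradient term \<open>10816/10000 * (u * a)\<close> and leaves room for the terms in
  \<open>u\<close>. Likewise \<open>k = 2 * \<kappa> + 1\<close> gains
  \<open>194/100 * (\<kappa> * l)\<close> against the loss \<open>(12/10) * \<kappa> * l\<close>,
  and its summand 1 pays for the term in \<open>l\<close> alone.\<close>

lemma riccati_step:
  fixes a l k \<kappa> :: real
  assumes a: "1 \<le> a" and l: "0 \<le> l" "l * a \<le> 1" and k: "k = 2 * \<kappa> + 1" and \<kappa>: "0 \<le> \<kappa>"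
  shows "(1 + 3 / 100 * l) * (2 * (1 - l * a) * a + (1 - l * a)\<^sup>2 * k) + ((104/100) * a + 2 / 100)\<^sup>2 * l + (12/10) * \<kappa> * l
    \<le> 2 * a + k"
proof -
  define u where "u = l * a"
  have u: "0 \<le> u" "u \<le> 1" "l \<le> u" using a l mult_left_mono[of 1 a l] by (auto simp: u_def)
  have ua: "u \<le> u * a" using a u mult_left_mono[of 1 a u] by simp
  have k0: "0 \<le> k" using k \<kappa> by simp
  have t: "(1 - u)\<^sup>2 \<le> 1 - u" using u mult_right_mono[of "1 - u" 1 "1 - u"] by (simp add: power2_eq_square)
  have 1: "2 * (1 - u) * a * (3 / 100 * l) \<le> 6 / 100 * u"
  proof -
    have "2 * (1 - u) * a * (3 / 100 * l) = 6 / 100 * ((1 - u) * u)" by (simp add: u_def algebra_simps)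
    moreover have "(1 - u) * u \<le> 1 * u" using u by (intro mult_right_mono) auto
    ultimately show ?thesis by linarith
  qed
  have 2: "(1 + 3 / 100 * l) * ((1 - u)\<^sup>2 * k) \<le> k - 97/100 * (k * l)"
  proof -
    have "(1 + 3 / 100 * l) * ((1 - u)\<^sup>2 * k) \<le> (1 + 3 / 100 * l) * ((1 - u) * k)"
      using t k0 l by (intro mult_left_mono mult_right_mono) auto
    also have "\<dots> = k * ((1 - u) * (1 + 3 / 100 * l))" by simp
    also have "\<dots> \<le> k * (1 - 97/100 * l)"
    proof (rule mult_left_mono[OF _ k0])
      have "0 \<le> u * l" using u l by simp
      moreover have "(1 - u) * (1 + 3 / 100 * l) = 1 - u + 3 / 100 * l - 3 / 100 * (u * l)" by (simp add: field_simps)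
      ultimately show "(1 - u) * (1 + 3 / 100 * l) \<le> 1 - 97/100 * l" using u by linarith
    qed
    finally show ?thesis by (simp add: algebra_simps)
  qed
  have 3: "((104/100) * a + 2 / 100)\<^sup>2 * l = 10816/10000 * (u * a) + 416/10000 * u + 4/10000 * l"
    by (simp add: u_def power2_eq_square algebra_simps)
  have 4: "97/100 * (k * l) = 194/100 * (\<kappa> * l) + 97/100 * l" by (simp add: k algebra_simps)
  have 5: "0 \<le> \<kappa> * l" using \<kappa> l by simp
  have "(1 + 3 / 100 * l) * (2 * (1 - u) * a + (1 - u)\<^sup>2 * k)
    = 2 * a - 2 * (u * a) + 2 * (1 - u) * a * (3 / 100 * l) + (1 + 3 / 100 * l) * ((1 - u)\<^sup>2 * k)"
    by (simp add: u_def field_simps)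
  then show ?thesis unfolding u_def[symmetric] 3 using 1 2 4 5 u ua l by linarith
qed

section \<open>Tools for the maximum principle\<close>

lemma second_difference_estimate:
  fixes s :: real
  assumes s: "s \<noteq> 0" and A: "A * s\<^sup>2 - e * s\<^sup>2 \<le> \<delta> * P" and P: "P \<le> s\<^sup>2 * W" and \<delta>: "0 \<le> \<delta>"
  shows "A \<le> e + \<delta> * W"
proof -
  have "\<delta> * P \<le> \<delta> * (s\<^sup>2 * W)" using P \<delta> by (rule mult_left_mono)
  then have "A * s\<^sup>2 \<le> (e + \<delta> * W) * s\<^sup>2" using A by (simp add: algebra_simps)
  then show ?thesis using s by simp
qed

text \<open>From the distance to its square, by \<open>p\<^sup>2 + q\<^sup>2 = ((p + q)\<^sup>2 + (p
  - q)\<^sup>2) / 2\<close>. The 8 is twice the crude bound \<open>4 * \<bar>s\<bar> * N\<close> on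
  the distance of the curve from its centre, and 32 is half of its square.\<close>

lemma sum_squares_estimate:
  fixes s :: real
  assumes pq: "0 \<le> p" "0 \<le> q" "p + q \<le> 2 * D + s\<^sup>2 * \<beta>" "\<bar>p - q\<bar> \<le> 8 * \<bar>s\<bar> * N"
    and b: "D * \<beta> \<le> b" "s\<^sup>2 * \<beta>\<^sup>2 \<le> 2 * e"
  shows "p\<^sup>2 + q\<^sup>2 - 2 * D\<^sup>2 \<le> s\<^sup>2 * (2 * b + e + 32 * N\<^sup>2)"
proof -
  have "p\<^sup>2 + q\<^sup>2 = (p + q)\<^sup>2 / 2 + (p - q)\<^sup>2 / 2" by (simp add: power2_eq_square field_simps)
  moreover have "(p + q)\<^sup>2 \<le> (2 * D + s\<^sup>2 * \<beta>)\<^sup>2" using pq by (intro power_mono) auto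
  moreover have "(p - q)\<^sup>2 \<le> (8 * \<bar>s\<bar> * N)\<^sup>2" using power_mono[OF pq(4), of 2] by simp
  moreover have "(8 * \<bar>s\<bar> * N)\<^sup>2 = 64 * (s\<^sup>2 * N\<^sup>2)" by (simp add: power_mult_distrib)
  moreover have "(2 * D + s\<^sup>2 * \<beta>)\<^sup>2 = 4 * D\<^sup>2 + 4 * (s\<^sup>2 * (D * \<beta>)) + s\<^sup>2 * (s\<^sup>2 * \<beta>\<^sup>2)" by (simp add: power2_eq_square algebra_simps)
  moreover have "s\<^sup>2 * (D * \<beta>) \<le> s\<^sup>2 * b" "s\<^sup>2 * (s\<^sup>2 * \<beta>\<^sup>2) \<le> s\<^sup>2 * (2 * e)" using b by (intro mult_left_mono; simp)+
  moreover have "s\<^sup>2 * (2 * b + e + 32 * N\<^sup>2) = 2 * (s\<^sup>2 * b) + s\<^sup>2 * (2 * e) / 2 + 32 * (s\<^sup>2 * N\<^sup>2)" by (simp add: algebra_simps)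
  ultimately show ?thesis by linarith
qed

lemma (in Metric_space) compact_attains_max:
  fixes h :: "'a \<Rightarrow> real"
  assumes K: "compactin mtopology K" and ne: "K \<noteq> {}" and bd: "\<And>p. p \<in> K \<Longrightarrow> h p \<le> b"
    and co: "\<And>\<sigma> l. limitin mtopology \<sigma> l sequentially \<Longrightarrow> range \<sigma> \<subseteq> K \<Longrightarrow> (\<lambda>n. h (\<sigma> n)) \<longlonglongrightarrow> h l"
  shows "\<exists>z\<in>K. \<forall>y\<in>K. h y \<le> h z"
proof -
  define S where "S = Sup (h ` K)"
  have bdd: "bdd_above (h ` K)" using bd by (intro bdd_aboveI[of _ b]) auto
  have S: "h p \<le> S" if "p \<in> K" for p unfolding S_def using that bdd by (intro cSup_upper) auto
  have "\<exists>y\<in>h ` K. S - 1 / Suc n < y" for n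
    using less_cSup_iff[of "h ` K" "S - 1 / Suc n"] bdd ne unfolding S_def by simp
  then have "\<exists>p. p \<in> K \<and> S - 1 / Suc n < h p" for n by blast
  then obtain \<sigma> where \<sigma>: "\<And>n. \<sigma> n \<in> K" "\<And>n. S - 1 / Suc n < h (\<sigma> n)" by metis
  have "range \<sigma> \<subseteq> K" using \<sigma>(1) by blast
  then obtain l r where l: "l \<in> K" "strict_mono r" "limitin mtopology (\<sigma> \<circ> r) l sequentially"
    using K unfolding compactin_sequentially by blast
  have 1: "(\<lambda>n. h ((\<sigma> \<circ> r) n)) \<longlonglongrightarrow> h l" by (rule co[OF l(3)]) (use \<sigma>(1) in auto)
  have "(\<lambda>n. 1 / real (Suc (r n))) \<longlonglongrightarrow> 0"
    using LIMSEQ_subseq_LIMSEQ[OF LIMSEQ_Suc[OF lim_const_over_n[of "1::real"]] l(2)] by (simp add: o_def)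
  from tendsto_diff[OF tendsto_const[of S] this] have 2: "(\<lambda>n. S - 1 / real (Suc (r n))) \<longlonglongrightarrow> S" by simp
  have "S \<le> h l" by (rule LIMSEQ_le[OF 2 1]) (use \<sigma>(2) in \<open>auto intro: less_imp_le\<close>)
  then show ?thesis using l(1) S by (meson order_trans)
qed

lemma jet2_second_difference:
  assumes "jet2 y x v q" "e > 0"
  shows "\<forall>\<^sub>F s in at 0. norm (y s + y (- s) - 2 *\<^sub>R x - s\<^sup>2 *\<^sub>R q) \<le> e * s\<^sup>2"
proof -
  have "e / 2 > 0" using assms by simp
  from assms(1)[unfolded jet2_iff_small, rule_format, OF this]
  have h: "\<forall>\<^sub>F s in at 0. norm (y s - x - s *\<^sub>R v - (s\<^sup>2 / 2) *\<^sub>R q) \<le> e / 2 * s\<^sup>2" .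
  from h eventually_at_0_minus[OF h] show ?thesis
  proof eventually_elim
    case (elim s)
    have "(s\<^sup>2 / 2) *\<^sub>R q + (s\<^sup>2 / 2) *\<^sub>R q = s\<^sup>2 *\<^sub>R q" by (simp add: scaleR_left_distrib[symmetric])
    then have eq: "y s + y (- s) - 2 *\<^sub>R x - s\<^sup>2 *\<^sub>R q
      = (y s - x - s *\<^sub>R v - (s\<^sup>2 / 2) *\<^sub>R q) + (y (- s) - x - (- s) *\<^sub>R v - ((- s)\<^sup>2 / 2) *\<^sub>R q)"
      by (simp add: scaleR_2 algebra_simps)
    have "norm (y s + y (- s) - 2 *\<^sub>R x - s\<^sup>2 *\<^sub>R q) \<le> e / 2 * s\<^sup>2 + e / 2 * (- s)\<^sup>2"
      unfolding eq by (rule norm_triangle_mono[OF elim])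
    then show ?case by simp
  qed
qed

lemma jet2_linear:
  assumes T: "bounded_linear T" and j: "jet2 y x v q" shows "jet2 (\<lambda>s. T (y s)) (T x) (T v) (T q)"
proof -
  interpret bounded_linear T by (rule T)
  have "((\<lambda>s. T ((1 / s\<^sup>2) *\<^sub>R (y s - x - s *\<^sub>R v - (s\<^sup>2 / 2) *\<^sub>R q))) \<longlongrightarrow> T 0) (at 0)"
    by (rule tendsto[OF j[unfolded jet2_def]])
  then show ?thesis unfolding jet2_def scaleR diff zero .
qed

context riem_conn
begin

text \<open>Both comparisons of distance and coordinates on one ball, in the form that moves limits
  and compactness between chart and manifold.\<close>

lemma chart_ball:
  assumes p: "p \<in> SM"
  shows "\<exists>c r K. c \<in> atlas M \<and> p \<in> fst c \<and> r > 0 \<and> K > 0 \<and> cball (snd c p) r \<subseteq> coords c \<and>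
    (\<forall>q\<in>SM. K * dM p q < r \<longrightarrow> q \<in> fst c \<and> snd c q \<in> ball (snd c p) r \<and> norm (snd c q - snd c p) \<le> K * dM p q) \<and>
    (\<forall>x\<in>cball (snd c p) r. \<forall>z\<in>cball (snd c p) r. dM (ci c x) (ci c z) \<le> K * norm (z - x))"
proof -
  obtain c where c: "c \<in> atlas M" "p \<in> fst c" using chart_exists[OF p] by blast
  have x0: "snd c p \<in> coords c" using c by blast
  obtain r K where rK: "r > 0" "K > 0" "cball (snd c p) r \<subseteq> coords c"
    "\<And>\<xi> w. \<xi> \<in> cball (snd c p) r \<Longrightarrow> norm w \<le> K * sqrt (rm c \<xi> w w)"
    "\<And>\<xi> w. \<xi> \<in> cball (snd c p) r \<Longrightarrow> sqrt (rm c \<xi> w w) \<le> K * norm w"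
    using chart_nbhd[OF c(1) x0] by blast
  have 1: "q \<in> fst c \<and> snd c q \<in> ball (snd c p) r \<and> norm (snd c q - snd c p) \<le> K * dM p q"
    if q: "q \<in> SM" "K * dM p q < r" for q
  proof -
    have "norm (snd c p - snd c p) + K * dM (ci c (snd c p)) q < r" using q(2) ci_snd[OF c] by simp
    from local_lower[OF c(1) rK(3,2,4) q(1) this] show ?thesis unfolding ci_snd[OF c] by blast
  qed
  have 2: "dM (ci c x) (ci c z) \<le> K * norm (z - x)" if "x \<in> cball (snd c p) r" "z \<in> cball (snd c p) r" for x z
  proof -
    have s: "closed_segment x z \<subseteq> cball (snd c p) r" using that by (intro closed_segment_subset convex_cball)
    then have "closed_segment x z \<subseteq> coords c" using rK(3) by (rule order_trans)
    from riem_dist_le_line[OF c(1) this] show ?thesis using rK(5) s by blast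
  qed
  show ?thesis
    by (rule exI[of _ c], rule exI[of _ r], rule exI[of _ K]) (intro conjI c rK(1-3) ballI impI 1[THEN conjunct1] 1[THEN conjunct2, THEN conjunct1] 1[THEN conjunct2, THEN conjunct2] 2)
qed

text \<open>Compactness of closed balls in a chart gives a limit point, and continuity of the
  distance keeps it in the metric ball.\<close>

lemma locally_compact_dist:
  assumes p: "p \<in> SM"
  shows "\<exists>r>0. compactin (Metric_space.mtopology SM dM) (Metric_space.mcball SM dM p r)"
proof -
  interpret MS: Metric_space SM dM by (rule metric)
  obtain c r K where c: "c \<in> atlas M" "p \<in> fst c" and rK: "r > 0" "K > 0" "cball (snd c p) r \<subseteq> coords c"
    and lo: "\<forall>q\<in>SM. K * dM p q < r \<longrightarrow> q \<in> fst c \<and> snd c q \<in> ball (snd c p) r \<and> norm (snd c q - snd c p) \<le> K * dM p q"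
    and up: "\<forall>x\<in>cball (snd c p) r. \<forall>z\<in>cball (snd c p) r. dM (ci c x) (ci c z) \<le> K * norm (z - x)"
    using chart_ball[OF p] by (elim exE conjE) (rule that)
  define t where "t = r / (2 * K)"
  have t: "t > 0" "K * t < r" using rK by (simp_all add: t_def)
  have "compactin MS.mtopology (MS.mcball p t)" unfolding MS.compactin_sequentially
  proof (intro conjI allI impI)
    show "MS.mcball p t \<subseteq> SM" by auto
    fix \<sigma> :: "nat \<Rightarrow> 'a" assume \<sigma>: "range \<sigma> \<subseteq> MS.mcball p t"
    have m: "\<sigma> n \<in> SM" "dM p (\<sigma> n) \<le> t" for n using \<sigma> by (auto simp: image_subset_iff)
    have m2: "\<sigma> n \<in> fst c \<and> snd c (\<sigma> n) \<in> cball (snd c p) r" for n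
    proof -
      have "K * dM p (\<sigma> n) \<le> K * t" using m(2) rK(2) by (intro mult_left_mono) auto
      then have "K * dM p (\<sigma> n) < r" using t(2) by linarith
      then have "\<sigma> n \<in> fst c \<and> snd c (\<sigma> n) \<in> ball (snd c p) r" using lo m(1) by blast
      then show ?thesis by simp
    qed
    have "\<forall>n. (\<lambda>n. snd c (\<sigma> n)) n \<in> cball (snd c p) r" using m2 by blast
    from seq_compactE[OF compact_cball[unfolded compact_eq_seq_compact_metric] this]
    obtain x h where x: "x \<in> cball (snd c p) r" "strict_mono h" "((\<lambda>n. snd c (\<sigma> n)) \<circ> h) \<longlonglongrightarrow> x" by blast
    have xU: "x \<in> coords c" using x(1) rK(3) by blast
    have xS: "ci c x \<in> SM" using ci_in[OF xU] domain_subset[OF c(1)] by blast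
    have l0: "(\<lambda>n. norm (snd c (\<sigma> (h n)) - x)) \<longlonglongrightarrow> 0"
      using x(3) by (simp add: o_def LIM_zero_iff tendsto_norm_zero_iff)
    have le: "dM (\<sigma> (h n)) (ci c x) \<le> K * norm (snd c (\<sigma> (h n)) - x)" for n
    proof -
      have "dM (ci c x) (ci c (snd c (\<sigma> (h n)))) \<le> K * norm (snd c (\<sigma> (h n)) - x)" using up x(1) m2 by blast
      then show ?thesis using ci_snd[OF c(1)] m2 dist_commute' by simp
    qed
    have "limitin MS.mtopology (\<sigma> \<circ> h) (ci c x) sequentially" unfolding MS.limitin_metric
    proof (intro conjI xS allI impI)
      fix e :: real assume e: "e > 0"
      have "(\<lambda>n. K * norm (snd c (\<sigma> (h n)) - x)) \<longlonglongrightarrow> K * 0" by (intro tendsto_intros l0)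
      then have "\<forall>\<^sub>F n in sequentially. K * norm (snd c (\<sigma> (h n)) - x) < e" using e by (intro order_tendstoD(2)) auto
      then show "\<forall>\<^sub>F n in sequentially. (\<sigma> \<circ> h) n \<in> SM \<and> dM ((\<sigma> \<circ> h) n) (ci c x) < e"
        by eventually_elim (use le m(1) in \<open>auto intro: le_less_trans\<close>)
    qed
    moreover from this have "ci c x \<in> MS.mcball p t"
    proof -
      have "(\<lambda>n. dM ((\<sigma> \<circ> h) n) p) \<longlonglongrightarrow> dM (ci c x) p"
        by (rule MS.d_limit[OF \<open>limitin MS.mtopology (\<sigma> \<circ> h) (ci c x) sequentially\<close>]) (use m p in auto)
      then have "dM (ci c x) p \<le> t" by (rule LIMSEQ_le_const2) (use m(2) dist_commute'[of _ p] in auto)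
      then show ?thesis using p xS dist_commute'[of _ p] by simp
    qed
    ultimately show "\<exists>l r. l \<in> MS.mcball p t \<and> strict_mono r \<and> limitin MS.mtopology (\<sigma> \<circ> r) l sequentially" using x(2) by blast
  qed
  then show ?thesis using t(1) by blast
qed

lemma closed_balls_compact:
  assumes "riem_complete M" "p \<in> SM"
  shows "compactin (Metric_space.mtopology SM dM) (Metric_space.mcball SM dM p R)"
  by (rule Metric_space.hopf_rinow[OF metric length_space locally_compact_dist assms(1)[unfolded riem_complete_def] assms(2)])

end

context rlor
begin

text \<open>The conclusion of \<open>link_chart\<close> as a property of pairs of points, free of
  charts, so that \<open>compact_uniform_radius\<close> can give one step length for the whole unit
  ball.\<close>

definition "linkable z z' \<longleftrightarrow> (\<forall>bp \<theta> B. bp \<in> SM \<longrightarrow> z \<noteq> z' \<longrightarrow> dM bp z + dM z z' \<le> dM bp z' \<longrightarrow> 0 \<le> \<theta> \<longrightarrow> \<theta> \<le> 1 \<longrightarrow> 0 \<le> B \<longrightarrow>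
  hbound bp z \<theta> B \<longrightarrow> hbound bp z' 1 (lstep B (dM z z') \<theta>))"

lemma linkable_locally:
  assumes p: "p \<in> SM"
  shows "\<exists>\<rho>>0. \<forall>z\<in>SM. \<forall>z'\<in>SM. dM p z < \<rho> \<longrightarrow> dM p z' < \<rho> \<longrightarrow> linkable z z'"
proof -
  obtain c r K where c: "c \<in> atlas M" "p \<in> fst c" and rK: "r > 0" "K > 0" "cball (snd c p) r \<subseteq> coords c"
    and lo: "\<forall>q\<in>SM. K * dM p q < r \<longrightarrow> q \<in> fst c \<and> snd c q \<in> ball (snd c p) r \<and> norm (snd c q - snd c p) \<le> K * dM p q"
    using chart_ball[OF p] by (elim exE conjE) (rule that)
  have x0: "snd c p \<in> coords c" using c by blast
  obtain \<rho>1 where \<rho>1: "\<rho>1 > 0" and link: "\<forall>x\<in>ball (snd c p) \<rho>1. \<forall>y\<in>ball (snd c p) \<rho>1. \<forall>bp \<theta> B l.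
    bp \<in> SM \<longrightarrow> l = dM (ci c x) (ci c y) \<longrightarrow> 0 < l \<longrightarrow> l < \<rho>1 \<longrightarrow> dM bp (ci c x) + l \<le> dM bp (ci c y) \<longrightarrow> 0 \<le> \<theta> \<longrightarrow> \<theta> \<le> 1 \<longrightarrow> 0 \<le> B \<longrightarrow>
    hbound bp (ci c x) \<theta> B \<longrightarrow> hbound bp (ci c y) 1 (lstep B l \<theta>)"
    using link_chart[OF c(1) x0] by (elim exE conjE) (rule that)
  define \<rho> where "\<rho> = min (\<rho>1 / 2) (min (r / K) (\<rho>1 / K))"
  have "\<rho> > 0" using \<rho>1 rK by (simp add: \<rho>_def)
  moreover have "\<rho> \<le> \<rho>1 / 2" "\<rho> \<le> r / K" "\<rho> \<le> \<rho>1 / K" unfolding \<rho>_def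
    by (rule min.cobounded1, rule min.coboundedI2, rule min.cobounded1, rule min.coboundedI2, rule min.cobounded2)
  ultimately have \<rho>: "\<rho> > 0" "\<rho> \<le> \<rho>1 / 2" "\<rho> \<le> r / K" "\<rho> \<le> \<rho>1 / K" by blast+
  have pt: "z \<in> fst c \<and> snd c z \<in> ball (snd c p) \<rho>1" if z: "z \<in> SM" "dM p z < \<rho>" for z
  proof -
    have "dM p z < r / K" "dM p z < \<rho>1 / K" using z(2) \<rho> by linarith+
    then have k: "K * dM p z < r" "K * dM p z < \<rho>1" using rK(2) by (simp_all add: pos_less_divide_eq mult.commute)
    then have "z \<in> fst c" "norm (snd c z - snd c p) \<le> K * dM p z" using lo z(1) by blast+
    then show ?thesis using k(2) by (simp add: dist_norm norm_minus_commute)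
  qed
  have "linkable z z'" if z: "z \<in> SM" "z' \<in> SM" "dM p z < \<rho>" "dM p z' < \<rho>" for z z'
    unfolding linkable_def
  proof (intro allI impI)
    fix bp \<theta> B assume a: "bp \<in> SM" "z \<noteq> z'" "dM bp z + dM z z' \<le> dM bp z'" "0 \<le> \<theta>" "\<theta> \<le> 1" "0 \<le> B" "hbound bp z \<theta> B"
    have z1: "z \<in> fst c" "snd c z \<in> ball (snd c p) \<rho>1" using pt[OF z(1,3)] by auto
    have z2: "z' \<in> fst c" "snd c z' \<in> ball (snd c p) \<rho>1" using pt[OF z(2,4)] by auto
    have "dM z z' \<le> dM z p + dM p z'" by (rule dist_triangle[OF z(1) p z(2)])
    then have l1: "dM z z' < \<rho>1" using z(3,4) \<rho>(2) dist_commute'[of z p] by linarith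
    have l0: "0 < dM z z'" using Metric_space.zero[OF metric z(1,2)] a(2) dist_nonneg[of z z'] by linarith
    show "hbound bp z' 1 (lstep B (dM z z') \<theta>)"
      using link[rule_format, OF z1(2) z2(2) a(1) refl, unfolded ci_snd[OF c(1) z1(1)] ci_snd[OF c(1) z2(1)], OF l0 l1 a(3-7)] .
  qed
  then show ?thesis using \<rho>(1) by blast
qed

text \<open>The comparison function \<open>2 / D + k\<close> is a supersolution of the Riccati equation governing the
  second fundamental form of geodesic spheres, on the unit ball.\<close>

lemma hbound_riccati:
  assumes compl: "riem_complete M" and bp: "bp \<in> SM"
    and z: "z \<in> SM" "0 < dM bp z" "dM bp z \<le> 1"
  shows "hbound bp z 1 (2 / dM bp z + (2 * \<kappa> + 1))"
proof -
  interpret MS: Metric_space SM dM by (rule metric)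
  have cp: "compactin MS.mtopology (MS.mcball bp R)" for R by (rule closed_balls_compact[OF compl bp])
  have "\<exists>l>0. \<forall>z'\<in>MS.mcball bp 1. \<forall>z\<in>SM. dM z z' < l \<longrightarrow> linkable z z'"
    by (rule MS.compact_uniform_radius[OF cp]) (rule linkable_locally, simp)
  then obtain l0 where l0: "l0 > 0" "\<And>z z'. z' \<in> MS.mcball bp 1 \<Longrightarrow> z \<in> SM \<Longrightarrow> dM z z' < l0 \<Longrightarrow> linkable z z'" by blast
  \<comment> \<open>Strictly below \<open>l0\<close>, so that points at distance exactly
    \<open>l\<close> are still linkable.\<close>
  define l where "l = l0 / 2"
  have l: "l > 0" "l < l0" using l0 by (simp_all add: l_def)
  define k where "k = 2 * \<kappa> + 1"
  have k: "0 \<le> k" using \<kappa> by (simp add: k_def)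
  \<comment> \<open>A single link from \<open>bp\<close> itself with \<open>\<theta> = 0\<close>,
    where the incoming bound drops out; it is the case \<open>l = D\<close> of
    \<open>riccati_step\<close>.\<close>
  have start: "hbound bp z 1 (2 / dM bp z + k)" if z: "z \<in> SM" "0 < dM bp z" "dM bp z \<le> 1" "dM bp z \<le> l" for z
  proof -
    let ?D = "dM bp z"
    have zb: "z \<in> MS.mcball bp 1" using z bp by simp
    have d0: "dM bp bp = 0" using MS.zero[OF bp bp] by simp
    have ne: "bp \<noteq> z" using z(2) d0 by force
    have "linkable bp z" using l0(2)[OF zb bp] z(4) l by simp
    then have h: "hbound bp z 1 (lstep 0 ?D 0)" unfolding linkable_def using bp ne d0 hbound_base[OF bp, of 0] by simp
    have "(1 + 3 / 100 * ?D) * (2 * (1 - ?D * (1 / ?D)) * (1 / ?D) + (1 - ?D * (1 / ?D))\<^sup>2 * k)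
      + ((104/100) * (1 / ?D) + 2 / 100)\<^sup>2 * ?D + (12/10) * \<kappa> * ?D \<le> 2 * (1 / ?D) + k"
      by (rule riccati_step[OF _ _ _ k_def \<kappa>]) (use z in auto)
    then have "lstep 0 ?D 0 \<le> 2 / ?D + k" using z(2) by (simp add: lstep_def)
    then show ?thesis by (rule hbound_mono[OF h])
  qed
  \<comment> \<open>Induction on the number of links. A farther point is reached by one more link of
    length exactly \<open>l\<close>, from an intermediate point at distance \<open>?D - l\<close>
    from \<open>bp\<close>; scaling the bound there by \<open>(?D - l) / ?D\<close> matches a field
    that grows linearly with the distance.\<close>
  have "\<forall>z. z \<in> SM \<longrightarrow> 0 < dM bp z \<longrightarrow> dM bp z \<le> 1 \<longrightarrow> dM bp z \<le> real (Suc n) * l \<longrightarrow> hbound bp z 1 (2 / dM bp z + k)" for n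
  proof (induction n)
    case 0 show ?case using start by simp
  next
    case (Suc n)
    show ?case
    proof (intro allI impI)
      fix z assume z: "z \<in> SM" "0 < dM bp z" "dM bp z \<le> 1" "dM bp z \<le> real (Suc (Suc n)) * l"
      let ?D = "dM bp z"
      show "hbound bp z 1 (2 / ?D + k)"
      proof (cases "?D \<le> l")
        case True then show ?thesis using start z by blast
      next
        case False
        then have t: "0 < ?D - l" "?D - l < ?D" using l by auto
        obtain m where m: "m \<in> SM" "dM bp m = ?D - l" "dM m z = ?D - (?D - l)"
          using MS.between_point[OF length_space bp z(1) t cp] by blast
        have ml: "dM m z = l" using m(3) by simp
        have "real (Suc (Suc n)) * l = real (Suc n) * l + l" by (simp add: algebra_simps)
        then have "hbound bp m 1 (2 / (?D - l) + k)" using Suc m t z l unfolding m(2)[symmetric] by (metis (no_types, lifting) add_le_cancel_right diff_add_cancel less_imp_le order_trans m(2))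
        then have hm: "hbound bp m ((?D - l) / ?D) (2 / (?D - l) + k)" by (rule hbound_scale)
        have zb: "z \<in> MS.mcball bp 1" using z bp by simp
        have lk: "linkable m z" by (rule l0(2)[OF zb m(1)]) (use ml l in simp)
        have ne: "m \<noteq> z" using ml l MS.zero[OF z(1) z(1)] by force
        have tri: "dM bp m + dM m z \<le> ?D" using m ml by simp
        have th: "0 \<le> (?D - l) / ?D" "(?D - l) / ?D \<le> 1" using t z l by auto
        have B0: "0 \<le> 2 / (?D - l) + k" using t k by simp
        have h: "hbound bp z 1 (lstep (2 / (?D - l) + k) l ((?D - l) / ?D))"
          using lk[unfolded linkable_def, rule_format, OF bp ne tri th B0 hm] unfolding ml .
        have r: "(1 + 3 / 100 * l) * (2 * (1 - l * (1 / ?D)) * (1 / ?D) + (1 - l * (1 / ?D))\<^sup>2 * k)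
            + ((104/100) * (1 / ?D) + 2 / 100)\<^sup>2 * l + (12/10) * \<kappa> * l \<le> 2 * (1 / ?D) + k"
          by (rule riccati_step[OF _ _ _ k_def \<kappa>]) (use z l t in auto)
        have e1: "1 - l * (1 / ?D) = (?D - l) / ?D" using z(2) by (simp add: diff_divide_distrib)
        have e2: "((?D - l) / ?D)\<^sup>2 * (2 / (?D - l) + k) = 2 * ((?D - l) / ?D) * (1 / ?D) + ((?D - l) / ?D)\<^sup>2 * k"
          using t z(2) by (simp add: power2_eq_square distrib_left)
        have e3: "(1 - (?D - l) / ?D) / l = 1 / ?D" using z(2) l(1) by (simp add: diff_divide_distrib)
        have e4: "t * u * B = u * (t * B)" for t u B :: real by simp
        have "lstep (2 / (?D - l) + k) l ((?D - l) / ?D) \<le> 2 * (1 / ?D) + k"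
          using r unfolding lstep_def e1 e3 e4 e2 .
        then show ?thesis using hbound_mono[OF h] by simp
      qed
    qed
  qed
  moreover obtain n where "1 / l < real n" using reals_Archimedean2 by blast
  then have "1 \<le> real (Suc n) * l" using l(1) by (simp add: pos_divide_less_eq algebra_simps)
  ultimately show ?thesis using z unfolding k_def by (meson order_trans)
qed

lemma FF_limit:
  assumes "limitin (Metric_space.mtopology SM dM) \<sigma> p sequentially"
  shows "(\<lambda>n. FF (\<sigma> n)) \<longlonglongrightarrow> FF p"
proof -
  interpret MS: Metric_space SM dM by (rule metric)
  have p: "p \<in> SM" and lim: "\<And>e. e > 0 \<Longrightarrow> \<forall>\<^sub>F n in sequentially. \<sigma> n \<in> SM \<and> dM (\<sigma> n) p < e"
    using assms unfolding MS.limitin_metric by auto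
  obtain c r K where c: "c \<in> atlas M" "p \<in> fst c" and rK: "r > 0" "K > 0"
    and lo: "\<forall>q\<in>SM. K * dM p q < r \<longrightarrow> q \<in> fst c \<and> snd c q \<in> ball (snd c p) r \<and> norm (snd c q - snd c p) \<le> K * dM p q"
    using chart_ball[OF p] by (elim exE conjE) (rule that)
  interpret C: lchart "coords c" "Fc c" Q "rm c" by (rule lc[OF c(1)])
  have x0: "snd c p \<in> coords c" using c by blast
  have ev: "\<forall>\<^sub>F n in sequentially. \<sigma> n \<in> fst c \<and> norm (snd c (\<sigma> n) - snd c p) < e" if e: "e > 0" for e
  proof -
    have "min (r / K) (e / K) > 0" using rK e by simp
    from lim[OF this] show ?thesis
    proof eventually_elim
      case (elim n)
      then have "dM p (\<sigma> n) < r / K" "dM p (\<sigma> n) < e / K" using dist_commute'[of p] by auto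
      then have "K * dM p (\<sigma> n) < r" "K * dM p (\<sigma> n) < e" using rK(2) by (simp_all add: pos_less_divide_eq mult.commute)
      then show ?case using lo elim by (meson le_less_trans)
    qed
  qed
  have "(\<lambda>n. snd c (\<sigma> n)) \<longlonglongrightarrow> snd c p"
  proof (rule tendstoI)
    fix e :: real assume "e > 0"
    from ev[OF this] show "\<forall>\<^sub>F n in sequentially. dist (snd c (\<sigma> n)) (snd c p) < e" by eventually_elim (simp add: dist_norm)
  qed
  moreover have "isCont (Fc c) (snd c p)"
    using smooth_on_continuous[OF C.F] C.U x0 by (simp only: continuous_on_eq_continuous_at)
  ultimately have "(\<lambda>n. Fc c (snd c (\<sigma> n))) \<longlonglongrightarrow> Fc c (snd c p)" by (rule isCont_tendsto_compose[rotated])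
  then have "(\<lambda>n. Fc c (snd c (\<sigma> n))) \<longlonglongrightarrow> FF p" unfolding ci_snd[OF c] .
  moreover have "\<forall>\<^sub>F n in sequentially. Fc c (snd c (\<sigma> n)) = FF (\<sigma> n)"
    using ev[OF rK(1)] by eventually_elim (simp add: ci_snd[OF c(1)])
  ultimately show ?thesis by (rule Lim_transform_eventually)
qed

text \<open>The first order bound in the norm of the metric comes along because the maximum
  principle must keep the curve in the unit ball and control the difference of the distances at
  \<open>s\<close> and \<open>- s\<close>. The factor 2 is \<open>1 + \<eta>\<close> with
  \<open>\<eta> = 1\<close> in \<open>good_nbhd\<close>.\<close>

lemma gjet_exists:
  assumes c: "c \<in> atlas M" "z \<in> fst c"
  shows "\<exists>\<sigma> B. gjet z c v \<sigma> \<and> (\<forall>\<^sub>F s in at 0. dM z (\<sigma> s) \<le> 2 * (\<bar>s\<bar> * (sqrt (rm c (snd c z) v v) + \<bar>s\<bar> * B)))"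
proof -
  interpret C: lchart "coords c" "Fc c" Q "rm c" by (rule lc[OF c(1)])
  define x where "x = snd c z"
  have x: "x \<in> coords c" using c by (auto simp: x_def)
  define G where "G = C.Gam x v v"
  define y where "y s = x + s *\<^sub>R v + (s\<^sup>2 / 2) *\<^sub>R (- G)" for s :: real
  have jy: "jet2 y x v (- G)" unfolding y_def[abs_def] by (rule jet2_explicit)
  have zero_less_one': "(0::real) < 1" by simp
  from C.good_nbhd[OF x this] obtain r where r: "r > 0" "ball x r \<subseteq> coords c"
    and good: "\<forall>a\<in>ball x r. \<forall>b\<in>ball x r. (\<forall>w. rm c a w w \<le> (1 + 1)\<^sup>2 * rm c b w w) \<and>
     (\<forall>w v. rm c a (C.nv b a w v) (C.nv b a w v) \<le> 1\<^sup>2 * (rm c a w w * rm c b v v)) \<and>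
     (\<forall>v. rm c a (C.ev b v a) (C.ev b v a) \<le> (1 + 1)\<^sup>2 * rm c b v v)" by blast
  have xr: "x \<in> ball x r" using r by simp
  have near: "\<forall>\<^sub>F s in at 0. y s \<in> ball x r" by (rule topological_tendstoD[OF jet2_tendsto[OF jy] open_ball xr])
  have nearU: "\<forall>\<^sub>F s in at 0. y s \<in> coords c" using near by eventually_elim (rule subsetD[OF r(2)])
  have yc: "\<forall>\<^sub>F s in at 0. y s = snd c (ci c (y s))" using nearU by eventually_elim (rule snd_ci[symmetric])
  have "\<forall>\<^sub>F s in at 0. ci c (y s) \<in> fst c" using nearU by eventually_elim (rule ci_in)
  then have "gjet z c v (\<lambda>s. ci c (y s))" unfolding gjet_def x_def[symmetric] G_def[symmetric] using c jet2_cong[OF jy yc] by (intro conjI)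
  moreover have "\<forall>\<^sub>F s in at 0. dM z (ci c (y s)) \<le> 2 * (\<bar>s\<bar> * (sqrt (rm c x v v) + \<bar>s\<bar> * (sqrt (rm c x G G) / 2)))"
    using near
  proof eventually_elim
    case (elim s)
    have sc: "sqrt (rm c x (a *\<^sub>R b) (a *\<^sub>R b)) = \<bar>a\<bar> * sqrt (rm c x b b)" for a b
      by (simp add: C.g_simps[OF x] real_sqrt_mult mult.assoc[symmetric])
    let ?u = "v + (- (s / 2)) *\<^sub>R G"
    have seg: "closed_segment x (y s) \<subseteq> ball x r" using xr elim by (intro closed_segment_subset convex_ball)
    then have segc: "closed_segment x (y s) \<subseteq> coords c" using r(2) by (rule order_trans)
    have k: "sqrt (rm c \<xi> (y s - x) (y s - x)) \<le> 2 * sqrt (rm c x (y s - x) (y s - x))" if "\<xi> \<in> closed_segment x (y s)" for \<xi>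
    proof -
      have "\<xi> \<in> ball x r" using that seg by blast
      then have "rm c \<xi> (y s - x) (y s - x) \<le> (1 + 1)\<^sup>2 * rm c x (y s - x) (y s - x)"
        by (rule good[THEN bspec, THEN bspec, OF _ xr, THEN conjunct1, THEN spec])
      from real_sqrt_le_mono[OF this] show ?thesis by (simp add: real_sqrt_mult)
    qed
    have "dM (ci c x) (ci c (y s)) \<le> 2 * sqrt (rm c x (y s - x) (y s - x))" by (rule riem_dist_le_line[OF c(1) segc k])
    then have d: "dM z (ci c (y s)) \<le> 2 * sqrt (rm c x (y s - x) (y s - x))" unfolding x_def ci_snd[OF c] .
    have e: "y s - x = s *\<^sub>R ?u" by (simp add: y_def power2_eq_square scaleR_diff_right)
    have "sqrt (rm c x ?u ?u) \<le> sqrt (rm c x v v) + \<bar>s\<bar> * (sqrt (rm c x G G) / 2)"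
      using C.g_triangle[OF x, of v "(- (s / 2)) *\<^sub>R G"] unfolding sc by simp
    then have "\<bar>s\<bar> * sqrt (rm c x ?u ?u) \<le> \<bar>s\<bar> * (sqrt (rm c x v v) + \<bar>s\<bar> * (sqrt (rm c x G G) / 2))"
      by (rule mult_left_mono) simp
    then show ?case using d unfolding e sc by linarith
  qed
  ultimately show ?thesis unfolding x_def by blast
qed

text \<open>The function \<open>\<phi>\<close> minus \<open>\<delta>\<close> times the squared
  distance is maximized on the closed unit ball about a point where \<open>\<phi>\<close> is within
  \<open>\<delta>\<close> of its supremum. The maximum lies in the interior, so there the Hessian of
  \<open>\<phi>\<close> is at most \<open>\<delta>\<close> times that of the squared distance, and
  the latter is bounded independently of the base point.\<close>

theorem maximum_principle:
  assumes compl: "riem_complete M" and ne: "SM \<noteq> {}" and T: "bounded_linear T"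
    and bd: "\<And>p. p \<in> SM \<Longrightarrow> T (FF p) \<le> \<Phi>" and \<epsilon>: "\<epsilon> > (0::real)"
  shows "\<exists>c\<in>atlas M. \<exists>x\<in>coords c. \<forall>v. T (alc c x v v) \<le> \<epsilon> * rm c x v v"
proof -
  interpret MS: Metric_space SM dM by (rule metric)
  interpret T: bounded_linear T by (rule T)
  define k where "k = 2 * \<kappa> + 1"
  have k: "0 \<le> k" using \<kappa> by (simp add: k_def)
  \<comment> \<open>\<open>2 * (2 + k) + 32\<close> bounds the second difference of the squared
    distance: \<open>D * (2 / D + k) \<le> 2 + k\<close> for \<open>0 < D < 1\<close>, and 32 is the
    constant of \<open>sum_squares_estimate\<close>.\<close>
  define \<delta> where "\<delta> = \<epsilon> / (2 * (2 + k) + 32)"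
  have \<delta>: "\<delta> > 0" "\<delta> * (2 * (2 + k) + 32) = \<epsilon>" using k \<epsilon> by (simp_all add: \<delta>_def)
  define \<phi> where "\<phi> p = T (FF p)" for p
  define S where "S = Sup (\<phi> ` SM)"
  have bdd: "bdd_above (\<phi> ` SM)" using bd by (intro bdd_aboveI[of _ \<Phi>]) (auto simp: \<phi>_def)
  have S: "\<phi> p \<le> S" if "p \<in> SM" for p unfolding S_def using that bdd by (intro cSup_upper) auto
  have "\<exists>y\<in>\<phi> ` SM. S - \<delta> < y"
    using less_cSup_iff[of "\<phi> ` SM" "S - \<delta>"] bdd ne \<delta>(1) unfolding S_def by simp
  then obtain bp where bp: "bp \<in> SM" "S - \<delta> < \<phi> bp" by (elim bexE imageE) simp
  define h where "h p = \<phi> p - \<delta> * (dM bp p)\<^sup>2" for p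
  have d0: "dM bp bp = 0" using MS.zero[OF bp(1) bp(1)] by simp
  have "\<exists>z\<in>MS.mcball bp 1. \<forall>y\<in>MS.mcball bp 1. h y \<le> h z"
  proof (rule MS.compact_attains_max[OF closed_balls_compact[OF compl bp(1)]])
    have "bp \<in> MS.mcball bp 1" using bp(1) d0 by simp
    then show "MS.mcball bp 1 \<noteq> {}" by blast
    show "h p \<le> S" if "p \<in> MS.mcball bp 1" for p
    proof -
      have "\<delta> * (dM bp p)\<^sup>2 \<ge> 0" using \<delta>(1) by simp
      then show ?thesis using S[of p] that unfolding h_def by auto
    qed
    fix \<sigma> l assume l: "limitin MS.mtopology \<sigma> l sequentially" "range \<sigma> \<subseteq> MS.mcball bp 1"
    have "(\<lambda>n. dM (\<sigma> n) bp) \<longlonglongrightarrow> dM l bp"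
    proof (rule MS.d_limit[OF l(1)])
      show "\<sigma> n \<in> SM" for n using subsetD[OF l(2) rangeI[of \<sigma> n]] by simp
    qed (use bp(1) in auto)
    then have "(\<lambda>n. dM bp (\<sigma> n)) \<longlonglongrightarrow> dM bp l" by (simp only: dist_commute'[of bp])
    then show "(\<lambda>n. h (\<sigma> n)) \<longlonglongrightarrow> h l" unfolding h_def \<phi>_def
      by (intro tendsto_intros T.tendsto FF_limit[OF l(1)])
  qed
  then obtain z where z: "z \<in> MS.mcball bp 1" and max: "\<And>y. y \<in> MS.mcball bp 1 \<Longrightarrow> h y \<le> h z" by blast
  define D where "D = dM bp z"
  have zS: "z \<in> SM" and D1: "D \<le> 1" using z by (auto simp: D_def)
  have D0: "0 \<le> D" using dist_nonneg by (simp add: D_def)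
  \<comment> \<open>On the boundary the penalty is \<open>\<delta>\<close>, more than
    \<open>\<phi>\<close> can gain over its value at \<open>bp\<close>.\<close>
  have "D \<noteq> 1"
  proof
    assume "D = 1"
    then have "h z = \<phi> z - \<delta>" by (simp add: h_def D_def)
    moreover have "h bp = \<phi> bp" by (simp add: h_def d0)
    moreover have "h bp \<le> h z" using max bp(1) d0 by simp
    ultimately show False using bp(2) S[OF zS] by linarith
  qed
  then have D1: "D < 1" using D1 by simp
  obtain c where c: "c \<in> atlas M" "z \<in> fst c" using chart_exists[OF zS] by blast
  interpret C: lchart "coords c" "Fc c" Q "rm c" by (rule lc[OF c(1)])
  define x where "x = snd c z"
  have x: "x \<in> coords c" using c by (auto simp: x_def)
  have "T (alc c x v v) \<le> \<epsilon> * rm c x v v" for v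
  proof (cases "v = 0")
    case True
    have "alc c x 0 0 = 0" by (rule bilinear_lzero[OF C.al_bilinear[OF x]])
    then show ?thesis using True by (simp add: T.zero C.g_simps[OF x])
  next
    case False
    define N where "N = sqrt (rm c x v v)"
    have N: "N > 0" using C.g_pos[OF x False] by (simp add: N_def)
    have N2: "rm c x v v = N\<^sup>2" using C.g_pos[OF x False] by (simp add: N_def)
    obtain \<sigma> B where j: "gjet z c v \<sigma>" and dz: "\<forall>\<^sub>F s in at 0. dM z (\<sigma> s) \<le> 2 * (\<bar>s\<bar> * (N + \<bar>s\<bar> * B))"
      using gjet_exists[OF c, of v] unfolding N_def x_def by blast
    have lim: "((\<lambda>s. a * \<bar>s\<bar>) \<longlongrightarrow> a * \<bar>0\<bar>) (at 0)" for a :: real by (intro tendsto_intros)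
    have small: "\<forall>\<^sub>F s in at 0. a * \<bar>s\<bar> < b" if "0 < b" for a b :: real
      using order_tendstoD(2)[OF lim[of a], of b] that by simp
    have inS: "\<forall>\<^sub>F s in at 0. \<sigma> s \<in> SM"
    proof -
      have "\<forall>\<^sub>F s in at 0. \<sigma> s \<in> fst c" using j by (simp add: gjet_def)
      then show ?thesis by eventually_elim (use domain_subset[OF c(1)] in blast)
    qed
    have near: "\<forall>\<^sub>F s in at 0. \<sigma> s \<in> SM \<and> dM z (\<sigma> s) \<le> 4 * \<bar>s\<bar> * N"
      using dz small[OF N, of B] inS
    proof eventually_elim
      case (elim s)
      have "\<bar>s\<bar> * (N + \<bar>s\<bar> * B) \<le> \<bar>s\<bar> * (2 * N)" using elim(2) by (intro mult_left_mono) (auto simp: mult.commute)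
      then show ?case using elim(1,3) by linarith
    qed
    show ?thesis
    proof (rule field_le_epsilon)
      fix e' :: real assume e': "e' > 0"
      \<comment> \<open>An error \<open>e\<close> from \<open>\<phi>\<close> and
        \<open>3 * e * \<delta>\<close> from the squared distance add up to
        \<open>e'\<close>.\<close>
      define e where "e = e' / (1 + 3 * \<delta>)"
      have e: "e > 0" "e * (1 + 3 * \<delta>) = e'" using e' \<delta>(1) by (simp_all add: e_def)
      define \<beta> where "\<beta> = (2 / D + k) * N\<^sup>2 + e"
      \<comment> \<open>At \<open>bp\<close> the comparison function is singular. The premise
        \<open>D > 0\<close> lets both cases share the estimates below; for \<open>D = 0\<close> the
        bound \<open>4 * \<bar>s\<bar> * N\<close> on both distances is enough, as their squares are
        then of order \<open>s\<^sup>2\<close>.\<close>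
      have second: "\<forall>\<^sub>F s in at 0. D > 0 \<longrightarrow> dM bp (\<sigma> s) + dM bp (\<sigma> (- s)) \<le> 2 * D + s\<^sup>2 * \<beta>"
      proof (cases "D > 0")
        case True
        have "hbound bp z 1 (2 / D + k)" unfolding D_def k_def
          by (rule hbound_riccati[OF compl bp(1) zS]) (use True D1 in \<open>auto simp: D_def\<close>)
        moreover have "gjet z c (1 *\<^sub>R v) \<sigma>" using j by simp
        ultimately have "\<forall>\<^sub>F s in at 0. dM bp (\<sigma> s) + dM bp (\<sigma> (- s)) \<le> 2 * dM bp z + s\<^sup>2 * (1\<^sup>2 * (2 / D + k) * rm c (snd c z) v v + e)"
          using e(1) unfolding hbound_def by blast
        then show ?thesis by eventually_elim (simp add: \<beta>_def D_def N2[unfolded x_def])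
      qed simp
      have "\<forall>\<^sub>F s in at 0. norm (T (FF (\<sigma> s)) + T (FF (\<sigma> (- s))) - 2 *\<^sub>R T (FF z) - s\<^sup>2 *\<^sub>R T (alc c (snd c z) v v)) \<le> e * s\<^sup>2"
        by (rule jet2_second_difference[OF jet2_linear[OF T gjet_F[OF j]] e(1)])
      then have taylor: "\<forall>\<^sub>F s in at 0. T (alc c x v v) * s\<^sup>2 - e * s\<^sup>2 \<le> \<phi> (\<sigma> s) + \<phi> (\<sigma> (- s)) - 2 * \<phi> z"
        by eventually_elim (simp add: \<phi>_def x_def abs_le_iff mult.commute)
      have b2: "\<forall>\<^sub>F s in at 0. s\<^sup>2 * \<beta>\<^sup>2 < 2 * e"
      proof -
        have "((\<lambda>s. s\<^sup>2 * \<beta>\<^sup>2) \<longlongrightarrow> 0\<^sup>2 * \<beta>\<^sup>2) (at (0::real))" by (intro tendsto_intros)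
        from order_tendstoD(2)[OF this, of "2 * e"] e(1) show ?thesis by simp
      qed
      have D1': "0 < 1 - D" using D1 by simp
      have nz: "\<forall>\<^sub>F s in at (0::real). s \<noteq> 0" by (simp add: eventually_at_filter)
      have "\<forall>\<^sub>F s in at (0::real). T (alc c x v v) \<le> e + \<delta> * (2 * ((2 + k) * N\<^sup>2 + e) + e + 32 * N\<^sup>2)"
        using near eventually_at_0_minus[OF near] second taylor b2 small[OF D1', of "4 * N"] nz
      proof eventually_elim
        case (elim s)
        let ?p = "dM bp (\<sigma> s)" and ?q = "dM bp (\<sigma> (- s))"
        have S: "\<sigma> s \<in> SM" "\<sigma> (- s) \<in> SM" and zs: "dM z (\<sigma> s) \<le> 4 * \<bar>s\<bar> * N" "dM z (\<sigma> (- s)) \<le> 4 * \<bar>s\<bar> * N"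
          using elim(1,2) by auto
        have sN: "4 * \<bar>s\<bar> * N < 1 - D" using elim(6) by (simp add: mult.commute mult.left_commute)
        have pq: "?p \<le> D + 4 * \<bar>s\<bar> * N" "?q \<le> D + 4 * \<bar>s\<bar> * N"
          using dist_triangle[OF bp(1) zS S(1)] dist_triangle[OF bp(1) zS S(2)] zs unfolding D_def by linarith+
        have p0: "0 \<le> ?p" "0 \<le> ?q" by (rule dist_nonneg)+
        have "h (\<sigma> s) \<le> h z" "h (\<sigma> (- s)) \<le> h z" using pq sN S bp(1) by (intro max; simp)+
        then have A: "T (alc c x v v) * s\<^sup>2 - e * s\<^sup>2 \<le> \<delta> * (?p\<^sup>2 + ?q\<^sup>2 - 2 * D\<^sup>2)"
          using elim(4) unfolding h_def D_def by (simp add: algebra_simps)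
        have P: "?p\<^sup>2 + ?q\<^sup>2 - 2 * D\<^sup>2 \<le> s\<^sup>2 * (2 * ((2 + k) * N\<^sup>2 + e) + e + 32 * N\<^sup>2)"
        proof (cases "D > 0")
          case True
          have pS: "\<bar>?p - ?q\<bar> \<le> 8 * \<bar>s\<bar> * N"
          proof -
            have "dM (\<sigma> s) (\<sigma> (- s)) \<le> dM (\<sigma> s) z + dM z (\<sigma> (- s))" by (rule dist_triangle[OF S(1) zS S(2)])
            moreover have "?p \<le> ?q + dM (\<sigma> (- s)) (\<sigma> s)" "?q \<le> ?p + dM (\<sigma> s) (\<sigma> (- s))"
              by (rule dist_triangle[OF bp(1) S(2) S(1)], rule dist_triangle[OF bp(1) S(1) S(2)])
            ultimately show ?thesis using zs dist_commute'[of "\<sigma> s" z] dist_commute'[of "\<sigma> s" "\<sigma> (- s)"] by linarith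
          qed
          have "D * \<beta> = 2 * N\<^sup>2 + D * (k * N\<^sup>2) + D * e" using True by (simp add: \<beta>_def distrib_left distrib_right)
          moreover have "D * (k * N\<^sup>2) \<le> 1 * (k * N\<^sup>2)" "D * e \<le> 1 * e" using D1 k e(1) by (intro mult_right_mono; simp)+
          ultimately have b: "D * \<beta> \<le> (2 + k) * N\<^sup>2 + e" by (simp add: distrib_right)
          show ?thesis
            by (rule sum_squares_estimate[OF p0 _ pS b]) (use elim(3,5) True in auto)
        next
          case False
          then have D00: "D = 0" using D0 by simp
          have "?p\<^sup>2 \<le> (4 * \<bar>s\<bar> * N)\<^sup>2" "?q\<^sup>2 \<le> (4 * \<bar>s\<bar> * N)\<^sup>2" using pq p0 D00 by (intro power_mono; simp)+
          moreover have "(4 * \<bar>s\<bar> * N)\<^sup>2 = 16 * (s\<^sup>2 * N\<^sup>2)" by (simp add: power_mult_distrib)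
          moreover have "s\<^sup>2 * (2 * ((2 + k) * N\<^sup>2 + e) + e + 32 * N\<^sup>2) = s\<^sup>2 * (2 * ((2 + k) * N\<^sup>2 + e) + e) + 32 * (s\<^sup>2 * N\<^sup>2)"
            by (simp add: distrib_left)
          moreover have "0 \<le> s\<^sup>2 * (2 * ((2 + k) * N\<^sup>2 + e) + e)" using k e(1) by simp
          ultimately show ?thesis using D00 by simp
        qed
        show ?case by (rule second_difference_estimate[OF elim(7) A P]) (use \<delta> in simp)
      qed
      then have "T (alc c x v v) \<le> e + \<delta> * (2 * ((2 + k) * N\<^sup>2 + e) + e + 32 * N\<^sup>2)" by simp
      also have "\<dots> = \<delta> * (2 * (2 + k) + 32) * N\<^sup>2 + e * (1 + 3 * \<delta>)" by (simp add: algebra_simps)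
      finally show "T (alc c x v v) \<le> \<epsilon> * rm c x v v + e'" unfolding \<delta>(2) e(2) N2 .
    qed
  qed
  then show ?thesis using c x by blast
qed

end

section \<open>The hyperboloid model\<close>

definition mink :: "real \<times> 'h::euclidean_space \<Rightarrow> real \<times> 'h \<Rightarrow> real" where
  "mink p q = snd p \<bullet> snd q - fst p * fst q"

text \<open>Half of the factor by which the Poincare metric scales lengths at \<open>y\<close>. A
  set is bounded in hyperbolic space only if \<open>conf\<close> is bounded on it.\<close>

definition conf :: "'h::euclidean_space \<Rightarrow> real" where "conf y = inverse (1 - y \<bullet> y)"

text \<open>The usual map from the Poincare ball to the upper sheet of the hyperboloid, with time
  component (1 + |y|^2) / (1 - |y|^2) and space component 2 y / (1 - |y|^2). Written through
  \<open>conf\<close>, its derivative is polynomial in \<open>conf\<close> and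
  \<open>y\<close>.\<close>

definition hlift :: "'h::euclidean_space \<Rightarrow> real \<times> 'h" where
  "hlift y = (2 * conf y - 1, (2 * conf y) *\<^sub>R y)"

lemma ball_conf: assumes "y \<in> ball 0 1" shows "1 - y \<bullet> y > 0" "1 \<le> conf y" "conf y * (1 - y \<bullet> y) = 1"
proof -
  have "norm y < 1" using assms by simp
  then have "(norm y)\<^sup>2 < 1" by (simp add: power_less_one_iff)
  then show 1: "1 - y \<bullet> y > 0" by (simp add: power2_norm_eq_inner)
  show "1 \<le> conf y" unfolding conf_def by (rule one_le_inverse[OF 1]) simp
  show "conf y * (1 - y \<bullet> y) = 1" using 1 by (simp add: conf_def)
qed

lemma bounded_bilinear_mink: "bounded_bilinear (mink :: real \<times> 'h::euclidean_space \<Rightarrow> _)"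
proof -
  have 1: "bounded_bilinear (\<lambda>(p :: real \<times> 'h) (q :: real \<times> 'h). snd p \<bullet> snd q)"
    by (rule bounded_bilinear.comp[OF bounded_bilinear_inner bounded_linear_snd bounded_linear_snd])
  have 2: "bounded_bilinear (\<lambda>(p :: real \<times> 'h) (q :: real \<times> 'h). fst p * fst q)"
    by (rule bounded_bilinear.comp[OF bounded_bilinear_mult bounded_linear_fst bounded_linear_fst])
  obtain K1 where K1: "\<And>p q.  norm (snd (p :: real \<times> 'h) \<bullet> snd (q :: real \<times> 'h)) \<le> norm p * norm q * K1" using bounded_bilinear.bounded[OF 1] by blast
  obtain K2 where K2: "\<And>p q.  norm (fst (p :: real \<times> 'h) * fst (q :: real \<times> 'h)) \<le> norm p * norm q * K2" using bounded_bilinear.bounded[OF 2] by blast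
  show ?thesis
  proof
    show "\<exists>K. \<forall>a b. norm (mink a (b :: real \<times> 'h)) \<le> norm a * norm b * K"
    proof (intro exI[of _ "K1 + K2"] allI)
      fix a b :: "real \<times> 'h"
      have "norm (mink a b) \<le> norm (snd a \<bullet> snd b) + norm (fst a * fst b)" unfolding mink_def by (rule norm_triangle_ineq4)
      then show "norm (mink a b) \<le> norm a * norm b * (K1 + K2)" using K1[of a b] K2[of a b] by (simp add: distrib_left)
    qed
  qed (simp_all add: mink_def inner_add_left inner_add_right algebra_simps)
qed

lemma mink_sym: "mink a b = mink b a"
  by (simp add: mink_def inner_commute mult.commute)

lemma mink_hlift: assumes "y \<in> ball 0 1" shows "mink (hlift y) (hlift y) = - 1"
proof -
  let ?s = "conf y"
  have "mink (hlift y) (hlift y) = - 4 * (?s * (?s * (1 - y \<bullet> y))) + 4 * ?s - 1"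
    by (simp add: mink_def hlift_def algebra_simps)
  then show ?thesis using ball_conf(3)[OF assms] by simp
qed

definition dconf :: "'h::euclidean_space \<Rightarrow> 'h \<Rightarrow> real" where "dconf y u = 2 * (y \<bullet> u) * (conf y)\<^sup>2"

lemma conf_deriv: assumes "y \<in> ball 0 1" shows "(conf has_derivative dconf y) (at y)"
proof -
  have "((\<lambda>y. 1 - y \<bullet> y) has_derivative (\<lambda>u. - (2 * (y \<bullet> u)))) (at y)"
    by (auto intro!: derivative_eq_intros simp: inner_commute)
  from Deriv.has_derivative_inverse[OF _ this] ball_conf(1)[OF assms]
  have "((\<lambda>y. inverse (1 - y \<bullet> y)) has_derivative (\<lambda>u. - (inverse (1 - y \<bullet> y) * - (2 * (y \<bullet> u)) * inverse (1 - y \<bullet> y)))) (at y)" by simp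
  then show ?thesis unfolding conf_def[abs_def] dconf_def[abs_def] by (simp add: power2_eq_square mult_ac)
qed

definition dhlift :: "'h::euclidean_space \<Rightarrow> 'h \<Rightarrow> real \<times> 'h" where
  "dhlift y u = (2 * dconf y u, (2 * conf y) *\<^sub>R u + (2 * dconf y u) *\<^sub>R y)"

lemma hlift_deriv: assumes "y \<in> ball 0 1" shows "(hlift has_derivative dhlift y) (at y)"
proof -
  have 1: "((\<lambda>y. 2 * conf y) has_derivative (\<lambda>u. 2 * dconf y u)) (at y)"
    by (rule has_derivative_mult_right[OF conf_deriv[OF assms]])
  have "((\<lambda>y. 2 * conf y - 1) has_derivative (\<lambda>u. 2 * dconf y u)) (at y)"
    using has_derivative_diff[OF 1 has_derivative_const[of 1]] by simp
  from has_derivative_Pair[OF this has_derivative_scaleR[OF 1 has_derivative_ident]]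
  show ?thesis unfolding hlift_def[abs_def] dhlift_def[abs_def] .
qed

text \<open>\<open>hlift\<close> is isometric: the terms in the radial components of
  \<open>u\<close> and \<open>v\<close> cancel because
  \<open>conf y * (1 - y \<bullet> y) = 1\<close>.\<close>

lemma mink_dhlift: assumes "y \<in> ball 0 1"
  shows "mink (dhlift y u) (dhlift y v) = 4 * (u \<bullet> v) / (1 - (norm y)\<^sup>2)\<^sup>2"
proof -
  let ?s = "conf y"
  define a where "a = y \<bullet> u"
  define b where "b = y \<bullet> v"
  have s: "?s * (1 - y \<bullet> y) = 1" by (rule ball_conf(3)[OF assms])
  have d: "dconf y u = 2 * a * ?s\<^sup>2" "dconf y v = 2 * b * ?s\<^sup>2" by (simp_all add: dconf_def a_def b_def)
  have "mink (dhlift y u) (dhlift y v) =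
     4 * ?s\<^sup>2 * (u \<bullet> v) + 4 * ?s * (dconf y v * a + dconf y u * b) - 4 * (dconf y u * dconf y v) * (1 - y \<bullet> y)"
    by (simp add: mink_def dhlift_def a_def b_def inner_add_left inner_add_right inner_commute[of u y] power2_eq_square algebra_simps)
  also have "\<dots> = 4 * ?s\<^sup>2 * (u \<bullet> v) + 16 * (a * b) * ?s ^ 3 - 16 * (a * b) * ?s ^ 3 * (?s * (1 - y \<bullet> y))"
    unfolding d by (simp add: power2_eq_square power3_eq_cube algebra_simps)
  also have "\<dots> = 4 * ?s\<^sup>2 * (u \<bullet> v)" unfolding s by simp
  also have "\<dots> = 4 * (u \<bullet> v) / (1 - (norm y)\<^sup>2)\<^sup>2"
    by (simp add: conf_def power2_norm_eq_inner power_inverse divide_inverse mult_ac)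
  finally show ?thesis .
qed

lemma smooth_on_inner_self: "open S \<Longrightarrow> smooth_on S h \<Longrightarrow> smooth_on S (\<lambda>x. h x \<bullet> h x)"
  by (rule smooth_on_bilinear[OF _ bounded_bilinear_inner])

lemma smooth_on_conf:
  assumes S: "open S" and h: "smooth_on S h" and im: "\<And>x. x \<in> S \<Longrightarrow> h x \<in> ball 0 1"
  shows "smooth_on S (\<lambda>x. conf (h x))"
  unfolding conf_def
proof (rule smooth_on_inverse[OF S])
  show "1 - h x \<bullet> h x \<noteq> 0" if "x \<in> S" for x using ball_conf(1)[OF im[OF that]] by simp
  show "smooth_on S (\<lambda>x. 1 - h x \<bullet> h x)"
    by (rule smooth_on_diff[OF S smooth_on_const smooth_on_inner_self[OF S h]])
qed

lemma smooth_on_hlift: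
  assumes S: "open S" and h: "smooth_on S h" and im: "\<And>x. x \<in> S \<Longrightarrow> h x \<in> ball 0 1"
  shows "smooth_on S (\<lambda>x. hlift (h x))"
proof -
  note cf = smooth_on_conf[OF S h im]
  note 2 = smooth_on_linear_comp[OF S bounded_linear_mult_right cf, of 2]
  have "bounded_linear (\<lambda>r::real. (r, 0::'b))" by (rule bounded_linear_Pair[OF bounded_linear_ident bounded_linear_zero])
  note a = smooth_on_linear_comp[OF S this smooth_on_diff[OF S 2 smooth_on_const[of S 1]]]
  have "bounded_linear (\<lambda>r::'b. (0::real, r))" by (rule bounded_linear_Pair[OF bounded_linear_zero bounded_linear_ident])
  note b = smooth_on_linear_comp[OF S this smooth_on_bilinear[OF S bounded_bilinear_scaleR 2 h]]
  show ?thesis using smooth_on_add[OF S a b] by (simp add: hlift_def)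
qed

section \<open>Hyperbolic space as a Riemannian manifold\<close>

abbreviation hyp :: "('h::euclidean_space, 'h) riemannian" where "hyp \<equiv> hyperbolic_space"

lemma hyp_simps [simp]: "mtop hyp = top_of_set (ball 0 1)" "atlas hyp = {(ball 0 1, \<lambda>x. x)}"
  "riem_metric hyp c x u v = 4 * (u \<bullet> v) / (1 - (norm x)\<^sup>2)\<^sup>2"
  by (simp_all add: hyperbolic_space_def)

lemma inv_into_ident: "x \<in> S \<Longrightarrow> inv_into S (\<lambda>x. x) x = x"
  using inv_into_f_f[of "\<lambda>x. x" S x] by simp

lemma hyp_transition:
  fixes x :: "'h::euclidean_space"
  defines "c \<equiv> (ball 0 1 :: 'h set, \<lambda>x::'h. x)"
  shows "transition_dom c c = ball 0 1" "x \<in> ball 0 1 \<Longrightarrow> transition c c x = x"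
    "x \<in> ball 0 1 \<Longrightarrow> (transition c c has_derivative (\<lambda>u. u)) (at x)"
proof -
  show 1: "transition c c x = x" if "x \<in> ball 0 1" for x using inv_into_ident[OF that] by (simp add: local_rep_def c_def)
  show "transition_dom c c = ball 0 1" by (auto simp: local_rep_dom_def c_def)
  show "(transition c c has_derivative (\<lambda>u. u)) (at x)" if "x \<in> ball 0 1"
    by (rule has_derivative_transform_within_open[OF has_derivative_ident open_ball that]) (simp add: 1)
qed

lemma riem_conn_hyp: "riem_conn (hyp :: ('h::euclidean_space, 'h) riemannian)"
proof unfold_locales
  let ?M = "hyp :: ('h, 'h) riemannian"
  show "Hausdorff_space (mtop ?M)" by (simp add: Hausdorff_space_subtopology)
  have "second_countable (euclidean :: 'h topology)"
  proof -
    obtain B :: "'h set set" where B: "countable B" "topological_basis B" using ex_countable_basis by blast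
    have op: "\<And>C. C \<in> B \<Longrightarrow> open C" using B(2) unfolding topological_basis_def by blast
    have "\<exists>V\<in>B. x \<in> V \<and> V \<subseteq> U" if U: "open U" "x \<in> U" for U x
    proof -
      obtain A where "A \<subseteq> B" "U = \<Union>A" using B(2) U(1) unfolding topological_basis_def by blast
      then show ?thesis using U(2) by blast
    qed
    then show ?thesis unfolding second_countable_def using B(1) op by (intro exI[of _ B] conjI) (simp_all add: open_openin[symmetric])
  qed
  then show "second_countable (mtop ?M)" by (simp add: second_countable_subtopology)
  show "(\<Union>c\<in>atlas ?M. fst c) = topspace (mtop ?M)" by simp
  show "connected_space (mtop ?M)" by (simp add: connected_space_subtopology)
  fix c assume c: "c \<in> atlas ?M"
  show "openin (mtop ?M) (fst c)" using c by (simp add: openin_subtopology_self)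
  show "open (coords c)" using c by simp
  show "homeomorphic_map (subtopology (mtop ?M) (fst c)) (top_of_set (coords c)) (snd c)"
    using c homeomorphic_map_id[of "top_of_set (ball 0 1 :: 'h set)" "top_of_set (ball 0 1)"] by (simp add: subtopology_subtopology id_def)
  have cu: "coords c = ball 0 1" using c by simp
  show "smooth_on (coords c) (\<lambda>x. riem_metric ?M c x u v)" for u v
  proof -
    have id: "smooth_on (ball 0 1) (\<lambda>x::'h. x)" by (rule smooth_on_linear[OF bounded_linear_ident])
    have cf: "smooth_on (ball 0 1) (\<lambda>x::'h. conf x)" by (rule smooth_on_conf[OF open_ball id])
    have "smooth_on (ball 0 1) (\<lambda>x::'h. conf x * conf x)" by (rule smooth_on_bilinear[OF open_ball bounded_bilinear_mult cf cf])
    then have sc: "smooth_on (ball 0 1) (\<lambda>x::'h. (4 * (u \<bullet> v)) * (conf x * conf x))"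
      by (rule smooth_on_linear_comp[OF open_ball bounded_linear_mult_right[of "4 * (u \<bullet> v)"]])
    have eq: "riem_metric ?M c x u v = (4 * (u \<bullet> v)) * (conf x * conf x)" for x
      unfolding conf_def hyp_simps power2_norm_eq_inner by (simp add: divide_inverse power2_eq_square)
    show ?thesis unfolding cu eq by (rule sc)
  qed
  fix c' assume c': "c' \<in> atlas ?M"
  have cc: "c = (ball 0 1, \<lambda>x. x)" "c' = (ball 0 1, \<lambda>x. x)" using c c' by auto
  show "smooth_on (transition_dom c c') (transition c c')" unfolding cc hyp_transition(1)
    by (rule smooth_on_cong[OF open_ball _ smooth_on_linear[OF bounded_linear_ident]]) (simp add: hyp_transition(2))
  show "riem_metric ?M c x u v = riem_metric ?M c' (transition c c' x) (fd (transition c c') x u) (fd (transition c c') x v)"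
    if "x \<in> transition_dom c c'" for x u v
    using that unfolding cc hyp_transition(1) by (simp only: hyp_simps hyp_transition(2) fd_eqI[OF hyp_transition(3)])
next
  let ?M = "hyp :: ('h, 'h) riemannian"
  fix c x assume c: "c \<in> atlas ?M" "x \<in> coords c"
  then have x: "x \<in> ball 0 1" by simp
  have pos: "(1 - (norm x)\<^sup>2)\<^sup>2 > 0" using ball_conf(1)[OF x] by (simp add: power2_norm_eq_inner)
  show "bilinear (riem_metric ?M c x)" unfolding bilinear_def
    by (intro conjI allI linearI) (simp_all add: inner_add_left inner_add_right add_divide_distrib distrib_left)
  show "riem_metric ?M c x u v = riem_metric ?M c x v u" for u v by (simp add: inner_commute)
  show "0 < riem_metric ?M c x u u" if "u \<noteq> 0" for u using that pos by simp
qed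

text \<open>The logarithm of \<open>conf\<close> is 1-Lipschitz for the hyperbolic distance: its
  derivative \<open>2 * (y \<bullet> w) * conf y\<close> is at most
  \<open>2 * norm w * conf y\<close>, the hyperbolic norm of \<open>w\<close>. So
  \<open>conf\<close> grows at most exponentially with the distance from \<open>p\<close>.\<close>

lemma hyp_bounded_conf:
  assumes b: "riem_bounded hyp S" and p: "p \<in> S"
  shows "\<exists>B>0. \<forall>q\<in>S. conf (q :: 'h::euclidean_space) \<le> B"
proof -
  interpret H: riem_conn "hyp :: ('h, 'h) riemannian" by (rule riem_conn_hyp)
  interpret MS: Metric_space "topspace (mtop (hyp :: ('h, 'h) riemannian))" "riem_dist (hyp :: ('h, 'h) riemannian)" by (rule H.metric)
  have "MS.mbounded S" using b by (simp add: riem_bounded_def)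
  then obtain B where S: "S \<subseteq> ball 0 1" and B: "\<And>x y. x \<in> S \<Longrightarrow> y \<in> S \<Longrightarrow> riem_dist hyp x y \<le> B"
    unfolding MS.mbounded_alt by auto
  let ?c = "(ball 0 1 :: 'h set, \<lambda>x::'h. x)"
  have c: "?c \<in> atlas hyp" by simp
  have main: "conf q \<le> conf p * exp (B + 1)" if q: "q \<in> S" for q
  proof -
    have pq: "p \<in> topspace (mtop hyp)" "q \<in> topspace (mtop hyp)" using S p q by auto
    obtain L where L: "H.conn p q L" "L < riem_dist hyp p q + 1" using H.dist_approx[OF pq, of 1] by auto
    obtain \<gamma> a b where g: "a < b" "H.seg \<gamma> a b" "(speed hyp \<gamma> has_integral L) {a..b}" "\<gamma> a = p" "\<gamma> b = q"
      using L(1) unfolding H.conn_def by blast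
    have im: "\<gamma> ` {a..b} \<subseteq> ball 0 1"
      using g(2) unfolding H.seg_def by (auto simp: continuous_map_in_subtopology)
    have "ln (conf (snd ?c (\<gamma> b))) - ln (conf (snd ?c (\<gamma> a))) \<le> 1 * L"
    proof (rule H.seg_potential[where dh="\<lambda>y w. dconf y w / conf y", OF c g(2,3) less_imp_le[OF g(1)]])
      show "\<gamma> ` {a..b} \<subseteq> fst ?c" using im by simp
      show "((\<lambda>x. ln (conf x)) has_derivative (\<lambda>w. dconf x w / conf x)) (at x)" if "x \<in> coords ?c" for x
      proof -
        have x: "x \<in> ball 0 1" using that by simp
        then have "0 < conf x" using ball_conf(2)[OF x] by linarith
        then show ?thesis
          by (auto intro!: derivative_eq_intros conf_deriv[OF x] simp: divide_inverse mult.commute)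
      qed
      fix t w assume "t \<in> {a..b}"
      then have y: "\<gamma> t \<in> ball 0 1" using im by blast
      let ?y = "\<gamma> t"
      have s: "conf ?y > 0" using ball_conf(2)[OF y] by linarith
      have "dconf ?y w / conf ?y = 2 * (?y \<bullet> w) * conf ?y" using s by (simp add: dconf_def power2_eq_square)
      also have "\<dots> \<le> 2 * norm w * conf ?y"
      proof -
        have "?y \<bullet> w \<le> norm ?y * norm w" by (rule norm_cauchy_schwarz)
        also have "\<dots> \<le> 1 * norm w" using y by (intro mult_right_mono) auto
        finally show ?thesis using s by simp
      qed
      also have "\<dots> = sqrt (4 * (w \<bullet> w) / (1 - (norm ?y)\<^sup>2)\<^sup>2)"
      proof (rule real_sqrt_unique[symmetric])
        show "(2 * norm w * conf ?y)\<^sup>2 = 4 * (w \<bullet> w) / (1 - (norm ?y)\<^sup>2)\<^sup>2"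
          by (simp add: conf_def power_mult_distrib power2_norm_eq_inner power_inverse divide_inverse)
      qed (use s in simp)
      finally show "dconf (snd ?c ?y) w / conf (snd ?c ?y) \<le> 1 * sqrt (riem_metric hyp ?c (snd ?c ?y) w w)" by simp
    qed
    then have "ln (conf q) - ln (conf p) \<le> B + 1" using L(2) B[OF p q] g(4,5) by simp
    then have "ln (conf q) \<le> ln (conf p) + (B + 1)" by simp
    moreover have cp: "conf p > 0" "conf q > 0" using ball_conf(2)[of p] ball_conf(2)[of q] S p q by fastforce+
    ultimately have "exp (ln (conf q)) \<le> exp (ln (conf p) + (B + 1))" by (simp only: exp_le_cancel_iff)
    then show ?thesis unfolding exp_add exp_ln[OF cp(1)] exp_ln[OF cp(2)] .
  qed
  have "conf p > 0" using ball_conf(2)[of p] S p by fastforce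
  then have "conf p * exp (B + 1) > 0" by simp
  then show ?thesis using main by blast
qed

section \<open>Kaehler submanifolds of hyperbolic space\<close>

lemma (in riemannian_manifold) lchart_hyp:
  fixes f :: "'a \<Rightarrow> 'h::euclidean_space"
  assumes iso: "isometric_immersion M (hyp :: ('h, 'h) riemannian) f" and c: "c \<in> atlas M"
  shows "lchart (coords c) (\<lambda>x. hlift (f (ci c x))) mink (rm c)"
    and "x \<in> coords c \<Longrightarrow> f (ci c x) \<in> ball 0 1"
proof -
  let ?c = "(ball 0 1 :: 'h set, \<lambda>x::'h. x)"
  have c0: "?c \<in> atlas hyp" by simp
  have sm: "smooth_map M (hyp :: ('h, 'h) riemannian) f" using iso by (simp add: isometric_immersion_def immersion_def)
  have fb: "f p \<in> ball 0 1" if "p \<in> topspace (mtop M)" for p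
    using sm that unfolding smooth_map_def by (auto simp: continuous_map_in_subtopology)
  have fc: "f (ci c x) \<in> ball 0 1" if x: "x \<in> coords c" for x
    using fb ci_in[OF x] domain_subset[OF c] by blast
  then show "x \<in> coords c \<Longrightarrow> f (ci c x) \<in> ball 0 1" .
  have lr: "local_rep f c ?c = (\<lambda>x. f (ci c x))" by (simp add: local_rep_def o_def)
  have ld: "local_rep_dom f c ?c = coords c" using fb domain_subset[OF c] unfolding local_rep_dom_def by auto
  have sf: "smooth_on (coords c) (\<lambda>x. f (ci c x))" using sm c c0 unfolding smooth_map_def lr[symmetric] ld[symmetric] by blast
  note oc = open_coords[OF c]
  show "lchart (coords c) (\<lambda>x. hlift (f (ci c x))) mink (rm c)"
  proof (rule lchart.intro)
    show "open (coords c)" by (rule oc)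
    show "smooth_on (coords c) (\<lambda>x. hlift (f (ci c x)))" by (rule smooth_on_hlift[OF oc sf fc])
    show "bounded_bilinear (mink :: real \<times> 'h \<Rightarrow> _)" by (rule bounded_bilinear_mink)
    show "mink a b = mink b a" for a b :: "real \<times> 'h" by (rule mink_sym)
    show "rm c x u u > 0" if "x \<in> coords c" "u \<noteq> 0" for x u by (rule metric_pos[OF c that])
    fix x u v assume x: "x \<in> coords c"
    have d: "((\<lambda>x. hlift (f (ci c x))) has_derivative (\<lambda>u. dhlift (f (ci c x)) (fd (\<lambda>x. f (ci c x)) x u))) (at x)"
      by (rule has_derivative_compose[OF smooth_on_has_derivative[OF sf x] hlift_deriv[OF fc[OF x]]])
    have "rm c x u v = riem_metric hyp ?c (local_rep f c ?c x) (fd (local_rep f c ?c) x u) (fd (local_rep f c ?c) x v)"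
    proof -
      have "x \<in> local_rep_dom f c ?c" using x ld by simp
      then show ?thesis using iso c c0 unfolding isometric_immersion_def by blast
    qed
    then show "rm c x u v = mink (fd (\<lambda>x. hlift (f (ci c x))) x u) (fd (\<lambda>x. hlift (f (ci c x))) x v)"
      unfolding lr fd_eqI[OF d] mink_dhlift[OF fc[OF x]] by simp
  qed
qed

text \<open>For causal vectors the spatial part is no longer than the time component. Hence
  \<open>2 * g \<le> fst a * fst F + \<bar>fst a\<bar> * fst F\<close>, which excludes a negative
  \<open>fst a\<close> and gives the bound for the others.\<close>

lemma causal_time_bound:
  fixes a F :: "real \<times> 'h::euclidean_space"
  assumes a: "mink a a \<le> 0" and F: "mink F F = - 1" "0 < fst F" and aF: "mink a F = - 2 * g" "0 < g"
  shows "g \<le> fst a * fst F"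
proof -
  have nF: "norm (snd F) < fst F"
  proof (rule power2_less_imp_less)
    show "(norm (snd F))\<^sup>2 < (fst F)\<^sup>2" using F(1) by (simp add: mink_def power2_norm_eq_inner) (simp add: power2_eq_square)
  qed (use F in simp)
  have na: "norm (snd a) \<le> \<bar>fst a\<bar>"
  proof (rule power2_le_imp_le)
    show "(norm (snd a))\<^sup>2 \<le> \<bar>fst a\<bar>\<^sup>2" using a by (simp add: mink_def power2_norm_eq_inner) (simp add: power2_eq_square)
  qed simp
  have "- (snd a \<bullet> snd F) \<le> norm (snd a) * norm (snd F)" using Cauchy_Schwarz_ineq2[of "snd a" "snd F"] by linarith
  also have "\<dots> \<le> \<bar>fst a\<bar> * fst F" using na nF by (intro mult_mono) auto
  finally have 1: "2 * g \<le> fst a * fst F + \<bar>fst a\<bar> * fst F" using aF(1) by (simp add: mink_def)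
  show ?thesis
  proof (cases "fst a \<ge> 0")
    case True then show ?thesis using 1 by (simp add: mult.commute)
  next
    case False
    then have "\<bar>fst a\<bar> * fst F = - (fst a * fst F)" by simp
    then show ?thesis using 1 aF(2) by linarith
  qed
qed

theorem theorem5:
  fixes n :: nat
    and M :: "('a, 'e::euclidean_space) riemannian"
    and J :: "('a, 'e) chart \<Rightarrow> 'e \<Rightarrow> 'e \<Rightarrow> 'e"
    and f :: "'a \<Rightarrow> 'h::euclidean_space"
  assumes "n \<ge> 2"
    and "DIM('e) = 2 * n"
    and "DIM('h) = 3 * n - 1"
    and "kaehler_manifold M J"
    and "riem_complete M"
    and "sectional_curvature_bounded_below M"
    and "isometric_immersion M (hyperbolic_space :: ('h, 'h) riemannian) f"
  shows "\<not> riem_bounded (hyperbolic_space :: ('h, 'h) riemannian) (f ` topspace (mtop M))"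
proof
  assume bdd: "riem_bounded (hyperbolic_space :: ('h, 'h) riemannian) (f ` topspace (mtop M))"
  interpret K: kaehler_manifold M J by (rule assms(4))
  interpret R: riem_conn M by unfold_locales (rule K.connected)
  define FF where "FF p = hlift (f p)" for p
  have lc: "lchart (coords c) (\<lambda>x. FF (K.ci c x)) mink (K.rm c)" if "c \<in> atlas M" for c
    unfolding FF_def by (rule K.lchart_hyp(1)[OF assms(7) that])
  obtain k0 where k0: "\<forall>c\<in>atlas M. \<forall>x\<in>coords c. \<forall>u v. u \<noteq> v \<longrightarrow> independent {u, v} \<longrightarrow> k0 \<le> sectional_curvature (K.rm c) x u v"
    using assms(6) unfolding sectional_curvature_bounded_below_def by (elim exE)
  \<comment> \<open>\<open>curvature_lower_bound\<close> works with a nonpositive lower bound, so a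
    positive \<open>k0\<close> is weakened to 0.\<close>
  define \<kappa> where "\<kappa> = max 0 (- k0)"
  interpret L: rlor M FF mink \<kappa>
  proof (rule rlor.intro[OF R.riem_conn_axioms], rule rlor_axioms.intro)
    show "lchart (coords c) (\<lambda>x. FF (K.ci c x)) mink (K.rm c)" if "c \<in> atlas M" for c by (rule lc[OF that])
    show "\<kappa> \<ge> 0" by (simp add: \<kappa>_def)
    fix c x u v assume c: "c \<in> atlas M" and x: "x \<in> coords c"
    show "- K.rm c x (lchart.Rm (\<lambda>x. FF (K.ci c x)) mink (K.rm c) x u v v) u \<le> \<kappa> * (K.rm c x u u * K.rm c x v v)"
    proof (rule lchart.curvature_lower_bound[OF lc[OF c] x])
      show "\<kappa> \<ge> 0" by (simp add: \<kappa>_def)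
      fix u v :: 'e assume uv: "u \<noteq> v" "independent {u, v}"
      have "k0 \<le> sectional_curvature (K.rm c) x u v" using k0[THEN bspec, THEN bspec, OF c x] uv by blast
      then show "- \<kappa> \<le> sectional_curvature (K.rm c) x u v" by (simp add: \<kappa>_def)
    qed
  qed
  obtain p0 where p0: "p0 \<in> topspace (mtop M)" using K.nonempty by blast
  obtain B where B: "B > 0" "\<And>p. p \<in> topspace (mtop M) \<Longrightarrow> conf (f p) \<le> B"
    using hyp_bounded_conf[OF bdd imageI[OF p0]] by blast
  have bd: "fst (FF p) \<le> 2 * B" if "p \<in> topspace (mtop M)" for p
    using B(2)[OF that] by (simp add: FF_def hlift_def)
  \<comment> \<open>Twice this factor times the bound \<open>2 * B\<close> on the time component of
    \<open>F\<close> is 1/2, so the estimate from above will be \<open>g / 2\<close> against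
    \<open>g\<close> from below.\<close>
  have \<epsilon>: "1 / (8 * B) > 0" using B by simp
  have "\<exists>c\<in>atlas M. \<exists>x\<in>coords c. \<forall>v. fst (lchart.al (\<lambda>x. FF (K.ci c x)) mink (K.rm c) x v v) \<le> 1 / (8 * B) * K.rm c x v v"
    by (rule L.maximum_principle[OF assms(5) K.nonempty bounded_linear_fst _ \<epsilon>]) (rule bd)
  then obtain c x where c: "c \<in> atlas M" and x: "x \<in> coords c"
    and al: "\<forall>v. fst (lchart.al (\<lambda>x. FF (K.ci c x)) mink (K.rm c) x v v) \<le> 1 / (8 * B) * K.rm c x v v"
    by (elim bexE) (rule that)
  interpret C: lchart "coords c" "\<lambda>x. FF (K.ci c x)" mink "K.rm c" by (rule lc[OF c])
  have "kchart (coords c) (\<lambda>x. FF (K.ci c x)) mink (K.rm c) (J c)"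
  proof (rule kchart.intro[OF C.lchart_axioms], rule kchart_axioms.intro)
    show "linear (J c x)" if "x \<in> coords c" for x by (rule K.J_linear[OF c that])
    show "smooth_on (coords c) (\<lambda>x. J c x w)" for w by (rule K.J_smooth[OF c])
    show "J c x (J c x w) = - w" if "x \<in> coords c" for x w by (rule K.J_square[OF c that])
    show "K.rm c x (J c x u) (J c x v) = K.rm c x u v" if "x \<in> coords c" for x u v by (rule K.J_orthogonal[OF c that])
    show "mink (FF (K.ci c x)) (FF (K.ci c x)) = - 1" if "x \<in> coords c" for x
      unfolding FF_def by (rule mink_hlift[OF K.lchart_hyp(2)[OF assms(7) c that]])
    \<comment> \<open>The dimension hypotheses give 2 * (1 + (3 n - 1)) = 6 n < 6 n + 2.\<close>
    show "2 * DIM(real \<times> 'h) < 3 * DIM('e) + 2" using assms(1-3) by simp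
    fix x u w :: 'e assume x: "x \<in> coords c"
    \<comment> \<open>\<open>J_parallel\<close> is applied to the constant field \<open>w\<close>,
      whose covariant derivative is \<open>C.Gam x u w\<close>.\<close>
    have "fd (\<lambda>_::'e. w) x u = 0" by (rule fd_eqI[OF has_derivative_const])
    then show "fd (\<lambda>y. J c y w) x u + C.Gam x u (J c x w) = J c x (C.Gam x u w)"
      using K.J_parallel[OF c smooth_on_const[of "coords c" w] x, of u]
      by (simp add: covariant_deriv_def C.levi_civita_eq[OF x])
  qed
  then interpret KC: kchart "coords c" "\<lambda>x. FF (K.ci c x)" mink "K.rm c" "J c" .
  obtain X where X: "X \<noteq> 0" "mink (KC.Bf x X X) (KC.Bf x X X) \<le> 0" using KC.exists_causal[OF x] by blast
  define g where "g = K.rm c x X X"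
  define F where "F = FF (K.ci c x)"
  have g: "0 < g" unfolding g_def by (rule C.g_pos[OF x X(1)])
  have ps: "K.ci c x \<in> topspace (mtop M)" using K.ci_in[OF x] K.domain_subset[OF c] by blast
  have F0: "0 < fst F" using ball_conf(2)[OF K.lchart_hyp(2)[OF assms(7) c x]] by (simp add: F_def FF_def hlift_def)
  have FB: "fst F \<le> 2 * B" unfolding F_def by (rule bd[OF ps])
  have 1: "g \<le> fst (KC.Bf x X X) * fst F"
    by (rule causal_time_bound[OF X(2) KC.F_unit[OF x, folded F_def] F0 KC.Bf_F[OF x, of X X, folded F_def g_def] g])
  have "fst (KC.Bf x X X) \<le> 1 / (8 * B) * g + 1 / (8 * B) * g"
    using al[THEN spec, of X] al[THEN spec, of "J c x X"] unfolding KC.Bf_def K.J_orthogonal[OF c x] g_def by simp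
  then have "fst (KC.Bf x X X) * fst F \<le> (1 / (8 * B) * g + 1 / (8 * B) * g) * fst F" using F0 by (intro mult_right_mono) auto
  also have "\<dots> \<le> (1 / (8 * B) * g + 1 / (8 * B) * g) * (2 * B)" using FB g B(1) by (intro mult_left_mono) auto
  also have "\<dots> = g / 2" using B(1) by simp
  finally show False using 1 g by linarith
qed

end
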